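(* Let $A$ be a compactly generated locally compact abelian group and $M$ a sheer LC $A$-module. For a closed submodule $N$ of $M$, let $N^\boxminus=\Omega^\sharp(N)$ and let $N^\boxplus$ be the inverse image in $M$ of $\mathrm{W}^\flat(M/N)\subseteq M/N$. Then $N^\boxminus\subseteq N\subseteq N^\boxplus$, $N/N^\boxminus$ is purely discrete, and $N^\boxplus/N$ is compact parafinite. Moreover $N^\boxminus$ is sheer and is maximal among sheer closed submodules contained in $N$, and $N^\boxplus$ is sheer and is minimal among sheer closed submodules containing $N$. Finally, if $N_1\subseteq N_2$ are closed submodules then $N_1^\boxminus\subseteq N_2^\boxminus$ and $N_1^\boxplus\subseteq N_2^\boxplus$.
   Context: An LC $A$-module is an LCA group with a continuous action of $A$ by topological automorphisms. Compact parafinite: compact, no nonzero finite quotient module; purely discrete: discrete, no nonzero finite submodule; $\mathrm{W}^\flat(M)$ = sum of compact parafinite submodules; $\Omega^\sharp(M)$ = intersection of open submodules $U$ with $M/U$ purely discrete; sheer means $\mathrm{W}^\flat(M)=0$ and $\Omega^\sharp(M)=M$. *)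

theory Defs
  imports "HOL-Analysis.Analysis"
begin

definition add_subgroup :: "'a::ab_group_add set \<Rightarrow> bool" where
  "add_subgroup S \<longleftrightarrow> 0 \<in> S \<and> (\<forall>x\<in>S. \<forall>y\<in>S. x + y \<in> S) \<and> (\<forall>x\<in>S. - x \<in> S)"

definition LCA_group_type :: "'a::{topological_ab_group_add, t2_space} itself \<Rightarrow> bool" where
  "LCA_group_type _ \<longleftrightarrow> locally_compact_space (euclidean :: 'a topology)"

definition compactly_generated_type :: "'a::{topological_ab_group_add, t2_space} itself \<Rightarrow> bool" where
  "compactly_generated_type _ \<longleftrightarrow>
     (\<exists>K::'a set. compact K \<and> (\<forall>S. add_subgroup S \<and> K \<subseteq> S \<longrightarrow> S = UNIV))"

record ('a, 'm) amod =
  mcar  :: "'m set"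
  madd  :: "'m \<Rightarrow> 'm \<Rightarrow> 'm"
  mzero :: "'m"
  mneg  :: "'m \<Rightarrow> 'm"
  mact  :: "'a \<Rightarrow> 'm \<Rightarrow> 'm"
  mtop  :: "'m topology"

definition is_lcmod :: "('a::{topological_ab_group_add, t2_space}, 'm) amod \<Rightarrow> bool" where
  "is_lcmod M \<longleftrightarrow>
     \<comment> \<open>abelian group\<close>
     mzero M \<in> mcar M \<and>
     (\<forall>x\<in>mcar M. \<forall>y\<in>mcar M. madd M x y \<in> mcar M) \<and>
     (\<forall>x\<in>mcar M. mneg M x \<in> mcar M) \<and>
     (\<forall>x\<in>mcar M. \<forall>y\<in>mcar M. \<forall>z\<in>mcar M. madd M (madd M x y) z = madd M x (madd M y z)) \<and>
     (\<forall>x\<in>mcar M. \<forall>y\<in>mcar M. madd M x y = madd M y x) \<and>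
     (\<forall>x\<in>mcar M. madd M (mzero M) x = x) \<and>
     (\<forall>x\<in>mcar M. madd M (mneg M x) x = mzero M) \<and>
     \<comment> \<open>locally compact Hausdorff topological group\<close>
     topspace (mtop M) = mcar M \<and>
     Hausdorff_space (mtop M) \<and>
     locally_compact_space (mtop M) \<and>
     continuous_map (prod_topology (mtop M) (mtop M)) (mtop M) (\<lambda>(x, y). madd M x y) \<and>
     continuous_map (mtop M) (mtop M) (mneg M) \<and>
     \<comment> \<open>continuous action of A by (topological) group automorphisms\<close>
     (\<forall>a. \<forall>x\<in>mcar M. mact M a x \<in> mcar M) \<and>
     (\<forall>a. \<forall>x\<in>mcar M. \<forall>y\<in>mcar M. mact M a (madd M x y) = madd M (mact M a x) (mact M a y)) \<and>
     (\<forall>x\<in>mcar M. mact M 0 x = x) \<and>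
     (\<forall>a b. \<forall>x\<in>mcar M. mact M (a + b) x = mact M a (mact M b x)) \<and>
     continuous_map (prod_topology (euclidean :: 'a topology) (mtop M)) (mtop M) (\<lambda>(a, x). mact M a x)"

definition submodule :: "('a, 'm) amod \<Rightarrow> 'm set \<Rightarrow> bool" where
  "submodule M N \<longleftrightarrow> N \<subseteq> mcar M \<and> mzero M \<in> N \<and>
     (\<forall>x\<in>N. \<forall>y\<in>N. madd M x y \<in> N) \<and> (\<forall>x\<in>N. mneg M x \<in> N) \<and>
     (\<forall>a. \<forall>x\<in>N. mact M a x \<in> N)"

definition closed_submodule :: "('a, 'm) amod \<Rightarrow> 'm set \<Rightarrow> bool" where
  "closed_submodule M N \<longleftrightarrow> submodule M N \<and> closedin (mtop M) N"

definition submod :: "('a, 'm) amod \<Rightarrow> 'm set \<Rightarrow> ('a, 'm) amod" where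
  "submod M N = M\<lparr>mcar := N, mtop := subtopology (mtop M) N\<rparr>"

definition mcoset :: "('a, 'm) amod \<Rightarrow> 'm set \<Rightarrow> 'm \<Rightarrow> 'm set" where
  "mcoset M N x = {madd M x n | n. n \<in> N}"

definition quotient_topology :: "'m topology \<Rightarrow> ('m \<Rightarrow> 'q) \<Rightarrow> 'q topology" where
  "quotient_topology X f =
     topology (\<lambda>U. U \<subseteq> f ` topspace X \<and> openin X {x \<in> topspace X. f x \<in> U})"

definition quotmod :: "('a, 'm) amod \<Rightarrow> 'm set \<Rightarrow> ('a, 'm set) amod" where
  "quotmod M N =
     \<lparr> mcar = mcoset M N ` mcar M,
       madd = (\<lambda>X Y. {madd M x y | x y. x \<in> X \<and> y \<in> Y}),
       mzero = N,
       mneg = (\<lambda>X. mneg M ` X),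
       mact = (\<lambda>a X. mact M a ` X),
       mtop = quotient_topology (mtop M) (mcoset M N) \<rparr>"

definition compact_parafinite :: "('a::{topological_ab_group_add, t2_space}, 'm) amod \<Rightarrow> bool" where
  "compact_parafinite M \<longleftrightarrow> is_lcmod M \<and> compact_space (mtop M) \<and>
     \<not> (\<exists>U. closed_submodule M U \<and> finite (mcar (quotmod M U)) \<and>
            mcar (quotmod M U) \<noteq> {mzero (quotmod M U)})"

definition purely_discrete :: "('a::{topological_ab_group_add, t2_space}, 'm) amod \<Rightarrow> bool" where
  "purely_discrete M \<longleftrightarrow> is_lcmod M \<and> mtop M = discrete_topology (mcar M) \<and>
     \<not> (\<exists>L. submodule M L \<and> finite L \<and> L \<noteq> {mzero M})"

text \<open>Sum of all compact parafinite submodules (= submodule generated by their union).\<close>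
definition Wflat :: "('a::{topological_ab_group_add, t2_space}, 'm) amod \<Rightarrow> 'm set" where
  "Wflat M = \<Inter>{S. submodule M S \<and>
                  (\<forall>C. submodule M C \<and> compact_parafinite (submod M C) \<longrightarrow> C \<subseteq> S)}"

definition Omega_sharp :: "('a::{topological_ab_group_add, t2_space}, 'm) amod \<Rightarrow> 'm set" where
  "Omega_sharp M = mcar M \<inter>
     \<Inter>{U. submodule M U \<and> openin (mtop M) U \<and> purely_discrete (quotmod M U)}"

definition sheer :: "('a::{topological_ab_group_add, t2_space}, 'm) amod \<Rightarrow> bool" where
  "sheer M \<longleftrightarrow> Wflat M = {mzero M} \<and> Omega_sharp M = mcar M"

definition boxminus :: "('a::{topological_ab_group_add, t2_space}, 'm) amod \<Rightarrow> 'm set \<Rightarrow> 'm set" where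
  "boxminus M N = Omega_sharp (submod M N)"

definition boxplus :: "('a::{topological_ab_group_add, t2_space}, 'm) amod \<Rightarrow> 'm set \<Rightarrow> 'm set" where
  "boxplus M N = {x \<in> mcar M. mcoset M N x \<in> Wflat (quotmod M N)}"

end

theory Submission
  imports Defs "HOL-Library.Set_Algebras"
begin

text \<open>Everything is done relative to a closed submodule X of a locally compact module G. If G/X has no
 nonzero compact parafinite submodule, then there are submodules X \<subseteq> H \<subseteq> Q of G with Q open, Q/H compact, and
 H/X filtered by finitely many layers on each of which doubling or a single element of the acting group is
 expanding. Doubling yields a vector group, and each generator of the acting group one layer coming from
 the dynamics of compact open subgroups. Expanding layers are rigid: an open submodule of X is cut out by
 an open submodule of H, and if C/H is compact then C = Z + H with Z/X compact.

 If M is sheer, M/U is locally finite for every open submodule U. For X the module \<open>boxplus M N\<close>,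
 rigidity extends its smallest open submodule with purely discrete quotient to an open submodule of M,
 and local finiteness forces that submodule to be everything. For a sheer S between N and
 \<open>boxplus M N\<close>, the second rigidity property (with X = 0 and G = S) writes \<open>boxplus M N\<close> as Z + S with Z
 compact. As Z is profinite and the quotient by S is parafinite, that quotient vanishes.\<close>

section \<open>Subgroups relative to a subgroup\<close>

text \<open>Expansion matters because it makes approximate data exact. If \<open>f\<close> expands
  \<open>Y/P\<close> and \<open>P0\<close> is open in \<open>P\<close>, a small point has a backward
  orbit of small points modulo \<open>P\<close>; the defects of this orbit are small elements of
  \<open>P\<close>, hence lie in \<open>P0\<close>, so it is an orbit modulo \<open>P0\<close> too.
  Dually, if \<open>C/Y\<close> is compact, a point of \<open>C\<close> can be corrected inside
  \<open>Y\<close> so that its forward orbit stays bounded, and the points with bounded orbits form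
  the desired \<open>Z\<close>. The obstacle is that the dynamics of one element only yields
  subgroups stable under finitely many operators. Two facts repair this: the acting group is
  commutative, so for \<open>f\<close> commuting with the action the points whose backward orbits
  tend to \<open>X\<close> form a submodule of \<open>G\<close>; and compact generation leaves,
  beyond finitely many generators, only a compact set of operators, under which an open subgroup can
  be made stable by shrinking it. The layers of a single element come from Willis's splitting of a
  compact open subgroup into a forward and a backward part, carried out modulo
  \<open>X\<close>.\<close>

lemma sg_zero: "add_subgroup X ==> 0 \<in> X"
 and sg_add: "add_subgroup X ==> x \<in> X ==> y \<in> X ==> x + y \<in> X"
 and sg_neg: "add_subgroup X ==> x \<in> X ==> - x \<in> X"
 by (auto simp: add_subgroup_def)

lemma sg_diff: "add_subgroup X ==> x \<in> X ==> y \<in> X ==> x - y \<in> X"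
 by (metis add_subgroup_def diff_conv_add_uminus)

lemma sg_cancel_left: "add_subgroup X ==> x \<in> X ==> x + y \<in> X \<longleftrightarrow> y \<in> X"
 by (metis add_diff_cancel_left' sg_add sg_diff)

lemma sg_cancel_right: "add_subgroup X ==> x \<in> X ==> y + x \<in> X \<longleftrightarrow> y \<in> X"
 by (metis add.commute sg_cancel_left)

lemma sg_cancel_diff: "add_subgroup X ==> x \<in> X ==> y - x \<in> X \<longleftrightarrow> y \<in> X"
 by (metis sg_cancel_right diff_add_cancel)

lemma sg_Int: "add_subgroup X ==> add_subgroup Y ==> add_subgroup (X \<inter> Y)"
 by (auto simp: add_subgroup_def)

lemma sg_Inter: "(!!X. X \<in> F ==> add_subgroup X) ==> add_subgroup (\<Inter>F)"
 by (auto simp: add_subgroup_def)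

lemma set_plusI: "a \<in> A ==> b \<in> B ==> c = a + b ==> c \<in> A + B"
 by (auto simp: set_plus_def)

lemma set_plusE: "c \<in> A + B ==> (!!a b. a \<in> A ==> b \<in> B ==> c = a + b ==> P) ==> P"
 by (auto simp: set_plus_def)

lemma set_plus_diff: "c \<in> A + B \<longleftrightarrow> (\<exists>a\<in>A. c - a \<in> (B::'k::ab_group_add set))"
proof
 assume "c \<in> A + B"
 then show "\<exists>a\<in>A. c - a \<in> B" by (elim set_plusE) (auto intro!: bexI)
next
 assume "\<exists>a\<in>A. c - a \<in> B"
 then obtain a where "a \<in> A" "c - a \<in> B" by blast
 then show "c \<in> A + B" by (intro set_plusI[of a _ "c - a"]) auto
qed

lemma set_plus_mono: "A \<subseteq> A' ==> B \<subseteq> B' ==> A + B \<subseteq> A' + B'"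
 by (auto simp: set_plus_def)

lemma set_plus_right: "(0::'k::ab_group_add) \<in> A ==> B \<subseteq> A + B"
 by (auto intro: set_plusI[of 0])

lemma set_plus_left: "(0::'k::ab_group_add) \<in> B ==> A \<subseteq> A + B"
 by (auto intro: set_plusI[of _ _ 0])

lemma sg_plus_subset: "add_subgroup Y ==> A \<subseteq> Y ==> B \<subseteq> Y ==> A + B \<subseteq> Y"
 by (auto simp: set_plus_def add_subgroup_def)

lemma sg_plus_self: "add_subgroup Y ==> Y + Y = Y"
 by (metis sg_plus_subset sg_zero equalityI order_refl set_plus_left)

lemma sg_plus:
 assumes "add_subgroup X" "add_subgroup Y" shows "add_subgroup (X + Y)"
 unfolding add_subgroup_def
proof (intro conjI ballI)
 show "0 \<in> X + Y" using assms by (intro set_plusI[of 0 _ 0]) (auto simp: sg_zero)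
next
 fix x y assume "x \<in> X + Y" "y \<in> X + Y"
 then obtain a b a' b' where "a \<in> X" "b \<in> Y" "x = a + b" "a' \<in> X" "b' \<in> Y" "y = a' + b'"
  by (elim set_plusE) auto
 then show "x + y \<in> X + Y"
  using assms by (intro set_plusI[of "a + a'" _ "b + b'"]) (auto simp: sg_add algebra_simps)
next
 fix x assume "x \<in> X + Y"
 then obtain a b where "a \<in> X" "b \<in> Y" "x = a + b" by (elim set_plusE) auto
 then show "- x \<in> X + Y"
  using assms by (intro set_plusI[of "- a" _ "- b"]) (auto simp: sg_neg)
qed

text \<open>The set \<open>V\<close> is closed under the operations only up to \<open>Z\<close>.
  Typically \<open>V\<close> is a small compact or finite set whose sums fall outside it, and
  \<open>Z\<close> absorbs the errors.\<close>

lemma sg_plusI: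
 assumes Z: "add_subgroup Z" and V: "0 \<in> V" "!!v. v \<in> V ==> - v \<in> V + Z" "!!v w. v \<in> V ==> w \<in> V ==> v + w \<in> V + Z"
 shows "add_subgroup (V + Z)"
 unfolding add_subgroup_def
proof (intro conjI ballI)
 have in_Z: "a + z \<in> V + Z" if az: "a \<in> V + Z" "z \<in> Z" for a z
 proof -
  obtain v y where v: "v \<in> V" "y \<in> Z" "a = v + y" using az(1) by (rule set_plusE)
  show ?thesis by (rule set_plusI[OF v(1) sg_add[OF Z v(2) az(2)]]) (simp add: v(3) add.assoc)
 qed
 show "0 \<in> V + Z" by (rule set_plusI[OF V(1) sg_zero[OF Z]]) simp
 fix x assume "x \<in> V + Z"
 then obtain v z where x: "v \<in> V" "z \<in> Z" "x = v + z" by (rule set_plusE)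
 show "- x \<in> V + Z" using in_Z[OF V(2)[OF x(1)] sg_neg[OF Z x(2)]] unfolding x(3) by simp
 fix y assume "y \<in> V + Z"
 then obtain w z' where y: "w \<in> V" "z' \<in> Z" "y = w + z'" by (rule set_plusE)
 show "x + y \<in> V + Z" using in_Z[OF V(3)[OF x(1) y(1)] sg_add[OF Z x(2) y(2)]]
  unfolding x(3) y(3) by (simp add: algebra_simps)
qed

section \<open>Neighbourhoods of zero, sums of sets and closures in a topological group\<close>

abbreviation nb :: "'k::{topological_space,zero} set => bool" where
 "nb U \<equiv> open U \<and> 0 \<in> U"

lemma open_translate_vimage:
 fixes U :: "'k::topological_ab_group_add set"
 assumes "open U" shows "open {x. x - a \<in> U}"
proof -
 have "continuous_on UNIV (\<lambda>x. x - a)" by (intro continuous_intros)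
 from open_vimage[OF assms this] show ?thesis by (simp add: vimage_def)
qed

lemma open_set_plus:
 fixes A :: "'k::topological_ab_group_add set"
 assumes "open A" shows "open (A + B)"
proof -
 have "A + B = (\<Union>b\<in>B. {x. x - b \<in> A})"
  by (subst add.commute) (auto simp: set_plus_diff)
 then show ?thesis using open_translate_vimage[OF assms] by auto
qed

lemma compact_set_plus:
 fixes A :: "'k::topological_ab_group_add set"
 assumes "compact A" "compact B" shows "compact (A + B)"
proof -
 have "A + B = (\<lambda>p. fst p + snd p) ` (A \<times> B)"
  by (force simp: set_plus_def)
 moreover have "continuous_on (A \<times> B) (\<lambda>p. fst p + snd p)"
  by (intro continuous_intros)
 ultimately show ?thesis using assms by (simp add: compact_Times compact_continuous_image)
qed

lemma compact_uminus_image: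
 fixes A :: "'k::topological_ab_group_add set"
 assumes "compact A" shows "compact (uminus ` A)"
 by (intro compact_continuous_image continuous_intros assms)

lemma tube:
 fixes K :: "'b::topological_space set" and W :: "('c::topological_space \<times> 'b) set"
 assumes "compact K" "open W" "!!k. k \<in> K ==> (x, k) \<in> W"
 shows "\<exists>U. open U \<and> x \<in> U \<and> (\<forall>u\<in>U. \<forall>k\<in>K. (u, k) \<in> W)"
proof -
 have "{x} \<times> K \<subseteq> W" using assms(3) by auto
 from Elementary_Topology.tube_lemma[OF assms(1,2) this] obtain X0 where
  "x \<in> X0" "open X0" "X0 \<times> K \<subseteq> W" by metis
 then show ?thesis by (intro exI[of _ X0]) auto
qed

lemma closed_compact_plus:
 fixes A :: "'k::topological_ab_group_add set"
 assumes "compact A" "closed B" shows "closed (A + B)"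
proof -
 have "open (- (A + B))"
 proof (subst open_subopen, intro ballI)
  fix x assume x: "x \<in> - (A + B)"
  have c: "continuous_on UNIV (\<lambda>p::'k\<times>'k. fst p - snd p)" by (intro continuous_intros)
  have o: "open ((\<lambda>p::'k\<times>'k. fst p - snd p) -` (- B))"
   using open_vimage[OF _ c, of "- B"] assms(2) by (simp add: open_Compl)
  have p: "!!k. k \<in> A ==> (x, k) \<in> (\<lambda>p::'k\<times>'k. fst p - snd p) -` (- B)"
   using x by (auto simp: set_plus_diff)
  from tube[OF assms(1) o p] obtain U where "open U" "x \<in> U"
   and U: "\<forall>u\<in>U. \<forall>k\<in>A. (u, k) \<in> (\<lambda>p::'k\<times>'k. fst p - snd p) -` (- B)"
   by metis
  then have "U \<subseteq> - (A + B)" by (auto simp: set_plus_diff)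
  then show "\<exists>T. open T \<and> x \<in> T \<and> T \<subseteq> - (A + B)"
   using \<open>open U\<close> \<open>x \<in> U\<close> by blast
 qed
 then show ?thesis by (simp add: closed_def)
qed

lemma nb_half:
 fixes U :: "'k::topological_ab_group_add set"
 assumes "nb U"
 obtains V where "nb V" "V \<subseteq> U" "!!x. x \<in> V ==> - x \<in> V"
  "!!x y. x \<in> V ==> y \<in> V ==> x + y \<in> U" "!!x y. x \<in> V ==> y \<in> V ==> x - y \<in> U"
proof -
 have c: "continuous_on UNIV (\<lambda>p::'k\<times>'k. fst p + snd p)" by (intro continuous_intros)
 have "open ((\<lambda>p::'k\<times>'k. fst p + snd p) -` U)" using open_vimage[OF _ c] assms by blast
 moreover have "(0,0) \<in> (\<lambda>p::'k\<times>'k. fst p + snd p) -` U" using assms by simp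
 ultimately obtain A B where AB: "open A" "open B" "0 \<in> A" "0 \<in> B"
   "A \<times> B \<subseteq> (\<lambda>p::'k\<times>'k. fst p + snd p) -` U"
  by (elim open_prod_elim) auto
 have cm: "continuous_on UNIV (\<lambda>x::'k. - x)" by (intro continuous_intros)
 define V where "V = A \<inter> B \<inter> (uminus -` (A \<inter> B))"
 have "open V" unfolding V_def using AB open_vimage[OF _ cm, of "A \<inter> B"]
  by (metis open_Int)
 moreover have "0 \<in> V" using AB by (simp add: V_def)
 moreover have "V \<subseteq> U" using AB by (force simp: V_def)
 moreover have s: "!!x. x \<in> V ==> - x \<in> V" by (auto simp: V_def)
 moreover have a: "!!x y. x \<in> V ==> y \<in> V ==> x + y \<in> U" using AB by (force simp: V_def)
 moreover have "!!x y. x \<in> V ==> y \<in> V ==> x - y \<in> U"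
  using a s by (metis diff_conv_add_uminus)
 ultimately show ?thesis using that by blast
qed

lemma nb_Int: "nb U ==> nb V ==> nb (U \<inter> V)"
 by auto

lemma nb_vimage:
 fixes f :: "'k::topological_ab_group_add => 'k"
 assumes "continuous_on UNIV f" "f 0 = 0" "nb U"
 shows "nb {x. f x \<in> U}"
 using open_vimage[OF _ assms(1), of U] assms by (simp add: vimage_def)

lemma closedI_nb:
 fixes X :: "'k::topological_ab_group_add set"
 assumes "!!x. (!!U. nb U ==> \<exists>y\<in>X. x - y \<in> U) ==> x \<in> X"
 shows "closed X"
proof -
 have "open (- X)"
 proof (subst open_subopen, intro ballI)
  fix x assume "x \<in> - X"
  then have "\<not> (\<forall>U. nb U --> (\<exists>y\<in>X. x - y \<in> U))" using assms[of x] by (metis ComplD)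
  then obtain U where U: "nb U" "!!y. y \<in> X ==> x - y \<notin> U" by auto
  have "continuous_on UNIV (\<lambda>y. x - y)" by (intro continuous_intros)
  then have "open ((\<lambda>y. x - y) -` U)" using U open_vimage by blast
  moreover have "x \<in> (\<lambda>y. x - y) -` U" using U by simp
  moreover have "(\<lambda>y. x - y) -` U \<subseteq> - X" using U by auto
  ultimately show "\<exists>T. open T \<and> x \<in> T \<and> T \<subseteq> - X" by blast
 qed
 then show ?thesis by (simp add: closed_def)
qed

lemma closure_nb:
 fixes X :: "'k::topological_ab_group_add set"
 assumes "x \<in> closure X" "nb U"
 obtains y where "y \<in> X" "x - y \<in> U"
proof -
 have "continuous_on UNIV (\<lambda>y. x - y)" by (intro continuous_intros)
 then have "open ((\<lambda>y. x - y) -` U)" using assms open_vimage by blast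
 moreover have "x \<in> (\<lambda>y. x - y) -` U" using assms by simp
 ultimately have "X \<inter> ((\<lambda>y. x - y) -` U) \<noteq> {}"
  using assms(1) by (metis IntI closure_iff_nhds_not_empty subset_refl)
 then show ?thesis using that by auto
qed

lemma closureI_nb:
 fixes X :: "'k::topological_ab_group_add set"
 assumes "!!U. nb U ==> \<exists>y\<in>X. x - y \<in> U"
 shows "x \<in> closure X"
proof -
 have "x \<in> C" if "closed C" "X \<subseteq> C" for C
 proof (rule ccontr)
  assume "x \<notin> C"
  have "continuous_on UNIV (\<lambda>u. x - u)" by (intro continuous_intros)
  then have "open ((\<lambda>u. x - u) -` (- C))" using \<open>closed C\<close> open_vimage by blast
  moreover have "0 \<in> (\<lambda>u. x - u) -` (- C)" using \<open>x \<notin> C\<close> by simp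
  ultimately obtain y where "y \<in> X" "x - y \<in> (\<lambda>u. x - u) -` (- C)" using assms by metis
  then show False using that by auto
 qed
 then show ?thesis using closed_closure closure_subset by blast
qed

lemma mem_closed_if_near:
 fixes X :: "'k::topological_ab_group_add set"
 assumes "closed X" "!!U. nb U ==> x \<in> U + X"
 shows "x \<in> X"
proof -
 have "x \<in> closure X"
 proof (rule closureI_nb)
  fix U assume "nb (U::'k set)"
  then have "x \<in> U + X" using assms(2) by blast
  then show "\<exists>y\<in>X. x - y \<in> U" by (simp add: add.commute[of U] set_plus_diff)
 qed
 then show ?thesis using assms(1) by simp
qed

text \<open>Closedness of a subgroup can be tested near zero: a limit point \<open>x\<close> is
  moved by some \<open>b \<in> B\<close> to \<open>x - b\<close> near zero, and there the nearby
  points of \<open>B\<close> all lie in the closed set \<open>C\<close>.\<close>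

lemma closed_if_locally_closed:
 fixes B :: "'k::topological_ab_group_add set"
 assumes B: "add_subgroup B" and "nb U" "closed C" "U \<inter> B \<subseteq> C" "C \<subseteq> B"
 shows "closed B"
proof (rule closedI_nb)
 fix x assume x: "!!U. nb U ==> \<exists>y\<in>B. x - y \<in> U"
 obtain V where V: "nb V" "!!x y. x \<in> V ==> y \<in> V ==> x - y \<in> U" using nb_half[OF assms(2)] by metis
 obtain b where b: "b \<in> B" "x - b \<in> V" using x V(1) by blast
 have "x - b \<in> closure C"
 proof (rule closureI_nb)
  fix W assume W: "nb (W::'k set)"
  obtain b' where b': "b' \<in> B" "x - b' \<in> W \<inter> V" using x[OF nb_Int[OF W V(1)]] by blast
  have "b' - b = (x - b) - (x - b')" by simp
  then have "b' - b \<in> U" using V(2) b b' by (metis IntD2)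
  then have "b' - b \<in> C" using b b' B assms(4) sg_diff by auto
  moreover have "(x - b) - (b' - b) = x - b'" by simp
  ultimately show "\<exists>y\<in>C. x - b - y \<in> W" using b' by (metis IntD1)
 qed
 then have "x - b \<in> B" using assms(3,5) by auto
 then show "x \<in> B" using b B sg_cancel_diff by blast
qed

section \<open>Relative compactness, openness and finite index of one subgroup in another\<close>

definition cocpt :: "'k::topological_ab_group_add set => 'k set => bool" where
 "cocpt X Y \<longleftrightarrow> (\<exists>V. compact V \<and> Y \<subseteq> V + X)"

definition omod :: "'k::topological_ab_group_add set => 'k set => bool" where
 "omod X Y \<longleftrightarrow> (\<exists>U. nb U \<and> U \<inter> Y \<subseteq> X)"

definition fmod :: "'k::ab_group_add set => 'k set => bool" where
 "fmod X Y \<longleftrightarrow> (\<exists>F. finite F \<and> Y \<subseteq> F + X)"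

lemma cocpt_refl: "cocpt X X"
 unfolding cocpt_def by (rule exI[of _ "{0}"]) (auto simp: set_plus_def)

lemma cocpt_mono: "cocpt X Y ==> X \<subseteq> X' ==> Y' \<subseteq> Y ==> cocpt X' Y'"
 unfolding cocpt_def by (meson order_trans set_plus_mono subset_refl)

lemma cocpt_trans: "cocpt X Y ==> cocpt Y Z ==> cocpt X Z"
 unfolding cocpt_def
proof (elim exE conjE)
 fix V W assume "compact V" "Y \<subseteq> V + X" "compact W" "Z \<subseteq> W + Y"
 then have "Z \<subseteq> (W + V) + X"
  by (metis (no_types, lifting) add.assoc order_trans set_plus_mono subset_refl)
 then show "\<exists>V. compact V \<and> Z \<subseteq> V + X" using compact_set_plus \<open>compact V\<close> \<open>compact W\<close> by blast
qed

lemma cocpt_plus: "cocpt X Y ==> cocpt X Z ==> add_subgroup X ==> cocpt X (Y + Z)"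
 unfolding cocpt_def
proof (elim exE conjE)
 fix V W assume "compact V" "Y \<subseteq> V + X" "compact W" "Z \<subseteq> W + X" "add_subgroup X"
 then have "Y + Z \<subseteq> (V + X) + (W + X)" by (simp add: set_plus_mono)
 also have "\<dots> = (V + W) + (X + X)" by (simp add: ac_simps)
 finally have "Y + Z \<subseteq> (V + W) + X" using sg_plus_self[OF \<open>add_subgroup X\<close>] by simp
 then show "\<exists>V. compact V \<and> Y + Z \<subseteq> V + X" using compact_set_plus \<open>compact V\<close> \<open>compact W\<close> by blast
qed

lemma cocpt_compact_plus: "compact V ==> cocpt X (V + X)"
 unfolding cocpt_def by blast

lemma cocpt_inside:
 fixes Y :: "'k::{topological_ab_group_add, t2_space} set"
 assumes "cocpt X Y" "closed Y" "X \<subseteq> Y" "add_subgroup X" "add_subgroup Y"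
 obtains V where "compact V" "V \<subseteq> Y" "0 \<in> V" "!!v. v \<in> V ==> - v \<in> V" "Y = V + X"
proof -
 obtain V0 where V0: "compact V0" "Y \<subseteq> V0 + X" using assms(1) cocpt_def by blast
 define V1 where "V1 = insert 0 (V0 \<inter> Y)"
 define V where "V = V1 \<union> uminus ` V1"
 have "compact V1" using V0 assms(2) by (auto simp: V1_def compact_Int_closed)
 then have "compact V" by (simp add: V_def compact_uminus_image compact_Un)
 moreover have VY: "V \<subseteq> Y" using assms(5) by (auto simp: V_def V1_def add_subgroup_def)
 moreover have "0 \<in> V" by (simp add: V_def V1_def)
 moreover have "!!v. v \<in> V ==> - v \<in> V" by (auto simp: V_def)
 moreover have "Y \<subseteq> V + X"
 proof
  fix y assume y: "y \<in> Y"
  then obtain v x where vx: "v \<in> V0" "x \<in> X" "y = v + x" using V0 by (meson set_plusE subsetD)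
  then have "v \<in> Y" using y assms(3,5) sg_cancel_right by blast
  then show "y \<in> V + X" using vx by (auto simp: V_def V1_def intro: set_plusI)
 qed
 moreover have "V + X \<subseteq> Y" using VY assms sg_plus_subset by blast
 ultimately show ?thesis using that by blast
qed

text \<open>Modulo \<open>X\<close> the summand \<open>Y\<close> is compact:
  \<open>Y = V + X\<close> gives \<open>Y + Z = V + Z\<close>, a compact plus a closed set.\<close>

lemma closed_if_cocpt:
 fixes X :: "'k::{topological_ab_group_add, t2_space} set"
 assumes "cocpt X Y" "closed X" "closed Y" "closed Z" "X \<subseteq> Y" "X \<subseteq> Z" "add_subgroup X" "add_subgroup Y" "add_subgroup Z"
 shows "closed (Y + Z)"
proof -
 obtain V where V: "compact V" "Y = V + X" using cocpt_inside[OF assms(1,3,5,7,8)] by metis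
 have "X + Z = Z" using assms by (metis sg_plus_subset sg_zero equalityI subset_refl set_plus_right)
 then have "Y + Z = V + Z" using V by (simp add: add.assoc)
 then show ?thesis using closed_compact_plus V assms by simp
qed

lemma compact_finite_translates:
 fixes V :: "'k::topological_ab_group_add set"
 assumes "compact V" "nb U"
 obtains F where "finite F" "F \<subseteq> V" "V \<subseteq> F + U"
proof -
 have "V \<subseteq> (\<Union>c\<in>V. {x. x - c \<in> U})" using assms by auto
 then obtain F where "F \<subseteq> V" "finite F" "V \<subseteq> (\<Union>c\<in>F. {x. x - c \<in> U})"
  using compactE_image[OF assms(1), of V "\<lambda>c. {x. x - c \<in> U}"] open_translate_vimage assms by metis
 then show ?thesis using that by (auto simp: set_plus_diff subset_iff)
qed

lemma compact_finite_mod: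
 fixes V :: "'k::topological_ab_group_add set"
 assumes "compact V" "V \<subseteq> Y" "add_subgroup Y" "omod E Y"
 obtains F where "finite F" "F \<subseteq> V" "V \<subseteq> F + E"
proof -
 obtain U where U: "nb U" "U \<inter> Y \<subseteq> E" using assms(4) omod_def by blast
 obtain F where F: "finite F" "F \<subseteq> V" "V \<subseteq> F + U" using compact_finite_translates[OF assms(1) U(1)] .
 have "V \<subseteq> F + E"
 proof
  fix v assume v: "v \<in> V"
  then have "v \<in> F + U" using F by blast
  then obtain f where f: "f \<in> F" "v - f \<in> U" by (auto simp: set_plus_diff)
  then have "v - f \<in> Y" using v F assms by (meson sg_diff subsetD)
  then show "v \<in> F + E" using f U by (auto simp: set_plus_diff)
 qed
 then show ?thesis using that F by blast
qed

text \<open>A compact group modulo an open subgroup is finite: finitely many cosets of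
  \<open>E\<close> cover the compact part of \<open>Y\<close>, and the remaining summand
  \<open>X\<close> lies in \<open>E\<close>.\<close>

lemma cocpt_omod_fmod:
 fixes Y :: "'k::{topological_ab_group_add, t2_space} set"
 assumes "cocpt X Y" "closed Y" "X \<subseteq> E" "E \<subseteq> Y" "add_subgroup X" "add_subgroup E" "add_subgroup Y" "omod E Y"
 shows "fmod E Y"
proof -
 obtain V where V: "compact V" "V \<subseteq> Y" "Y = V + X" using cocpt_inside[OF assms(1,2) _ assms(5,7)] assms by (metis order_trans)
 obtain F where F: "finite F" "V \<subseteq> F + E" using compact_finite_mod[OF V(1,2) assms(7,8)] by metis
 have "Y \<subseteq> (F + E) + X" using V F by (simp add: set_plus_mono)
 also have "\<dots> \<subseteq> F + E" using assms
  by (metis add.assoc sg_plus_self set_plus_mono subset_refl)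
 finally show ?thesis using F fmod_def by blast
qed

lemma omod_closed:
 fixes X :: "'k::topological_ab_group_add set"
 assumes "omod X Y" "closed Y" "add_subgroup X" "add_subgroup Y" "X \<subseteq> Y"
 shows "closed X"
proof -
 obtain U where U: "nb U" "U \<inter> Y \<subseteq> X" using assms(1) omod_def by blast
 show ?thesis
 proof (rule closedI_nb)
  fix x assume x: "!!U. nb U ==> \<exists>y\<in>X. x - y \<in> U"
  have "x \<in> closure X" using x by (rule closureI_nb)
  then have "x \<in> Y" using assms by (metis closure_closed closure_mono subsetD)
  obtain y where "y \<in> X" "x - y \<in> U" using x U by blast
  then have "x - y \<in> X" using U \<open>x \<in> Y\<close> assms sg_diff by blast
  then show "x \<in> X" using \<open>y \<in> X\<close> assms sg_cancel_diff by blast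
 qed
qed

lemma omod_trans: "omod X Y ==> omod Y Z ==> omod X Z"
 unfolding omod_def
proof (elim exE conjE)
 fix U U' assume "open U" "0 \<in> U" "U \<inter> Y \<subseteq> X" "open U'" "0 \<in> U'" "U' \<inter> Z \<subseteq> Y"
 then have "nb (U \<inter> U')" "(U \<inter> U') \<inter> Z \<subseteq> X" by auto
 then show "\<exists>U. nb U \<and> U \<inter> Z \<subseteq> X" by metis
qed

lemma omod_mono: "omod X Y ==> X \<subseteq> X' ==> Y' \<subseteq> Y ==> omod X' Y'"
 unfolding omod_def by (meson Int_mono order_refl order_trans)

lemma omod_Int: "omod X Y ==> omod X' Y ==> omod (X \<inter> X') Y"
 unfolding omod_def
proof (elim exE conjE)
 fix U U' assume "open U" "0 \<in> U" "U \<inter> Y \<subseteq> X" "open U'" "0 \<in> U'" "U' \<inter> Y \<subseteq> X'"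
 then have "nb (U \<inter> U')" "(U \<inter> U') \<inter> Y \<subseteq> X \<inter> X'" by auto
 then show "\<exists>U. nb U \<and> U \<inter> Y \<subseteq> X \<inter> X'" by metis
qed

lemma omod_refl: "omod X X"
 unfolding omod_def by (rule exI[of _ UNIV]) auto

lemma omod_restrict: "omod X Y ==> Z \<subseteq> Y ==> omod (X \<inter> Z) Z"
 unfolding omod_def by (meson Int_greatest Int_lower2 Int_mono order_refl order_trans)

lemma fmod_mono: "fmod X Y ==> X \<subseteq> X' ==> Y' \<subseteq> Y ==> fmod X' Y'"
 unfolding fmod_def by (meson order_trans set_plus_mono subset_refl)

lemma fmod_inside:
 assumes "fmod X Y" "X \<subseteq> Y" "add_subgroup X" "add_subgroup Y"
 obtains F where "finite F" "F \<subseteq> Y" "0 \<in> F" "Y = F + X"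
proof -
 obtain F0 where F0: "finite F0" "Y \<subseteq> F0 + X" using assms(1) fmod_def by blast
 have "Y \<subseteq> insert 0 (F0 \<inter> Y) + X"
 proof
  fix y assume y: "y \<in> Y"
  then obtain v x where vx: "v \<in> F0" "x \<in> X" "y = v + x" using F0 by (meson set_plusE subsetD)
  then have "v \<in> Y" using y assms sg_cancel_right by blast
  then show "y \<in> insert 0 (F0 \<inter> Y) + X" using vx by (auto intro: set_plusI)
 qed
 moreover have "insert 0 (F0 \<inter> Y) + X \<subseteq> Y"
  using assms by (intro sg_plus_subset) (auto simp: sg_zero)
 ultimately show ?thesis using that[of "insert 0 (F0 \<inter> Y)"] F0 assms sg_zero by auto
qed

lemma fmod_restrict:
 assumes "fmod X Y" "add_subgroup X" "add_subgroup Z" "Z \<subseteq> Y"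
 shows "fmod (X \<inter> Z) Z"
proof -
 obtain F where F: "finite F" "Y \<subseteq> F + X" using assms(1) fmod_def by blast
 \<comment> \<open>A translate of \<open>X\<close> by an element of \<open>F\<close> need not meet
   \<open>Z\<close>; each one that does gets a representative in \<open>Z\<close>. For the others
   the value is arbitrary, which does no harm.\<close>
 define r where "r f = (SOME z. z \<in> Z \<and> z - f \<in> X)" for f
 have "Z \<subseteq> r ` F + (X \<inter> Z)"
 proof
  fix z assume z: "z \<in> Z"
  then have "z \<in> F + X" using F assms by blast
  then obtain f where f: "f \<in> F" "z - f \<in> X" by (auto simp: set_plus_diff)
  then have "r f \<in> Z \<and> r f - f \<in> X" unfolding r_def using z by (metis (mono_tags, lifting) someI)
  then have "z - r f \<in> X \<inter> Z"
   using z f assms sg_diff[of X "z - f" "r f - f"] sg_diff[of Z z "r f"] by simp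
  then show "z \<in> r ` F + (X \<inter> Z)" using f by (auto simp: set_plus_diff)
 qed
 then show ?thesis using F fmod_def by blast
qed

lemma fmod_trans: "fmod X Y ==> fmod Y Z ==> fmod X Z"
 unfolding fmod_def
proof (elim exE conjE)
 fix V W assume "finite V" "Y \<subseteq> V + X" "finite W" "Z \<subseteq> W + Y"
 then have "Z \<subseteq> (W + V) + X"
  by (metis (no_types, lifting) add.assoc order_trans set_plus_mono subset_refl)
 then show "\<exists>V. finite V \<and> Z \<subseteq> V + X" using finite_set_plus \<open>finite V\<close> \<open>finite W\<close> by blast
qed

lemma fmod_plus: "fmod X Y ==> fmod X Z ==> add_subgroup X ==> fmod X (Y + Z)"
 unfolding fmod_def
proof (elim exE conjE)
 fix V W assume "finite V" "Y \<subseteq> V + X" "finite W" "Z \<subseteq> W + X" "add_subgroup X"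
 then have "Y + Z \<subseteq> (V + X) + (W + X)" by (simp add: set_plus_mono)
 also have "\<dots> = (V + W) + (X + X)" by (simp add: ac_simps)
 finally have "Y + Z \<subseteq> (V + W) + X" using sg_plus_self[OF \<open>add_subgroup X\<close>] by simp
 then show "\<exists>V. finite V \<and> Y + Z \<subseteq> V + X" using finite_set_plus \<open>finite V\<close> \<open>finite W\<close> by blast
qed

lemma fmod_refl: "fmod X X"
 unfolding fmod_def by (rule exI[of _ "{0}"]) (auto simp: set_plus_def)

text \<open>The complement of \<open>X\<close> in \<open>Y\<close> is covered by the finitely many
  other cosets, and each of them is closed.\<close>

lemma fmod_omod:
 fixes Y :: "'k::topological_ab_group_add set"
 assumes "fmod X Y" "closed X" "X \<subseteq> Y" "add_subgroup X" "add_subgroup Y"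
 shows "omod X Y"
proof -
 obtain F where F: "finite F" "Y = F + X" using fmod_inside[OF assms(1,3,4,5)] by metis
 define C where "C = (\<Union>f\<in>F - X. {x. x - f \<in> X})"
 have cl: "closed {x. x - f \<in> X}" for f
 proof -
  have "continuous_on UNIV (\<lambda>x. x - f)" by (intro continuous_intros)
  from closed_vimage[OF assms(2) this] show ?thesis by (simp add: vimage_def)
 qed
 have "closed C" unfolding C_def using F cl by (intro closed_UN) auto
 moreover have "0 \<notin> C" using assms(4) by (auto simp: C_def) (metis add.inverse_inverse sg_neg)
 moreover have "(- C) \<inter> Y \<subseteq> X"
 proof
  fix y assume y: "y \<in> (- C) \<inter> Y"
  then obtain f where f: "f \<in> F" "y - f \<in> X" using F by (auto simp: set_plus_diff)
  then have "f \<in> X" using y by (auto simp: C_def)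
  then show "y \<in> X" using f assms sg_cancel_diff by blast
 qed
 ultimately show ?thesis unfolding omod_def by (intro exI[of _ "- C"]) auto
qed

section \<open>Compactness arguments for directed families of closed sets modulo a subgroup\<close>

definition directed_down :: "'b set set => bool" where
 "directed_down F \<longleftrightarrow> (\<forall>A\<in>F. \<forall>B\<in>F. \<exists>C\<in>F. C \<subseteq> A \<inter> B)"

lemma directed_down_finite:
 assumes "directed_down F" "finite G" "G \<subseteq> F" "A \<in> F"
 shows "\<exists>C\<in>F. C \<subseteq> A \<inter> \<Inter>G"
 using assms(2,3)
proof (induction G)
 case empty then show ?case using assms(4) by auto
next
 case (insert B G)
 then obtain C where "C \<in> F" "C \<subseteq> A \<inter> \<Inter>G" by auto
 moreover obtain D where "D \<in> F" "D \<subseteq> C \<inter> B" using assms(1) insert.prems \<open>C \<in> F\<close> unfolding directed_down_def by (metis insert_subset)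
 ultimately show ?case by (intro bexI[of _ D]) auto
qed

lemma directed_down_range:
 assumes "!!n. A (Suc n) \<subseteq> A n"
 shows "directed_down (range (A :: nat => 'b set))"
proof -
 have d: "antimono A" using assms by (simp add: antimono_iff_le_Suc)
 show ?thesis unfolding directed_down_def
 proof (clarsimp)
  fix m n
  have "A (max m n) \<subseteq> A m" "A (max m n) \<subseteq> A n" using d by (auto simp: antimono_def)
  then show "\<exists>k. A k \<subseteq> A m \<and> A k \<subseteq> A n" by blast
 qed
qed

text \<open>Compactness is available only modulo \<open>X\<close>, so the members must be stable
  under subtracting elements of \<open>X\<close>: a point of a member can then be shifted into the
  compact set \<open>V\<close>, where the ordinary finite intersection property applies.\<close>

lemma cocpt_fip:
 fixes F :: "'k::topological_ab_group_add set set"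
 assumes "directed_down F" "A0 \<in> F" "cocpt X A0"
  and cl: "!!A. A \<in> F ==> closed A" and ne: "!!A. A \<in> F ==> A \<noteq> {}"
  and sat: "!!A a x. A \<in> F ==> a \<in> A ==> x \<in> X ==> a - x \<in> A"
 obtains z where "!!A. A \<in> F ==> z \<in> A"
proof -
 obtain V where V: "compact V" "A0 \<subseteq> V + X" using assms(3) cocpt_def by blast
 have "V \<inter> \<Inter>F \<noteq> {}"
 proof (rule compact_imp_fip[OF V(1) cl])
  fix G assume "finite G" "G \<subseteq> F"
  then obtain C where C: "C \<in> F" "C \<subseteq> A0 \<inter> \<Inter>G" using directed_down_finite assms by metis
  obtain c where c: "c \<in> C" using ne[OF C(1)] by blast
  then have "c \<in> V + X" using C(2) V(2) by blast
  then obtain v x where vx: "v \<in> V" "x \<in> X" "c = v + x" by (rule set_plusE)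
  have "c - x \<in> C" by (rule sat[OF C(1) c vx(2)])
  then have "v \<in> C" using vx(3) by simp
  have "v \<in> A0 \<inter> \<Inter>G" by (rule subsetD[OF C(2) \<open>v \<in> C\<close>])
  then have "v \<in> V \<inter> \<Inter>G" using vx(1) by blast
  then show "V \<inter> \<Inter>G \<noteq> {}" by blast
 qed
 then obtain z where "z \<in> V \<inter> \<Inter>F" by (metis ex_in_conv)
 then show ?thesis using that by (metis IntD2 InterE)
qed

text \<open>Otherwise the sets \<open>A - (U + X)\<close> would be nonempty, closed and again stable
  under \<open>X\<close>, and \<open>cocpt_fip\<close> would produce a point of
  \<open>\<Inter>F\<close> outside \<open>U + X\<close>.\<close>

lemma cocpt_directed_subset:
 fixes F :: "'k::topological_ab_group_add set set"
 assumes "directed_down F" "A0 \<in> F" "cocpt X A0"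
  and cl: "!!A. A \<in> F ==> closed A"
  and sat: "!!A a x. A \<in> F ==> a \<in> A ==> x \<in> X ==> a - x \<in> A"
  and X: "add_subgroup X" "nb U" "\<Inter>F \<subseteq> U + X"
 shows "\<exists>A\<in>F. A \<subseteq> U + X"
proof (rule ccontr)
 assume con: "\<not> ?thesis"
 define G where "G = (\<lambda>A. A - (U + X)) ` F"
 have "directed_down G"
  unfolding directed_down_def G_def
 proof (clarsimp)
  fix A B assume "A \<in> F" "B \<in> F"
  then obtain C where "C \<in> F" "C \<subseteq> A \<inter> B" using assms(1) unfolding directed_down_def by metis
  then show "\<exists>C\<in>F. C - (U + X) \<subseteq> A - (U + X) \<and> C - (U + X) \<subseteq> B - (U + X)" by (intro bexI[of _ C]) auto
 qed
 moreover have "A0 - (U + X) \<in> G" using assms(2) G_def by auto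
 moreover have "cocpt X (A0 - (U + X))" using cocpt_mono[OF assms(3)] by auto
 moreover have "!!A. A \<in> G ==> closed A" using cl open_set_plus X by (auto simp: G_def intro!: closed_Diff)
 moreover have "!!A. A \<in> G ==> A \<noteq> {}" using con by (auto simp: G_def)
 moreover have "!!A a x. A \<in> G ==> a \<in> A ==> x \<in> X ==> a - x \<in> A"
 proof -
  fix A a x assume "A \<in> G" "a \<in> A" "x \<in> X"
  then obtain B where B: "B \<in> F" "A = B - (U + X)" by (auto simp: G_def)
  then have "a - x \<in> B" using sat \<open>a \<in> A\<close> \<open>x \<in> X\<close> by auto
  moreover have "a - x \<notin> U + X"
  proof
   assume "a - x \<in> U + X"
   then obtain u x' where "u \<in> U" "x' \<in> X" "a - x = u + x'" by (rule set_plusE)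
   then have "a = u + (x' + x)" by (simp add: algebra_simps)
   then have "a \<in> U + X" using \<open>u \<in> U\<close> \<open>x' \<in> X\<close> \<open>x \<in> X\<close> X sg_add set_plusI by metis
   then show False using \<open>a \<in> A\<close> B by simp
  qed
  ultimately show "a - x \<in> A" using B by simp
 qed
 ultimately obtain z where z: "!!A. A \<in> G ==> z \<in> A" using cocpt_fip[of G "A0 - (U + X)" X] by metis
 then have "z \<in> A \<and> z \<notin> U + X" if "A \<in> F" for A using that by (auto simp: G_def)
 then show False using X assms(2) by auto
qed

text \<open>The ambient group is not assumed locally compact, since it will be an infinite product.
  A compact set is only asked to contain the part of a neighbourhood that lies in
  \<open>G\<close>.\<close>

definition lcg :: "'k::topological_ab_group_add set => bool" where
 "lcg G \<longleftrightarrow> closed G \<and> add_subgroup G \<and> (\<exists>U V. nb U \<and> compact V \<and> U \<inter> G \<subseteq> V)"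

lemma lcg_subset: "lcg G ==> closed Y ==> add_subgroup Y ==> Y \<subseteq> G ==> lcg Y"
 unfolding lcg_def by blast

lemma lcg_nbhd:
 fixes G :: "'k::{topological_ab_group_add, t2_space} set"
 assumes "lcg G"
 obtains U V where "nb U" "compact V" "V \<subseteq> G" "0 \<in> V" "!!v. v \<in> V ==> - v \<in> V" "U \<inter> G \<subseteq> V"
proof -
 obtain U V0 where V0: "nb U" "compact V0" "U \<inter> G \<subseteq> V0" using assms lcg_def by blast
 have G: "closed G" "add_subgroup G" using assms lcg_def by auto
 define V where "V = (V0 \<inter> G) \<union> uminus ` (V0 \<inter> G)"
 have "compact V" using V0 G by (auto simp: V_def compact_Int_closed intro!: compact_Un compact_uminus_image)
 moreover have "V \<subseteq> G" using G by (auto simp: V_def sg_neg)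
 moreover have "0 \<in> V" using V0 G sg_zero by (auto simp: V_def)
 moreover have "!!v. v \<in> V ==> - v \<in> V" by (auto simp: V_def)
 moreover have "U \<inter> G \<subseteq> V" using V0 by (auto simp: V_def)
 ultimately show ?thesis using that V0 by blast
qed

lemma closure_add_subgroup:
 fixes X :: "'k::topological_ab_group_add set"
 assumes "add_subgroup X" shows "add_subgroup (closure X)"
 unfolding add_subgroup_def
proof (intro conjI ballI)
 show "0 \<in> closure X" using assms sg_zero closure_subset by blast
next
 fix x y assume xy: "x \<in> closure X" "y \<in> closure X"
 show "x + y \<in> closure X"
 proof (rule closureI_nb)
  fix U assume "nb (U::'k set)"
  then obtain V where V: "nb V" "!!x y. x \<in> V ==> y \<in> V ==> x + y \<in> U" using nb_half by metis
  obtain a where a: "a \<in> X" "x - a \<in> V" using closure_nb[OF xy(1) V(1)] .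
  obtain b where b: "b \<in> X" "y - b \<in> V" using closure_nb[OF xy(2) V(1)] .
  have "(x + y) - (a + b) = (x - a) + (y - b)" by simp
  then show "\<exists>z\<in>X. x + y - z \<in> U" using V a b assms sg_add by metis
 qed
next
 fix x assume x: "x \<in> closure X"
 show "- x \<in> closure X"
 proof (rule closureI_nb)
  fix U assume "nb (U::'k set)"
  then obtain V where V: "nb V" "V \<subseteq> U" "!!x. x \<in> V ==> - x \<in> V" using nb_half by metis
  obtain a where a: "a \<in> X" "x - a \<in> V" using closure_nb[OF x V(1)] .
  have "- x - - a = - (x - a)" by simp
  then show "\<exists>z\<in>X. - x - z \<in> U" using V a assms sg_neg by (metis subsetD)
 qed
qed

section \<open>Modules over a topological group\<close>

locale tgact =
 fixes act :: "'a::{topological_ab_group_add, t2_space} => 'k::{topological_ab_group_add, t2_space} => 'k"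
 assumes act_add: "act a (x + y) = act a x + act a y"
  and act_0 [simp]: "act 0 x = x"
  and act_act: "act (a + b) x = act a (act b x)"
  and act_cont: "continuous_on UNIV (\<lambda>p. act (fst p) (snd p))"
begin

lemma act_zero [simp]: "act a 0 = 0"
 using act_add[of a 0 0] by simp

lemma act_neg: "act a (- x) = - act a x"
 using act_add[of a x "- x"] by (simp add: eq_neg_iff_add_eq_0 add.commute)

lemma act_diff: "act a (x - y) = act a x - act a y"
 using act_add[of a x "- y"] by (simp add: act_neg)

lemma act_inv [simp]: "act (- a) (act a x) = x" "act a (act (- a) x) = x"
 using act_act[of "- a" a x] act_act[of a "- a" x] by simp_all

lemma act_comm: "act a (act b x) = act b (act a x)"
 by (metis act_act add.commute)

lemma act_cont1: "continuous_on UNIV (act a)"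
proof -
 have "continuous_on UNIV (\<lambda>x. (a, x))" by (intro continuous_intros)
 then have "continuous_on UNIV ((\<lambda>p. act (fst p) (snd p)) \<circ> (\<lambda>x. (a, x)))"
  by (rule continuous_on_compose) (rule continuous_on_subset[OF act_cont], simp)
 then show ?thesis by (simp add: o_def)
qed

lemma compact_act:
 assumes "compact S" "compact V"
 shows "compact ((\<lambda>p. act (fst p) (snd p)) ` (S \<times> V))"
 by (intro compact_continuous_image continuous_on_subset[OF act_cont] compact_Times assms) simp

lemma compact_act1: "compact V ==> compact (act a ` V)"
 by (intro compact_continuous_image continuous_on_subset[OF act_cont1]) simp_all

text \<open>Joint continuity and the tube lemma give one neighbourhood that works for all operators
  in \<open>S\<close> at once.\<close>

lemma nb_act:
 assumes "compact S" "nb U"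
 obtains V where "nb V" "!!a v. a \<in> S ==> v \<in> V ==> act a v \<in> U"
proof -
 have c: "continuous_on UNIV (\<lambda>p::'k\<times>'a. act (snd p) (fst p))"
 proof -
  have "continuous_on UNIV (\<lambda>p::'k\<times>'a. (snd p, fst p))" by (intro continuous_intros)
  then have "continuous_on UNIV ((\<lambda>p. act (fst p) (snd p)) \<circ> (\<lambda>p::'k\<times>'a. (snd p, fst p)))"
   by (rule continuous_on_compose) (rule continuous_on_subset[OF act_cont], simp)
  then show ?thesis by (simp add: o_def)
 qed
 have o: "open ((\<lambda>p::'k\<times>'a. act (snd p) (fst p)) -` U)"
  using open_vimage[OF _ c, of U] assms(2) by simp
 have p: "!!k. k \<in> S ==> (0, k) \<in> (\<lambda>p::'k\<times>'a. act (snd p) (fst p)) -` U"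
  using assms(2) by simp
 from tube[OF assms(1) o p] obtain V where "open V" "0 \<in> V"
  "\<forall>u\<in>V. \<forall>k\<in>S. (u, k) \<in> (\<lambda>p::'k\<times>'a. act (snd p) (fst p)) -` U" by metis
 then show ?thesis using that[of V] by simp
qed

text \<open>The operator set \<open>T\<close> varies: intermediate subgroups in the dynamical
  arguments are stable only under finitely many elements of the acting group, the final objects
  under \<open>UNIV\<close>.\<close>

definition sub :: "'a set => 'k set => bool" where
 "sub T X \<longleftrightarrow> add_subgroup X \<and> (\<forall>a\<in>T. \<forall>x\<in>X. act a x \<in> X)"

text \<open>Compactness of \<open>S\<close> allows neighbourhoods of zero to be chosen uniformly for
  its operators, and stability under \<open>S\<close> is then all that has to be checked.\<close>

definition gens :: "'a set => 'a set => bool" where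
 "gens S T \<longleftrightarrow> compact S \<and> S \<subseteq> T \<and>
   (\<forall>X. add_subgroup X \<and> (\<forall>a\<in>S. \<forall>x\<in>X. act a x \<in> X) --> sub T X)"

lemma subD: "sub T X ==> add_subgroup X" "sub T X ==> a \<in> T ==> x \<in> X ==> act a x \<in> X"
 by (auto simp: sub_def)

lemma sub_mono: "sub T X ==> T' \<subseteq> T ==> sub T' X"
 by (auto simp: sub_def)

lemma sub_Int: "sub T X ==> sub T Y ==> sub T (X \<inter> Y)"
 by (auto simp: sub_def sg_Int)

lemma sub_Inter: "(!!X. X \<in> F ==> sub T X) ==> sub T (\<Inter>F)"
 by (auto simp: sub_def intro: sg_Inter)

lemma sub_plus: assumes "sub T X" "sub T Y" shows "sub T (X + Y)"
 unfolding sub_def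
proof (intro conjI ballI)
 show "add_subgroup (X + Y)" using assms sg_plus subD by blast
 fix a x assume "a \<in> T" "x \<in> X + Y"
 then obtain u v where "u \<in> X" "v \<in> Y" "x = u + v" by (elim set_plusE)
 then show "act a x \<in> X + Y" using assms \<open>a \<in> T\<close> by (intro set_plusI[of "act a u" _ "act a v"]) (auto simp: act_add subD)
qed

lemma sub_closure: assumes "sub T X" shows "sub T (closure X)"
 unfolding sub_def
proof (intro conjI ballI)
 show "add_subgroup (closure X)" using assms closure_add_subgroup subD by blast
 fix a x assume a: "a \<in> T" and x: "x \<in> closure X"
 show "act a x \<in> closure X"
 proof (rule closureI_nb)
  fix U assume "nb (U::'k set)"
  then have "nb {y. act a y \<in> U}" using nb_vimage act_cont1 act_zero by blast
  from closure_nb[OF x this] obtain y where "y \<in> X" "x - y \<in> {y. act a y \<in> U}" by blast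
  then have "act a y \<in> X" "act a x - act a y \<in> U" using a assms subD by (auto simp: act_diff)
  then show "\<exists>z\<in>X. act a x - z \<in> U" by (rule bexI[rotated])
 qed
qed

lemma gensD: "gens S T ==> add_subgroup X ==> (!!a x. a \<in> S ==> x \<in> X ==> act a x \<in> X) ==> sub T X"
 by (auto simp: gens_def)

lemma sub_plusI:
 assumes S: "gens S T" and Z: "sub T Z" and V: "0 \<in> V" "!!v. v \<in> V ==> - v \<in> V + Z"
  "!!v w. v \<in> V ==> w \<in> V ==> v + w \<in> V + Z" "!!a v. a \<in> S ==> v \<in> V ==> act a v \<in> V + Z"
 shows "sub T (V + Z)"
proof (rule gensD[OF S sg_plusI[OF subD(1)[OF Z] V(1-3)]])
 fix a x assume a: "a \<in> S" "x \<in> V + Z"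
 obtain v z where x: "v \<in> V" "z \<in> Z" "x = v + z" using a(2) by (rule set_plusE)
 obtain w y where w: "w \<in> V" "y \<in> Z" "act a v = w + y" using V(4)[OF a(1) x(1)] by (rule set_plusE)
 have "act a z \<in> Z" using S a(1) by (intro subD(2)[OF Z _ x(2)]) (auto simp: gens_def)
 then show "act a x \<in> V + Z"
  by (rule set_plusI[OF w(1) sg_add[OF subD(1)[OF Z] w(2)]]) (simp add: x(3) act_add w(3) add.assoc)
qed

lemma gens_finite: "finite T ==> gens T T"
 by (auto simp: gens_def sub_def finite_imp_compact)

text \<open>The threefold sums and the expressions \<open>act a u + v\<close> are exactly the
  elements that \<open>split_off_open\<close> has to recognise as small.\<close>

lemma nb_small:
 assumes "compact S" "nb U0"
 shows "\<exists>U. nb U \<and> U \<subseteq> U0 \<and> (\<forall>u\<in>U. - u \<in> U) \<and>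
  (\<forall>x\<in>U. \<forall>y\<in>U. \<forall>z\<in>U. x + y + z \<in> U0) \<and> (\<forall>a\<in>S. \<forall>u\<in>U. \<forall>v\<in>U. act a u + v \<in> U0)"
proof -
 obtain U1 where U1: "nb U1" "U1 \<subseteq> U0" "!!x y. x \<in> U1 ==> y \<in> U1 ==> x + y \<in> U0"
  using nb_half[OF assms(2)] by metis
 obtain V where V: "nb V" "!!a v. a \<in> S ==> v \<in> V ==> act a v \<in> U1" using nb_act[OF assms(1) U1(1)] by metis
 obtain U where U: "nb U" "U \<subseteq> U1 \<inter> V" "!!u. u \<in> U ==> - u \<in> U" "!!x y. x \<in> U ==> y \<in> U ==> x + y \<in> U1 \<inter> V"
  using nb_half[OF nb_Int[OF U1(1) V(1)]] by metis
 show ?thesis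
 proof (intro exI[of _ U] conjI ballI)
  show "U \<subseteq> U0" using U U1 by auto
  show "- u \<in> U" if "u \<in> U" for u using U(3)[OF that] .
  fix x y z assume "x \<in> U" "y \<in> U" "z \<in> U"
  then show "x + y + z \<in> U0" using U(2) U(4)[of x y] U1(3)[of "x + y" z] by blast
 next
  fix a u v assume "a \<in> S" "u \<in> U" "v \<in> U"
  then show "act a u + v \<in> U0" using U(2) U1(3)[of "act a u" v] V(2)[of a u] by blast
 qed (use U(1) in auto)
qed

text \<open>\<open>D\<close> lies within \<open>U\<close> of \<open>H\<close>. So a sum, or an image
  under \<open>S\<close>, of small elements of \<open>D\<close> is a small element plus some
  \<open>h \<in> H\<close>; this \<open>h\<close> is itself a short combination of small elements
  and hence lies in \<open>E\<close>. Thus the small elements of \<open>D\<close> generate, together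
  with \<open>E\<close>, nothing in \<open>H\<close> beyond \<open>E\<close>.\<close>

lemma split_off_open:
 assumes S: "gens S T" and H: "sub T H" and D: "sub T D" and E: "sub T E" and "E \<subseteq> H" "H \<subseteq> D"
  and U: "nb U" "!!u. u \<in> U ==> - u \<in> U" "D \<subseteq> U + H"
  and E3: "!!x y z. x \<in> U ==> y \<in> U ==> z \<in> U ==> x + y + z \<in> H ==> x + y + z \<in> E"
  and ES: "!!a u v. a \<in> S ==> u \<in> U ==> v \<in> U ==> act a u + v \<in> H ==> act a u + v \<in> E"
 defines "Y \<equiv> E + (D \<inter> U)"
 shows "sub T Y" "Y \<inter> H = E" "E \<subseteq> Y" "Y \<subseteq> D" "omod Y D"
proof -
 have gE: "add_subgroup E" and gD: "add_subgroup D" and gH: "add_subgroup H" using E D H subD by auto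
 have key: "w \<in> Y" if w: "w \<in> D" "!!u. u \<in> U ==> w + - u \<in> H ==> w + - u \<in> E" for w
 proof -
  obtain u h where uh: "u \<in> U" "h \<in> H" "w = u + h" using w U(3) by (meson set_plusE subsetD)
  then have "h \<in> E" using w(2)[of u] by simp
  moreover have "u \<in> D" using uh w gD assms(6) sg_cancel_right by blast
  ultimately show ?thesis unfolding Y_def using uh by (intro set_plusI[of h _ u]) (auto simp: add.commute)
 qed
 have inE: "x + y \<in> Y" if xy: "x \<in> E" "y \<in> Y" for x y
 proof -
  obtain e u where "e \<in> E" "u \<in> D \<inter> U" "y = e + u" using xy(2) unfolding Y_def by (rule set_plusE)
  then show ?thesis unfolding Y_def using xy(1) gE sg_add by (intro set_plusI[of "x + e" _ u]) (auto simp: add.assoc)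
 qed
 have ED: "E \<subseteq> D" using assms by blast
 have 3: "x + y + z \<in> E" if "x \<in> U" "y \<in> U" "z \<in> U" "x + y + z \<in> H" for x y z using E3 that .
 have add: "x + y \<in> Y" if xy: "x \<in> Y" "y \<in> Y" for x y
 proof -
  obtain e u where 1: "e \<in> E" "u \<in> D" "u \<in> U" "x = e + u" using xy(1) unfolding Y_def by (auto elim: set_plusE)
  obtain e' u' where 2: "e' \<in> E" "u' \<in> D" "u' \<in> U" "y = e' + u'" using xy(2) unfolding Y_def by (auto elim: set_plusE)
  have "u + u' \<in> Y"
  proof (rule key)
   show "u + u' \<in> D" using 1 2 gD sg_add by blast
   show "u + u' + - w \<in> E" if "w \<in> U" "u + u' + - w \<in> H" for w
    using 3[OF 1(3) 2(3) U(2)[OF that(1)] that(2)] .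
  qed
  then have "(e + e') + (u + u') \<in> Y" using inE gE 1 2 sg_add by blast
  then show ?thesis using 1 2 by (simp add: algebra_simps)
 qed
 have neg: "- x \<in> Y" if xy: "x \<in> Y" for x
 proof -
  obtain e u where 1: "e \<in> E" "u \<in> D" "u \<in> U" "x = e + u" using xy(1) unfolding Y_def by (auto elim: set_plusE)
  then show ?thesis unfolding Y_def using gE gD sg_neg U(2)
   by (intro set_plusI[of "- e" _ "- u"]) auto
 qed
 have "0 \<in> Y" unfolding Y_def using gE gD U(1) sg_zero by (intro set_plusI[of 0 _ 0]) auto
 then have "add_subgroup Y" using add neg by (auto simp: add_subgroup_def)
 then show "sub T Y"
 proof (rule gensD[OF S])
  fix a x assume a: "a \<in> S" and "x \<in> Y"
  then obtain e u where 1: "e \<in> E" "u \<in> D" "u \<in> U" "x = e + u" unfolding Y_def by (auto elim: set_plusE)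
  have aT: "a \<in> T" using S a gens_def by auto
  have "act a u \<in> Y"
  proof (rule key)
   show "act a u \<in> D" using subD(2)[OF D aT 1(2)] .
   show "act a u + - w \<in> E" if "w \<in> U" "act a u + - w \<in> H" for w
    using ES[OF a 1(3) U(2)[OF that(1)] that(2)] .
  qed
  moreover have "act a e \<in> E" using 1 aT E subD by auto
  ultimately show "act a x \<in> Y" using inE 1 by (simp add: act_add)
 qed
 show EY: "E \<subseteq> Y" unfolding Y_def using gD U(1) sg_zero by (intro set_plus_left) auto
 show "Y \<subseteq> D" unfolding Y_def using ED gD by (intro sg_plus_subset) auto
 have "x \<in> E" if xy: "x \<in> Y" "x \<in> H" for x
 proof -
  obtain e u where 1: "e \<in> E" "u \<in> D" "u \<in> U" "x = e + u" using xy(1) unfolding Y_def by (auto elim: set_plusE)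
  then have "u \<in> H" using xy(2) gH assms(5) sg_cancel_left by blast
  then have "u \<in> E" using E3[of u 0 0] 1 U(1) by simp
  then show ?thesis using 1 gE sg_add by blast
 qed
 then show "Y \<inter> H = E" using EY assms(5) by auto
 have "U \<inter> D \<subseteq> Y" unfolding Y_def using gE sg_zero set_plus_right by (metis Int_commute)
 then show "omod Y D" unfolding omod_def using U(1) by blast
qed

text \<open>Quotients are not formed: \<open>parafin T X Y\<close> stands for "Y/X is compact parafinite", \<open>pdisc T U N\<close> for
 "N/U has no nonzero finite submodule".\<close>

definition parafin :: "'a set => 'k set => 'k set => bool" where
 "parafin T X Y \<longleftrightarrow> closed X \<and> closed Y \<and> sub T X \<and> sub T Y \<and> X \<subseteq> Y \<and> cocpt X Y \<and>
   (\<forall>U. sub T U \<and> closed U \<and> X \<subseteq> U \<and> U \<subseteq> Y \<and> fmod U Y --> U = Y)"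

definition Wzero :: "'a set => 'k set => 'k set => bool" where
 "Wzero T X G \<longleftrightarrow> (\<forall>Y. parafin T X Y \<and> Y \<subseteq> G --> Y = X)"

text \<open>The trace \<open>U \<inter> Y\<close> has finite index in \<open>Y\<close>, and a
  parafinite \<open>Y\<close> has no proper closed submodule of that kind.\<close>

lemma parafin_subset:
 assumes "parafin T X Y" "sub T U" "closed U" "X \<subseteq> U" "fmod U Z" "Y \<subseteq> Z"
 shows "Y \<subseteq> U"
proof -
 have Y: "closed Y" "sub T Y" "X \<subseteq> Y" using assms(1) parafin_def by auto
 have "fmod (U \<inter> Y) Y" by (rule fmod_restrict[OF assms(5)]) (use assms Y subD in auto)
 then have "U \<inter> Y = Y"
  using assms Y sub_Int closed_Int unfolding parafin_def by (metis Int_lower2 le_inf_iff)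
 then show ?thesis by blast
qed

lemma fmod_Int:
 assumes "fmod A D" "fmod B D" "add_subgroup A" "add_subgroup B" "A \<subseteq> D"
 shows "fmod (A \<inter> B) D"
 using fmod_trans[OF fmod_restrict[OF assms(2,4,3,5)] assms(1)] by (simp add: Int_commute)

text \<open>The intersection \<open>I\<close> of all closed submodules of finite index is parafinite
  over \<open>X\<close>: a submodule \<open>E\<close> of finite index in \<open>I\<close> extends,
  by \<open>split_off_open\<close> over a member \<open>A\<close> close to \<open>I\<close>, to a
  member of the family that meets \<open>I\<close> in \<open>E\<close>, so
  \<open>I \<subseteq> E\<close>. Hence \<open>I = X\<close>, and compactness puts some member
  inside \<open>U + X\<close>.\<close>

lemma profinite_basis:
 assumes S: "gens S T" and X: "closed X" "sub T X" and D: "closed D" "sub T D" "X \<subseteq> D" "cocpt X D"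
  and W: "Wzero T X D" and U: "nb U"
 obtains D1 where "sub T D1" "closed D1" "X \<subseteq> D1" "D1 \<subseteq> D" "fmod D1 D" "D1 \<subseteq> U + X"
proof -
 define F where "F = {D1. sub T D1 \<and> closed D1 \<and> X \<subseteq> D1 \<and> D1 \<subseteq> D \<and> fmod D1 D}"
 have DF: "D \<in> F" using D F_def fmod_refl by auto
 have dir: "directed_down F"
  unfolding directed_down_def
 proof (intro ballI)
  fix A B assume "A \<in> F" "B \<in> F"
  then have ab: "sub T A" "closed A" "X \<subseteq> A" "A \<subseteq> D" "fmod A D"
   "sub T B" "closed B" "X \<subseteq> B" "fmod B D" unfolding F_def by auto
  have "fmod (A \<inter> B) D" by (rule fmod_Int[OF ab(5,9) subD(1)[OF ab(1)] subD(1)[OF ab(6)] ab(4)])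
  then have "A \<inter> B \<in> F" unfolding F_def using ab sub_Int[OF ab(1,6)] closed_Int[OF ab(2,7)] by blast
  then show "\<exists>C\<in>F. C \<subseteq> A \<inter> B" by blast
 qed
 define I where "I = \<Inter>F"
 have cl: "!!A. A \<in> F ==> closed A" by (auto simp: F_def)
 have sg: "!!A. A \<in> F ==> add_subgroup A" using subD by (auto simp: F_def)
 have I: "sub T I" "closed I" "X \<subseteq> I" "I \<subseteq> D"
  unfolding I_def using DF by (auto simp: F_def intro!: sub_Inter closed_Inter)
 have "parafin T X I"
  unfolding parafin_def
 proof (intro conjI allI impI)
  show "cocpt X I" using cocpt_mono[OF D(4)] I by auto
  fix E assume E: "sub T E \<and> closed E \<and> X \<subseteq> E \<and> E \<subseteq> I \<and> fmod E I"
  have "omod E I" using fmod_omod E I subD by blast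
  then obtain U0 where U0: "nb U0" "U0 \<inter> I \<subseteq> E" unfolding omod_def by blast
  have cS: "compact S" using S gens_def by auto
  obtain U1 where U1: "nb U1" "U1 \<subseteq> U0" "\<forall>u\<in>U1. - u \<in> U1"
   "\<forall>x\<in>U1. \<forall>y\<in>U1. \<forall>z\<in>U1. x + y + z \<in> U0"
   "\<forall>a\<in>S. \<forall>u\<in>U1. \<forall>v\<in>U1. act a u + v \<in> U0"
   using nb_small[OF cS U0(1)] by metis
  have "\<exists>A\<in>F. A \<subseteq> U1 + I"
  proof (rule cocpt_directed_subset[OF dir DF _ cl _ _ U1(1)])
   show "cocpt I D" using cocpt_mono[OF D(4)] I by auto
   show "a - x \<in> A" if "A \<in> F" "a \<in> A" "x \<in> I" for A a x
    using sg_diff[OF sg[OF that(1)] that(2), of x] that(1,3) I_def by blast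
   show "add_subgroup I" using I subD by auto
   show "\<Inter>F \<subseteq> U1 + I" using U1(1) set_plus_right I_def by blast
  qed
  then obtain A where A: "A \<in> F" "A \<subseteq> U1 + I" by blast
  have IA: "I \<subseteq> A" using A I_def by blast
  have sA: "sub T A" using A F_def by auto
  have so: "sub T (E + (A \<inter> U1))" "(E + (A \<inter> U1)) \<inter> I = E" "E \<subseteq> E + (A \<inter> U1)" "E + (A \<inter> U1) \<subseteq> A" "omod (E + (A \<inter> U1)) A"
  proof -
   have E': "sub T E" "E \<subseteq> I" using E by auto
   have e3: "x + y + z \<in> E" if "x \<in> U1" "y \<in> U1" "z \<in> U1" "x + y + z \<in> I" for x y z
    using U1(4) that U0(2) by blast
   have eS: "act a u + v \<in> E" if "a \<in> S" "u \<in> U1" "v \<in> U1" "act a u + v \<in> I" for a u v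
    using U1(5) that U0(2) by blast
   note so = split_off_open[OF S I(1) sA E' IA U1(1) bspec[OF U1(3)] A(2) e3 eS]
   show "sub T (E + (A \<inter> U1))" "(E + (A \<inter> U1)) \<inter> I = E" "E \<subseteq> E + (A \<inter> U1)" "E + (A \<inter> U1) \<subseteq> A" "omod (E + (A \<inter> U1)) A"
    by (rule so; assumption)+
  qed
  have "closed (E + (A \<inter> U1))" using omod_closed[OF so(5) cl[OF A(1)] subD(1)[OF so(1)] sg[OF A(1)] so(4)] .
  moreover have "fmod (E + (A \<inter> U1)) A"
  proof (rule cocpt_omod_fmod[of X])
   show "cocpt X A" using cocpt_mono[OF D(4)] A F_def by auto
   show "X \<subseteq> E + (A \<inter> U1)" using E so by blast
  qed (use so A(1) cl sg subD X in auto)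
  then have "fmod (E + (A \<inter> U1)) D" using fmod_trans A F_def by blast
  ultimately have "E + (A \<inter> U1) \<in> F" using so A E unfolding F_def by blast
  then have "I \<subseteq> E + (A \<inter> U1)" using I_def by blast
  then show "E = I" using so(2) by blast
 qed (use X I in auto)
 then have "I = X" using W I Wzero_def by blast
 have "\<exists>A\<in>F. A \<subseteq> U + X"
 proof (rule cocpt_directed_subset[OF dir DF D(4) cl _ _ U])
  show "a - x \<in> A" if "A \<in> F" "a \<in> A" "x \<in> X" for A a x
   using sg_diff[OF sg[OF that(1)] that(2), of x] that(1,3) I_def \<open>I = X\<close> by blast
  show "add_subgroup X" using X subD by auto
  show "\<Inter>F \<subseteq> U + X" using U set_plus_right I_def \<open>I = X\<close> by blast
 qed
 then show ?thesis using that F_def by blast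
qed

lemma parafin_plus:
 assumes "parafin T X Y" "parafin T X Z" shows "parafin T X (Y + Z)"
proof -
 have Y: "closed X" "sub T X" "closed Y" "sub T Y" "X \<subseteq> Y" "cocpt X Y" using assms(1) parafin_def by auto
 have Z: "closed Z" "sub T Z" "X \<subseteq> Z" "cocpt X Z" using assms(2) parafin_def by auto
 have g: "add_subgroup X" "add_subgroup Y" "add_subgroup Z" using Y Z subD by auto
 have YZ: "Y \<subseteq> Y + Z" "Z \<subseteq> Y + Z" using g sg_zero set_plus_left set_plus_right by blast+
 show ?thesis unfolding parafin_def
 proof (intro conjI allI impI)
  show "closed (Y + Z)" using closed_if_cocpt Y Z g by blast
  show "cocpt X (Y + Z)" using cocpt_plus Y Z g by blast
  show "sub T (Y + Z)" using sub_plus Y Z by blast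
  show "X \<subseteq> Y + Z" using YZ Y by blast
  fix U assume U: "sub T U \<and> closed U \<and> X \<subseteq> U \<and> U \<subseteq> Y + Z \<and> fmod U (Y + Z)"
  then have u: "sub T U" "closed U" "X \<subseteq> U" "fmod U (Y + Z)" by auto
  have "Y \<subseteq> U" by (rule parafin_subset[OF assms(1) u YZ(1)])
  moreover have "Z \<subseteq> U" by (rule parafin_subset[OF assms(2) u YZ(2)])
  ultimately have "Y + Z \<subseteq> U" by (rule sg_plus_subset[OF subD(1)[OF u(1)]])
  then show "U = Y + Z" using U by blast
 qed (use Y in auto)
qed

text \<open>The submodules parafinite over \<open>X\<close> form a directed family; the difficulty
  is that the closure \<open>D\<close> of their union is still compact over \<open>X\<close>. For a
  compact neighbourhood \<open>V\<close> of zero in \<open>D\<close>, finitely many points of the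
  union suffice to bring sums and images of \<open>V\<close> back into \<open>V\<close>. They lie in
  one member \<open>Y\<close>, so \<open>V + Y\<close> is an open submodule, compact over
  \<open>X\<close>, and it absorbs every other member because its trace there has finite
  index.\<close>

theorem largest_parafin:
 assumes S: "gens S T" and G: "lcg G" "sub T G" and X: "closed X" "sub T X" "X \<subseteq> G"
 obtains W where "parafin T X W" "W \<subseteq> G" "!!Y. parafin T X Y ==> Y \<subseteq> G ==> Y \<subseteq> W"
proof -
 define P where "P = {Y. parafin T X Y \<and> Y \<subseteq> G}"
 have cG: "closed G" "add_subgroup G" using G lcg_def by auto
 have XP: "X \<in> P" using X by (auto simp: P_def parafin_def cocpt_refl)
 have PP: "Y + Z \<in> P \<and> Y \<subseteq> Y + Z \<and> Z \<subseteq> Y + Z" if "Y \<in> P" "Z \<in> P" for Y Z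
 proof -
  have yz: "parafin T X Y" "parafin T X Z" "Y \<subseteq> G" "Z \<subseteq> G" using that P_def by auto
  have "parafin T X (Y + Z)" by (rule parafin_plus[OF yz(1,2)])
  moreover have "Y + Z \<subseteq> G" by (rule sg_plus_subset[OF cG(2) yz(3,4)])
  moreover have "sub T Y" "sub T Z" using yz parafin_def by auto
  then have "0 \<in> Y" "0 \<in> Z" using sg_zero subD(1) by auto
  ultimately show ?thesis
   using set_plus_left[of Z Y] set_plus_right[of Y Z] unfolding P_def by simp
 qed
 have fin: "\<exists>Y\<in>P. F \<subseteq> Y" if "finite F" "F \<subseteq> \<Union>P" for F
  using that
 proof (induction F)
  case empty then show ?case using XP by blast
 next
  case (insert x F)
  then obtain Y Z where "Y \<in> P" "F \<subseteq> Y" "Z \<in> P" "x \<in> Z" by auto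
  then show ?case using PP[of Y Z] by blast
 qed
 have sP: "!!Y. Y \<in> P ==> sub T Y" by (auto simp: P_def parafin_def)
 have gP: "!!Y. Y \<in> P ==> add_subgroup Y" using sP subD(1) by auto
 have "add_subgroup (\<Union>P)" unfolding add_subgroup_def
 proof (intro conjI ballI)
  show "0 \<in> \<Union>P" using XP sg_zero[OF gP[OF XP]] by blast
  fix x assume x: "x \<in> \<Union>P"
  then obtain Y where "Y \<in> P" "x \<in> Y" by blast
  then show "- x \<in> \<Union>P" using sg_neg[OF gP] by blast
  fix y assume "y \<in> \<Union>P"
  then have "\<exists>Y\<in>P. {x, y} \<subseteq> Y" using x by (intro fin) auto
  then obtain Y where "Y \<in> P" "x \<in> Y" "y \<in> Y" by blast
  then show "x + y \<in> \<Union>P" using sg_add[OF gP] by blast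
 qed
 then have "sub T (\<Union>P)" using sP by (auto simp: sub_def)
 define D where "D = closure (\<Union>P)"
 have D: "closed D" "sub T D" "\<Union>P \<subseteq> D" using sub_closure[OF \<open>sub T (\<Union>P)\<close>] closure_subset[of "\<Union>P"] by (simp_all add: D_def)
 have DG: "D \<subseteq> G" unfolding D_def using cG by (intro closure_minimal) (auto simp: P_def)
 have gD: "add_subgroup D" using D subD by auto
 have "lcg D" using lcg_subset[OF G(1) D(1) gD DG] .
 then obtain U V where UV: "nb U" "compact V" "V \<subseteq> D" "0 \<in> V" "!!v. v \<in> V ==> - v \<in> V" "U \<inter> D \<subseteq> V"
  using lcg_nbhd by metis
 \<comment> \<open>Zero is included so that \<open>V + V + SV\<close> contains the sums of two
   elements of \<open>V\<close>; as zero is also in \<open>V\<close>, it contains the images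
   \<open>act a v\<close> as well. One covering then serves both purposes.\<close>
 define SV where "SV = insert 0 ((\<lambda>p. act (fst p) (snd p)) ` (S \<times> V))"
 have cS: "compact S" using S gens_def by auto
 have ST: "S \<subseteq> T" using S gens_def by auto
 have cSV: "compact SV" unfolding SV_def using compact_insert[OF compact_act[OF cS UV(2)]] .
 have "compact (V + V + SV)" by (intro compact_set_plus UV(2) cSV)
 moreover have SVD: "SV \<subseteq> D" using UV(3) ST sg_zero[OF gD] by (auto simp: SV_def intro!: subD(2)[OF D(2)])
 have VV: "V + V + SV \<subseteq> D" by (intro sg_plus_subset gD UV(3) SVD)
 have cov: "V + V + SV \<subseteq> (\<Union>w\<in>\<Union>P. {x. x - w \<in> U})"
 proof
  fix x assume "x \<in> V + V + SV"
  then have "x \<in> closure (\<Union>P)" using VV D_def by blast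
  then obtain w where "w \<in> \<Union>P" "x - w \<in> U" by (rule closure_nb[OF _ UV(1)])
  then show "x \<in> (\<Union>w\<in>\<Union>P. {x. x - w \<in> U})" by blast
 qed
 ultimately obtain F where F: "F \<subseteq> \<Union>P" "finite F" "V + V + SV \<subseteq> (\<Union>w\<in>F. {x. x - w \<in> U})"
  using compactE_image[of "V + V + SV" "\<Union>P" "\<lambda>w. {x. x - w \<in> U}"] open_translate_vimage[OF conjunct1[OF UV(1)]] by metis
 obtain Y where Y: "Y \<in> P" "F \<subseteq> Y" using fin[OF F(2,1)] by blast
 have gY: "sub T Y" "add_subgroup Y" using sP Y subD by auto
 have YD: "Y \<subseteq> D" using Y D by blast
 have big: "V + V + SV \<subseteq> V + Y"
 proof
  fix x assume x: "x \<in> V + V + SV"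
  then obtain w where w: "w \<in> F" "x - w \<in> U" using F by blast
  have "w \<in> Y" using w Y by blast
  have "x - w \<in> D" using x VV \<open>w \<in> Y\<close> YD by (intro sg_diff[OF gD]) auto
  then have "x - w \<in> V" using w UV by blast
  then show "x \<in> V + Y" using \<open>w \<in> Y\<close> by (intro set_plusI[of "x - w" _ w]) auto
 qed
 define B where "B = V + Y"
 have 0: "0 \<in> SV" by (simp add: SV_def)
 have b2: "x + y \<in> B" if "x \<in> V" "y \<in> V" for x y
 proof -
  have "x + y + 0 \<in> V + V + SV" using that 0 by (meson set_plus_intro)
  then show ?thesis using big B_def by auto
 qed
 have bS: "act a x \<in> B" if "a \<in> S" "x \<in> V" for a x
 proof -
  have "act a x \<in> SV" using that by (auto simp: SV_def intro!: image_eqI[of _ _ "(a, x)"])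
  then have "0 + 0 + act a x \<in> V + V + SV" using UV(4) by (meson set_plus_intro)
  then show ?thesis using big B_def by auto
 qed
 have VV: "- v \<in> V + Y" if "v \<in> V" for v by (rule set_plusI[OF UV(5)[OF that] sg_zero[OF gY(2)]]) simp
 have sB: "sub T B" unfolding B_def by (rule sub_plusI[OF S gY(1) UV(4) VV b2[unfolded B_def] bS[unfolded B_def]])
 have gB: "add_subgroup B" by (rule subD(1)[OF sB])
 have pY: "parafin T X Y" using Y P_def by blast
 have cY: "closed Y" "X \<subseteq> Y" "cocpt X Y" using pY parafin_def by auto
 have cB: "closed B" unfolding B_def by (rule closed_compact_plus[OF UV(2) cY(1)])
 have VB: "V \<subseteq> B" unfolding B_def by (rule set_plus_left[OF sg_zero[OF gY(2)]])
 have XB: "X \<subseteq> B" unfolding B_def using cY(2) set_plus_right[OF UV(4), of Y] by blast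
 have "omod B D" unfolding omod_def using UV VB by blast
 have "Y' \<subseteq> B" if Y': "Y' \<in> P" for Y'
 proof -
  have p: "parafin T X Y'" using Y' P_def by blast
  then have q: "closed Y'" "X \<subseteq> Y'" "cocpt X Y'" "sub T Y'" "add_subgroup Y'" using parafin_def subD by auto
  have "Y' \<subseteq> D" using Y' D by blast
  have "fmod (B \<inter> Y') Y'"
  proof (rule cocpt_omod_fmod[OF q(3,1)])
   show "omod (B \<inter> Y') Y'" using omod_restrict[OF \<open>omod B D\<close> \<open>Y' \<subseteq> D\<close>] .
  qed (use q XB gB subD(1)[OF X(2)] sg_Int[OF gB q(5)] in auto)
  then have "Y' \<subseteq> B \<inter> Y'"
   by (intro parafin_subset[OF p _ _ _ _ order_refl] sub_Int sB q closed_Int cB) (use XB q in auto)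
  then show ?thesis by blast
 qed
 then have "D \<subseteq> B" unfolding D_def using cB by (intro closure_minimal) auto
 then have "cocpt X D"
  using cocpt_mono[OF cocpt_trans[OF cY(3) cocpt_compact_plus[OF UV(2), of Y]] order_refl, of D] unfolding B_def by simp
 have "parafin T X D" unfolding parafin_def
 proof (intro conjI allI impI)
  fix U assume U: "sub T U \<and> closed U \<and> X \<subseteq> U \<and> U \<subseteq> D \<and> fmod U D"
  have "Y' \<subseteq> U" if "Y' \<in> P" for Y'
   by (rule parafin_subset[of T X Y' U D]) (use U that D P_def in auto)
  then have "D \<subseteq> U" unfolding D_def using U by (intro closure_minimal) auto
  then show "U = D" using U by blast
 qed (use X D \<open>cocpt X D\<close> XP in auto)
 then show ?thesis
 proof (rule that[OF _ DG])
  show "Y \<subseteq> D" if "parafin T X Y" "Y \<subseteq> G" for Y using that D(3) P_def by blast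
 qed
qed

definition pdisc :: "'a set => 'k set => 'k set => bool" where
 "pdisc T U N \<longleftrightarrow> (\<forall>L. sub T L \<and> U \<subseteq> L \<and> L \<subseteq> N \<and> fmod U L --> L = U)"

section \<open>The smallest open submodule with purely discrete quotient\<close>

definition Ufam :: "'a set => 'k set => 'k set set" where
 "Ufam T N = {U. sub T U \<and> U \<subseteq> N \<and> omod U N \<and> pdisc T U N}"

text \<open>If \<open>L\<close> is finite modulo \<open>X\<close>, then \<open>(L + U)/U\<close> is
  a finite submodule of \<open>N/U\<close>, which has only the zero one.\<close>

lemma Ufam_absorb:
 assumes "U \<in> Ufam T N" "sub T L" "L \<subseteq> N" "sub T N" "fmod X L" "X \<subseteq> U"
 shows "L \<subseteq> U"
proof -
 have U: "sub T U" "U \<subseteq> N" "pdisc T U N" using assms(1) Ufam_def by auto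
 have g: "add_subgroup U" "add_subgroup L" "add_subgroup N" using U assms subD by auto
 have "fmod U L" using fmod_mono[OF assms(5,6) order_refl] .
 then have "fmod U (L + U)" using fmod_plus[OF _ fmod_refl g(1)] by simp
 moreover have "U \<subseteq> L + U" "L \<subseteq> L + U"
  using sg_zero[OF g(1)] sg_zero[OF g(2)] set_plus_right[of L U] set_plus_left[of U L] by auto
 moreover have "L + U \<subseteq> N" by (rule sg_plus_subset[OF g(3) assms(3) U(2)])
 ultimately have "L + U = U" using U(3) sub_plus[OF assms(2) U(1)] unfolding pdisc_def by simp
 then show ?thesis using \<open>L \<subseteq> L + U\<close> by blast
qed

text \<open>This is dual to \<open>largest_parafin\<close>: the point is that the intersection
  \<open>Om\<close> is open. By compactness one member \<open>A\<close> has
  \<open>A \<inter> W\<close> within \<open>U0\<close> of \<open>Om\<close>; then sums and images of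
  elements of \<open>A \<inter> V\<close> return to \<open>A \<inter> V + Om\<close>, which is
  therefore an open submodule. It is covered by finitely many cosets of any member \<open>B\<close>,
  so \<open>Ufam_absorb\<close> puts it inside every \<open>B\<close>, that is, inside
  \<open>Om\<close>.\<close>

theorem Inter_Ufam:
 assumes S: "gens S T" and N: "lcg N" "sub T N"
 shows "\<Inter>(Ufam T N) \<in> Ufam T N"
proof -
 define F where "F = Ufam T N"
 have gN: "add_subgroup N" "closed N" using N lcg_def by auto
 have F: "!!U. U \<in> F ==> sub T U \<and> add_subgroup U \<and> U \<subseteq> N \<and> omod U N" using subD by (auto simp: F_def Ufam_def)
 have NF: "N \<in> F" using N by (auto simp: F_def Ufam_def omod_refl pdisc_def)
 have cl: "!!U. U \<in> F ==> closed U" using F omod_closed[OF _ gN(2) _ gN(1)] by auto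
 have dir: "directed_down F" unfolding directed_down_def
 proof (intro ballI)
  fix A B assume AB: "A \<in> F" "B \<in> F"
  have "pdisc T (A \<inter> B) N" unfolding pdisc_def
  proof (intro allI impI)
   fix L assume L: "sub T L \<and> A \<inter> B \<subseteq> L \<and> L \<subseteq> N \<and> fmod (A \<inter> B) L"
   have "L \<subseteq> A" "L \<subseteq> B" using Ufam_absorb[of A T N L "A \<inter> B"] Ufam_absorb[of B T N L "A \<inter> B"] L AB N F_def by auto
   then show "L = A \<inter> B" using L by blast
  qed
  moreover have "sub T (A \<inter> B)" "omod (A \<inter> B) N" "A \<inter> B \<subseteq> N" using F[OF AB(1)] F[OF AB(2)] sub_Int omod_Int by auto
  ultimately have "A \<inter> B \<in> F" unfolding F_def Ufam_def by simp
  then show "\<exists>C\<in>F. C \<subseteq> A \<inter> B" by blast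
 qed
 define Om where "Om = \<Inter>F"
 have Om: "sub T Om" "Om \<subseteq> N" unfolding Om_def using F NF by (auto intro!: sub_Inter)
 have gO: "add_subgroup Om" using Om subD by auto
 have gO: "add_subgroup Om" "0 \<in> Om" using gO sg_zero by auto
 obtain U0 V where UV: "nb U0" "compact V" "V \<subseteq> N" "0 \<in> V" "!!v. v \<in> V ==> - v \<in> V" "U0 \<inter> N \<subseteq> V"
  using lcg_nbhd[OF N(1)] by metis
 define SV where "SV = insert 0 ((\<lambda>p. act (fst p) (snd p)) ` (S \<times> V))"
 have cS: "compact S" "S \<subseteq> T" using S gens_def by auto
 define W where "W = V + V + SV"
 have cW: "compact W" unfolding W_def SV_def by (intro compact_set_plus compact_insert compact_act UV(2) cS(1))
 have SVN: "SV \<subseteq> N" using UV(3) cS(2) sg_zero[OF gN(1)] by (auto simp: SV_def intro!: subD(2)[OF N(2)])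
 have WN: "W \<subseteq> N" unfolding W_def by (intro sg_plus_subset gN(1) UV(3) SVN)
 \<comment> \<open>\<open>Om\<close> is added to each set because
   \<open>cocpt_directed_subset\<close> needs sets stable under \<open>Om\<close>; this does not
   enlarge the intersection.\<close>
 define FW where "FW = (\<lambda>A. A \<inter> W + Om) ` F"
 have "\<exists>A\<in>FW. A \<subseteq> U0 + Om"
 proof (rule cocpt_directed_subset[of FW "N \<inter> W + Om"])
  show "directed_down FW" unfolding directed_down_def FW_def
  proof (clarify)
   fix A B assume "A \<in> F" "B \<in> F"
   then obtain C where "C \<in> F" "C \<subseteq> A \<inter> B" using dir unfolding directed_down_def by metis
   then have "C \<inter> W + Om \<subseteq> (A \<inter> W + Om) \<inter> (B \<inter> W + Om)" by (auto simp: set_plus_def)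
   then show "\<exists>C\<in>(\<lambda>A. A \<inter> W + Om) ` F. C \<subseteq> (A \<inter> W + Om) \<inter> (B \<inter> W + Om)" using \<open>C \<in> F\<close> by blast
  qed
  show "N \<inter> W + Om \<in> FW" using NF FW_def by blast
  show "cocpt Om (N \<inter> W + Om)" using WN cW cocpt_compact_plus by (metis inf.absorb2)
  have "closed Om" unfolding Om_def using cl by blast
  then show "closed A" if "A \<in> FW" for A
   using that cl unfolding FW_def by (auto intro!: closed_compact_plus compact_Int_closed cW simp: Int_commute[of _ W])
  show "a - x \<in> A" if ax: "A \<in> FW" "a \<in> A" "x \<in> Om" for A a x
  proof -
   obtain B where B: "A = B \<inter> W + Om" using ax FW_def by blast
   then obtain b y where bw: "b \<in> B \<inter> W" "y \<in> Om" "a = b + y" using ax by (auto elim: set_plusE)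
   then have "a - x = b + (y - x)" "y - x \<in> Om" using bw ax(3) gO sg_diff by auto
   then show ?thesis unfolding B using bw by (metis set_plus_intro)
  qed
  have "\<Inter>FW \<subseteq> Om"
  proof
   fix x assume x: "x \<in> \<Inter>FW"
   show "x \<in> Om" unfolding Om_def
   proof
    fix A assume A: "A \<in> F"
    then have "x \<in> A \<inter> W + Om" using x FW_def by blast
    then obtain b y where bw: "b \<in> A \<inter> W" "y \<in> Om" "x = b + y" by (auto elim: set_plusE)
    then have "y \<in> A" using A Om_def by blast
    then show "x \<in> A" using bw F[OF A] by (auto intro: sg_add)
   qed
  qed
  then show "\<Inter>FW \<subseteq> U0 + Om" using UV(1) set_plus_right[of U0 Om] by simp
 qed (use gO UV in auto)
 then obtain A where A: "A \<in> F" "A \<inter> W + Om \<subseteq> U0 + Om" unfolding FW_def by blast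
 have gA: "add_subgroup A" "sub T A" "A \<subseteq> N" "omod A N" using F A by auto
 have OA: "Om \<subseteq> A" using A Om_def by blast
 define Y where "Y = A \<inter> V + Om"
 have key: "z \<in> Y" if "z \<in> A" "z \<in> W" for z
 proof -
  have "z \<in> A \<inter> W + Om" using that gO by (intro set_plusI[of z _ 0]) auto
  then obtain u w where uw: "u \<in> U0" "w \<in> Om" "z = u + w" using A(2) by (meson set_plusE subsetD)
  then have "u \<in> A" using that OA gA sg_cancel_right by blast
  then have "u \<in> V" using uw UV gA by blast
  then show ?thesis unfolding Y_def using uw \<open>u \<in> A\<close> by (intro set_plusI[of u _ w]) auto
 qed
 have 0: "0 \<in> SV" by (simp add: SV_def)
 have b2: "x + y \<in> Y" if "x \<in> A \<inter> V" "y \<in> A \<inter> V" for x y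
 proof (rule key)
  show "x + y \<in> A" using that gA sg_add by blast
  have "x + y + 0 \<in> V + V + SV" using that 0 by (meson IntD2 set_plus_intro)
  then show "x + y \<in> W" using W_def by auto
 qed
 have bS: "act a x \<in> Y" if "a \<in> S" "x \<in> A \<inter> V" for a x
 proof (rule key)
  show "act a x \<in> A" using that cS by (intro subD(2)[OF gA(2)]) auto
  have "act a x \<in> SV" using that by (auto simp: SV_def intro!: image_eqI[of _ _ "(a, x)"])
  then have "0 + 0 + act a x \<in> V + V + SV" using UV(4) by (meson set_plus_intro)
  then show "act a x \<in> W" using W_def by auto
 qed
 have AV: "- v \<in> A \<inter> V + Om" if "v \<in> A \<inter> V" for v
  using that UV(5) sg_neg[OF gA(1)] gO by (intro set_plusI[of "- v" _ 0]) auto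
 have "0 \<in> A \<inter> V" using UV(4) sg_zero[OF gA(1)] by blast
 then have sY: "sub T Y" unfolding Y_def by (rule sub_plusI[OF S Om(1) _ AV b2[unfolded Y_def] bS[unfolded Y_def]])
 have gY: "add_subgroup Y" by (rule subD(1)[OF sY])
 have YN: "Y \<subseteq> N" unfolding Y_def by (rule sg_plus_subset[OF gN(1)]) (use UV Om in auto)
 have "omod Y N"
 proof -
  obtain U1 where U1: "nb U1" "U1 \<inter> N \<subseteq> A" using gA(4) omod_def by blast
  have "(U0 \<inter> U1) \<inter> N \<subseteq> A \<inter> V" using U1 UV by blast
  also have "\<dots> \<subseteq> Y" unfolding Y_def by (rule set_plus_left[OF gO(2)])
  finally show ?thesis unfolding omod_def using nb_Int[OF UV(1) U1(1)] by blast
 qed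
 have "Y \<subseteq> B" if B: "B \<in> F" for B
 proof -
  have gB: "add_subgroup B" "omod B N" using F B by auto
  have OB: "Om \<subseteq> B" using B Om_def by blast
  obtain E where E: "finite E" "V \<subseteq> E + B" using compact_finite_mod[OF UV(2,3) gN(1) gB(2)] by metis
  have "Y \<subseteq> (E + B) + B" unfolding Y_def using E OB by (intro set_plus_mono) auto
  also have "(E + B) + B = E + B" using sg_plus_self[OF gB(1)] by (simp add: add.assoc)
  finally have "fmod B Y" unfolding fmod_def using E(1) by blast
  then show ?thesis using Ufam_absorb[of B T N Y B] B sY YN N F_def by simp
 qed
 then have "Y \<subseteq> Om" unfolding Om_def by blast
 then have oOm: "omod Om N" using omod_mono[OF \<open>omod Y N\<close>] by blast
 have "pdisc T Om N" unfolding pdisc_def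
 proof (intro allI impI)
  fix L assume L: "sub T L \<and> Om \<subseteq> L \<and> L \<subseteq> N \<and> fmod Om L"
  have "L \<subseteq> B" if "B \<in> F" for B
   by (rule Ufam_absorb[of B T N L Om]) (use L N that F_def Om_def in auto)
  then have "L \<subseteq> Om" unfolding Om_def by blast
  then show "L = Om" using L by blast
 qed
 then show ?thesis using Om oOm unfolding Om_def F_def Ufam_def by blast
qed

end

section \<open>Expanding operators\<close>

lemma set_plus_mono_right: "X \<subseteq> X' ==> x \<in> U + X ==> x \<in> U + X'"
 by (auto simp: set_plus_def)

context tgact
begin

text \<open>Commuting with the whole action is what turns \<open>null\<close> and \<open>bdd\<close>
  of submodules into submodules again.\<close>

definition oper :: "('k => 'k) => bool" where
 "oper f \<longleftrightarrow> (\<forall>x y. f (x + y) = f x + f y) \<and> continuous_on UNIV f \<and> (\<forall>a x. f (act a x) = act a (f x))"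

lemma oper_add: "oper f ==> f (x + y) = f x + f y"
 by (simp add: oper_def)

lemma oper_0: "oper f ==> f 0 = 0"
 using oper_add[of f 0 0] by simp

lemma oper_neg: "oper f ==> f (- x) = - f x"
 using oper_add[of f x "- x"] oper_0[of f] by (simp add: eq_neg_iff_add_eq_0 add.commute)

lemma oper_diff: "oper f ==> f (x - y) = f x - f y"
 using oper_add[of f x "- y"] oper_neg[of f y] by simp

lemma oper_cont: "oper f ==> continuous_on UNIV f"
 by (simp add: oper_def)

lemma oper_comm: "oper f ==> f (act a x) = act a (f x)"
 by (simp add: oper_def)

lemma oper_funpow: assumes "oper f" shows "oper (f ^^ n)"
proof (induction n)
 case 0 then show ?case by (simp add: oper_def)
next
 case (Suc n)
 have "continuous_on UNIV (f \<circ> (f ^^ n))"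
  using oper_cont[OF Suc] oper_cont[OF assms] by (intro continuous_on_compose) (auto intro: continuous_on_subset)
 then show ?case using Suc assms by (simp add: oper_def)
qed

lemma oper_act: "oper (act t)"
 by (simp add: oper_def act_add act_cont1 act_comm)

lemma oper_double: "oper (\<lambda>x. x + x)"
 unfolding oper_def by (auto simp: act_add algebra_simps intro!: continuous_intros)

lemma funpow_mem: "(!!x. x \<in> X ==> f x \<in> X) ==> x \<in> X ==> (f ^^ n) x \<in> X"
 by (induction n) auto

text \<open>A backward orbit of \<open>f\<close> in \<open>Y/X\<close> that tends to zero. Sequences
  of representatives replace an inverse of \<open>f\<close>, which exists at best on the
  quotient.\<close>

definition bseq :: "('k => 'k) => 'k set => 'k set => (nat => 'k) => bool" where
 "bseq f X Y s \<longleftrightarrow> (\<forall>n. s n \<in> Y \<and> f (s (Suc n)) - s n \<in> X) \<and>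
   (\<forall>U. nb U --> (\<exists>m. \<forall>n\<ge>m. s n \<in> U + X))"

text \<open>For \<open>f\<close> invertible on \<open>Y/X\<close> this is the contraction group of
  its inverse.\<close>

definition null :: "('k => 'k) => 'k set => 'k set => 'k set" where
 "null f X Y = {y. \<exists>s. s 0 = y \<and> bseq f X Y s}"

text \<open>That f is an expanding automorphism of Y/X is expressed through the backward orbits \<open>bseq\<close>.\<close>

definition expd :: "('k => 'k) => 'k set => 'k set => bool" where
 "expd f X Y \<longleftrightarrow>
   (\<forall>W y. compact W \<and> y \<in> Y \<and> (\<forall>n. (f ^^ n) y \<in> W + X) --> y \<in> X) \<and>
   Y \<subseteq> null f X Y \<and>
   (\<forall>U. nb U --> (\<exists>U'. nb U' \<and> (\<forall>s. bseq f X Y s \<and> s 0 \<in> U' --> (\<forall>n. s n \<in> U + X)))) \<and>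
   (\<forall>W. compact W \<and> W \<subseteq> Y --> (\<exists>E. compact E \<and> 0 \<in> E \<and> E \<subseteq> Y \<and> W + E \<subseteq> f ` E + X))"

lemma bseqD: "bseq f X Y s ==> s n \<in> Y" "bseq f X Y s ==> f (s (Suc n)) - s n \<in> X"
 "bseq f X Y s ==> nb U ==> \<exists>m. \<forall>n\<ge>m. s n \<in> U + X"
 by (auto simp: bseq_def)

lemma bseqI:
 assumes "!!n. s n \<in> Y" "!!n. f (s (Suc n)) - s n \<in> X" "!!U. nb U ==> \<exists>m. \<forall>n\<ge>m. s n \<in> U + X"
 shows "bseq f X Y s"
 unfolding bseq_def
proof (rule conjI; intro allI)
 show "s n \<in> Y \<and> f (s (Suc n)) - s n \<in> X" for n by (rule conjI[OF assms(1,2)])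
 show "nb U --> (\<exists>m. \<forall>n\<ge>m. s n \<in> U + X)" for U by (rule impI) (rule assms(3))
qed

lemma bseq_shift: assumes "bseq f X Y s" shows "bseq f X Y (\<lambda>n. s (n + k))"
proof (rule bseqI)
 show "s (n + k) \<in> Y" for n using bseqD(1)[OF assms] .
 show "f (s (Suc n + k)) - s (n + k) \<in> X" for n using bseqD(2)[OF assms, of "n + k"] by simp
 fix U assume "nb (U::'k set)"
 from bseqD(3)[OF assms this] obtain m where "\<forall>n\<ge>m. s n \<in> U + X" by blast
 then show "\<exists>m. \<forall>n\<ge>m. s (n + k) \<in> U + X" by (intro exI[of _ m]) auto
qed

lemma bseq_mono: assumes "bseq f X Y s" "X \<subseteq> X'" "!!n. s n \<in> Y'" shows "bseq f X' Y' s"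
proof (rule bseqI)
 show "s n \<in> Y'" for n using assms(3) .
 show "f (s (Suc n)) - s n \<in> X'" for n using bseqD(2)[OF assms(1), of n] assms(2) by blast
 fix U assume "nb (U::'k set)"
 from bseqD(3)[OF assms(1) this] obtain m where "\<forall>n\<ge>m. s n \<in> U + X" by blast
 then show "\<exists>m. \<forall>n\<ge>m. s n \<in> U + X'" using set_plus_mono_right[OF assms(2)] by (intro exI[of _ m]) auto
qed

lemma bseq_add:
 assumes f: "oper f" and X: "add_subgroup X" and Y: "add_subgroup Y" and s: "bseq f X Y s" "bseq f X Y s'"
 shows "bseq f X Y (\<lambda>n. s n + s' n)"
proof (rule bseqI)
 show "s n + s' n \<in> Y" for n by (intro sg_add[OF Y] bseqD(1)[OF s(1)] bseqD(1)[OF s(2)])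
 show "f (s (Suc n) + s' (Suc n)) - (s n + s' n) \<in> X" for n
  using sg_add[OF X bseqD(2)[OF s(1), of n] bseqD(2)[OF s(2), of n]]
  by (simp add: oper_add[OF f] algebra_simps)
 fix U assume "nb (U::'k set)"
 then obtain V where V: "nb V" "!!x y. x \<in> V ==> y \<in> V ==> x + y \<in> U" using nb_half by metis
 from bseqD(3)[OF s(1) V(1)] obtain m where m: "\<forall>n\<ge>m. s n \<in> V + X" by blast
 from bseqD(3)[OF s(2) V(1)] obtain m' where m': "\<forall>n\<ge>m'. s' n \<in> V + X" by blast
 have "s n + s' n \<in> U + X" if n: "n \<ge> max m m'" for n
 proof -
  have "s n \<in> V + X" using m n by auto
  then obtain v x where 1: "v \<in> V" "x \<in> X" "s n = v + x" by (rule set_plusE)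
  have "s' n \<in> V + X" using m' n by auto
  then obtain v' x' where 2: "v' \<in> V" "x' \<in> X" "s' n = v' + x'" by (rule set_plusE)
  show ?thesis using V(2)[OF 1(1) 2(1)] sg_add[OF X 1(2) 2(2)] 1(3) 2(3)
   by - (rule set_plusI[of "v + v'" _ "x + x'"], auto simp: algebra_simps)
 qed
 then show "\<exists>m. \<forall>n\<ge>m. s n + s' n \<in> U + X" by blast
qed

lemma bseq_map:
 assumes f: "oper f" and g: "oper g" and fg: "!!x. f (g x) = g (f x)"
  and gX: "!!x. x \<in> X ==> g x \<in> X" and gY: "!!x. x \<in> Y ==> g x \<in> Y" and s: "bseq f X Y s"
 shows "bseq f X Y (\<lambda>n. g (s n))"
proof (rule bseqI)
 show "g (s n) \<in> Y" for n using gY bseqD(1)[OF s] by blast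
 show "f (g (s (Suc n))) - g (s n) \<in> X" for n
  using gX[OF bseqD(2)[OF s, of n]] by (simp add: fg oper_diff[OF g])
 fix U assume U: "nb (U::'k set)"
 have "nb {x. g x \<in> U}" by (rule nb_vimage[OF oper_cont[OF g] oper_0[OF g] U])
 from bseqD(3)[OF s this] obtain m where m: "\<forall>n\<ge>m. s n \<in> {x. g x \<in> U} + X" by blast
 have "g (s n) \<in> U + X" if "n \<ge> m" for n
 proof -
  have "s n \<in> {x. g x \<in> U} + X" using m that by blast
  then obtain v x where "v \<in> {x. g x \<in> U}" "x \<in> X" "s n = v + x" by (rule set_plusE)
  then show ?thesis using gX by - (rule set_plusI[of "g v" _ "g x"], auto simp: oper_add[OF g])
 qed
 then show "\<exists>m. \<forall>n\<ge>m. g (s n) \<in> U + X" by blast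
qed

lemma bseq_neg:
 assumes f: "oper f" and X: "add_subgroup X" and Y: "add_subgroup Y" and s: "bseq f X Y s"
 shows "bseq f X Y (\<lambda>n. - s n)"
proof (rule bseq_map[OF f _ _ _ _ s])
 show "oper uminus" unfolding oper_def by (intro conjI allI continuous_intros) (simp_all add: act_neg)
qed (use oper_neg[OF f] sg_neg[OF X] sg_neg[OF Y] in auto)

lemma nullI: "bseq f X Y s ==> s 0 \<in> null f X Y"
 by (auto simp: null_def)

lemma nullE: assumes "y \<in> null f X Y" obtains s where "s 0 = y" "bseq f X Y s"
 using assms by (auto simp: null_def)

lemma bseq_null: assumes "bseq f X Y s" shows "s n \<in> null f X Y"
 using nullI[OF bseq_shift[OF assms, of n]] by simp

lemma null_subset: "null f X Y \<subseteq> Y"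
 using bseqD(1) by (auto simp: null_def)

lemma null_contains:
 assumes "oper f" "add_subgroup X" "X \<subseteq> Y" shows "X \<subseteq> null f X Y"
proof
 fix x assume x: "x \<in> X"
 have 0: "0 \<in> X" using sg_zero[OF assms(2)] .
 have "bseq f X Y (\<lambda>n. if n = 0 then x else 0)"
 proof (rule bseqI)
  fix U assume "nb (U::'k set)"
  then have "0 \<in> U + X" using 0 by (auto intro: set_plusI[of 0 _ 0])
  then show "\<exists>m::nat. \<forall>n\<ge>m. (if n = 0 then x else 0) \<in> U + X"
   by (intro exI[of _ "1::nat"]) auto
 qed (use x 0 assms sg_neg[OF assms(2) x] oper_0[OF assms(1)] in auto)
 from nullI[OF this] show "x \<in> null f X Y" by simp
qed

lemma null_add_subgroup:
 assumes f: "oper f" and X: "add_subgroup X" and Y: "add_subgroup Y" and "X \<subseteq> Y"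
 shows "add_subgroup (null f X Y)"
 unfolding add_subgroup_def
proof (intro conjI ballI)
 show "0 \<in> null f X Y" using null_contains[OF f X \<open>X \<subseteq> Y\<close>] sg_zero[OF X] by blast
 fix x assume "x \<in> null f X Y"
 then obtain s where s: "s 0 = x" "bseq f X Y s" by (rule nullE)
 from nullI[OF bseq_neg[OF f X Y s(2)]] show "- x \<in> null f X Y" using s by simp
 fix y assume "y \<in> null f X Y"
 then obtain s' where s': "s' 0 = y" "bseq f X Y s'" by (rule nullE)
 from nullI[OF bseq_add[OF f X Y s(2) s'(2)]] show "x + y \<in> null f X Y" using s s' by simp
qed

lemma null_sub:
 assumes f: "oper f" and X: "sub T X" and Y: "sub T Y" and "X \<subseteq> Y"
 shows "sub T (null f X Y)"
 unfolding sub_def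
proof (intro conjI ballI)
 show "add_subgroup (null f X Y)" using null_add_subgroup f subD(1)[OF X] subD(1)[OF Y] assms(4) by blast
 fix a x assume a: "a \<in> T" and "x \<in> null f X Y"
 then obtain s where s: "s 0 = x" "bseq f X Y s" by (blast elim: nullE)
 have "bseq f X Y (\<lambda>n. act a (s n))"
  by (rule bseq_map[OF f oper_act oper_comm[OF f] _ _ s(2)]) (use subD(2)[OF X a] subD(2)[OF Y a] in auto)
 from nullI[OF this] show "act a x \<in> null f X Y" using s by simp
qed

lemma null_stable:
 assumes f: "oper f" and fX: "!!x. x \<in> X ==> f x \<in> X" and fY: "!!x. x \<in> Y ==> f x \<in> Y" and x: "x \<in> null f X Y"
 shows "f x \<in> null f X Y"
proof -
 obtain s where s: "s 0 = x" "bseq f X Y s" using x by (rule nullE)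
 from nullI[OF bseq_map[OF f f refl fX fY s(2)]] show ?thesis using s by simp
qed

lemma expd_bounded:
 assumes "expd f X Y" "compact W" "y \<in> Y" "!!n. (f ^^ n) y \<in> W + X"
 shows "y \<in> X"
proof -
 have *: "\<forall>W y. compact W \<and> y \<in> Y \<and> (\<forall>n. (f ^^ n) y \<in> W + X) --> y \<in> X"
  using assms(1) unfolding expd_def by (rule conjunct1)
 show ?thesis by (rule mp[OF spec[OF spec[OF *]]], intro conjI allI) (rule assms(2-4))+
qed

lemma expd_null: "expd f X Y ==> Y \<subseteq> null f X Y"
 unfolding expd_def by (elim conjE)

lemma expd_small:
 assumes "expd f X Y" "nb U"
 shows "\<exists>U'. nb U' \<and> (\<forall>s. bseq f X Y s \<and> s 0 \<in> U' --> (\<forall>n. s n \<in> U + X))"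
proof -
 have "\<forall>U. nb U --> (\<exists>U'. nb U' \<and> (\<forall>s. bseq f X Y s \<and> s 0 \<in> U' --> (\<forall>n. s n \<in> U + X)))"
  using assms(1) unfolding expd_def by (elim conjE)
 then show ?thesis using assms(2) by simp
qed

lemma expd_compact:
 assumes "expd f X Y" "compact W" "W \<subseteq> Y"
 shows "\<exists>E. compact E \<and> 0 \<in> E \<and> E \<subseteq> Y \<and> W + E \<subseteq> f ` E + X"
proof -
 have "\<forall>W. compact W \<and> W \<subseteq> Y --> (\<exists>E. compact E \<and> 0 \<in> E \<and> E \<subseteq> Y \<and> W + E \<subseteq> f ` E + X)"
  using assms(1) unfolding expd_def by (elim conjE)
 then show ?thesis using assms(2,3) by simp
qed

text \<open>If \<open>f y\<close> lies in \<open>X\<close>, the whole forward orbit of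
  \<open>y\<close> stays in \<open>{0, y} + X\<close>; it is bounded, so expansion forces
  \<open>y\<close> into \<open>X\<close>.\<close>

lemma expd_inj:
 assumes "expd f X Y" and fX: "!!x. x \<in> X ==> f x \<in> X" and X: "add_subgroup X" and y: "y \<in> Y" "f y \<in> X"
 shows "y \<in> X"
proof (rule expd_bounded[OF assms(1) _ y(1)])
 show "compact {0, y}" by simp
 fix n show "(f ^^ n) y \<in> {0, y} + X"
 proof (cases n)
  case 0 then show ?thesis using sg_zero[OF X] by (auto intro!: set_plusI[of y _ 0])
 next
  case (Suc m)
  have "(f ^^ m) (f y) \<in> X" using funpow_mem[OF fX y(2)] .
  then have "(f ^^ n) y \<in> X" using Suc by (simp add: funpow_swap1)
  then show ?thesis by (auto intro!: set_plusI[of 0])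
 qed
qed

text \<open>The difference of two orbits lies in \<open>X\<close> at the start, and injectivity of
  \<open>f\<close> modulo \<open>X\<close> passes this on from each point to the next.\<close>

lemma bseq_unique:
 assumes f: "oper f" and e: "expd f X Y" and fX: "!!x. x \<in> X ==> f x \<in> X" and X: "add_subgroup X" and Y: "add_subgroup Y"
  and s: "bseq f X Y s" "bseq f X Y s'" "s 0 - s' 0 \<in> X"
 shows "s n - s' n \<in> X"
proof (induction n)
 case 0 then show ?case using s by simp
next
 case (Suc n)
 have "f (s (Suc n) - s' (Suc n)) = (f (s (Suc n)) - s n) - (f (s' (Suc n)) - s' n) + (s n - s' n)"
  by (simp add: oper_diff[OF f])
 also have "\<dots> \<in> X"
  by (rule sg_add[OF X sg_diff[OF X bseqD(2)[OF s(1)] bseqD(2)[OF s(2)]] Suc])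
 finally have fm: "f (s (Suc n) - s' (Suc n)) \<in> X" .
 show ?case
 proof (rule expd_inj[OF e _ X _ fm])
  show "f x \<in> X" if "x \<in> X" for x using fX that .
  show "s (Suc n) - s' (Suc n) \<in> Y" by (rule sg_diff[OF Y bseqD(1)[OF s(1)] bseqD(1)[OF s(2)]])
 qed
qed

text \<open>For the trace on \<open>P\<close>: an orbit tending to \<open>P0\<close> that starts in
  \<open>P\<close> stays in \<open>P\<close> by injectivity of \<open>f\<close> modulo
  \<open>P\<close>, so far out it consists of small elements of \<open>P\<close> up to
  \<open>P0\<close> and lies in \<open>P0\<close>; applying \<open>f\<close> carries membership in
  \<open>P0\<close> back to the start. For openness, a small backward orbit modulo \<open>P\<close>
  is shown to be one modulo \<open>P0\<close>.\<close>

theorem rigid: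
 assumes f: "oper f" and P0: "add_subgroup P0" and P: "add_subgroup P" and Y: "add_subgroup Y"
  and sub: "P0 \<subseteq> P" "P \<subseteq> Y"
  and fP0: "!!x. x \<in> P0 ==> f x \<in> P0" and fP: "!!x. x \<in> P ==> f x \<in> P"
  and o: "omod P0 P" and e: "expd f P Y"
 shows "omod (null f P0 Y) Y" "null f P0 Y \<inter> P = P0"
proof -
 obtain U0 where U0: "nb U0" "U0 \<inter> P \<subseteq> P0" using o omod_def by blast
 have P0Y: "P0 \<subseteq> Y" using sub by blast
 have "x \<in> P0" if x: "x \<in> null f P0 Y" "x \<in> P" for x
 proof -
  obtain s where s: "s 0 = x" "bseq f P0 Y s" using x(1) by (rule nullE)
  have sP: "s n \<in> P" for n
  proof (induction n)
   case 0 then show ?case using s x by simp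
  next
   case (Suc n)
   have "f (s (Suc n)) - s n \<in> P" using bseqD(2)[OF s(2)] sub by blast
   then have "f (s (Suc n)) \<in> P" using sg_cancel_diff[OF P Suc] by blast
   then show ?case using expd_inj[OF e fP P bseqD(1)[OF s(2)]] by blast
  qed
  obtain m where m: "\<forall>n\<ge>m. s n \<in> U0 + P0" using bseqD(3)[OF s(2) U0(1)] by blast
  then have "s m \<in> U0 + P0" by blast
  then obtain u p where up: "u \<in> U0" "p \<in> P0" "s m = u + p" by (rule set_plusE)
  have "u \<in> P" using sP[of m] up sub sg_cancel_right[OF P, of p u] by auto
  then have "u \<in> P0" using up U0 by blast
  then have "s m \<in> P0" using up sg_add[OF P0] by auto
  \<comment> \<open>Descending induction from \<open>m\<close> to zero. Subtraction is truncated, so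
    beyond \<open>k = m\<close> the claim merely repeats the one for \<open>s 0\<close>.\<close>
  have "s (m - k) \<in> P0" for k
  proof (induction k)
   case 0 then show ?case using \<open>s m \<in> P0\<close> by simp
  next
   case (Suc k)
   show ?case
   proof (cases "m - k")
    case 0 then show ?thesis using Suc by simp
   next
    case (Suc j)
    then have "m - Suc k = j" by simp
    have "f (s (Suc j)) \<in> P0" using fP0 Suc.IH Suc by metis
    moreover have "f (s (Suc j)) - s j \<in> P0" using bseqD(2)[OF s(2)] .
    ultimately have "f (s (Suc j)) - (f (s (Suc j)) - s j) \<in> P0" by (rule sg_diff[OF P0])
    then show ?thesis using \<open>m - Suc k = j\<close> by simp
   qed
  qed
  from this[of m] show ?thesis using s by simp
 qed
 then show "null f P0 Y \<inter> P = P0" using null_contains[OF f P0 P0Y] sub by blast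
 obtain U1 where U1: "nb U1" "!!x y. x \<in> U1 ==> y \<in> U1 ==> x - y \<in> U0" using nb_half[OF U0(1)] by metis
 define U2 where "U2 = U1 \<inter> {x. f x \<in> U1}"
 have U2: "nb U2" unfolding U2_def using nb_Int[OF U1(1) nb_vimage[OF oper_cont[OF f] oper_0[OF f] U1(1)]] .
 obtain U' where U': "nb U'" "\<forall>s. bseq f P Y s \<and> s 0 \<in> U' --> (\<forall>n. s n \<in> U2 + P)"
  using expd_small[OF e U2] by blast
 have "y \<in> null f P0 Y" if y: "y \<in> (U' \<inter> U2) \<inter> Y" for y
 proof -
  have "y \<in> null f P Y" using y expd_null[OF e] by blast
  then obtain s where s: "s 0 = y" "bseq f P Y s" by (rule nullE)
  have sn: "s n \<in> U2 + P" for n using U'(2) s y by blast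
  \<comment> \<open>Each orbit point is replaced by a small representative modulo \<open>P\<close>.
    At index zero the point \<open>y\<close>, itself small, is kept so that the new orbit starts
    exactly there.\<close>
  define u where "u n = (if n = 0 then y else (SOME u. u \<in> U2 \<and> s n - u \<in> P))" for n
  have u: "u n \<in> U2 \<and> s n - u n \<in> P" for n
  proof (cases "n = 0")
   case True then show ?thesis using y s sg_zero[OF P] by (simp add: u_def)
  next
   case False
   have "\<exists>u. u \<in> U2 \<and> s n - u \<in> P" using sn[of n] by (auto simp: set_plus_diff)
   from someI_ex[OF this] show ?thesis using False by (simp add: u_def)
  qed
  have uY: "u n \<in> Y" for n
  proof -
   have "s n - (s n - u n) \<in> Y"
    using u[of n] sub by - (rule sg_diff[OF Y bseqD(1)[OF s(2)]], auto)
   then show ?thesis by simp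
  qed
  have "bseq f P0 Y u"
  proof (rule bseqI)
   show "u n \<in> Y" for n using uY .
   fix n
   have "f (u (Suc n)) - u n = (f (s (Suc n)) - s n) - f (s (Suc n) - u (Suc n)) + (s n - u n)"
    by (simp add: oper_diff[OF f])
   also have "\<dots> \<in> P"
    using sg_add[OF P sg_diff[OF P bseqD(2)[OF s(2), of n] fP[OF conjunct2[OF u[of "Suc n"]]]] conjunct2[OF u[of n]]] .
   finally have "f (u (Suc n)) - u n \<in> P" .
   moreover have "f (u (Suc n)) - u n \<in> U0" using u[of n] u[of "Suc n"] by (intro U1(2)) (auto simp: U2_def)
   ultimately show "f (u (Suc n)) - u n \<in> P0" using U0 by blast
  next
   fix U assume U: "nb (U::'k set)"
   obtain m where m: "\<forall>n\<ge>m. s n \<in> (U \<inter> U1) + P" using bseqD(3)[OF s(2) nb_Int[OF U U1(1)]] by blast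
   have "u n \<in> U + P0" if "n \<ge> m" for n
   proof -
    have "s n \<in> (U \<inter> U1) + P" using m that by blast
    then obtain v p where vp: "v \<in> U \<inter> U1" "p \<in> P" "s n = v + p" by (rule set_plusE)
    have eq: "u n - v = p - (s n - u n)" using vp by (simp add: algebra_simps)
    have "u n - v \<in> P" unfolding eq by (rule sg_diff[OF P vp(2) conjunct2[OF u[of n]]])
    moreover have "u n - v \<in> U0" using u[of n] vp by (intro U1(2)) (auto simp: U2_def)
    ultimately have "u n - v \<in> P0" using U0 by blast
    then show ?thesis using vp by - (rule set_plusI[of v _ "u n - v"], auto)
   qed
   then show "\<exists>m. \<forall>n\<ge>m. u n \<in> U + P0" by blast
  qed
  from nullI[OF this] show ?thesis by (simp add: u_def)
 qed
 then show "omod (null f P0 Y) Y" unfolding omod_def using nb_Int[OF U'(1) U2] by blast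
qed

section \<open>Points with bounded forward orbit as a complement to an expanding layer\<close>

definition bdd :: "('k => 'k) => 'k set => 'k set => 'k set" where
 "bdd f X C = {c \<in> C. \<exists>W. compact W \<and> (\<forall>n. (f ^^ n) c \<in> W + X)}"

lemma bdd_sub:
 assumes f: "oper f" and X: "sub T X" and C: "sub T C"
 shows "sub T (bdd f X C)"
 unfolding sub_def add_subgroup_def
proof (intro conjI ballI)
 have gX: "add_subgroup X" and gC: "add_subgroup C" using subD(1)[OF X] subD(1)[OF C] .
 note fn = oper_funpow[OF f]
 show "0 \<in> bdd f X C"
 proof -
  have "(f ^^ n) 0 \<in> {0} + X" for n
   unfolding oper_0[OF fn] by (rule set_plusI[of 0 _ 0]) (simp_all add: sg_zero[OF gX])
  then have "compact {0} \<and> (\<forall>n. (f ^^ n) 0 \<in> {0} + X)" by simp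
  then show ?thesis unfolding bdd_def using sg_zero[OF gC] by blast
 qed
 fix x assume x: "x \<in> bdd f X C"
 then obtain W where W: "x \<in> C" "compact W" "!!n. (f ^^ n) x \<in> W + X" by (auto simp: bdd_def)
 have "(f ^^ n) (- x) \<in> uminus ` W + X" for n
 proof -
  obtain w z where "w \<in> W" "z \<in> X" "(f ^^ n) x = w + z" using W(3) by (rule set_plusE)
  then show ?thesis using sg_neg[OF gX] by - (rule set_plusI[of "- w" _ "- z"], auto simp: oper_neg[OF fn])
 qed
 then show "- x \<in> bdd f X C"
  using sg_neg[OF gC W(1)] compact_uminus_image[OF W(2)] unfolding bdd_def by blast
 { fix y assume y: "y \<in> bdd f X C"
  then obtain W' where W': "y \<in> C" "compact W'" "!!n. (f ^^ n) y \<in> W' + X" by (auto simp: bdd_def)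
  have "(f ^^ n) (x + y) \<in> (W + W') + X" for n
  proof -
   obtain w z where 1: "w \<in> W" "z \<in> X" "(f ^^ n) x = w + z" using W(3) by (rule set_plusE)
   obtain w' z' where 2: "w' \<in> W'" "z' \<in> X" "(f ^^ n) y = w' + z'" using W'(3) by (rule set_plusE)
   have "(f ^^ n) (x + y) = (w + w') + (z + z')" using 1 2 by (simp add: oper_add[OF fn] algebra_simps)
   then show ?thesis using 1 2 sg_add[OF gX 1(2) 2(2)] by (simp add: set_plus_intro)
  qed
  then show "x + y \<in> bdd f X C"
   using sg_add[OF gC W(1) W'(1)] compact_set_plus[OF W(2) W'(2)] unfolding bdd_def by blast }
 { fix a assume a: "a \<in> T"
  have "(f ^^ n) (act a x) \<in> act a ` W + X" for n
  proof -
   obtain w z where "w \<in> W" "z \<in> X" "(f ^^ n) x = w + z" using W(3) by (rule set_plusE)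
   then show ?thesis using subD(2)[OF X a] by - (rule set_plusI[of "act a w" _ "act a z"], auto simp: oper_comm[OF fn] act_add)
  qed
  then show "act a x \<in> bdd f X C"
   using subD(2)[OF C a W(1)] compact_act1[OF W(2)] unfolding bdd_def by blast }
qed

text \<open>A shadowing argument. For \<open>v \<in> V\<close> write \<open>f v = v' + w\<close>
  with \<open>v'\<close> again in \<open>V\<close> and \<open>w\<close> in the compact part
  \<open>W\<close> of \<open>Y\<close>. The set \<open>E\<close> supplied by
  \<open>expd_compact\<close> is so large that every error \<open>w + e'\<close> with
  \<open>e' \<in> E\<close> is, modulo \<open>X\<close>, the image of some correction
  \<open>d \<in> E\<close>. So corrections keep the orbit in \<open>K + X\<close> for any number of
  steps, and by compactness of \<open>E\<close> one correction does it forever.\<close>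

theorem corigid:
 assumes f: "oper f" and g: "add_subgroup X" "add_subgroup Y" "add_subgroup C"
  and cl: "closed X" "closed Y" "closed C" and sub: "X \<subseteq> Y" "Y \<subseteq> C"
  and fX: "!!x. x \<in> X ==> f x \<in> X" and fC: "!!x. x \<in> C ==> f x \<in> C"
  and e: "expd f X Y" and c: "cocpt Y C"
 shows "closed (bdd f X C)" "X \<subseteq> bdd f X C" "bdd f X C + Y = C" "cocpt X (bdd f X C)"
proof -
 note fn = oper_funpow[OF f]
 define Z where "Z = bdd f X C"
 have "sub {} Z" unfolding Z_def by (rule bdd_sub[OF f]; simp add: sub_def g)
 then have gZ: "add_subgroup Z" by (rule subD(1))
 obtain V where V: "compact V" "V \<subseteq> C" "C = V + Y"
  using cocpt_inside[OF c cl(3) sub(2) g(2,3)] by metis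
 define W where "W = (f ` V + uminus ` V) \<inter> Y"
 have "compact (f ` V)" using V(1) oper_cont[OF f] by (intro compact_continuous_image) (auto intro: continuous_on_subset)
 then have "compact W" unfolding W_def
  by (intro compact_Int_closed[OF compact_set_plus[OF _ compact_uminus_image[OF V(1)]] cl(2)])
 then obtain E where E: "compact E" "0 \<in> E" "E \<subseteq> Y" "W + E \<subseteq> f ` E + X"
  using expd_compact[OF e, of W] W_def by auto
 define K where "K = V + uminus ` E"
 have cK: "compact K" unfolding K_def by (rule compact_set_plus[OF V(1) compact_uminus_image[OF E(1)]])
 have VE: "v - e \<in> K" if "v \<in> V" "e \<in> E" for v e
  using that unfolding K_def by - (rule set_plusI[of v _ "- e"], auto)
 have KX: "k + x \<in> K + X" if "k \<in> K + X" "x \<in> X" for k x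
 proof -
  note kx = that
  obtain k' x' where "k' \<in> K" "x' \<in> X" "k = k' + x'" using kx(1) by (rule set_plusE)
  then show ?thesis using sg_add[OF g(1) _ kx(2)] by - (rule set_plusI[of k' _ "x' + x"], auto simp: add.assoc)
 qed
 \<comment> \<open>\<open>m\<close> is the length of the controlled orbit. The induction hypothesis
   is used for the next point \<open>v'\<close>, so corrections are built from the far end of the
   orbit.\<close>
 have 1: "\<forall>v\<in>V. \<exists>e\<in>E. \<forall>n\<le>m. (f ^^ n) (v - e) \<in> K + X" for m
 proof (induction m)
  case 0
  show ?case
  proof
   fix v assume "v \<in> V"
   then have "v - 0 \<in> K + X" using VE[OF _ E(2)] sg_zero[OF g(1)] by - (rule set_plusI[of "v - 0" _ 0], auto)
   then show "\<exists>e\<in>E. \<forall>n\<le>0. (f ^^ n) (v - e) \<in> K + X" using E(2) by (intro bexI[of _ 0]) auto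
  qed
 next
  case (Suc m)
  show ?case
  proof
   fix v assume v: "v \<in> V"
   have "f v \<in> V + Y" using fC[of v] v V(2,3) by blast
   then obtain v' w where vw: "v' \<in> V" "w \<in> Y" "f v = v' + w" by (rule set_plusE)
   have "w \<in> W" unfolding W_def using vw v by (auto intro!: set_plusI[of "f v" _ "- v'"])
   obtain e' where e': "e' \<in> E" "!!n. n \<le> m ==> (f ^^ n) (v' - e') \<in> K + X" using Suc vw by blast
   have "w + e' \<in> f ` E + X" using E(4) \<open>w \<in> W\<close> e'(1) by (meson set_plus_intro subsetD)
   then obtain d x where dx: "d \<in> E" "x \<in> X" "w + e' = f d + x" by (auto elim: set_plusE)
   have fd: "f (v - d) = (v' - e') + x" using vw dx by (simp add: oper_diff[OF f] algebra_simps)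
   have "(f ^^ n) (v - d) \<in> K + X" if n: "n \<le> Suc m" for n
   proof (cases n)
    case 0 then show ?thesis using VE[OF v dx(1)] sg_zero[OF g(1)] by (auto intro: set_plusI[of "v - d" _ 0])
   next
    case (Suc k)
    then have "(f ^^ n) (v - d) = (f ^^ k) (v' - e') + (f ^^ k) x"
     using fd by (simp add: funpow_swap1 oper_add[OF fn])
    moreover have "(f ^^ k) x \<in> X" using funpow_mem[of X f x k] fX dx(2) by blast
    ultimately show ?thesis using KX[OF e'(2)[of k], of "(f ^^ k) x"] n Suc by simp
   qed
   then show "\<exists>e\<in>E. \<forall>n\<le>Suc m. (f ^^ n) (v - e) \<in> K + X" using dx(1) by blast
  qed
 qed
 have cKX: "closed (K + X)" by (rule closed_compact_plus[OF cK cl(1)])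
 have cln: "closed {e. (f ^^ n) (v - e) \<in> K + X}" for n v
 proof -
  have "continuous_on UNIV ((f ^^ n) \<circ> (\<lambda>e. v - e))"
   using oper_cont[OF fn] by (intro continuous_on_compose continuous_intros) (auto intro: continuous_on_subset)
  from closed_vimage[OF cKX this] show ?thesis by (simp add: vimage_def)
 qed
 have 2: "\<exists>e\<in>E. \<forall>n. (f ^^ n) (v - e) \<in> K + X" if v: "v \<in> V" for v
 proof -
  define A where "A m = {e \<in> E. \<forall>n\<le>m. (f ^^ n) (v - e) \<in> K + X}" for m
  have Aeq: "A m = E \<inter> (\<Inter>n\<in>{..m}. {e. (f ^^ n) (v - e) \<in> K + X})" for m by (auto simp: A_def)
  obtain z where z: "!!B. B \<in> range A ==> z \<in> B"
  proof (rule cocpt_fip[of "range A" "A 0" "{0}"])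
   show "directed_down (range A)" by (rule directed_down_range) (auto simp: A_def)
   show "cocpt {0} (A 0)" unfolding cocpt_def using E(1) by (intro exI[of _ E]) (auto simp: A_def set_plus_def)
   show "closed B" if "B \<in> range A" for B
    using that cln compact_imp_closed[OF E(1)] by (auto simp: Aeq)
   show "B \<noteq> {}" if "B \<in> range A" for B using that 1 v by (force simp: A_def)
  qed auto
  then have "z \<in> A n" for n by blast
  then show ?thesis unfolding A_def by blast
 qed
 have XZ: "X \<subseteq> Z"
 proof
  fix x assume "x \<in> X"
  then have "(f ^^ n) x \<in> {0} + X" for n using funpow_mem[of X f x n] fX by (auto intro!: set_plusI[of 0])
  then show "x \<in> Z" using sub \<open>x \<in> X\<close> compact_insert[OF compact_empty, of "0::'k"] unfolding Z_def bdd_def by blast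
 qed
 have ZY: "z \<in> X" if "z \<in> Z" "z \<in> Y" for z
  using that expd_bounded[OF e _ that(2)] by (auto simp: Z_def bdd_def)
 have dec: "\<exists>v\<in>V. \<exists>e\<in>E. (\<forall>n. (f ^^ n) (v - e) \<in> K + X) \<and> v - e \<in> Z \<and> c - (v - e) \<in> Y" if c: "c \<in> C" for c
 proof -
  obtain v y where vy: "v \<in> V" "y \<in> Y" "c = v + y" using c V(3) by (auto elim: set_plusE)
  obtain e where e: "e \<in> E" "\<forall>n. (f ^^ n) (v - e) \<in> K + X" using 2[OF vy(1)] by blast
  have "v - e \<in> C" using vy e V(2) E(3) sub by (intro sg_diff[OF g(3)]) auto
  then have "v - e \<in> Z" using e cK unfolding Z_def bdd_def by blast
  moreover have "c - (v - e) = e + y" using vy by simp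
  then have "c - (v - e) \<in> Y" using e vy E(3) sg_add[OF g(2)] by auto
  ultimately show ?thesis using vy e by blast
 qed
 have "C \<subseteq> Z + Y"
 proof
  fix c assume "c \<in> C"
  from dec[OF this] obtain v d where "v - d \<in> Z" "c - (v - d) \<in> Y" by blast
  then show "c \<in> Z + Y" unfolding set_plus_diff by (rule bexI[rotated])
 qed
 moreover have "Z + Y \<subseteq> C" using sub by (intro sg_plus_subset[OF g(3)]) (auto simp: Z_def bdd_def)
 ultimately show "bdd f X C + Y = C" unfolding Z_def by blast
 \<comment> \<open>The one bound \<open>K\<close> serves every bounded point: \<open>z\<close>
   differs from a corrected point by an element of \<open>Z \<inter> Y\<close>, which lies in
   \<open>X\<close>. This uniformity yields both closedness and compactness over
   \<open>X\<close>.\<close>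
 have ZK: "(f ^^ n) z \<in> K + X" "z \<in> K + X" if z: "z \<in> Z" for z n
 proof -
  have "z \<in> C" using z by (simp add: Z_def bdd_def)
  then obtain v d where vd: "v \<in> V" "d \<in> E" "\<forall>n. (f ^^ n) (v - d) \<in> K + X" "v - d \<in> Z" "z - (v - d) \<in> Y"
   using dec by blast
  have "z - (v - d) \<in> X" by (rule ZY[OF sg_diff[OF gZ z vd(4)] vd(5)])
  then have "(f ^^ n) (v - d) + (f ^^ n) (z - (v - d)) \<in> K + X" for n
   using vd(3) funpow_mem[of X f "z - (v - d)" n] fX by (intro KX) auto
  then have "(f ^^ n) z \<in> K + X" for n by (simp add: oper_add[OF fn, symmetric])
  then show "(f ^^ n) z \<in> K + X" .
  from \<open>!!n. (f ^^ n) z \<in> K + X\<close>[of 0] show "z \<in> K + X" by simp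
 qed
 show "X \<subseteq> bdd f X C" using XZ Z_def by simp
 show "cocpt X (bdd f X C)" unfolding cocpt_def using cK ZK(2) unfolding Z_def by blast
 have "Z = C \<inter> (\<Inter>n. {c. (f ^^ n) c \<in> K + X})"
  using ZK(1) cK by (auto simp: Z_def bdd_def)
 moreover have "closed {c. (f ^^ n) c \<in> K + X}" for n
  using closed_vimage[OF cKX oper_cont[OF fn]] by (simp add: vimage_def)
 ultimately show "closed (bdd f X C)" unfolding Z_def using cl(3) by (metis closed_Int closed_INT)
qed

end

lemma closed_translate_vimage:
 fixes A :: "'k::topological_ab_group_add set"
 assumes "closed A" shows "closed {z. z - c \<in> A}" "closed {z. c - z \<in> A}"
proof -
 have "continuous_on UNIV (\<lambda>z. z - c)" by (intro continuous_intros)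
 from closed_vimage[OF assms this] show "closed {z. z - c \<in> A}" by (simp add: vimage_def)
 have "continuous_on UNIV (\<lambda>z. c - z)" by (intro continuous_intros)
 from closed_vimage[OF assms this] show "closed {z. c - z \<in> A}" by (simp add: vimage_def)
qed

lemma cocpt_translate:
 fixes N :: "'k::topological_ab_group_add set"
 assumes "cocpt X N" shows "cocpt X ({c} + N)"
proof -
 obtain V where V: "compact V" "N \<subseteq> V + X" using assms cocpt_def by blast
 have "{c} + N \<subseteq> ({c} + V) + X" unfolding add.assoc by (rule set_plus_mono[OF order_refl V(2)])
 moreover have "compact ({c} + V)" by (rule compact_set_plus[OF _ V(1)]) simp
 ultimately show ?thesis unfolding cocpt_def by blast
qed

context tgact
begin

lemma null_mono:
 assumes "X \<subseteq> X'" shows "null f X Y \<subseteq> null f X' Y"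
proof
 fix y assume "y \<in> null f X Y"
 then obtain s where s: "s 0 = y" "bseq f X Y s" by (rule nullE)
 from nullI[OF bseq_mono[OF s(2) assms bseqD(1)[OF s(2)]]] show "y \<in> null f X' Y" using s by simp
qed

text \<open>When \<open>N/X\<close> is compact, the expansion on \<open>B/N\<close> lifts to a
  complement of \<open>N/X\<close> in \<open>B/X\<close>. For each stable open \<open>N1\<close>
  between \<open>X\<close> and \<open>N\<close>, \<open>rigid\<close> gives an open
  \<open>L N1\<close> with trace \<open>N1\<close> on \<open>N\<close>, and the complement is the
  intersection of these. It equals \<open>null f X B\<close>: the orbits modulo the various
  \<open>N1\<close> are compatible by uniqueness, and compactness of \<open>N/X\<close> glues them
  to one orbit modulo \<open>X\<close>.\<close>

theorem split_compact_kernel: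
 assumes f: "oper f" and gX: "add_subgroup X" and gN: "add_subgroup N" and gB: "add_subgroup B"
  and clX: "closed X" and clN: "closed N" and clB: "closed B" and XN: "X \<subseteq> N" and NB: "N \<subseteq> B"
  and fX: "!!x. x \<in> X ==> f x \<in> X" and fN: "!!x. x \<in> N ==> f x \<in> N" and fB: "!!x. x \<in> B ==> f x \<in> B"
  and e: "expd f N B" and c: "cocpt X N"
  and res: "!!U. nb U ==> \<exists>N1. add_subgroup N1 \<and> closed N1 \<and> X \<subseteq> N1 \<and> N1 \<subseteq> N \<and> omod N1 N \<and>
   N1 \<subseteq> U + X \<and> (\<forall>x\<in>N1. f x \<in> N1)"
 shows "closed (null f X B)" "null f X B \<inter> N = X" "null f X B + N = B" "expd f X (null f X B)"
proof -
 have XB: "X \<subseteq> B" using XN NB by blast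
 define NN where "NN = {N1. add_subgroup N1 \<and> closed N1 \<and> X \<subseteq> N1 \<and> N1 \<subseteq> N \<and> omod N1 N \<and> (\<forall>x\<in>N1. f x \<in> N1)}"
 define L where "L N1 = null f N1 B" for N1
 define H where "H = null f X B"
 have NND: "add_subgroup N1" "closed N1" "X \<subseteq> N1" "N1 \<subseteq> N" "omod N1 N" "!!x. x \<in> N1 ==> f x \<in> N1" "N1 \<subseteq> B" "0 \<in> N1"
  if "N1 \<in> NN" for N1
 proof -
  show "add_subgroup N1" "closed N1" "X \<subseteq> N1" "N1 \<subseteq> N" "omod N1 N" "!!x. x \<in> N1 ==> f x \<in> N1"
   using that unfolding NN_def by auto
  then show "N1 \<subseteq> B" "0 \<in> N1" using NB sg_zero by auto
 qed
 have N_NN: "N \<in> NN" unfolding NN_def using gN clN XN fN omod_refl by auto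
 have dir: "directed_down NN" unfolding directed_down_def
 proof (intro ballI)
  fix A B assume "A \<in> NN" "B \<in> NN"
  then have "A \<inter> B \<in> NN"
   using sg_Int[of A B] closed_Int[of A B] omod_Int[of A N B] unfolding NN_def by auto
  then show "\<exists>C\<in>NN. C \<subseteq> A \<inter> B" by blast
 qed
 have IntNN: "x \<in> X" if x: "!!N1. N1 \<in> NN ==> x \<in> N1" for x
 proof (rule mem_closed_if_near[OF clX])
  fix U assume "nb (U::'k set)"
  from res[OF this] obtain N1 where "N1 \<in> NN" "N1 \<subseteq> U + X" unfolding NN_def by blast
  then show "x \<in> U + X" using x by blast
 qed
 have Lo: "omod (L N1) B" "L N1 \<inter> N = N1" if "N1 \<in> NN" for N1
  unfolding L_def using rigid[OF f NND(1)[OF that] gN gB NND(4)[OF that] NB NND(6)[OF that] fN NND(5)[OF that] e] by blast+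
 have Lg: "add_subgroup (L N1)" if "N1 \<in> NN" for N1
  unfolding L_def by (rule null_add_subgroup[OF f NND(1)[OF that] gB NND(7)[OF that]])
 have LB: "L N1 \<subseteq> B" for N1 unfolding L_def by (rule null_subset)
 have NL: "N1 \<subseteq> L N1" if "N1 \<in> NN" for N1
  unfolding L_def by (rule null_contains[OF f NND(1)[OF that] NND(7)[OF that]])
 have Lc: "closed (L N1)" if "N1 \<in> NN" for N1
  by (rule omod_closed[OF Lo(1)[OF that] clB Lg[OF that] gB LB])
 have Lf: "f x \<in> L N1" if "N1 \<in> NN" "x \<in> L N1" for N1 x
  using null_stable[OF f NND(6)[OF that(1)] fB] that(2) unfolding L_def by blast
 have Lmono: "L N2 \<subseteq> L N1" if "N2 \<subseteq> N1" for N1 N2 unfolding L_def by (rule null_mono[OF that])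
 have HL: "H \<subseteq> L N1" if "N1 \<in> NN" for N1 unfolding H_def L_def by (rule null_mono[OF NND(3)[OF that]])
 \<comment> \<open>Far out, the backward orbit modulo \<open>N\<close> consists of points of
   \<open>L N1 + N\<close>; applying \<open>f\<close> preserves this, so it holds at the
   start.\<close>
 have Lsum: "\<exists>l\<in>L N1. y - l \<in> N" if N1: "N1 \<in> NN" and y: "y \<in> B" for N1 y
 proof -
  have "y \<in> null f N B" using y expd_null[OF e] by blast
  then obtain s where s: "s 0 = y" "bseq f N B s" by (rule nullE)
  obtain U where U: "nb U" "U \<inter> B \<subseteq> L N1" using Lo(1)[OF N1] omod_def by blast
  obtain m where m: "\<forall>n\<ge>m. s n \<in> U + N" using bseqD(3)[OF s(2) U(1)] by blast
  then have "s m \<in> U + N" by blast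
  then obtain u \<nu> where u: "u \<in> U" "\<nu> \<in> N" "s m = u + \<nu>" by (rule set_plusE)
  have "u + \<nu> \<in> B" using bseqD(1)[OF s(2), of m] u(3) by simp
  then have "u \<in> B" using sg_cancel_right[OF gB, of \<nu> u] u(2) NB by blast
  then have "\<exists>l\<in>L N1. s m - l \<in> N" using u U by (intro bexI[of _ u]) auto
  then have "\<exists>l\<in>L N1. s (m - k) - l \<in> N" for k
  proof (induction k)
   case 0 then show ?case by simp
  next
   case (Suc k)
   then obtain l where l: "l \<in> L N1" "s (m - k) - l \<in> N" by blast
   show ?case
   proof (cases "m - k")
    case 0 then show ?thesis using l by auto
   next
    case (Suc j)
    then have j: "m - Suc k = j" by simp
    have "s j - f l = f (s (Suc j) - l) - (f (s (Suc j)) - s j)" by (simp add: oper_diff[OF f])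
    also have "\<dots> \<in> N" using sg_diff[OF gN fN bseqD(2)[OF s(2)]] l(2) Suc by metis
    finally show ?thesis using Lf[OF N1 l(1)] j by blast
   qed
  qed
  from this[of m] show ?thesis using s by simp
 qed
 have uniq: "s n - s' n \<in> N1" if N1: "N1 \<in> NN" and s: "bseq f N1 B s" "bseq f N1 B s'" "s 0 - s' 0 \<in> N1" for N1 s s' n
 proof -
  have sN: "bseq f N B s" "bseq f N B s'"
   using bseq_mono[OF s(1) NND(4)[OF N1] bseqD(1)[OF s(1)]] bseq_mono[OF s(2) NND(4)[OF N1] bseqD(1)[OF s(2)]] .
  have s0: "s 0 - s' 0 \<in> N" using s(3) NND(4)[OF N1] by blast
  have "s n - s' n \<in> N"
  proof (rule bseq_unique[OF f e _ gN gB sN s0])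
   show "f x \<in> N" if "x \<in> N" for x using fN that .
  qed
  moreover have "s n - s' n \<in> L N1"
   unfolding L_def by (rule sg_diff[OF Lg[OF N1, unfolded L_def] bseq_null[OF s(1)] bseq_null[OF s(2)]])
  ultimately show ?thesis using Lo(2)[OF N1] by blast
 qed
 have LH: "y \<in> H" if y: "!!N1. N1 \<in> NN ==> y \<in> L N1" for y
 proof -
  have ex: "\<exists>s. s 0 = y \<and> bseq f N1 B s" if "N1 \<in> NN" for N1
   using y[OF that] unfolding L_def null_def by blast
  define S where "S N1 = (SOME s. s 0 = y \<and> bseq f N1 B s)" for N1
  have S: "S N1 0 = y" "bseq f N1 B (S N1)" if "N1 \<in> NN" for N1
   using someI_ex[OF ex[OF that]] unfolding S_def by auto
  have SS: "S N2 n - S N1 n \<in> N1" if N: "N1 \<in> NN" "N2 \<in> NN" "N2 \<subseteq> N1" for N1 N2 n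
  proof (rule uniq[OF N(1) _ S(2)[OF N(1)]])
   show "bseq f N1 B (S N2)" by (rule bseq_mono[OF S(2)[OF N(2)] N(3) bseqD(1)[OF S(2)[OF N(2)]]])
   show "S N2 0 - S N1 0 \<in> N1" using S(1)[OF N(1)] S(1)[OF N(2)] NND(8)[OF N(1)] by simp
  qed
  \<comment> \<open>The cosets \<open>S N1 n + N1\<close> are directed, closed and compact modulo
    \<open>X\<close>. A common point serves as the \<open>n\<close>-th orbit point modulo every
    \<open>N1\<close> at once.\<close>
  have "\<exists>z. \<forall>N1\<in>NN. z - S N1 n \<in> N1" for n
  proof -
   define F where "F = (\<lambda>N1. {z. z - S N1 n \<in> N1}) ` NN"
   obtain z where z: "!!A. A \<in> F ==> z \<in> A"
   proof (rule cocpt_fip[of F "{z. z - S N n \<in> N}" X])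
    show "directed_down F" unfolding directed_down_def
    proof (intro ballI)
     fix A B assume "A \<in> F" "B \<in> F"
     then obtain N1 N1' where N1: "N1 \<in> NN" "A = {z. z - S N1 n \<in> N1}" "N1' \<in> NN" "B = {z. z - S N1' n \<in> N1'}"
      unfolding F_def by blast
     obtain N2 where N2: "N2 \<in> NN" "N2 \<subseteq> N1 \<inter> N1'" using dir N1 unfolding directed_down_def by metis
     have sub: "{z. z - S N2 n \<in> N2} \<subseteq> {z. z - S M n \<in> M}" if M: "M \<in> NN" "N2 \<subseteq> M" for M
     proof clarify
      fix z assume "z - S N2 n \<in> N2"
      then have "(z - S N2 n) + (S N2 n - S M n) \<in> M"
       using M(2) by (intro sg_add[OF NND(1)[OF M(1)] _ SS[OF M(1) N2(1) M(2)]]) auto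
      then show "z - S M n \<in> M" by simp
     qed
     have "{z. z - S N2 n \<in> N2} \<subseteq> A \<inter> B" using sub[OF N1(1)] sub[OF N1(3)] N2(2) N1(2,4) by blast
     then show "\<exists>C\<in>F. C \<subseteq> A \<inter> B" unfolding F_def using N2(1) by blast
    qed
    show "{z. z - S N n \<in> N} \<in> F" unfolding F_def using N_NN by blast
    have "{z. z - S N n \<in> N} \<subseteq> {S N n} + N" by (auto simp: set_plus_diff)
    then show "cocpt X {z. z - S N n \<in> N}" by (rule cocpt_mono[OF cocpt_translate[OF c] order_refl])
    show "closed A" if "A \<in> F" for A
     using that closed_translate_vimage(1) NND(2) unfolding F_def by blast
    show "A \<noteq> {}" if "A \<in> F" for A
    proof -
     obtain N1 where "N1 \<in> NN" "A = {z. z - S N1 n \<in> N1}" using \<open>A \<in> F\<close> unfolding F_def by blast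
     then have "S N1 n \<in> A" using NND(8) by simp
     then show ?thesis by blast
    qed
    show "a - x \<in> A" if ax: "A \<in> F" "a \<in> A" "x \<in> X" for A a x
    proof -
     obtain N1 where N1: "N1 \<in> NN" "A = {z. z - S N1 n \<in> N1}" using ax(1) unfolding F_def by blast
     have "a - S N1 n \<in> N1" "x \<in> N1" using ax N1 NND(3)[OF N1(1)] by auto
     then have "(a - S N1 n) - x \<in> N1" by (rule sg_diff[OF NND(1)[OF N1(1)]])
     then show ?thesis using N1 by (simp add: algebra_simps)
    qed
   qed blast
   then have "\<forall>N1\<in>NN. z - S N1 n \<in> N1" unfolding F_def by blast
   then show ?thesis by blast
  qed
  then obtain z where z: "!!n. \<forall>N1\<in>NN. z n - S N1 n \<in> N1" by metis
  define w where "w n = (if n = 0 then y else z n)" for n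
  have w: "w n - S N1 n \<in> N1" if "N1 \<in> NN" for N1 n
   using z[of n] that S(1)[OF that] NND(8)[OF that] by (simp add: w_def)
  have "bseq f X B w"
  proof (rule bseqI)
   show "w n \<in> B" for n
   proof -
    have "(w n - S N n) + S N n \<in> B"
     using w[OF N_NN, of n] NB bseqD(1)[OF S(2)[OF N_NN], of n] by (intro sg_add[OF gB]) auto
    then show ?thesis by simp
   qed
   show "f (w (Suc n)) - w n \<in> X" for n
   proof (rule IntNN)
    fix N1 assume N1: "N1 \<in> NN"
    have "f (w (Suc n)) - w n = f (w (Suc n) - S N1 (Suc n)) + (f (S N1 (Suc n)) - S N1 n) - (w n - S N1 n)"
     by (simp add: oper_diff[OF f])
    also have "\<dots> \<in> N1"
     by (rule sg_diff[OF NND(1)[OF N1] sg_add[OF NND(1)[OF N1] NND(6)[OF N1 w[OF N1]] bseqD(2)[OF S(2)[OF N1]]] w[OF N1]])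
    finally show "f (w (Suc n)) - w n \<in> N1" .
   qed
   fix U assume U: "nb (U::'k set)"
   obtain V where V: "nb V" "!!x y. x \<in> V ==> y \<in> V ==> x + y \<in> U" using nb_half[OF U] by metis
   from res[OF V(1)] obtain N1 where N1: "N1 \<in> NN" "N1 \<subseteq> V + X" unfolding NN_def by blast
   obtain m where m: "\<forall>n\<ge>m. S N1 n \<in> V + N1" using bseqD(3)[OF S(2)[OF N1(1)] V(1)] by blast
   have "w n \<in> U + X" if "n \<ge> m" for n
   proof -
    have "S N1 n \<in> V + N1" using m that by blast
    then obtain v p where vp: "v \<in> V" "p \<in> N1" "S N1 n = v + p" by (rule set_plusE)
    have "p + (w n - S N1 n) \<in> N1" by (rule sg_add[OF NND(1)[OF N1(1)] vp(2) w[OF N1(1)]])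
    then obtain v' x where v': "v' \<in> V" "x \<in> X" "p + (w n - S N1 n) = v' + x" using N1(2) by (meson set_plusE subsetD)
    have "w n = v + (p + (w n - S N1 n))" using vp(3) by simp
    also have "\<dots> = (v + v') + x" using v'(3) by (simp add: add.assoc)
    finally show ?thesis using V(2)[OF vp(1) v'(1)] v'(2) by (rule set_plusI[rotated 2])
   qed
   then show "\<exists>m. \<forall>n\<ge>m. w n \<in> U + X" by blast
  qed
  from nullI[OF this] show ?thesis by (simp add: w_def H_def)
 qed
 have Heq: "H = \<Inter>(L ` NN)" using LH HL by blast
 then have cH: "closed H" using Lc by auto
 then show "closed (null f X B)" unfolding H_def .
 have XH: "X \<subseteq> H" unfolding H_def by (rule null_contains[OF f gX XB])
 have HN: "x \<in> X" if "x \<in> H" "x \<in> N" for x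
 proof (rule IntNN)
  fix N1 assume "N1 \<in> NN"
  then show "x \<in> N1" using HL Lo(2) that by blast
 qed
 then show "null f X B \<inter> N = X" using XH XN unfolding H_def by blast
 have HB: "H \<subseteq> B" unfolding H_def by (rule null_subset)
 have gH: "add_subgroup H" unfolding H_def by (rule null_add_subgroup[OF f gX gB XB])
 have sum: "\<exists>h\<in>H. y - h \<in> N" if y: "y \<in> B" for y
 proof -
  define F where "F = (\<lambda>N1. L N1 \<inter> {h. y - h \<in> N}) ` NN"
  obtain z where z: "!!A. A \<in> F ==> z \<in> A"
  proof (rule cocpt_fip[of F "L N \<inter> {h. y - h \<in> N}" X])
   show "directed_down F" unfolding directed_down_def
   proof (intro ballI)
    fix A A' assume "A \<in> F" "A' \<in> F"
    then obtain N1 N1' where N1: "N1 \<in> NN" "A = L N1 \<inter> {h. y - h \<in> N}" "N1' \<in> NN" "A' = L N1' \<inter> {h. y - h \<in> N}"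
     unfolding F_def by blast
    obtain N2 where N2: "N2 \<in> NN" "N2 \<subseteq> N1 \<inter> N1'" using dir N1 unfolding directed_down_def by metis
    have "L N2 \<subseteq> L N1" "L N2 \<subseteq> L N1'" using Lmono N2(2) by auto
    then have "L N2 \<inter> {h. y - h \<in> N} \<subseteq> A \<inter> A'" using N1 by blast
    then show "\<exists>C\<in>F. C \<subseteq> A \<inter> A'" unfolding F_def using N2(1) by blast
   qed
   show "L N \<inter> {h. y - h \<in> N} \<in> F" unfolding F_def using N_NN by blast
   have "h \<in> {y} + N" if "y - h \<in> N" for h
    using sg_neg[OF gN that] by (auto simp: set_plus_diff)
   then have "L N \<inter> {h. y - h \<in> N} \<subseteq> {y} + N" by blast
   then show "cocpt X (L N \<inter> {h. y - h \<in> N})" by (rule cocpt_mono[OF cocpt_translate[OF c] order_refl])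
   show "closed A" if "A \<in> F" for A
    using that Lc closed_translate_vimage(2)[OF clN, of y] unfolding F_def by (auto intro!: closed_Int)
   show "A \<noteq> {}" if "A \<in> F" for A using that Lsum[OF _ y] unfolding F_def by blast
   show "a - x \<in> A" if ax: "A \<in> F" "a \<in> A" "x \<in> X" for A a x
   proof -
    obtain N1 where N1: "N1 \<in> NN" "A = L N1 \<inter> {h. y - h \<in> N}" using ax(1) unfolding F_def by blast
    have "a - x \<in> L N1" using ax N1 XH HL[OF N1(1)] by (intro sg_diff[OF Lg[OF N1(1)]]) auto
    moreover have "(y - a) + x \<in> N" using ax N1 XN by (intro sg_add[OF gN]) auto
    ultimately show ?thesis using N1 by (simp add: algebra_simps)
   qed
  qed blast
  have "z \<in> L N1" "y - z \<in> N" if "N1 \<in> NN" for N1 using z that unfolding F_def by blast+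
  then show ?thesis using LH N_NN by blast
 qed
 have "B \<subseteq> H + N" using sum by (simp add: set_plus_diff subset_iff)
 moreover have "H + N \<subseteq> B" by (rule sg_plus_subset[OF gB HB NB])
 ultimately show "null f X B + N = B" unfolding H_def by blast
 have sH: "bseq f X H s" if "bseq f X B s" for s
  by (rule bseq_mono[OF that order_refl]) (unfold H_def, rule bseq_null[OF that])
 have sB: "bseq f N B s" if "bseq f X H s" for s
  using bseq_mono[OF that XN, of B] bseqD(1)[OF that] HB by blast
 have "expd f X H" unfolding expd_def
 proof (intro conjI allI impI)
  fix W y assume Wy: "compact W \<and> y \<in> H \<and> (\<forall>n. (f ^^ n) y \<in> W + X)"
  have "y \<in> N"
  proof (rule expd_bounded[OF e])
   show "(f ^^ n) y \<in> W + N" for n using Wy set_plus_mono_right[OF XN] by blast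
  qed (use Wy HB in auto)
  then show "y \<in> X" using HN Wy by blast
 next
  show "H \<subseteq> null f X H"
  proof
   fix y assume "y \<in> H"
   then obtain s where s: "s 0 = y" "bseq f X B s" unfolding H_def by (rule nullE)
   from nullI[OF sH[OF s(2)]] show "y \<in> null f X H" using s by simp
  qed
 next
  fix U assume U: "nb (U::'k set)"
  obtain V where V: "nb V" "V \<subseteq> U" "!!x y. x \<in> V ==> y \<in> V ==> x + y \<in> U" using nb_half[OF U] by metis
  from res[OF V(1)] obtain N1 where N1: "N1 \<in> NN" "N1 \<subseteq> V + X" unfolding NN_def by blast
  obtain U2 where U2: "nb U2" "U2 \<inter> B \<subseteq> L N1" using Lo(1)[OF N1(1)] omod_def by blast
  obtain U' where U': "nb U'" "\<forall>s. bseq f N B s \<and> s 0 \<in> U' --> (\<forall>n. s n \<in> (U2 \<inter> V) + N)"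
   using expd_small[OF e nb_Int[OF U2(1) V(1)]] by blast
  have "s n \<in> U + X" if s: "bseq f X H s" "s 0 \<in> U'" for s n
  proof -
   have "s n \<in> (U2 \<inter> V) + N" using U'(2) sB[OF s(1)] s(2) by blast
   then obtain u \<nu> where u: "u \<in> U2 \<inter> V" "\<nu> \<in> N" "s n = u + \<nu>" by (rule set_plusE)
   have sn: "s n \<in> H" using bseqD(1)[OF s(1)] .
   have "u + \<nu> \<in> B" using sn u(3) HB by auto
   then have "u \<in> B" using sg_cancel_right[OF gB, of \<nu> u] u(2) NB by blast
   then have uL: "u \<in> L N1" using u U2 by blast
   have "s n \<in> L N1" using HL[OF N1(1)] sn by blast
   then have "u + \<nu> \<in> L N1" using u(3) by simp
   then have "\<nu> \<in> L N1" using sg_cancel_left[OF Lg[OF N1(1)] uL] by blast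
   then have "\<nu> \<in> N1" using Lo(2)[OF N1(1)] u(2) by blast
   then obtain v x where vx: "v \<in> V" "x \<in> X" "\<nu> = v + x" using N1(2) by (meson set_plusE subsetD)
   have "s n = (u + v) + x" using u(3) vx(3) by (simp add: add.assoc)
   moreover have "u + v \<in> U" using V(3) u(1) vx(1) by blast
   ultimately show ?thesis using vx(2) by (rule set_plusI[rotated 2])
  qed
  then show "\<exists>U'. nb U' \<and> (\<forall>s. bseq f X H s \<and> s 0 \<in> U' --> (\<forall>n. s n \<in> U + X))" using U'(1) by blast
 next
  fix W assume W: "compact W \<and> W \<subseteq> H"
  then obtain E where E: "compact E" "0 \<in> E" "E \<subseteq> B" "W + E \<subseteq> f ` E + N"
   using expd_compact[OF e, of W] HB by blast
  obtain V where V: "compact V" "V \<subseteq> N" "0 \<in> V" "N = V + X" using cocpt_inside[OF c clN XN gX gN] by metis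
  \<comment> \<open>\<open>E\<close> solves the equation only modulo \<open>N\<close>. The solution
    inside \<open>H\<close> differs from it by an element of \<open>N = V + X\<close>, hence the
    extra summand \<open>V\<close>.\<close>
  define E' where "E' = (E + V) \<inter> H"
  have cE: "compact E'" unfolding E'_def by (rule compact_Int_closed[OF compact_set_plus[OF E(1) V(1)] cH])
  have "0 + 0 \<in> E + V" using E V by (intro set_plus_intro)
  then have "0 \<in> E'" unfolding E'_def using sg_zero[OF gH] by simp
  moreover have "W + E' \<subseteq> f ` E' + X"
  proof
   fix z assume "z \<in> W + E'"
   then obtain h d where hd: "h \<in> W" "d \<in> E'" "z = h + d" by (rule set_plusE)
   have "d \<in> E + V" using hd(2) E'_def by blast
   then obtain d1 v where d1: "d1 \<in> E" "v \<in> V" "d = d1 + v" by (rule set_plusE)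
   have zH: "z \<in> H" using hd W E'_def sg_add[OF gH] by blast
   have "h + d1 \<in> f ` E + N" using E(4) hd(1) d1(1) by (meson set_plus_intro subsetD)
   then obtain d2 \<nu> where d2: "d2 \<in> E" "\<nu> \<in> N" "h + d1 = f d2 + \<nu>" by (auto elim: set_plusE)
   obtain s where s: "s 0 = z" "bseq f X B s" using zH unfolding H_def by (rule nullE)
   define y where "y = s 1"
   have y: "y \<in> H" "f y - z \<in> X" using bseqD(1)[OF sH[OF s(2)]] bseqD(2)[OF s(2), of 0] s(1) by (auto simp: y_def)
   have "f (y - d2) = (f y - z) + (\<nu> + v)"
    using hd(3) d1(3) d2(3) by (simp add: oper_diff[OF f] algebra_simps)
   also have "\<dots> \<in> N" using y(2) XN d2(2) d1(2) V(2) by (intro sg_add[OF gN]) auto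
   finally have "f (y - d2) \<in> N" .
   moreover have "y - d2 \<in> B" using y(1) HB d2(1) E(3) by (intro sg_diff[OF gB]) auto
   ultimately have "y - d2 \<in> N" using expd_inj[OF e fN gN] by blast
   then have "y - d2 \<in> V + X" using V(4) by blast
   then obtain v' x where v': "v' \<in> V" "x \<in> X" "y - d2 = v' + x" by (rule set_plusE)
   have yx: "y - x = d2 + v'" using v'(3) by (simp add: algebra_simps)
   have "y - x \<in> E'" unfolding E'_def
   proof
    show "y - x \<in> E + V" unfolding yx by (rule set_plus_intro[OF d2(1) v'(1)])
    show "y - x \<in> H" using y(1) v'(2) XH by (intro sg_diff[OF gH]) auto
   qed
   moreover have "z = f (y - x) + (f x - (f y - z))" by (simp add: oper_diff[OF f])
   moreover have "f x - (f y - z) \<in> X" by (rule sg_diff[OF gX fX[OF v'(2)] y(2)])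
   ultimately show "z \<in> f ` E' + X" by (intro set_plusI[of "f (y - x)" _ "f x - (f y - z)"]) auto
  qed
  ultimately show "\<exists>E. compact E \<and> 0 \<in> E \<and> E \<subseteq> H \<and> W + E \<subseteq> f ` E + X"
   using cE unfolding E'_def by blast
 qed
 then show "expd f X (null f X B)" unfolding H_def .
qed

lemma act_funpow: "\<exists>a. (\<forall>x. (act t ^^ n) x = act a x) \<and> (\<forall>x. (act (- t) ^^ n) x = act (- a) x)"
proof (induction n)
 case 0 show ?case by (intro exI[of _ 0]) simp
next
 case (Suc n)
 then obtain a where "!!x. (act t ^^ n) x = act a x" "!!x. (act (- t) ^^ n) x = act (- a) x" by blast
 then show ?case by (intro exI[of _ "t + a"]) (simp add: act_act[symmetric] add.commute)
qed

lemma funpow_act_inv [simp]: "(act t ^^ n) ((act (- t) ^^ n) x) = x" "(act (- t) ^^ n) ((act t ^^ n) x) = x"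
 using act_funpow[of n t] by auto

lemma funpow_act_comm: "(act t ^^ m) ((act s ^^ n) x) = (act s ^^ n) ((act t ^^ m) x)"
 using act_funpow[of m t] act_funpow[of n s] act_comm by metis

lemma funpow_act_cancel: "k \<le> m ==> (act t ^^ k) ((act (- t) ^^ m) x) = (act (- t) ^^ (m - k)) x"
 using funpow_add[of k "m - k" "act (- t)"] by simp

text \<open>The criterion for an invertible operator: \<open>E\<close> is open in \<open>B\<close>,
  compact modulo \<open>N\<close> and mapped into itself by the inverse; the forward images of
  \<open>E\<close> exhaust \<open>B\<close> and the backward images shrink to \<open>N\<close>.
  Compactness makes the shrinking uniform (\<open>unif\<close>) and lets one power of the inverse
  bring any compact subset of \<open>B\<close> into \<open>E\<close> (\<open>cpt\<close>).\<close>

lemma expd_act: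
 assumes g: "add_subgroup N" "add_subgroup E" "add_subgroup B" and cl: "closed N" "closed E"
  and sub: "N \<subseteq> E" "E \<subseteq> B"
  and N: "!!x. x \<in> N ==> act t x \<in> N" "!!x. x \<in> N ==> act (- t) x \<in> N"
  and B: "!!x. x \<in> B ==> act t x \<in> B" "!!x. x \<in> B ==> act (- t) x \<in> B"
  and E: "!!x. x \<in> E ==> act (- t) x \<in> E"
  and EN: "!!x. (!!n. (act t ^^ n) x \<in> E) ==> x \<in> N"
  and EB: "!!x. x \<in> B ==> \<exists>n. (act (- t) ^^ n) x \<in> E"
  and o: "omod E B" and c: "cocpt N E"
 shows "expd (act t) N B"
proof -
 define f where "f = act t"
 define h where "h = act (- t)"
 have opf: "oper f" and oph: "oper h" unfolding f_def h_def by (rule oper_act)+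
 note fn = oper_funpow[OF opf] and hn = oper_funpow[OF oph]
 have inv: "(f ^^ n) ((h ^^ n) x) = x" "(h ^^ n) ((f ^^ n) x) = x" for n x unfolding f_def h_def by simp_all
 have inv1: "f (h x) = x" "h (f x) = x" for x unfolding f_def h_def by simp_all
 have comm: "(f ^^ m) ((h ^^ n) x) = (h ^^ n) ((f ^^ m) x)" for m n x unfolding f_def h_def by (rule funpow_act_comm)
 have canc: "k \<le> m ==> (f ^^ k) ((h ^^ m) x) = (h ^^ (m - k)) x" for k m x unfolding f_def h_def by (rule funpow_act_cancel)
 have fN: "(f ^^ n) x \<in> N" "(h ^^ n) x \<in> N" if "x \<in> N" for x n
  using funpow_mem[of N f x n] funpow_mem[of N h x n] N that unfolding f_def h_def by blast+
 have fB: "(f ^^ n) x \<in> B" "(h ^^ n) x \<in> B" if "x \<in> B" for x n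
  using funpow_mem[of B f x n] funpow_mem[of B h x n] B that unfolding f_def h_def by blast+
 have hE: "(h ^^ n) x \<in> E" if "x \<in> E" for x n
  using funpow_mem[of E h x n] E that unfolding h_def by blast
 have hE': "(h ^^ m) x \<in> E" if "(h ^^ n) x \<in> E" "n \<le> m" for x n m
 proof -
  have "(h ^^ (m - n)) ((h ^^ n) x) \<in> E" by (rule hE[OF that(1)])
  then show ?thesis using that(2) funpow_add[of "m - n" n h] by simp
 qed
 have EN': "x \<in> N" if "!!n. (f ^^ n) x \<in> E" for x using EN that unfolding f_def by blast
 have EB': "\<exists>n. (h ^^ n) x \<in> E" if "x \<in> B" for x using EB that unfolding h_def by blast
 have unif: "\<exists>m. \<forall>n\<ge>m. \<forall>x\<in>E. (h ^^ n) x \<in> U + N" if U: "nb U" for U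
 proof -
  define A where "A n = {x. \<forall>k\<le>n. (f ^^ k) x \<in> E}" for n
  have "\<exists>D\<in>range A. D \<subseteq> U + N"
  proof (rule cocpt_directed_subset[of "range A" "A 0"])
   show "directed_down (range A)" by (rule directed_down_range) (auto simp: A_def)
   have "A 0 = E" by (auto simp: A_def)
   then show "cocpt N (A 0)" using c by simp
   show "closed D" if "D \<in> range A" for D
   proof -
    obtain n where n: "D = A n" using \<open>D \<in> range A\<close> by blast
    have "A n = (\<Inter>k\<in>{..n}. (f ^^ k) -` E)" by (auto simp: A_def)
    then show ?thesis unfolding n using closed_vimage[OF cl(2) oper_cont[OF fn]] by auto
   qed
   show "a - x \<in> D" if ax: "D \<in> range A" "a \<in> D" "x \<in> N" for D a x
   proof -
    obtain n where n: "D = A n" using ax(1) by blast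
    have "(f ^^ k) (a - x) \<in> E" if "k \<le> n" for k
     unfolding oper_diff[OF fn] using ax(2) n that fN(1)[OF ax(3)] sub by (intro sg_diff[OF g(2)]) (auto simp: A_def)
    then show ?thesis unfolding n A_def by blast
   qed
   have "\<Inter>(range A) \<subseteq> N" using EN' unfolding A_def by blast
   then show "\<Inter>(range A) \<subseteq> U + N" using set_plus_right[of U N] U by blast
  qed (use g U in auto)
  then obtain n where n: "A n \<subseteq> U + N" by blast
  have "(h ^^ m) x \<in> U + N" if mx: "m \<ge> n" "x \<in> E" for m x
  proof -
   have "(f ^^ k) ((h ^^ m) x) \<in> E" if "k \<le> n" for k
    using canc[of k m x] hE[OF mx(2)] that mx(1) by simp
   then show ?thesis using n unfolding A_def by blast
  qed
  then show ?thesis by blast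
 qed
 obtain UE where UE: "nb UE" "UE \<inter> B \<subseteq> E" using o omod_def by blast
 have cpt: "\<exists>m. \<forall>w\<in>W. (h ^^ m) w \<in> E" if W: "compact W" "W \<subseteq> B" for W
 proof -
  define r where "r w = (SOME n. (h ^^ n) w \<in> E)" for w
  have r: "(h ^^ r w) w \<in> E" if "w \<in> B" for w using someI_ex[OF EB'[OF that]] unfolding r_def .
  define Ow where "Ow w = {x. x - w \<in> {y. (h ^^ r w) y \<in> UE}}" for w
  have "open (Ow w)" for w
   unfolding Ow_def using open_translate_vimage[OF conjunct1[OF nb_vimage[OF oper_cont[OF hn] oper_0[OF hn] UE(1)]]] .
  moreover have "W \<subseteq> (\<Union>w\<in>W. Ow w)" unfolding Ow_def using UE(1) oper_0[OF hn] by auto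
  ultimately obtain C where C: "C \<subseteq> W" "finite C" "W \<subseteq> (\<Union>w\<in>C. Ow w)" using compactE_image[OF W(1), of W Ow] by metis
  define m where "m = Max (insert 0 (r ` C))"
  have "(h ^^ m) x \<in> E" if x: "x \<in> W" for x
  proof -
   obtain w where w: "w \<in> C" "(h ^^ r w) (x - w) \<in> UE" using C(3) x unfolding Ow_def by blast
   have "x - w \<in> B" using x w C(1) W(2) by (intro sg_diff[OF g(3)]) auto
   then have "(h ^^ r w) (x - w) \<in> E" using fB(2) w UE by blast
   moreover have "(h ^^ r w) w \<in> E" using r w C(1) W(2) by blast
   ultimately have "(h ^^ r w) (x - w) + (h ^^ r w) w \<in> E" by (rule sg_add[OF g(2)])
   then have "(h ^^ r w) x \<in> E" by (simp add: oper_add[OF hn, symmetric])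
   moreover have "r w \<le> m" unfolding m_def using C(2) w(1) by (intro Max_ge) auto
   ultimately show ?thesis by (rule hE')
  qed
  then show ?thesis by blast
 qed
 \<comment> \<open>With a genuine inverse \<open>h\<close> the backward orbit is determined: modulo
   \<open>N\<close> it is the \<open>h\<close>-orbit of its first point.\<close>
 have bs: "s n - (h ^^ n) (s 0) \<in> N" if s: "bseq f N B s" for s n
 proof (induction n)
  case 0 then show ?case using sg_zero[OF g(1)] by simp
 next
  case (Suc n)
  have "h (f (s (Suc n)) - s n) \<in> N" using fN(2)[OF bseqD(2)[OF s], of 1] by simp
  moreover have "h (s n - (h ^^ n) (s 0)) \<in> N" using fN(2)[OF Suc, of 1] by simp
  ultimately have "h (f (s (Suc n)) - s n) + h (s n - (h ^^ n) (s 0)) \<in> N" by (rule sg_add[OF g(1)])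
  then show ?case by (simp add: oper_diff[OF oph] inv1)
 qed
 have "expd f N B" unfolding expd_def
 proof (intro conjI allI impI)
  fix W y assume Wy: "compact W \<and> y \<in> B \<and> (\<forall>n. (f ^^ n) y \<in> W + N)"
  have NB: "N \<subseteq> B" using sub by blast
  have "compact (W \<inter> closure B)" using Wy by (intro compact_Int_closed) auto
  have cB: "closed B" using closed_if_locally_closed[OF g(3) UE(1) cl(2) UE(2) sub(2)] .
  have "compact (W \<inter> B)" using Wy cB by (intro compact_Int_closed) auto
  then obtain m where m: "\<forall>w\<in>W \<inter> B. (h ^^ m) w \<in> E" using cpt by blast
  have "(f ^^ n) ((h ^^ m) y) \<in> E" for n
  proof -
   obtain w \<nu> where w: "w \<in> W" "\<nu> \<in> N" "(f ^^ n) y = w + \<nu>" using Wy by (meson set_plusE)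
   have "w + \<nu> \<in> B" using fB(1)[of y n] Wy w(3) by simp
   then have "w \<in> B" using sg_cancel_right[OF g(3), of \<nu> w] w(2) NB by blast
   then have "(h ^^ m) w \<in> E" using m w by blast
   moreover have "(h ^^ m) \<nu> \<in> E" using fN(2)[OF w(2)] sub by blast
   ultimately have "(h ^^ m) w + (h ^^ m) \<nu> \<in> E" by (rule sg_add[OF g(2)])
   then show ?thesis unfolding comm w(3) oper_add[OF hn] .
  qed
  then have "(h ^^ m) y \<in> N" by (rule EN')
  then have "(f ^^ m) ((h ^^ m) y) \<in> N" by (rule fN(1))
  then show "y \<in> N" unfolding inv .
 next
  show "B \<subseteq> null f N B"
  proof
   fix y assume y: "y \<in> B"
   have "bseq f N B (\<lambda>n. (h ^^ n) y)"
   proof (rule bseqI)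
    show "(h ^^ n) y \<in> B" for n by (rule fB(2)[OF y])
    show "f ((h ^^ Suc n) y) - (h ^^ n) y \<in> N" for n using sg_zero[OF g(1)] by (simp add: inv1)
    fix U assume U: "nb (U::'k set)"
    obtain m where m: "\<forall>n\<ge>m. \<forall>x\<in>E. (h ^^ n) x \<in> U + N" using unif[OF U] by blast
    obtain k where k: "(h ^^ k) y \<in> E" using EB'[OF y] by blast
    have "(h ^^ n) y \<in> U + N" if "n \<ge> m + k" for n
    proof -
     have "(h ^^ (n - k)) ((h ^^ k) y) \<in> U + N" using m k that by auto
     then show ?thesis using that funpow_add[of "n - k" k h] by simp
    qed
    then show "\<exists>m. \<forall>n\<ge>m. (h ^^ n) y \<in> U + N" by blast
   qed
   from nullI[OF this] show "y \<in> null f N B" by simp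
  qed
 next
  fix U assume U: "nb (U::'k set)"
  obtain m where m: "\<forall>n\<ge>m. \<forall>x\<in>E. (h ^^ n) x \<in> U + N" using unif[OF U] by blast
  have nbU: "nb {x. (f ^^ m) x \<in> UE}" by (rule nb_vimage[OF oper_cont[OF fn] oper_0[OF fn] UE(1)])
  have "s n \<in> U + N" if s: "bseq f N B s" "s 0 \<in> {x. (f ^^ m) x \<in> UE}" for s n
  proof -
   have "(f ^^ m) (s 0) \<in> E" using s(2) UE fB(1)[OF bseqD(1)[OF s(1)]] by blast
   then have "(h ^^ (m + n)) ((f ^^ m) (s 0)) \<in> U + N" using m by auto
   then have "(h ^^ n) (s 0) \<in> U + N" using funpow_add[of n m h] inv(2)[of m "s 0"] by (simp add: add.commute)
   then obtain u \<nu> where u: "u \<in> U" "\<nu> \<in> N" "(h ^^ n) (s 0) = u + \<nu>" by (rule set_plusE)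
   have "s n = u + (\<nu> + (s n - (h ^^ n) (s 0)))" using u(3) by simp
   moreover have "\<nu> + (s n - (h ^^ n) (s 0)) \<in> N" by (rule sg_add[OF g(1) u(2) bs[OF s(1)]])
   ultimately show ?thesis using u(1) by (metis set_plus_intro)
  qed
  then show "\<exists>U'. nb U' \<and> (\<forall>s. bseq f N B s \<and> s 0 \<in> U' --> (\<forall>n. s n \<in> U + N))" using nbU by blast
 next
  fix W assume W: "compact W \<and> W \<subseteq> B"
  then obtain m where m: "\<forall>w\<in>W. (h ^^ m) w \<in> E" using cpt by blast
  obtain V where V: "compact V" "V \<subseteq> E" "0 \<in> V" "E = V + N" using cocpt_inside[OF c cl(2) sub(1) g(1,2)] by metis
  \<comment> \<open>The compact representatives of \<open>E/N\<close>, pushed forward by the power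
    whose inverse brings \<open>W\<close> into \<open>E\<close>. Pulled back by that power, the
    required inclusion only says that the inverse maps \<open>E\<close> into itself.\<close>
  define D where "D = (f ^^ m) ` V"
  have "compact D" unfolding D_def using V(1) oper_cont[OF fn] by (intro compact_continuous_image) (auto intro: continuous_on_subset)
  moreover have "(f ^^ m) 0 \<in> D" unfolding D_def using V(3) by (rule imageI)
  then have "0 \<in> D" using oper_0[OF fn] by simp
  moreover have "D \<subseteq> B" unfolding D_def using V(2) sub fB(1) by blast
  moreover have "W + D \<subseteq> f ` D + N"
  proof
   fix z assume "z \<in> W + D"
   then obtain w v where wv: "w \<in> W" "v \<in> V" "z = w + (f ^^ m) v" unfolding D_def by (auto elim: set_plusE)
   have "(h ^^ m) w + v \<in> E" using m wv V(2) by (intro sg_add[OF g(2)]) auto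
   then have "h ((h ^^ m) w + v) \<in> E" using hE[of _ 1] by simp
   then have "h ((h ^^ m) w + v) \<in> V + N" using V(4) by simp
   then obtain v' \<nu> where v': "v' \<in> V" "\<nu> \<in> N" "h ((h ^^ m) w + v) = v' + \<nu>" by (rule set_plusE)
   have "z = (f ^^ m) ((h ^^ m) w + v)" using wv(3) by (simp add: oper_add[OF fn] inv)
   also have "\<dots> = (f ^^ m) (f (h ((h ^^ m) w + v)))" by (simp add: inv1)
   also have "\<dots> = f ((f ^^ m) v') + (f ^^ Suc m) \<nu>"
    unfolding v'(3) by (simp add: oper_add[OF opf] oper_add[OF fn] funpow_swap1)
   finally have "z = f ((f ^^ m) v') + (f ^^ Suc m) \<nu>" .
   moreover have "f ((f ^^ m) v') \<in> f ` D" unfolding D_def using v'(1) by blast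
   ultimately show "z \<in> f ` D + N" using fN(1)[OF v'(2), of "Suc m"] by (metis set_plus_intro)
  qed
  ultimately show "\<exists>E. compact E \<and> 0 \<in> E \<and> E \<subseteq> B \<and> W + E \<subseteq> f ` E + N" by blast
 qed
 then show ?thesis unfolding f_def .
qed

section \<open>Chains of expanding layers\<close>

definition isop :: "('k => 'k) => bool" where
 "isop f \<longleftrightarrow> (\<exists>t. f = act t) \<or> f = (\<lambda>x. x + x)"

lemma isop_oper: "isop f ==> oper f"
 unfolding isop_def using oper_act oper_double by auto

lemma isop_stable: "isop f ==> sub UNIV X ==> x \<in> X ==> f x \<in> X"
 unfolding isop_def sub_def by (auto intro: sg_add)

text \<open>The chain grows at its upper end. Accordingly \<open>rigid_hyper\<close> climbs layer by
  layer from the bottom, while \<open>corigid_hyper\<close> removes the top layer first and for that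
  reason treats \<open>C\<close> as arbitrary in the induction.\<close>

inductive hyper :: "'k set => 'k set => bool" where
 hyper_refl: "closed X ==> sub UNIV X ==> hyper X X"
| hyper_step: "hyper X Y ==> isop f ==> expd f Y Z ==> closed Z ==> sub UNIV Z ==> Y \<subseteq> Z ==> hyper X Z"

lemma hyperD: assumes "hyper X Y"
 shows "closed X" "sub UNIV X" "closed Y" "sub UNIV Y" "X \<subseteq> Y"
 using assms by (induction) auto

lemma rigid_hyper:
 assumes "hyper P Y" "sub UNIV P0" "P0 \<subseteq> P" "omod P0 P"
 shows "\<exists>L. sub UNIV L \<and> P0 \<subseteq> L \<and> L \<subseteq> Y \<and> omod L Y \<and> L \<inter> P = P0"
 using assms
proof (induction)
 case (hyper_refl X)
 then show ?case by (intro exI[of _ P0]) auto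
next
 case (hyper_step X Y f Z)
 then obtain L where L: "sub UNIV L" "P0 \<subseteq> L" "L \<subseteq> Y" "omod L Y" "L \<inter> X = P0" by blast
 note f = isop_oper[OF hyper_step.hyps(2)] and st = isop_stable[OF hyper_step.hyps(2)]
 have Y: "sub UNIV Y" "X \<subseteq> Y" using hyperD[OF hyper_step.hyps(1)] by auto
 note Z = hyper_step.hyps(5,6)
 define L' where "L' = null f L Z"
 have r: "omod L' Z" "L' \<inter> Y = L" unfolding L'_def
  using rigid[OF f subD(1)[OF L(1)] subD(1)[OF Y(1)] subD(1)[OF Z(1)] L(3) Z(2) st[OF L(1)] st[OF Y(1)] L(4) hyper_step.hyps(3)] by auto
 have LZ: "L \<subseteq> Z" using L(3) Z(2) by blast
 have "sub UNIV L'" unfolding L'_def by (rule null_sub[OF f L(1) Z(1) LZ])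
 moreover have "L' \<subseteq> Z" unfolding L'_def by (rule null_subset)
 moreover have "P0 \<subseteq> L'" using L(2) r(2) by blast
 moreover have "L' \<inter> X = P0" using r(2) L(5) Y(2) by blast
 ultimately show ?case using r(1) by blast
qed

lemma corigid_hyper:
 assumes "hyper X Y" "closed C" "sub UNIV C" "Y \<subseteq> C" "cocpt Y C"
 shows "\<exists>Z. closed Z \<and> sub UNIV Z \<and> X \<subseteq> Z \<and> Z \<subseteq> C \<and> Z + Y = C \<and> cocpt X Z"
 using assms
proof (induction arbitrary: C)
 case (hyper_refl X)
 have "C + X = C" using hyper_refl.prems sg_plus_subset[of C C X] set_plus_left[of X C]
   subD(1)[of UNIV C] subD(1)[OF hyper_refl.hyps(2)] sg_zero[of X] by blast
 then show ?case using hyper_refl by (intro exI[of _ C]) auto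
next
 case (hyper_step X Y f Z)
 note f = isop_oper[OF hyper_step.hyps(2)] and st = isop_stable[OF hyper_step.hyps(2)]
 have Y: "closed Y" "sub UNIV Y" "X \<subseteq> Y" using hyperD[OF hyper_step.hyps(1)] by auto
 note Z = hyper_step.hyps(4,5,6)
 note C = hyper_step.prems
 define Z1 where "Z1 = bdd f Y C"
 have r: "closed Z1" "Y \<subseteq> Z1" "Z1 + Z = C" "cocpt Y Z1" unfolding Z1_def
  using corigid[OF f subD(1)[OF Y(2)] subD(1)[OF Z(2)] subD(1)[OF C(2)] Y(1) Z(1) C(1) Z(3) C(3) st[OF Y(2)] st[OF C(2)] hyper_step.hyps(3) C(4)] by auto
 have sZ1: "sub UNIV Z1" unfolding Z1_def by (rule bdd_sub[OF f Y(2) C(2)])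
 have Z1C: "Z1 \<subseteq> C" unfolding Z1_def bdd_def by blast
 from hyper_step.IH[OF r(1) sZ1 r(2,4)] obtain Z' where
  Z': "closed Z'" "sub UNIV Z'" "X \<subseteq> Z'" "Z' \<subseteq> Z1" "Z' + Y = Z1" "cocpt X Z'" by blast
 have "Y + Z = Z"
  using sg_plus_subset[OF subD(1)[OF Z(2)] Z(3) order_refl] set_plus_right[OF sg_zero[OF subD(1)[OF Y(2)]], of Z] by blast
 then have "Z' + Z = C" using Z'(5) r(3) by (metis add.assoc)
 then show ?case using Z' Z1C by blast
qed

text \<open>By \<open>corigid_hyper\<close> a parafinite \<open>C/Y\<close> is the image of some
  \<open>Z\<close> with \<open>Z/X\<close> compact, and \<open>Z\<close> has submodules
  \<open>D\<close> of finite index inside \<open>U + X\<close>. Then \<open>D + Y\<close> has finite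
  index in \<open>C\<close>, so it is all of \<open>C\<close>; hence \<open>C\<close> lies in
  \<open>U + Y\<close> for every \<open>U\<close>.\<close>

lemma Wzero_hyper:
 assumes S: "gens S UNIV" and h: "hyper X Y" and W: "Wzero UNIV X G"
 shows "Wzero UNIV Y G"
 unfolding Wzero_def
proof (intro allI impI)
 fix C assume C: "parafin UNIV Y C \<and> C \<subseteq> G"
 then have c: "closed C" "sub UNIV C" "Y \<subseteq> C" "cocpt Y C" by (auto simp: parafin_def)
 note XY = hyperD[OF h]
 obtain Z where Z: "closed Z" "sub UNIV Z" "X \<subseteq> Z" "Z \<subseteq> C" "Z + Y = C" "cocpt X Z"
  using corigid_hyper[OF h c] by blast
 have WZ: "Wzero UNIV X Z" using W C Z(4) unfolding Wzero_def by blast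
 have "C \<subseteq> Y"
 proof
  fix x assume x: "x \<in> C"
  show "x \<in> Y"
  proof (rule mem_closed_if_near[OF XY(3)])
   fix U assume U: "nb (U::'k set)"
   obtain D where D: "sub UNIV D" "closed D" "X \<subseteq> D" "D \<subseteq> Z" "fmod D Z" "D \<subseteq> U + X"
    by (rule profinite_basis[OF S XY(1,2) Z(1,2,3,6) WZ U])
   have gg: "add_subgroup X" "add_subgroup D" "add_subgroup Y" "add_subgroup Z" using subD(1) XY(2,4) D(1) Z(2) by auto
   have "closed (D + Y)"
    by (rule closed_if_cocpt[OF cocpt_mono[OF Z(6) order_refl D(4)] XY(1) D(2) XY(3) D(3) XY(5) gg(1,2,3)])
   moreover have "sub UNIV (D + Y)" by (rule sub_plus[OF D(1) XY(4)])
   moreover have "Y \<subseteq> D + Y" by (rule set_plus_right[OF sg_zero[OF gg(2)]])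
   moreover have "D + Y \<subseteq> C" unfolding Z(5)[symmetric] by (rule set_plus_mono[OF D(4) order_refl])
   moreover have "fmod (D + Y) C"
   proof -
    obtain F where F: "finite F" "Z \<subseteq> F + D" using D(5) fmod_def by blast
    have "C \<subseteq> (F + D) + Y" unfolding Z(5)[symmetric] by (rule set_plus_mono[OF F(2) order_refl])
    then show ?thesis unfolding fmod_def using F(1) by (metis add.assoc)
   qed
   ultimately have "D + Y = C" using C unfolding parafin_def by blast
   then have "x \<in> D + Y" using x by simp
   moreover have "D + Y \<subseteq> (U + X) + Y" by (rule set_plus_mono[OF D(6) order_refl])
   moreover have "(U + X) + Y \<subseteq> U + Y" unfolding add.assoc
    by (rule set_plus_mono[OF order_refl sg_plus_subset[OF gg(3) XY(5) order_refl]])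
   ultimately show "x \<in> U + Y" by blast
  qed
 qed
 then show "C = Y" using c by blast
qed

end

section \<open>Orbits of a single element\<close>

text \<open>Integer multiples in a bare abelian group. They serve in the acting group, as powers of
  one operator, and in the module, for cyclic subgroups.\<close>

definition zm :: "int => 'g::ab_group_add => 'g" where
 "zm n x = (if 0 \<le> n then ((+) x ^^ nat n) 0 else - (((+) x ^^ nat (- n)) 0))"

lemma zm_0 [simp]: "zm 0 x = 0"
 by (simp add: zm_def)

lemma zm_1 [simp]: "zm 1 x = x"
 by (simp add: zm_def)

lemma zm_Suc: "zm (n + 1) x = x + zm n x"
proof -
 consider "0 \<le> n" | "n = -1" | "n < -1" by linarith
 then show ?thesis
 proof cases
  case 1
  then have "nat (n + 1) = Suc (nat n)" by simp
  then show ?thesis using 1 by (simp add: zm_def)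
 next
  case 2 then show ?thesis by (simp add: zm_def)
 next
  case 3
  then have "nat (- n) = Suc (nat (- (n + 1)))" by simp
  then show ?thesis using 3 by (simp add: zm_def)
 qed
qed

lemma zm_add: "zm (m + n) x = zm m x + zm n x"
proof (induction m rule: int_induct[where k = 0])
 case base then show ?case by simp
next
 case (step1 i)
 have "zm (i + 1 + n) x = zm ((i + n) + 1) x" by (simp add: ac_simps)
 also have "\<dots> = x + (zm i x + zm n x)" using step1 zm_Suc[of "i + n" x] by simp
 also have "\<dots> = zm (i + 1) x + zm n x" using zm_Suc[of i x] by (simp add: add.assoc)
 finally show ?case .
next
 case (step2 i)
 have "zm (i + n) x = x + zm (i - 1 + n) x" using zm_Suc[of "i - 1 + n" x] by (simp add: algebra_simps)
 moreover have "zm i x = x + zm (i - 1) x" using zm_Suc[of "i - 1" x] by simp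
 ultimately show ?case using step2 by (simp add: add.assoc)
qed

lemma zm_neg: "zm (- n) x = - zm n x"
 using zm_add[of n "- n" x] by (simp add: eq_neg_iff_add_eq_0 add.commute)

lemma zm_neg2: "zm n (- x) = zm (- n) x"
proof -
 have "zm n (- x) + zm n x = 0"
 proof (induction n rule: int_induct[where k = 0])
  case base then show ?case by simp
 next
  case (step1 i)
  have "zm (i + 1) (- x) + zm (i + 1) x = zm i (- x) + zm i x" unfolding zm_Suc by (simp add: algebra_simps)
  then show ?case using step1 by simp
 next
  case (step2 i)
  have "zm i (- x) = - x + zm (i - 1) (- x)" "zm i x = x + zm (i - 1) x"
   using zm_Suc[of "i - 1" "- x"] zm_Suc[of "i - 1" x] by simp_all
  then have "zm i (- x) + zm i x = zm (i - 1) (- x) + zm (i - 1) x" by simp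
  then show ?case using step2 by simp
 qed
 then show ?thesis by (simp add: zm_neg eq_neg_iff_add_eq_0)
qed

lemma finite_cocpt:
 assumes "finite F" "cocpt X K" shows "cocpt X (F + K)"
 by (rule cocpt_trans[OF assms(2) cocpt_compact_plus[OF finite_imp_compact[OF assms(1)]]])

context tgact
begin

text \<open>A null orbit in \<open>G\<close> eventually enters the open subgroup \<open>B\<close>,
  and stability under \<open>f\<close> brings this back to the start. The gain is that
  \<open>null f X G\<close> is stable under the whole acting group when \<open>X\<close> and
  \<open>G\<close> are, even if \<open>B\<close> is not.\<close>

lemma null_absorb:
 assumes f: "oper f" and B: "add_subgroup B" "!!x. x \<in> B ==> f x \<in> B" "X \<subseteq> B" "B \<subseteq> G" "omod B G" and G: "add_subgroup G"
 shows "null f X G = null f X B"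
proof
 show "null f X B \<subseteq> null f X G"
 proof
  fix y assume "y \<in> null f X B"
  then obtain s where s: "s 0 = y" "bseq f X B s" by (rule nullE)
  have "bseq f X G s" by (rule bseq_mono[OF s(2) order_refl]) (use bseqD(1)[OF s(2)] B(4) in blast)
  from nullI[OF this] show "y \<in> null f X G" using s by simp
 qed
 show "null f X G \<subseteq> null f X B"
 proof
  fix y assume "y \<in> null f X G"
  then obtain s where s: "s 0 = y" "bseq f X G s" by (rule nullE)
  obtain U where U: "nb U" "U \<inter> G \<subseteq> B" using B(5) omod_def by blast
  obtain m where m: "\<forall>n\<ge>m. s n \<in> U + X" using bseqD(3)[OF s(2) U(1)] by blast
  have big: "s n \<in> B" if "n \<ge> m" for n
  proof -
   have "s n \<in> U + X" using m that by blast
   then obtain u x where ux: "u \<in> U" "x \<in> X" "s n = u + x" by (rule set_plusE)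
   have "x \<in> G" using ux(2) B(3,4) by blast
   moreover have "u + x \<in> G" using bseqD(1)[OF s(2), of n] ux(3) by simp
   ultimately have "u \<in> G" using sg_cancel_right[OF G] by blast
   then have "u \<in> B" using ux(1) U(2) by blast
   then show ?thesis using ux B(3) sg_add[OF B(1)] by auto
  qed
  have "s (m - k) \<in> B" for k
  proof (induction k)
   case 0 then show ?case using big[of m] by simp
  next
   case (Suc k)
   show ?case
   proof (cases "m - k")
    case 0 then show ?thesis using Suc by simp
   next
    case (Suc j)
    then have j: "m - Suc k = j" by simp
    have "f (s (Suc j)) \<in> B" using B(2) Suc.IH Suc by metis
    moreover have "f (s (Suc j)) - s j \<in> B" using bseqD(2)[OF s(2)] B(3) by blast
    ultimately have "f (s (Suc j)) - (f (s (Suc j)) - s j) \<in> B" by (rule sg_diff[OF B(1)])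
    then show ?thesis using j by simp
   qed
  qed
  from this[of "m - n" for n] have "s n \<in> B" if "n \<le> m" for n using that by (metis diff_diff_cancel)
  then have "s n \<in> B" for n using big by (meson linear)
  then have "bseq f X B s" by (rule bseq_mono[OF s(2) order_refl])
  from nullI[OF this] show "y \<in> null f X B" using s by simp
 qed
qed

text \<open>The largest \<open>T\<close>-parafinite submodule over \<open>X\<close> is unique, and
  by commutativity its translate by any \<open>a\<close> is again \<open>T\<close>-parafinite; so it
  is stable under the whole group. There it remains parafinite, because submodules for more
  operators are fewer, and therefore it equals \<open>X\<close>.\<close>

lemma Wzero_restrict_ops:
 assumes S: "gens S T" and G: "lcg G" "sub UNIV G" and X: "closed X" "sub UNIV X" "X \<subseteq> G" and W: "Wzero UNIV X G"
 shows "Wzero T X G"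
proof -
 obtain Y where Y: "parafin T X Y" "Y \<subseteq> G" "!!Z. parafin T X Z ==> Z \<subseteq> G ==> Z \<subseteq> Y"
  using largest_parafin[OF S G(1) sub_mono[OF G(2) subset_UNIV] X(1) sub_mono[OF X(2) subset_UNIV] X(3)] by metis
 have y: "closed Y" "sub T Y" "X \<subseteq> Y" "cocpt X Y" using Y(1) by (auto simp: parafin_def)
 have gX: "add_subgroup X" and gY: "add_subgroup Y" using subD(1)[OF X(2)] subD(1)[OF y(2)] .
 have "act a x \<in> Y" if x: "x \<in> Y" for a x
 proof -
  define Z where "Z = {x. act (- a) x \<in> Y}"
  have "parafin T X Z" unfolding parafin_def
  proof (intro conjI allI impI)
   show "closed Z" using closed_vimage[OF y(1) act_cont1[of "- a"]] by (simp add: Z_def vimage_def)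
   show "sub T Z" unfolding sub_def add_subgroup_def
   proof (intro conjI ballI)
    show "0 \<in> Z" using sg_zero[OF gY] by (simp add: Z_def)
    fix x assume x: "x \<in> Z"
    then show "- x \<in> Z" using sg_neg[OF gY] by (simp add: Z_def act_neg)
    show "x + x' \<in> Z" if "x' \<in> Z" for x' using x that sg_add[OF gY] by (simp add: Z_def act_add)
    show "act b x \<in> Z" if "b \<in> T" for b using x subD(2)[OF y(2) that] by (simp add: Z_def act_comm[of "- a"])
   qed
   show "X \<subseteq> Z" using subD(2)[OF X(2)] y(3) by (auto simp: Z_def)
   obtain V where V: "compact V" "Y \<subseteq> V + X" using y(4) cocpt_def by blast
   have "Z \<subseteq> act a ` V + X"
   proof
    fix z assume "z \<in> Z"
    then have "act (- a) z \<in> V + X" using V(2) Z_def by blast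
    then obtain v w where vw: "v \<in> V" "w \<in> X" "act (- a) z = v + w" by (rule set_plusE)
    have "z = act a (act (- a) z)" by simp
    also have "\<dots> = act a v + act a w" unfolding vw(3) by (rule act_add)
    finally show "z \<in> act a ` V + X" using vw(1) subD(2)[OF X(2) UNIV_I vw(2)] by (metis imageI set_plus_intro)
   qed
   then show "cocpt X Z" unfolding cocpt_def using compact_act1[OF V(1)] by blast
   fix U assume U: "sub T U \<and> closed U \<and> X \<subseteq> U \<and> U \<subseteq> Z \<and> fmod U Z"
   then have gU: "add_subgroup U" "sub T U" using subD(1) by auto
   define U' where "U' = {x. act a x \<in> U}"
   have "U' = Y"
   proof -
    have "sub T U'" unfolding sub_def add_subgroup_def
    proof (intro conjI ballI)
     show "0 \<in> U'" using sg_zero[OF gU(1)] by (simp add: U'_def)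
     fix x assume x: "x \<in> U'"
     then show "- x \<in> U'" using sg_neg[OF gU(1)] by (simp add: U'_def act_neg)
     show "x + x' \<in> U'" if "x' \<in> U'" for x' using x that sg_add[OF gU(1)] by (simp add: U'_def act_add)
     show "act b x \<in> U'" if "b \<in> T" for b using x subD(2)[OF gU(2) that] by (simp add: U'_def act_comm[of a])
    qed
    moreover have "closed U'" using closed_vimage[OF _ act_cont1[of a], of U] U by (simp add: U'_def vimage_def)
    moreover have "X \<subseteq> U'" using subD(2)[OF X(2)] U by (auto simp: U'_def)
    moreover have "U' \<subseteq> Y"
    proof
     fix u assume "u \<in> U'"
     then have "act a u \<in> Z" using U by (auto simp: U'_def)
     then show "u \<in> Y" by (simp add: Z_def)
    qed
    moreover have "fmod U' Y"
    proof -
     obtain F where F: "finite F" "Z \<subseteq> F + U" using U fmod_def by blast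
     have "Y \<subseteq> act (- a) ` F + U'"
     proof
      fix w assume "w \<in> Y"
      then have "act a w \<in> Z" by (simp add: Z_def)
      then obtain p u where pu: "p \<in> F" "u \<in> U" "act a w = p + u" using F(2) by (meson set_plusE subsetD)
      have "w = act (- a) (act a w)" by simp
      also have "\<dots> = act (- a) p + act (- a) u" unfolding pu(3) by (rule act_add)
      finally show "w \<in> act (- a) ` F + U'" using pu by (intro set_plusI[of "act (- a) p" _ "act (- a) u"]) (auto simp: U'_def)
     qed
     then show ?thesis unfolding fmod_def using F(1) by blast
    qed
    ultimately show ?thesis using Y(1) unfolding parafin_def by blast
   qed
   show "U = Z"
   proof
    show "Z \<subseteq> U"
    proof
     fix z assume "z \<in> Z"
     then have "act (- a) z \<in> U'" using \<open>U' = Y\<close> by (simp add: Z_def)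
     then show "z \<in> U" by (simp add: U'_def)
    qed
   qed (use U in blast)
  qed (use X sub_mono[OF X(2) subset_UNIV] in auto)
  moreover have "Z \<subseteq> G"
  proof
   fix z assume "z \<in> Z"
   then have "act (- a) z \<in> G" using Y(2) Z_def by blast
   then have "act a (act (- a) z) \<in> G" by (rule subD(2)[OF G(2) UNIV_I])
   then show "z \<in> G" by simp
  qed
  ultimately have "Z \<subseteq> Y" by (rule Y(3))
  moreover have "act a x \<in> Z" using x by (simp add: Z_def)
  ultimately show ?thesis by blast
 qed
 then have sY: "sub UNIV Y" using gY by (simp add: sub_def)
 have "parafin UNIV X Y" unfolding parafin_def
 proof (intro conjI allI impI)
  fix U assume U: "sub UNIV U \<and> closed U \<and> X \<subseteq> U \<and> U \<subseteq> Y \<and> fmod U Y"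
  then have "sub T U" using sub_mono by blast
  then show "U = Y" using U Y(1) unfolding parafin_def by blast
 qed (use X y sY in auto)
 then have "Y = X" using W Y(2) unfolding Wzero_def by blast
 show ?thesis unfolding Wzero_def
 proof (intro allI impI)
  fix Z assume Z: "parafin T X Z \<and> Z \<subseteq> G"
  then have "Z \<subseteq> X" using Y(3) \<open>Y = X\<close> by blast
  moreover have "X \<subseteq> Z" using Z unfolding parafin_def by blast
  ultimately show "Z = X" by blast
 qed
qed

lemma Wzero_mono: "Wzero T X G ==> G' \<subseteq> G ==> Wzero T X G'"
 unfolding Wzero_def by (meson order_trans)

lemma act_zm_add: "act (zm (m + n) t) x = act (zm m t) (act (zm n t) x)"
 by (simp add: zm_add act_act)

lemma act_funpow_zm: "(act t ^^ n) x = act (zm (int n) t) x" "(act (- t) ^^ n) x = act (zm (- int n) t) x"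
proof -
 have 1: "(act t ^^ n) x = act (zm (int n) t) x" for t
 proof (induction n)
  case (Suc n)
  have "int (Suc n) = 1 + int n" by simp
  then have "act (zm (int (Suc n)) t) x = act (zm 1 t) (act (zm (int n) t) x)" using act_zm_add[of 1 "int n" t x] by metis
  then show ?case using Suc by simp
 qed simp
 show "(act t ^^ n) x = act (zm (int n) t) x" by (rule 1)
 show "(act (- t) ^^ n) x = act (zm (- int n) t) x" using 1[of "- t"] by (simp add: zm_neg2)
qed

lemma sub_zm:
 assumes "sub T Y" "t \<in> T" "- t \<in> T" "x \<in> Y" shows "act (zm n t) x \<in> Y"
proof -
 have "(act t ^^ m) x \<in> Y" "(act (- t) ^^ m) x \<in> Y" for m
  using funpow_mem[of Y "act t" x m] funpow_mem[of Y "act (- t)" x m] subD(2)[OF assms(1)] assms by blast+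
 then have "act (zm (int m) t) x \<in> Y" "act (zm (- int m) t) x \<in> Y" for m using act_funpow_zm[of m t x] by metis+
 then show ?thesis by (cases n rule: int_cases2) auto
qed

text \<open>As in Willis's theory of tidy subgroups, \<open>pos t K\<close> is the intersection of
  the translates of \<open>K\<close> by nonnegative powers of \<open>t\<close>,
  \<open>evt t K\<close> is the union of the forward translates of \<open>pos t K\<close>, and
  \<open>hom t K\<close> consists of the homoclinic points, whose orbit is eventually in
  \<open>K\<close> in both directions.\<close>

definition pos :: "'a => 'k set => 'k set" where
 "pos t K = {x. \<forall>n\<ge>0. act (zm (- n) t) x \<in> K}"

definition evt :: "'a => 'k set => 'k set" where
 "evt t K = {x. \<exists>m. \<forall>n\<ge>m. act (zm (- n) t) x \<in> K}"

definition hom :: "'a => 'k set => 'k set" where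
 "hom t K = evt t K \<inter> evt (- t) K"

lemma pos_evt: "pos t K \<subseteq> evt t K"
 by (auto simp: pos_def evt_def)

lemma pos_subset: "pos t K \<subseteq> K"
proof
 fix x assume "x \<in> pos t K"
 then have "act (zm (- 0) t) x \<in> K" unfolding pos_def by blast
 then show "x \<in> K" by simp
qed

lemma sub_pos: assumes "sub T K" shows "sub T (pos t K)"
 unfolding sub_def add_subgroup_def pos_def
 using subD(1)[OF assms] subD(2)[OF assms]
 by (auto simp: act_add act_neg sg_zero sg_add sg_neg act_comm[of "zm _ t"])

lemma closed_pos: assumes "closed K" shows "closed (pos t K)"
proof -
 have "pos t K = (\<Inter>n\<in>{0..}. act (zm (- n) t) -` K)" by (auto simp: pos_def)
 moreover have "closed (act (zm (- n) t) -` K)" for n by (rule closed_vimage[OF assms act_cont1])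
 ultimately show ?thesis by auto
qed

lemma pos_shift: assumes "x \<in> pos t K" "0 \<le> n" shows "act (zm (- n) t) x \<in> pos t K"
 unfolding pos_def
proof (clarify)
 fix m :: int assume "0 \<le> m"
 then have "act (zm (- (m + n)) t) x \<in> K" using assms unfolding pos_def by (metis (mono_tags, lifting) add_nonneg_nonneg mem_Collect_eq)
 moreover have "- (m + n) = (- m) + (- n)" by simp
 ultimately show "act (zm (- m) t) (act (zm (- n) t) x) \<in> K" by (metis act_zm_add)
qed

lemma evt_pos: assumes "x \<in> evt t K" shows "\<exists>m\<ge>0. \<forall>n\<ge>m. act (zm (- n) t) x \<in> pos t K"
proof -
 obtain m where m: "\<forall>n\<ge>m. act (zm (- n) t) x \<in> K" using assms unfolding evt_def by blast
 have "act (zm (- n) t) x \<in> pos t K" if n: "n \<ge> max 0 m" for n unfolding pos_def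
 proof (clarify)
  fix k :: int assume "0 \<le> k"
  then have "act (zm (- (k + n)) t) x \<in> K" using spec[OF m, of "k + n"] n by auto
  moreover have "- (k + n) = (- k) + (- n)" by simp
  ultimately show "act (zm (- k) t) (act (zm (- n) t) x) \<in> K" by (metis act_zm_add)
 qed
 then show ?thesis by (meson max.cobounded1)
qed

lemma evt_shift: assumes "x \<in> evt t K" shows "act (zm n t) x \<in> evt t K"
proof -
 obtain m where m: "\<forall>n\<ge>m. act (zm (- n) t) x \<in> K" using assms unfolding evt_def by blast
 have "act (zm (- k) t) (act (zm n t) x) \<in> K" if "k \<ge> m + n" for k
 proof -
  have "act (zm (- (k - n)) t) x \<in> K" using spec[OF m, of "k - n"] that by simp
  moreover have "- (k - n) = (- k) + n" by simp
  ultimately show ?thesis by (metis act_zm_add)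
 qed
 then show ?thesis unfolding evt_def by blast
qed

lemma evt_mono: "K \<subseteq> K' ==> evt t K \<subseteq> evt t K'"
 unfolding evt_def by blast

lemma sub_evt: assumes "sub T K" shows "sub (T \<union> {t, - t}) (evt t K)"
 unfolding sub_def add_subgroup_def
proof (intro conjI ballI)
 have g: "add_subgroup K" by (rule subD(1)[OF assms])
 show "0 \<in> evt t K" using sg_zero[OF g] by (simp add: evt_def)
 fix x assume x: "x \<in> evt t K"
 then obtain m where m: "\<forall>n\<ge>m. act (zm (- n) t) x \<in> K" unfolding evt_def by blast
 then show "- x \<in> evt t K" using sg_neg[OF g] unfolding evt_def by (auto simp: act_neg)
 show "x + y \<in> evt t K" if "y \<in> evt t K" for y
 proof -
  obtain m' where m': "\<forall>n\<ge>m'. act (zm (- n) t) y \<in> K" using \<open>y \<in> evt t K\<close> unfolding evt_def by blast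
  have "\<forall>n\<ge>max m m'. act (zm (- n) t) (x + y) \<in> K" using m m' sg_add[OF g] by (auto simp: act_add)
  then show ?thesis unfolding evt_def by blast
 qed
 fix a assume "a \<in> T \<union> {t, - t}"
 then consider "a \<in> T" | "a = t" | "a = - t" by blast
 then show "act a x \<in> evt t K"
 proof cases
  case 1
  have "act (zm (- n) t) (act a x) = act a (act (zm (- n) t) x)" for n by (rule act_comm)
  then have "\<forall>n\<ge>m. act (zm (- n) t) (act a x) \<in> K" using m subD(2)[OF assms 1] by simp
  then show ?thesis unfolding evt_def by blast
 next
  case 2 then show ?thesis using evt_shift[OF x, of 1] by simp
 next
  case 3 then show ?thesis using evt_shift[OF x, of "-1"] zm_neg[of 1 t] by simp
 qed
qed

lemma hom_contains:
 assumes "X \<subseteq> K" "sub UNIV X" shows "X \<subseteq> hom t K" "X \<subseteq> pos t K" "X \<subseteq> evt t K"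
 using subD(2)[OF assms(2) UNIV_I] assms(1) by (auto simp: hom_def evt_def pos_def)

text \<open>The homoclinic points that \<open>P (- 1)\<close> sends into \<open>pos t K\<close> form
  \<open>Z\<close>, which is finite modulo \<open>pos t K\<close>, with representatives
  \<open>Phi0\<close>. Peeling off one representative per step writes a homoclinic point as a finite
  sum of terms \<open>P j \<phi>\<close> plus an element of \<open>pos t K\<close>. The
  representatives are homoclinic themselves, so \<open>P j \<phi>\<close> lies in \<open>K\<close>
  once \<open>j \<ge> n0\<close>, and only the finitely many partial sums below \<open>n0\<close>
  remain.\<close>

lemma hom_bounded:
 assumes K: "sub T K" "X \<subseteq> K" "K \<subseteq> G" "omod K G" "cocpt X K" "closed K" and X: "closed X" "sub UNIV X" and G: "sub UNIV G"
 obtains F where "finite F" "hom t K \<subseteq> F + K"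
proof -
 define P where "P n = act (zm n t)" for n
 have Padd: "P (m + n) x = P m (P n x)" for m n x unfolding P_def by (rule act_zm_add)
 have P0: "P 0 x = x" for x unfolding P_def by simp
 have Pplus: "P n (x + y) = P n x + P n y" "P n (x - y) = P n x - P n y" for n x y unfolding P_def by (simp_all add: act_add act_diff)
 have gK: "add_subgroup K" "add_subgroup G" "add_subgroup X" using subD(1) K(1) G X(2) by auto
 have PX: "P n x \<in> X" if "x \<in> X" for n x unfolding P_def using subD(2)[OF X(2) UNIV_I that] .
 have PG: "P n x \<in> G" if "x \<in> G" for n x unfolding P_def using subD(2)[OF G UNIV_I that] .
 have pK: "pos t K = {x. \<forall>n\<ge>0. P (- n) x \<in> K}" unfolding pos_def P_def ..
 have C: "hom t K = {x. \<exists>m. \<forall>n\<ge>m. P n x \<in> K \<and> P (- n) x \<in> K}"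
 proof -
  have "x \<in> hom t K \<longleftrightarrow> (\<exists>m. \<forall>n\<ge>m. P n x \<in> K \<and> P (- n) x \<in> K)" for x
  proof
   assume "x \<in> hom t K"
   then obtain m m' where m: "\<forall>n\<ge>m. P (- n) x \<in> K" "\<forall>n\<ge>m'. P n x \<in> K"
    unfolding hom_def evt_def P_def by (auto simp: zm_neg2)
   then show "\<exists>m. \<forall>n\<ge>m. P n x \<in> K \<and> P (- n) x \<in> K" by (intro exI[of _ "max m m'"]) auto
  next
   assume "\<exists>m. \<forall>n\<ge>m. P n x \<in> K \<and> P (- n) x \<in> K"
   then show "x \<in> hom t K" unfolding hom_def evt_def P_def by (auto simp: zm_neg2)
  qed
  then show ?thesis by blast
 qed
 have gC: "add_subgroup (hom t K)" unfolding hom_def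
  by (rule sg_Int[OF subD(1)[OF sub_evt[OF K(1)]] subD(1)[OF sub_evt[OF K(1)]]])
 have PC: "P n x \<in> hom t K" if "x \<in> hom t K" for n x
  using that evt_shift[of x t K n] evt_shift[of x "- t" K "- n"] unfolding hom_def P_def by (simp add: zm_neg2)
 define tK where "tK = {x. P (- 1) x \<in> K}"
 define Z where "Z = hom t K \<inter> {x. P (- 1) x \<in> pos t K}"
 have gtK: "add_subgroup tK" unfolding tK_def add_subgroup_def P_def
  using gK(1) by (auto simp: sg_zero sg_add sg_neg act_add act_neg)
 have gpos: "add_subgroup (pos t K)" by (rule subD(1)[OF sub_pos[OF K(1)]])
 have gZ: "add_subgroup Z" unfolding Z_def
  by (rule sg_Int[OF gC]) (use gpos in \<open>auto simp: add_subgroup_def P_def act_add act_neg\<close>)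
 have "fmod K tK"
 proof -
  obtain V where V: "compact V" "V \<subseteq> K" "K = V + X"
   using cocpt_inside[OF K(5,6,2) gK(3,1)] by metis
  define V' where "V' = P 1 ` V"
  have "compact V'" unfolding V'_def P_def by (rule compact_act1[OF V(1)])
  moreover have "V' \<subseteq> G" unfolding V'_def using V(2) K(3) PG by blast
  ultimately obtain F where F: "finite F" "V' \<subseteq> F + K" using compact_finite_mod[OF _ _ gK(2) K(4)] by metis
  have "tK \<subseteq> F + K"
  proof
   fix x assume "x \<in> tK"
   then have "P (- 1) x \<in> V + X" using V(3) tK_def by blast
   then obtain v w where vw: "v \<in> V" "w \<in> X" "P (- 1) x = v + w" by (rule set_plusE)
   have "x = P 1 (P (- 1) x)" using Padd[of 1 "- 1" x] P0 by simp
   also have "\<dots> = P 1 v + P 1 w" unfolding vw(3) by (rule Pplus)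
   finally have x: "x = P 1 v + P 1 w" .
   have "P 1 v \<in> F + K" using F(2) vw(1) V'_def by blast
   then obtain p k where "p \<in> F" "k \<in> K" "P 1 v = p + k" by (rule set_plusE)
   moreover have "k + P 1 w \<in> K" using \<open>k \<in> K\<close> PX[OF vw(2)] K(2) by (intro sg_add[OF gK(1)]) auto
   ultimately show "x \<in> F + K" using x by (metis add.assoc set_plus_intro)
  qed
  then show ?thesis unfolding fmod_def using F(1) by blast
 qed
 moreover have "Z \<subseteq> tK" unfolding Z_def tK_def using pos_subset by blast
 ultimately have "fmod (K \<inter> Z) Z" using fmod_restrict[OF _ gK(1) gZ] by blast
 then obtain Phi0 where Phi0: "finite Phi0" "Phi0 \<subseteq> Z" "0 \<in> Phi0" "Z = Phi0 + (K \<inter> Z)"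
  by (rule fmod_inside[OF _ _ sg_Int[OF gK(1) gZ] gZ]) auto
 have KZ: "K \<inter> Z \<subseteq> pos t K"
 proof
  fix x assume x: "x \<in> K \<inter> Z"
  show "x \<in> pos t K" unfolding pK
  proof clarify
   fix n :: int assume n: "0 \<le> n"
   show "P (- n) x \<in> K"
   proof (cases "n = 0")
    case True then show ?thesis using x P0 by simp
   next
    case False
    have "P (- 1) x \<in> pos t K" using x Z_def by blast
    then have "\<forall>k\<ge>0. P (- k) (P (- 1) x) \<in> K" unfolding pK by simp
    from spec[OF this, of "n - 1"] have "P (- (n - 1)) (P (- 1) x) \<in> K" using n False by simp
    then show ?thesis using Padd[of "- (n - 1)" "- 1" x] by simp
   qed
  qed
 qed
 have "\<exists>m. \<forall>n\<ge>m. P n \<phi> \<in> K" if "\<phi> \<in> Phi0" for \<phi>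
  using that Phi0(2) unfolding Z_def C by blast
 then obtain r where r: "!!\<phi> n. \<phi> \<in> Phi0 ==> n \<ge> r \<phi> ==> P n \<phi> \<in> K" by metis
 define n0 where "n0 = nat (Max (r ` Phi0))"
 have n0: "P (int n) \<phi> \<in> K" if "\<phi> \<in> Phi0" "n \<ge> n0" for n \<phi>
 proof (rule r[OF that(1)])
  have "r \<phi> \<le> Max (r ` Phi0)" using that(1) Phi0(1) by simp
  also have "\<dots> \<le> int n0" unfolding n0_def by simp
  finally show "r \<phi> \<le> int n" using that(2) by simp
 qed
 define PS where "PS = rec_nat {0::'k} (\<lambda>j A. A + P (int j) ` Phi0)"
 have PS0: "PS 0 = {0}" and PSS: "!!j. PS (Suc j) = PS j + P (int j) ` Phi0" unfolding PS_def by simp_all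
 have finPS: "finite (PS j)" for j by (induction j) (simp_all add: PS0 PSS finite_set_plus Phi0(1))
 have PSmono: "PS j \<subseteq> PS (Suc j)" for j
 proof -
  have "0 \<in> P (int j) ` Phi0" using Phi0(3) unfolding P_def by (metis act_zero imageI)
  then show ?thesis unfolding PSS by (rule set_plus_left)
 qed
 have PSn0: "PS j \<subseteq> PS n0 + K" for j
 proof (cases "j \<le> n0")
  case True
  have "PS j \<subseteq> PS n0" using lift_Suc_mono_le[of PS, OF PSmono True] .
  then show ?thesis using set_plus_left[OF sg_zero[OF gK(1)], of "PS n0"] by blast
 next
  case False
  have "PS (n0 + i) \<subseteq> PS n0 + K" for i
  proof (induction i)
   case 0 then show ?case using set_plus_left[OF sg_zero[OF gK(1)], of "PS n0"] by simp
  next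
   case (Suc i)
   have "P (int (n0 + i)) ` Phi0 \<subseteq> K" using n0[of _ "n0 + i"] by auto
   then have "PS (n0 + Suc i) \<subseteq> (PS n0 + K) + K" using Suc PSS[of "n0 + i"] set_plus_mono by (metis add_Suc_right)
   then show ?case using sg_plus_self[OF gK(1)] by (simp add: add.assoc)
  qed
  from this[of "j - n0"] show ?thesis using False by simp
 qed
 have main: "x \<in> PS n + pos t K" if "x \<in> hom t K" "P (- int n) x \<in> pos t K" for n x
  using that
 proof (induction n arbitrary: x)
  case 0
  then show ?case using PS0 P0 by (auto intro!: set_plusI[of 0 _ x])
 next
  case (Suc n)
  define y where "y = P (- int n) x"
  have "P (- 1) y = P (- int (Suc n)) x" unfolding y_def Padd[symmetric] by simp
  then have "y \<in> Z" unfolding Z_def using Suc.prems PC y_def by auto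
  then have "y \<in> Phi0 + (K \<inter> Z)" by (subst Phi0(4)[symmetric])
  then obtain \<phi> k where pk: "\<phi> \<in> Phi0" "k \<in> K \<inter> Z" "y = \<phi> + k" by (rule set_plusE)
  define x' where "x' = x - P (int n) \<phi>"
  have "\<phi> \<in> hom t K" using pk(1) Phi0(2) Z_def by blast
  then have "x' \<in> hom t K" unfolding x'_def by (intro sg_diff[OF gC Suc.prems(1) PC])
  moreover have "P (- int n) x' = k"
   unfolding x'_def Pplus using pk(3) y_def Padd[of "- int n" "int n" \<phi>] P0 by simp
  then have "P (- int n) x' \<in> pos t K" using pk(2) KZ by blast
  ultimately have "x' \<in> PS n + pos t K" by (rule Suc.IH)
  then obtain a b where ab: "a \<in> PS n" "b \<in> pos t K" "x' = a + b" by (rule set_plusE)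
  have "x = (a + P (int n) \<phi>) + b" using ab(3) unfolding x'_def by (simp add: algebra_simps)
  moreover have "a + P (int n) \<phi> \<in> PS (Suc n)" unfolding PSS using ab(1) pk(1) by (intro set_plus_intro) auto
  ultimately show ?case using ab(2) by (metis set_plus_intro)
 qed
 have "hom t K \<subseteq> PS n0 + K"
 proof
  fix x assume x: "x \<in> hom t K"
  then obtain m where m: "m \<ge> 0" "\<forall>n\<ge>m. act (zm (- n) t) x \<in> pos t K" using evt_pos unfolding hom_def by blast
  then have "P (- int (nat m)) x \<in> pos t K" unfolding P_def by simp
  then have "x \<in> PS (nat m) + pos t K" by (rule main[OF x])
  also have "\<dots> \<subseteq> (PS n0 + K) + K" by (rule set_plus_mono[OF PSn0 pos_subset])
  also have "\<dots> = PS n0 + K" using sg_plus_self[OF gK(1)] by (simp add: add.assoc)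
  finally show "x \<in> PS n0 + K" .
 qed
 then show ?thesis using that finPS by blast
qed

end

text \<open>Inside a subgroup that contains \<open>X\<close>, being close to \<open>X\<close>
  reduces to being close to zero, as the \<open>X\<close>-part can be subtracted.\<close>

lemma set_plus_subset_near:
 assumes "add_subgroup D" "X \<subseteq> D" "U \<inter> D \<subseteq> E" "X \<subseteq> E" "add_subgroup E"
 shows "(U + X) \<inter> D \<subseteq> E"
proof
 fix z assume z: "z \<in> (U + X) \<inter> D"
 then obtain u x where ux: "u \<in> U" "x \<in> X" "z = u + x" by (auto elim: set_plusE)
 then have "u \<in> D" using z sg_cancel_right[OF assms(1), of x u] assms(2) by blast
 then have "u \<in> E" "x \<in> E" using ux assms(3,4) by auto
 then show "z \<in> E" unfolding ux(3) by (rule sg_add[OF assms(5)])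
qed

context tgact
begin

text \<open>The closure of the homoclinic points is compact over \<open>X\<close>, so it has a
  closed \<open>t\<close>-stable submodule \<open>D1\<close> of finite index inside
  \<open>K\<close>. \<open>K3\<close> is chosen so small that it meets the closure only in
  \<open>D1\<close>. A homoclinic point of \<open>K3 + D1\<close> then has an orbit point in
  \<open>D1\<close>, and \<open>t\<close>-stability of \<open>D1\<close> brings the point itself
  there. Thus the homoclinic part is confined to a closed invariant subgroup.\<close>

lemma nice_subgroup:
 assumes T: "finite T" and G: "lcg G" "sub UNIV G" and X: "closed X" "sub UNIV X" "X \<subseteq> G" and W: "Wzero UNIV X G"
  and K: "sub T K" "X \<subseteq> K" "K \<subseteq> G" "omod K G" "cocpt X K"
 obtains L D where "sub T L" "X \<subseteq> D" "D \<subseteq> L" "L \<subseteq> K" "omod L G" "closed D" "sub (T \<union> {t, - t}) D" "hom t L \<subseteq> D"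
proof -
 define T' where "T' = T \<union> {t, - t}"
 have gT: "gens T T" "gens T' T'" using T by (auto simp: T'_def intro!: gens_finite)
 have gG: "closed G" "add_subgroup G" using G(1) lcg_def by auto
 have gK: "add_subgroup K" by (rule subD(1)[OF K(1)])
 have gX: "add_subgroup X" by (rule subD(1)[OF X(2)])
 have sX: "sub T X" "sub T' X" using sub_mono[OF X(2) subset_UNIV] by auto
 have clK: "closed K" by (rule omod_closed[OF K(4) gG(1) gK gG(2) K(3)])
 obtain F where F: "finite F" "hom t K \<subseteq> F + K" by (rule hom_bounded[OF K clK X(1,2) G(2)])
 define D where "D = closure (hom t K)"
 have sC: "sub T' (hom t K)"
 proof -
  have "T \<union> {- t, - (- t)} = T'" by (auto simp: T'_def)
  then show ?thesis unfolding hom_def using sub_Int[of T' "evt t K" "evt (- t) K"] sub_evt[OF K(1), of t] sub_evt[OF K(1), of "- t"] T'_def by simp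
 qed
 have sD: "sub T' D" unfolding D_def by (rule sub_closure[OF sC])
 have gD: "add_subgroup D" by (rule subD(1)[OF sD])
 have CD: "hom t K \<subseteq> D" unfolding D_def by (rule closure_subset)
 have clD: "closed D" unfolding D_def by simp
 have XC: "X \<subseteq> hom t K" by (rule hom_contains(1)[OF K(2) X(2)])
 have XD: "X \<subseteq> D" using XC CD by blast
 have DF: "D \<subseteq> F + K" unfolding D_def
  by (rule closure_minimal[OF F(2) closed_compact_plus[OF finite_imp_compact[OF F(1)] clK]])
 have cD: "cocpt X D" by (rule cocpt_mono[OF finite_cocpt[OF F(1) K(5)] order_refl DF])
 have CG: "hom t K \<subseteq> G"
 proof
  fix x assume "x \<in> hom t K"
  then obtain m where "\<forall>n\<ge>m. act (zm (- n) t) x \<in> K" unfolding hom_def evt_def by blast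
  then have "act (zm (- m) t) x \<in> G" using K(3) by blast
  then have "act (zm m t) (act (zm (- m) t) x) \<in> G" by (rule subD(2)[OF G(2) UNIV_I])
  then show "x \<in> G" using act_zm_add[of m "- m" t x] by simp
 qed
 have DG: "D \<subseteq> G" unfolding D_def by (rule closure_minimal[OF CG gG(1)])
 obtain U where U: "nb U" "U \<inter> G \<subseteq> K" using K(4) omod_def by blast
 have WT: "Wzero T X K" "Wzero T' X D"
  using Wzero_mono[OF Wzero_restrict_ops[OF gT(1) G X W] K(3)] Wzero_mono[OF Wzero_restrict_ops[OF gT(2) G X W] DG] .
 obtain D1 where D1: "sub T' D1" "closed D1" "X \<subseteq> D1" "D1 \<subseteq> D" "fmod D1 D" "D1 \<subseteq> U + X"
  by (rule profinite_basis[OF gT(2) X(1) sX(2) clD sD XD cD WT(2) U(1)])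
 have gD1: "add_subgroup D1" by (rule subD(1)[OF D1(1)])
 have D1K: "D1 \<subseteq> K" using set_plus_subset_near[OF gG(2) X(3) U(2) K(2) gK] D1(4,6) DG by blast
 have "omod D1 D" by (rule fmod_omod[OF D1(5,2,4) gD1 gD])
 then obtain U1 where U1: "nb U1" "U1 \<inter> D \<subseteq> D1" unfolding omod_def by blast
 obtain K3 where K3: "sub T K3" "closed K3" "X \<subseteq> K3" "K3 \<subseteq> K" "fmod K3 K" "K3 \<subseteq> U1 + X"
  by (rule profinite_basis[OF gT(1) X(1) sX(1) clK K(1,2,5) WT(1) U1(1)])
 have gK3: "add_subgroup K3" by (rule subD(1)[OF K3(1)])
 have K3D: "K3 \<inter> D \<subseteq> D1" using set_plus_subset_near[OF gD XD U1(2) D1(3) gD1] K3(6) by blast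
 have oK3: "omod K3 G" by (rule omod_trans[OF fmod_omod[OF K3(5,2,4) gK3 gK] K(4)])
 define L where "L = K3 + D1"
 have sL: "sub T L" unfolding L_def by (rule sub_plus[OF K3(1) sub_mono[OF D1(1)]]) (auto simp: T'_def)
 have K3L: "K3 \<subseteq> L" unfolding L_def by (rule set_plus_left[OF sg_zero[OF gD1]])
 have D1L: "D1 \<subseteq> L" unfolding L_def by (rule set_plus_right[OF sg_zero[OF gK3]])
 have LK: "L \<subseteq> K" unfolding L_def by (rule sg_plus_subset[OF gK K3(4) D1K])
 have LD: "x \<in> D1" if x: "x \<in> L" "x \<in> D" for x
 proof -
  obtain k d where kd: "k \<in> K3" "d \<in> D1" "x = k + d" using x(1) unfolding L_def by (rule set_plusE)
  have "k \<in> D" using x(2) kd D1(4) sg_cancel_right[OF gD, of d k] by blast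
  then have "k \<in> D1" using kd(1) K3D by blast
  then show ?thesis unfolding kd(3) by (rule sg_add[OF gD1 _ kd(2)])
 qed
 have "hom t L \<subseteq> D1"
 proof
  fix y assume y: "y \<in> hom t L"
  have "hom t L \<subseteq> hom t K" unfolding hom_def using evt_mono[OF LK, of t] evt_mono[OF LK, of "- t"] by blast
  then have yD: "y \<in> D" using y CD by blast
  obtain m where m: "\<forall>n\<ge>m. act (zm (- n) t) y \<in> L" using y unfolding hom_def evt_def by blast
  have tT: "t \<in> T'" "- t \<in> T'" by (auto simp: T'_def)
  have "act (zm (- m) t) y \<in> L" using m by blast
  moreover have "act (zm (- m) t) y \<in> D" by (rule sub_zm[OF sD tT yD])
  ultimately have "act (zm (- m) t) y \<in> D1" by (rule LD)
  then have "act (zm m t) (act (zm (- m) t) y) \<in> D1" by (rule sub_zm[OF D1(1) tT])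
  then show "y \<in> D1" using act_zm_add[of m "- m" t y] by simp
 qed
 then show ?thesis using that[of L D1] sL D1(1,2,3) D1L LK omod_mono[OF oK3 K3L order_refl] T'_def by blast
qed

text \<open>The first half of Willis's tidying procedure, modulo \<open>X\<close>. The subgroups
  \<open>J 0 n + M\<close> decrease and contain \<open>M\<close>, which has finite index in
  \<open>K\<close>, so they are constant from \<open>N\<close> on. Hence a point of
  \<open>J 0 b\<close>, with \<open>b = N\<close>, can be changed by an element of
  \<open>pos t K\<close> so that its window of membership in \<open>K\<close> reaches one step
  further to the left. Iterating and passing to the limit makes the window infinite on the left; a
  shift by \<open>b\<close> then lands in \<open>pos (- t) K\<close>.\<close>

lemma tidy:
 assumes K: "sub T K" "X \<subseteq> K" "K \<subseteq> G" "omod K G" "cocpt X K" "closed K" and X: "closed X" "sub UNIV X" and G: "sub UNIV G"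
 obtains U where "nb U" "U \<inter> G \<subseteq> pos t K + pos (- t) K"
proof -
 define P where "P n = act (zm n t)" for n
 have Padd: "P (m + n) x = P m (P n x)" for m n x unfolding P_def by (rule act_zm_add)
 have P0: "P 0 x = x" for x unfolding P_def by simp
 have Pplus: "P n (x + y) = P n x + P n y" "P n (x - y) = P n x - P n y" for n x y unfolding P_def by (simp_all add: act_add act_diff)
 have Pcont: "continuous_on UNIV (P n)" for n unfolding P_def by (rule act_cont1)
 have gK: "add_subgroup K" "add_subgroup G" "add_subgroup X" using subD(1) K(1) G X(2) by auto
 have PX: "P n x \<in> X" if "x \<in> X" for n x unfolding P_def using subD(2)[OF X(2) UNIV_I that] .
 have PG: "P n x \<in> G" if "x \<in> G" for n x unfolding P_def using subD(2)[OF G UNIV_I that] .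
 define J where "J a b = {x. \<forall>n. a \<le> n \<and> n \<le> b --> P (- n) x \<in> K}" for a b
 have JD: "P (- n) x \<in> K" if "x \<in> J a b" "a \<le> n" "n \<le> b" for a b n x using that unfolding J_def by blast
 have gJ: "add_subgroup (J a b)" for a b unfolding J_def add_subgroup_def P_def
  using gK(1) by (auto simp: sg_zero sg_add sg_neg act_add act_neg)
 have clJ: "closed (J a b)" for a b
 proof -
  have "J a b = (\<Inter>n\<in>{a..b}. P (- n) -` K)" by (auto simp: J_def)
  moreover have "closed (P (- n) -` K)" for n by (rule closed_vimage[OF K(6) Pcont])
  ultimately show ?thesis by auto
 qed
 have XJ: "X \<subseteq> J a b" for a b unfolding J_def using PX K(2) by auto
 have pos_eq: "pos t K = {x. \<forall>n\<ge>0. P (- n) x \<in> K}" "pos (- t) K = {x. \<forall>n\<ge>0. P n x \<in> K}"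
  unfolding pos_def P_def by (simp_all add: zm_neg2)
 have Xpos: "X \<subseteq> pos t K" unfolding pos_eq using PX K(2) by auto
 have gpos: "add_subgroup (pos t K)" by (rule subD(1)[OF sub_pos[OF K(1)]])
 have clpos: "closed (pos t K)" by (rule closed_pos[OF K(6)])
 have JK: "J 0 b \<subseteq> K" if "0 \<le> b" for b
 proof
  fix x assume "x \<in> J 0 b"
  then have "P (- 0) x \<in> K" using that by (intro JD) auto
  then show "x \<in> K" using P0 by simp
 qed
 define M where "M = J (- 1) 0"
 have oJ: "omod (J a b) G" for a b
 proof -
  obtain U where U: "nb U" "U \<inter> G \<subseteq> K" using K(4) omod_def by blast
  define V where "V = (\<Inter>n\<in>{a..b}. P (- n) -` U)"
  have "open V" unfolding V_def using U(1) open_vimage[OF _ Pcont] by (intro open_INT) auto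
  moreover have "0 \<in> V" unfolding V_def P_def using U(1) by auto
  moreover have "V \<inter> G \<subseteq> J a b" unfolding V_def J_def using U(2) PG by auto
  ultimately show ?thesis unfolding omod_def by blast
 qed
 have MK: "M \<subseteq> K"
 proof
  fix x assume "x \<in> M"
  then have "P (- 0) x \<in> K" unfolding M_def by (intro JD) auto
  then show "x \<in> K" using P0 by simp
 qed
 have gM: "add_subgroup M" unfolding M_def by (rule gJ)
 have "fmod M K" by (rule cocpt_omod_fmod[OF K(5,6) XJ[of "- 1" 0, folded M_def] MK gK(3) gM gK(1) omod_mono[OF oJ[of "- 1" 0, folded M_def] order_refl K(3)]])
 then obtain F where F: "finite F" "K \<subseteq> F + M" unfolding fmod_def by blast
 define A where "A n = J 0 (int n) + M" for n
 have Amono: "A n' \<subseteq> A n" if "n \<le> n'" for n n'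
  unfolding A_def by (rule set_plus_mono) (use that in \<open>auto simp: J_def\<close>)
 \<comment> \<open>An index at which the representative \<open>f\<close> has already left the
   decreasing chain, unless it never leaves. The maximum over \<open>F\<close> is where the chain
   stabilises.\<close>
 define r where "r f = (SOME m. f \<in> A m --> (\<forall>n. f \<in> A n))" for f
 have r: "f \<in> A n" if "f \<in> A (r f)" for f n
 proof -
  have "\<exists>m. f \<in> A m --> (\<forall>n. f \<in> A n)" by blast
  from someI_ex[OF this] show ?thesis using that unfolding r_def by blast
 qed
 define N where "N = Max (insert 0 (r ` F))"
 have stab: "x \<in> A n" if x: "x \<in> A N" for x n
 proof -
  have AK: "A N \<subseteq> K" unfolding A_def by (rule sg_plus_subset[OF gK(1) JK MK]) simp
  have "x \<in> F + M" using x AK F(2) by blast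
  then obtain f m where fm: "f \<in> F" "m \<in> M" "x = f + m" by (rule set_plusE)
  have gA: "add_subgroup (A n)" for n unfolding A_def by (rule sg_plus[OF gJ gM])
  have MA: "M \<subseteq> A n" for n unfolding A_def by (rule set_plus_right[OF sg_zero[OF gJ]])
  have "f \<in> A N" using x fm sg_cancel_right[OF gA, of m N f] MA by blast
  moreover have "r f \<le> N" unfolding N_def using F(1) fm(1) by (intro Max_ge) auto
  ultimately have "f \<in> A (r f)" using Amono by blast
  then have "f \<in> A n" by (rule r)
  then show ?thesis unfolding fm(3) using fm(2) MA by (intro sg_add[OF gA]) auto
 qed
 define b where "b = int N"
 have b0: "0 \<le> b" by (simp add: b_def)
 have s1: "\<exists>y\<in>pos t K. x - y \<in> J (- 1) b" if x: "x \<in> J 0 b" for x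
 proof -
  define R where "R n = {y \<in> J 0 (int n). x - y \<in> M}" for n
  obtain y where y: "!!B. B \<in> range R ==> y \<in> B"
  proof (rule cocpt_fip[of "range R" "R 0" X])
   show "directed_down (range R)" by (rule directed_down_range) (auto simp: R_def J_def)
   have "R 0 \<subseteq> K" unfolding R_def using JK[of 0] by auto
   then show "cocpt X (R 0)" by (rule cocpt_mono[OF K(5) order_refl])
   show "closed B" if "B \<in> range R" for B
   proof -
    obtain n where n: "B = R n" using \<open>B \<in> range R\<close> by blast
    have "R n = J 0 (int n) \<inter> {y. x - y \<in> M}" by (auto simp: R_def)
    then show ?thesis unfolding n using closed_Int[OF clJ closed_translate_vimage(2)[OF clJ[of "- 1" 0, folded M_def]]] by simp
   qed
   show "B \<noteq> {}" if "B \<in> range R" for B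
   proof -
    obtain n where n: "B = R n" using \<open>B \<in> range R\<close> by blast
    have "0 \<in> M" by (rule sg_zero[OF gM])
    then have "x \<in> A N" unfolding A_def using x b_def by (intro set_plusI[of x _ 0]) auto
    then have "x \<in> J 0 (int n) + M" using stab A_def by blast
    then obtain y where "y \<in> J 0 (int n)" "x - y \<in> M" by (auto simp: set_plus_diff)
    then show ?thesis unfolding n R_def by blast
   qed
   show "a - z \<in> B" if az: "B \<in> range R" "a \<in> B" "z \<in> X" for B a z
   proof -
    obtain n where n: "B = R n" using az(1) by blast
    have "a - z \<in> J 0 (int n)" using az n XJ by (intro sg_diff[OF gJ]) (auto simp: R_def)
    moreover have "(x - a) + z \<in> M" using az n XJ unfolding M_def by (intro sg_add[OF gJ]) (auto simp: R_def M_def)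
    ultimately show ?thesis unfolding n R_def by (simp add: algebra_simps)
   qed
  qed auto
  then have yR: "y \<in> J 0 (int n)" "x - y \<in> M" for n unfolding R_def by blast+
  have yp: "y \<in> pos t K" unfolding pos_eq
  proof clarify
   fix n :: int assume "0 \<le> n"
   then show "P (- n) y \<in> K" using yR(1)[of "nat n"] unfolding J_def by auto
  qed
  have "x - y \<in> J 0 b" by (rule sg_diff[OF gJ x yR(1)[of N, folded b_def]])
  have "x - y \<in> J (- 1) b" unfolding J_def
  proof clarify
   fix n :: int assume n: "- 1 \<le> n" "n \<le> b"
   show "P (- n) (x - y) \<in> K"
   proof (cases "0 \<le> n")
    case True then show ?thesis using JD[OF \<open>x - y \<in> J 0 b\<close>] n by blast
   next
    case False then show ?thesis using n by (intro JD[OF yR(2)[unfolded M_def]]) auto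
   qed
  qed
  then show ?thesis using yp by blast
 qed
 have s2: "\<exists>y\<in>pos t K. x - y \<in> J (- int m) b" if x: "x \<in> J 0 b" for x m
 proof (induction m)
  case 0
  then show ?case using x sg_zero[OF gpos] by (intro bexI[of _ 0]) auto
 next
  case (Suc m)
  then obtain y where y: "y \<in> pos t K" "x - y \<in> J (- int m) b" by blast
  define z where "z = x - y"
  have Jz: "P (- n) z \<in> K" if "- int m \<le> n" "n \<le> b" for n using y(2) that unfolding J_def z_def by blast
  \<comment> \<open>Shifting by \<open>m\<close> moves the left end of the window to zero, where
    \<open>s1\<close> gains one more step. The correction \<open>w\<close> is shifted back and stays
    in \<open>pos t K\<close>.\<close>
  have "P (int m) z \<in> J 0 b" unfolding J_def
  proof clarify
   fix n :: int assume n: "0 \<le> n" "n \<le> b"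
   have "P (- n) (P (int m) z) = P (- (n - int m)) z" unfolding Padd[symmetric] by simp
   then show "P (- n) (P (int m) z) \<in> K" using Jz[of "n - int m"] n by simp
  qed
  from s1[OF this] obtain w where w: "w \<in> pos t K" "P (int m) z - w \<in> J (- 1) b" by blast
  define w' where "w' = P (- int m) w"
  have w': "w' \<in> pos t K" unfolding w'_def P_def by (rule pos_shift[OF w(1)]) simp
  have "z - w' \<in> J (- int (Suc m)) b" unfolding J_def
  proof clarify
   fix n :: int assume n: "- int (Suc m) \<le> n" "n \<le> b"
   show "P (- n) (z - w') \<in> K"
   proof (cases "n = - int (Suc m)")
    case True
    have "P (- n) (z - w') = P 1 (P (int m) (z - w'))" unfolding Padd[symmetric] using True by (simp add: add.commute)
    also have "P (int m) (z - w') = P (int m) z - w" unfolding w'_def Pplus Padd[symmetric] by (simp add: P0)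
    finally have "P (- n) (z - w') = P (- (- 1)) (P (int m) z - w)" by simp
    moreover have "P (- (- 1)) (P (int m) z - w) \<in> K" using b0 by (intro JD[OF w(2)]) auto
    ultimately show ?thesis by simp
   next
    case False
    then have "P (- n) z \<in> K" using Jz n by simp
    moreover have "P (- n) w' = P (- (n + int m)) w" unfolding w'_def Padd[symmetric] by simp
    moreover have "\<forall>k\<ge>0. P (- k) w \<in> K" using w(1) unfolding pos_eq by simp
    from spec[OF this, of "n + int m"] have "P (- (n + int m)) w \<in> K" using n False by simp
    ultimately show ?thesis unfolding Pplus using sg_diff[OF gK(1)] by simp
   qed
  qed
  moreover have "x - (y + w') = z - w'" unfolding z_def by (simp add: algebra_simps)
  ultimately show ?case using sg_add[OF gpos y(1) w'] by (metis (no_types, lifting))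
 qed
 have s3: "\<exists>y\<in>pos t K. \<forall>n\<le>b. P (- n) (x - y) \<in> K" if x: "x \<in> J 0 b" for x
 proof -
  define R where "R m = {y \<in> pos t K. x - y \<in> J (- int m) b}" for m
  obtain y where y: "!!B. B \<in> range R ==> y \<in> B"
  proof (rule cocpt_fip[of "range R" "R 0" X])
   show "directed_down (range R)" by (rule directed_down_range) (auto simp: R_def J_def)
   have "R 0 \<subseteq> K" unfolding R_def using pos_subset by auto
   then show "cocpt X (R 0)" by (rule cocpt_mono[OF K(5) order_refl])
   show "closed B" if "B \<in> range R" for B
   proof -
    obtain n where n: "B = R n" using \<open>B \<in> range R\<close> by blast
    have "R n = pos t K \<inter> {y. x - y \<in> J (- int n) b}" by (auto simp: R_def)
    then show ?thesis unfolding n using closed_Int[OF clpos closed_translate_vimage(2)[OF clJ]] by simp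
   qed
   show "B \<noteq> {}" if "B \<in> range R" for B using that s2[OF x] unfolding R_def by blast
   show "a - z \<in> B" if az: "B \<in> range R" "a \<in> B" "z \<in> X" for B a z
   proof -
    obtain n where n: "B = R n" using az(1) by blast
    have "a - z \<in> pos t K" using az n Xpos by (intro sg_diff[OF gpos]) (auto simp: R_def)
    moreover have "(x - a) + z \<in> J (- int n) b" using az n XJ by (intro sg_add[OF gJ]) (auto simp: R_def)
    ultimately show ?thesis unfolding n R_def by (simp add: algebra_simps)
   qed
  qed auto
  then have yR: "y \<in> pos t K" "x - y \<in> J (- int n) b" for n unfolding R_def by blast+
  have "P (- n) (x - y) \<in> K" if "n \<le> b" for n using yR(2)[of "nat (- n)"] that unfolding J_def by auto
  then show ?thesis using yR(1) by blast
 qed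
 have "J (- b) 0 \<subseteq> pos t K + pos (- t) K"
 proof
  fix x assume x: "x \<in> J (- b) 0"
  have "P b x \<in> J 0 b" unfolding J_def
  proof clarify
   fix n :: int assume n: "0 \<le> n" "n \<le> b"
   have "P (- n) (P b x) = P (- (n - b)) x" unfolding Padd[symmetric] by simp
   moreover have "P (- (n - b)) x \<in> K" using n by (intro JD[OF x]) auto
   ultimately show "P (- n) (P b x) \<in> K" by simp
  qed
  from s3[OF this] obtain y where y: "y \<in> pos t K" "\<forall>n\<le>b. P (- n) (P b x - y) \<in> K" by blast
  have 1: "P (- b) y \<in> pos t K" unfolding P_def by (rule pos_shift[OF y(1) b0])
  have 2: "x - P (- b) y \<in> pos (- t) K" unfolding pos_eq
  proof clarify
   fix k :: int assume k: "0 \<le> k"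
   have "x = P (- b) (P b x)" unfolding Padd[symmetric] by (simp add: P0)
   then have "P k (x - P (- b) y) = P k (P (- b) (P b x - y))" unfolding Pplus by simp
   also have "\<dots> = P (- (b - k)) (P b x - y)" unfolding Padd[symmetric] by simp
   finally show "P k (x - P (- b) y) \<in> K" using spec[OF y(2), of "b - k"] k by simp
  qed
  show "x \<in> pos t K + pos (- t) K" using 1 2 by (intro set_plusI[of "P (- b) y" _ "x - P (- b) y"]) auto
 qed
 moreover obtain U where "nb U" "U \<inter> G \<subseteq> J (- b) 0" using oJ[of "- b" 0] omod_def by blast
 ultimately show ?thesis using that by blast
qed

text \<open>For the tidied \<open>K\<close> the group \<open>Bp\<close> is closed and
  \<open>t\<close> expands \<open>Bp/D\<close>; splitting off the compact \<open>D/X\<close> leaves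
  the layer \<open>H1/X\<close>. On \<open>B = Bp + Bm\<close> the inverse of \<open>t\<close>
  expands \<open>B/Bp\<close>, and since \<open>Bp/H1\<close> is compact a second splitting gives
  the layer \<open>H/H1\<close>. So one element contributes two steps of \<open>hyper\<close>, one
  for \<open>t\<close> and one for \<open>- t\<close>, and \<open>B\<close> is compact over the
  outcome.\<close>

theorem act_step:
 assumes T: "finite T" and G: "lcg G" "sub UNIV G" and X: "closed X" "sub UNIV X" "X \<subseteq> G" and W: "Wzero UNIV X G"
  and K0: "sub T K0" "X \<subseteq> K0" "K0 \<subseteq> G" "omod K0 G" "cocpt X K0"
 shows "\<exists>H B. hyper X H \<and> H \<subseteq> B \<and> B \<subseteq> G \<and> sub (T \<union> {t, - t}) B \<and> omod B G \<and> cocpt H B"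
proof -
 define T' where "T' = T \<union> {t, - t}"
 have tT: "t \<in> T'" "- t \<in> T'" by (auto simp: T'_def)
 have gT: "gens T' T'" using T by (auto simp: T'_def intro!: gens_finite)
 have gG: "closed G" "add_subgroup G" using G(1) lcg_def by auto
 have gX: "add_subgroup X" by (rule subD(1)[OF X(2)])
 have sX: "sub T' X" using sub_mono[OF X(2) subset_UNIV] .
 obtain K D where K: "sub T K" "X \<subseteq> D" "D \<subseteq> K" "K \<subseteq> K0" "omod K G" and D: "closed D" "sub T' D" "hom t K \<subseteq> D"
  using nice_subgroup[OF T G X W K0, of t] unfolding T'_def by metis
 have XK: "X \<subseteq> K" and KG: "K \<subseteq> G" using K K0 by auto
 have gK: "add_subgroup K" by (rule subD(1)[OF K(1)])
 have gD: "add_subgroup D" by (rule subD(1)[OF D(2)])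
 have clK: "closed K" by (rule omod_closed[OF K(5) gG(1) gK gG(2) KG])
 have cK: "cocpt X K" by (rule cocpt_mono[OF K0(5) order_refl K(4)])
 obtain U where U: "nb U" "U \<inter> G \<subseteq> pos t K + pos (- t) K"
  by (rule tidy[OF K(1) XK KG K(5) cK clK X(1,2) G(2)])
 define Kp where "Kp = pos t K"
 define Km where "Km = pos (- t) K"
 define Bp where "Bp = evt t K"
 define Bm where "Bm = evt (- t) K"
 have TT: "T \<union> {- t, - (- t)} = T'" by (auto simp: T'_def)
 have sB: "sub T' Bp" "sub T' Bm"
  unfolding Bp_def Bm_def using sub_evt[OF K(1), of t] sub_evt[OF K(1), of "- t"] TT by (auto simp: T'_def)
 have gB: "add_subgroup Bp" "add_subgroup Bm" using subD(1)[OF sB(1)] subD(1)[OF sB(2)] .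
 have gKp: "add_subgroup Kp" "add_subgroup Km" unfolding Kp_def Km_def using subD(1)[OF sub_pos[OF K(1)]] by auto
 have KB: "Kp \<subseteq> Bp" "Km \<subseteq> Bm" unfolding Kp_def Km_def Bp_def Bm_def by (rule pos_evt)+
 have KK: "Kp \<subseteq> K" "Km \<subseteq> K" unfolding Kp_def Km_def by (rule pos_subset)+
 have BD: "x \<in> D" if "x \<in> Bp" "x \<in> Bm" for x using that D(3) unfolding hom_def Bp_def Bm_def by blast
 have DKp: "D \<subseteq> Kp" "D \<subseteq> Km"
  unfolding Kp_def Km_def pos_def using sub_zm[OF D(2) tT] sub_zm[OF D(2), of "- t"] tT K(3) by (auto simp: zm_neg2)
 have XKp: "X \<subseteq> Kp" "X \<subseteq> Bp" using K(2) DKp KB by auto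
 have evtG: "evt s K \<subseteq> G" for s
 proof
  fix x assume "x \<in> evt s K"
  then obtain m where "\<forall>n\<ge>m. act (zm (- n) s) x \<in> K" unfolding evt_def by blast
  then have "act (zm (- m) s) x \<in> G" using KG by blast
  then have "act (zm m s) (act (zm (- m) s) x) \<in> G" by (rule subD(2)[OF G(2) UNIV_I])
  then show "x \<in> G" using act_zm_add[of m "- m" s x] by simp
 qed
 have BG: "Bp \<subseteq> G" "Bm \<subseteq> G" unfolding Bp_def Bm_def by (rule evtG)+
 have clKp: "closed Kp" unfolding Kp_def by (rule closed_pos[OF clK])
 \<comment> \<open>A small point of \<open>Bp\<close> is \<open>k + k'\<close> with
   \<open>k \<in> Kp\<close> and \<open>k' \<in> Km\<close>. Then \<open>k'\<close> lies in both
   \<open>Bp\<close> and \<open>Bm\<close>, so it is homoclinic, hence in \<open>D\<close> and in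
   \<open>Kp\<close>.\<close>
 have UB: "U \<inter> Bp \<subseteq> Kp"
 proof
  fix x assume x: "x \<in> U \<inter> Bp"
  then have "x \<in> Kp + Km" using U(2) BG(1) unfolding Kp_def Km_def by blast
  then obtain k k' where k: "k \<in> Kp" "k' \<in> Km" "x = k + k'" by (rule set_plusE)
  have "k' \<in> Bp" using x k KB(1) sg_cancel_left[OF gB(1), of k k'] by blast
  then have "k' \<in> D" using BD k(2) KB(2) by blast
  then show "x \<in> Kp" unfolding k(3) using k(1) DKp by (intro sg_add[OF gKp(1)]) auto
 qed
 have clBp: "closed Bp" by (rule closed_if_locally_closed[OF gB(1) U(1) clKp UB KB(1)])
 have oKp: "omod Kp Bp" unfolding omod_def using U(1) UB by blast
 have e1: "expd (act t) D Bp"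
 proof (rule expd_act[of D Kp Bp])
  show "act t x \<in> D" if "x \<in> D" for x by (rule subD(2)[OF D(2) tT(1) that])
  show "act (- t) x \<in> D" if "x \<in> D" for x by (rule subD(2)[OF D(2) tT(2) that])
  show "act t x \<in> Bp" if "x \<in> Bp" for x by (rule subD(2)[OF sB(1) tT(1) that])
  show "act (- t) x \<in> Bp" if "x \<in> Bp" for x by (rule subD(2)[OF sB(1) tT(2) that])
  show "act (- t) x \<in> Kp" if "x \<in> Kp" for x
   using pos_shift[of x t K 1] that unfolding Kp_def by (simp add: zm_neg)
  show "x \<in> D" if x: "!!n. (act t ^^ n) x \<in> Kp" for x
  proof (rule BD)
   have "act (zm (int n) t) x \<in> Kp" for n using x[of n] by (simp add: act_funpow_zm)
   then have "act (zm n t) x \<in> Kp" if "n \<ge> 0" for n using that by (metis nat_0_le)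
   then have "x \<in> Kp" "\<forall>n\<ge>0. act (zm n t) x \<in> K" using KK(1) x[of 0] by auto
   then show "x \<in> Bp" "x \<in> Bm" using KB(1) unfolding Bm_def evt_def by (auto simp: zm_neg2)
  qed
  show "\<exists>n. (act (- t) ^^ n) x \<in> Kp" if "x \<in> Bp" for x
  proof -
   obtain m where "m \<ge> 0" "\<forall>n\<ge>m. act (zm (- n) t) x \<in> Kp" using evt_pos[of x t K] \<open>x \<in> Bp\<close> unfolding Bp_def Kp_def by blast
   then have "act (zm (- int (nat m)) t) x \<in> Kp" by simp
   then show ?thesis unfolding act_funpow_zm(2) by blast
  qed
  show "cocpt D Kp" by (rule cocpt_mono[OF cK K(2) KK(1)])
 qed (use gD gKp gB D(1) clKp DKp KB oKp in auto)
 have WD: "Wzero T' X D"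
  by (rule Wzero_mono[OF Wzero_restrict_ops[OF gT G X W]]) (use K(3) KG in blast)
 have cD: "cocpt X D" by (rule cocpt_mono[OF cK order_refl K(3)])
 have basis: "\<exists>D1. sub T' D1 \<and> closed D1 \<and> X \<subseteq> D1 \<and> D1 \<subseteq> D \<and> fmod D1 D \<and> D1 \<subseteq> V + X" if V: "nb V" for V
  using profinite_basis[OF gT X(1) sX D(1,2) K(2) cD WD V] by metis
 define H1 where "H1 = null (act t) X Bp"
 have q1: "closed H1" "H1 \<inter> D = X" "H1 + D = Bp" "expd (act t) X H1"
 proof -
  have res: "\<exists>N1. add_subgroup N1 \<and> closed N1 \<and> X \<subseteq> N1 \<and> N1 \<subseteq> D \<and> omod N1 D \<and> N1 \<subseteq> V + X \<and> (\<forall>x\<in>N1. act t x \<in> N1)" if V: "nb V" for V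
  proof -
   obtain D1 where D1: "sub T' D1" "closed D1" "X \<subseteq> D1" "D1 \<subseteq> D" "fmod D1 D" "D1 \<subseteq> V + X" using basis[OF V] by blast
   have "omod D1 D" by (rule fmod_omod[OF D1(5,2,4) subD(1)[OF D1(1)] gD])
   then show ?thesis using D1 subD(1)[OF D1(1)] subD(2)[OF D1(1) tT(1)] by blast
  qed
  have DB: "D \<subseteq> Bp" using DKp(1) KB(1) by blast
  have st: "act t x \<in> X" if "x \<in> X" for x by (rule subD(2)[OF X(2) UNIV_I that])
  have stD: "act t x \<in> D" if "x \<in> D" for x by (rule subD(2)[OF D(2) tT(1) that])
  have stB: "act t x \<in> Bp" if "x \<in> Bp" for x by (rule subD(2)[OF sB(1) tT(1) that])
  note q = split_compact_kernel[OF oper_act gX gD gB(1) X(1) D(1) clBp K(2) DB st stD stB e1 cD res]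
  show "closed H1" "H1 \<inter> D = X" "H1 + D = Bp" "expd (act t) X H1" unfolding H1_def by (rule q; assumption)+
 qed
 have H1G: "H1 = null (act t) X G"
 proof
  show "H1 \<subseteq> null (act t) X G"
  proof
   fix y assume "y \<in> H1"
   then obtain s where s: "s 0 = y" "bseq (act t) X Bp s" unfolding H1_def by (rule nullE)
   have "bseq (act t) X G s" by (rule bseq_mono[OF s(2) order_refl]) (use bseqD(1)[OF s(2)] BG(1) in blast)
   from nullI[OF this] show "y \<in> null (act t) X G" using s by simp
  qed
  show "null (act t) X G \<subseteq> H1"
  proof
   fix y assume "y \<in> null (act t) X G"
   then obtain s where s: "s 0 = y" "bseq (act t) X G s" by (rule nullE)
   obtain U1 where U1: "nb U1" "U1 \<inter> G \<subseteq> K" using K(5) omod_def by blast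
   obtain m where m: "\<forall>n\<ge>m. s n \<in> U1 + X" using bseqD(3)[OF s(2) U1(1)] by blast
   have big: "s n \<in> K" if "n \<ge> m" for n
    using set_plus_subset_near[OF gG(2) X(3) U1(2) XK gK] m that bseqD(1)[OF s(2), of n] by blast
   have rel: "s (n + k) - act (zm (- int k) t) (s n) \<in> X" for n k
   proof (induction k)
    case 0 then show ?case using sg_zero[OF gX] by simp
   next
    case (Suc k)
    have "act (- t) (act t (s (Suc (n + k))) - s (n + k)) \<in> X"
     by (rule subD(2)[OF X(2) UNIV_I bseqD(2)[OF s(2)]])
    moreover have "act (- t) (s (n + k) - act (zm (- int k) t) (s n)) \<in> X" by (rule subD(2)[OF X(2) UNIV_I Suc])
    ultimately have "act (- t) (act t (s (Suc (n + k))) - s (n + k)) + act (- t) (s (n + k) - act (zm (- int k) t) (s n)) \<in> X"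
     by (rule sg_add[OF gX])
    then have "s (Suc (n + k)) - act (- t) (act (zm (- int k) t) (s n)) \<in> X" by (simp add: act_diff)
    moreover have "act (- t) (act (zm (- int k) t) (s n)) = act (zm (- int (Suc k)) t) (s n)"
     using act_zm_add[of "- 1" "- int k" t "s n"] by (simp add: zm_neg)
    ultimately show ?case by simp
   qed
   have "s n \<in> Bp" for n unfolding Bp_def evt_def
   proof (clarify, intro exI[of _ "int m"] allI impI)
    fix k :: int assume k: "int m \<le> k"
    have 1: "s (n + nat k) - act (zm (- int (nat k)) t) (s n) \<in> K" using rel XK by blast
    have 2: "s (n + nat k) \<in> K" using k by (intro big) simp
    have "s (n + nat k) - (s (n + nat k) - act (zm (- int (nat k)) t) (s n)) \<in> K"
     by (rule sg_diff[OF gK 2 1])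
    then show "act (zm (- k) t) (s n) \<in> K" using k by simp
   qed
   then have "bseq (act t) X Bp s" by (rule bseq_mono[OF s(2) order_refl])
   from nullI[OF this] show "y \<in> H1" using s unfolding H1_def by simp
  qed
 qed
 have sH1: "sub UNIV H1" unfolding H1G by (rule null_sub[OF oper_act X(2) G(2) X(3)])
 have gH1: "add_subgroup H1" by (rule subD(1)[OF sH1])
 have XH1: "X \<subseteq> H1" using q1(2) by blast
 have H1Bp: "H1 \<subseteq> Bp" unfolding H1_def by (rule null_subset)
 define B where "B = Bp + Bm"
 have sBB: "sub T' B" unfolding B_def by (rule sub_plus[OF sB])
 have gBB: "add_subgroup B" by (rule subD(1)[OF sBB])
 have BBG: "B \<subseteq> G" unfolding B_def by (rule sg_plus_subset[OF gG(2) BG])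
 have BpB: "Bp \<subseteq> B" "Bm \<subseteq> B" unfolding B_def
  using set_plus_left[OF sg_zero[OF gB(2)]] set_plus_right[OF sg_zero[OF gB(1)]] by auto
 define E where "E = Bp + Km"
 have gE: "add_subgroup E" unfolding E_def by (rule sg_plus[OF gB(1) gKp(2)])
 have EB: "E \<subseteq> B" unfolding E_def B_def by (rule set_plus_mono[OF order_refl KB(2)])
 have UE: "U \<inter> G \<subseteq> E" using U(2) set_plus_mono[OF KB(1) order_refl[of Km]] unfolding E_def Kp_def Km_def by blast
 have oE: "omod E G" unfolding omod_def using U(1) UE by blast
 have oB: "omod B G" by (rule omod_mono[OF oE EB order_refl])
 have clB: "closed B" by (rule omod_closed[OF oB gG(1) gBB gG(2) BBG])
 have oEB: "omod E B" by (rule omod_mono[OF oE order_refl BBG])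
 have clE: "closed E" by (rule omod_closed[OF oEB clB gE gBB EB])
 have BpE: "Bp \<subseteq> E" "Km \<subseteq> E" unfolding E_def
  using set_plus_left[OF sg_zero[OF gKp(2)]] set_plus_right[OF sg_zero[OF gB(1)]] by auto
 have e2: "expd (act (- t)) Bp B"
 proof (rule expd_act[of Bp E B])
  show "act (- t) x \<in> Bp" if "x \<in> Bp" for x by (rule subD(2)[OF sB(1) tT(2) that])
  show "act (- (- t)) x \<in> Bp" if "x \<in> Bp" for x using subD(2)[OF sB(1) tT(1) that] by simp
  show "act (- t) x \<in> B" if "x \<in> B" for x by (rule subD(2)[OF sBB tT(2) that])
  show "act (- (- t)) x \<in> B" if "x \<in> B" for x using subD(2)[OF sBB tT(1) that] by simp
  show "act (- (- t)) x \<in> E" if x: "x \<in> E" for x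
  proof -
   obtain p k where pk: "p \<in> Bp" "k \<in> Km" "x = p + k" using x unfolding E_def by (rule set_plusE)
   have "act t k \<in> Km" using pos_shift[of k "- t" K 1] pk(2) unfolding Km_def by (simp add: zm_neg2)
   moreover have "act t p \<in> Bp" by (rule subD(2)[OF sB(1) tT(1) pk(1)])
   ultimately show ?thesis unfolding pk(3) E_def act_add by (simp add: set_plus_intro)
  qed
  show "x \<in> Bp" if x: "!!n. (act (- t) ^^ n) x \<in> E" for x
  proof -
   have "x \<in> Bp + Km" using x[of 0] E_def by simp
   then obtain p k where pk: "p \<in> Bp" "k \<in> Km" "x = p + k" by (rule set_plusE)
   \<comment> \<open>The translate of \<open>x\<close> is decomposed in two ways. The two parts in
     \<open>Bm\<close> differ by an element of \<open>Bp \<inter> Bm\<close>, which lies in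
     \<open>D \<subseteq> K\<close>.\<close>
   have "act (zm (- int n) t) k \<in> K" for n
   proof -
    have "act (zm (- int n) t) x \<in> Bp + Km" using x[of n] E_def by (simp add: act_funpow_zm(1) zm_neg2)
    then obtain p' k' where pk': "p' \<in> Bp" "k' \<in> Km" "act (zm (- int n) t) x = p' + k'" by (rule set_plusE)
    have eq: "act (zm (- int n) t) k - k' = p' - act (zm (- int n) t) p"
     using pk' unfolding pk(3) act_add by (simp add: algebra_simps)
    have "act (zm (- int n) t) p \<in> Bp" by (rule sub_zm[OF sB(1) tT pk(1)])
    then have "p' - act (zm (- int n) t) p \<in> Bp" by (rule sg_diff[OF gB(1) pk'(1)])
    then have 1: "act (zm (- int n) t) k - k' \<in> Bp" unfolding eq .
    have "act (zm (- int n) t) k \<in> Bm" by (rule sub_zm[OF sB(2) tT]) (use pk(2) KB(2) in blast)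
    then have "act (zm (- int n) t) k - k' \<in> Bm" using pk'(2) KB(2) by (intro sg_diff[OF gB(2)]) auto
    then have "act (zm (- int n) t) k - k' \<in> K" using BD[OF 1] K(3) by blast
    moreover have "k' \<in> K" using pk'(2) KK(2) by blast
    ultimately show ?thesis using sg_cancel_diff[OF gK] by blast
   qed
   then have "\<forall>n\<ge>0. act (zm (- n) t) k \<in> K" by (metis nat_0_le)
   then have "k \<in> Bp" unfolding Bp_def evt_def by blast
   then show ?thesis unfolding pk(3) by (rule sg_add[OF gB(1) pk(1)])
  qed
  show "\<exists>n. (act (- (- t)) ^^ n) x \<in> E" if x: "x \<in> B" for x
  proof -
   obtain p k where pk: "p \<in> Bp" "k \<in> Bm" "x = p + k" using x unfolding B_def by (rule set_plusE)
   obtain m where m: "m \<ge> 0" "\<forall>n\<ge>m. act (zm (- n) (- t)) k \<in> Km" using evt_pos[of k "- t" K] pk(2) unfolding Bm_def Km_def by blast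
   have "act (zm (- m) (- t)) k \<in> Km" using m(2) by blast
   then have "act (zm m t) k \<in> Km" by (simp add: zm_neg2)
   moreover have "act (zm m t) p \<in> Bp" by (rule sub_zm[OF sB(1) tT pk(1)])
   ultimately have "act (zm m t) x \<in> E" unfolding pk(3) E_def act_add by (simp add: set_plus_intro)
   then have "act (zm (int (nat m)) t) x \<in> E" using m(1) by simp
   then have "(act t ^^ nat m) x \<in> E" by (simp add: act_funpow_zm)
   then show ?thesis by auto
  qed
  show "cocpt Bp E"
  proof -
   obtain V where V: "compact V" "Km \<subseteq> V + X" using cocpt_mono[OF cK order_refl KK(2)] cocpt_def by blast
   have "E \<subseteq> Bp + (V + X)" unfolding E_def by (rule set_plus_mono[OF order_refl V(2)])
   also have "\<dots> = V + (X + Bp)" by (simp add: ac_simps)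
   also have "\<dots> \<subseteq> V + Bp" by (rule set_plus_mono[OF order_refl sg_plus_subset[OF gB(1) XKp(2) order_refl]])
   finally show ?thesis unfolding cocpt_def using V(1) by blast
  qed
 qed (use gB gE gBB clBp clE BpE EB oEB in auto)
 have cH1: "cocpt H1 Bp"
 proof -
  obtain V where V: "compact V" "D \<subseteq> V + X" using cD cocpt_def by blast
  have "Bp \<subseteq> H1 + (V + X)" unfolding q1(3)[symmetric] by (rule set_plus_mono[OF order_refl V(2)])
  also have "\<dots> = V + (X + H1)" by (simp add: ac_simps)
  also have "\<dots> \<subseteq> V + H1" by (rule set_plus_mono[OF order_refl sg_plus_subset[OF gH1 XH1 order_refl]])
  finally show ?thesis unfolding cocpt_def using V(1) by blast
 qed
 define H where "H = null (act (- t)) H1 B"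
 have q2: "closed H" "H \<inter> Bp = H1" "H + Bp = B" "expd (act (- t)) H1 H"
 proof -
  have st: "act (- t) x \<in> H1" if "x \<in> H1" for x by (rule subD(2)[OF sH1 UNIV_I that])
  have stD: "act (- t) x \<in> Bp" if "x \<in> Bp" for x by (rule subD(2)[OF sB(1) tT(2) that])
  have stB: "act (- t) x \<in> B" if "x \<in> B" for x by (rule subD(2)[OF sBB tT(2) that])
  have res: "\<exists>N1. add_subgroup N1 \<and> closed N1 \<and> H1 \<subseteq> N1 \<and> N1 \<subseteq> Bp \<and> omod N1 Bp \<and> N1 \<subseteq> V + H1 \<and> (\<forall>x\<in>N1. act (- t) x \<in> N1)" if V: "nb V" for V
  proof -
   obtain D1 where D1: "sub T' D1" "closed D1" "X \<subseteq> D1" "D1 \<subseteq> D" "fmod D1 D" "D1 \<subseteq> V + X" using basis[OF V] by blast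
   have gD1: "add_subgroup D1" by (rule subD(1)[OF D1(1)])
   define N1 where "N1 = D1 + H1"
   have sN1: "sub T' N1" unfolding N1_def by (rule sub_plus[OF D1(1) sub_mono[OF sH1 subset_UNIV]])
   have gN1: "add_subgroup N1" by (rule subD(1)[OF sN1])
   have cN1: "closed N1" unfolding N1_def
    by (rule closed_if_cocpt[OF cocpt_mono[OF cD order_refl D1(4)] X(1) D1(2) q1(1) D1(3) XH1 gX gD1 gH1])
   have HN1: "H1 \<subseteq> N1" unfolding N1_def by (rule set_plus_right[OF sg_zero[OF gD1]])
   have NB: "N1 \<subseteq> Bp" unfolding N1_def q1(3)[symmetric] by (subst add.commute) (rule set_plus_mono[OF order_refl D1(4)])
   have "fmod N1 Bp"
   proof -
    obtain F where F: "finite F" "D \<subseteq> F + D1" using D1(5) fmod_def by blast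
    have "Bp \<subseteq> H1 + (F + D1)" unfolding q1(3)[symmetric] by (rule set_plus_mono[OF order_refl F(2)])
    also have "\<dots> = F + N1" unfolding N1_def by (simp add: ac_simps)
    finally show ?thesis unfolding fmod_def using F(1) by blast
   qed
   then have "omod N1 Bp" using fmod_omod[OF _ cN1 NB gN1 gB(1)] by blast
   moreover have "N1 \<subseteq> V + H1"
   proof -
    have "N1 \<subseteq> (V + X) + H1" unfolding N1_def by (rule set_plus_mono[OF D1(6) order_refl])
    also have "\<dots> \<subseteq> V + H1" unfolding add.assoc by (rule set_plus_mono[OF order_refl sg_plus_subset[OF gH1 XH1 order_refl]])
    finally show ?thesis .
   qed
   moreover have "\<forall>x\<in>N1. act (- t) x \<in> N1" using subD(2)[OF sN1 tT(2)] by blast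
   ultimately show ?thesis using gN1 cN1 HN1 NB by blast
  qed
  note q = split_compact_kernel[OF oper_act gH1 gB(1) gBB q1(1) clBp clB H1Bp BpB(1) st stD stB e2 cH1 res]
  show "closed H" "H \<inter> Bp = H1" "H + Bp = B" "expd (act (- t)) H1 H" unfolding H_def by (rule q; assumption)+
 qed
 have H1B: "H1 \<subseteq> B" using H1Bp BpB by blast
 have H1G': "H1 \<subseteq> G" using H1B BBG by blast
 have "null (act (- t)) H1 G = H" unfolding H_def
  by (rule null_absorb[OF oper_act gBB _ H1B BBG oB gG(2)]) (rule subD(2)[OF sBB tT(2)])
 then have sH: "sub UNIV H" using null_sub[OF oper_act sH1 G(2) H1G'] by metis
 have H1H: "H1 \<subseteq> H" using q2(2) by blast
 have "hyper X H1" by (rule hyper_step[OF hyper_refl[OF X(1,2)] _ q1(4,1) sH1 XH1]) (auto simp: isop_def)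
 then have "hyper X H" by (rule hyper_step[OF _ _ q2(4,1) sH H1H]) (auto simp: isop_def)
 moreover have HB: "H \<subseteq> B" unfolding H_def by (rule null_subset)
 moreover have "cocpt H B"
 proof -
  obtain V where V: "compact V" "Bp \<subseteq> V + H1" using cH1 cocpt_def by blast
  have gH: "add_subgroup H" by (rule subD(1)[OF sH])
  have "B \<subseteq> H + (V + H1)" unfolding q2(3)[symmetric] by (rule set_plus_mono[OF order_refl V(2)])
  also have "\<dots> = V + (H1 + H)" by (simp add: ac_simps)
  also have "\<dots> \<subseteq> V + H" by (rule set_plus_mono[OF order_refl sg_plus_subset[OF gH H1H order_refl]])
  finally show ?thesis unfolding cocpt_def using V(1) by blast
 qed
 ultimately show ?thesis using BBG sBB oB unfolding T'_def by blast
qed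

end

section \<open>Lattices and doubling\<close>

lemma zm_mult: "zm (i * k) x = zm i (zm k x)"
proof (induction i rule: int_induct[where k = 0])
 case base then show ?case by simp
next
 case (step1 i)
 have "zm ((i + 1) * k) x = zm (k + i * k) x" by (simp add: algebra_simps)
 also have "\<dots> = zm k x + zm i (zm k x)" using step1 by (simp add: zm_add)
 also have "\<dots> = zm (i + 1) (zm k x)" by (simp add: zm_Suc)
 finally show ?case .
next
 case (step2 i)
 have "zm (i * k) x = zm (k + (i - 1) * k) x" by (simp add: algebra_simps)
 then have "zm k x + zm ((i - 1) * k) x = zm i (zm k x)" using step2 by (simp add: zm_add)
 also have "\<dots> = zm k x + zm (i - 1) (zm k x)" using zm_Suc[of "i - 1" "zm k x"] by simp
 finally show ?case by simp
qed

lemma sg_zm: assumes "add_subgroup Y" "x \<in> Y" shows "zm n x \<in> Y"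
proof (induction n rule: int_induct[where k = 0])
 case base then show ?case using assms sg_zero by simp
next
 case (step1 i) then show ?case using assms sg_add by (simp add: zm_Suc)
next
 case (step2 i)
 have "zm (i - 1) x = zm i x - x" using zm_Suc[of "i - 1" x] by simp
 then show ?case using step2 assms sg_diff by metis
qed

lemma sg_range_zm: "add_subgroup (range (\<lambda>n. zm n x))"
 unfolding add_subgroup_def
proof (intro conjI ballI)
 show "0 \<in> range (\<lambda>n. zm n x)" using zm_0[of x] by (metis rangeI)
 fix a assume "a \<in> range (\<lambda>n. zm n x)"
 then obtain m where m: "a = zm m x" by blast
 have "- a = zm (- m) x" unfolding m by (rule zm_neg[symmetric])
 then show "- a \<in> range (\<lambda>n. zm n x)" by blast
 fix b assume "b \<in> range (\<lambda>n. zm n x)"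
 then obtain n where n: "b = zm n x" by blast
 have "a + b = zm (m + n) x" unfolding m n by (rule zm_add[symmetric])
 then show "a + b \<in> range (\<lambda>n. zm n x)" by blast
qed

text \<open>The relative form of the fact that a cyclic subgroup of a locally compact group is
  discrete or relatively compact. Infinitely many multiples near a compact set give, by pigeonhole,
  arbitrarily large \<open>n\<close> with \<open>h n\<close> near \<open>X\<close>
  (\<open>returns\<close>). The compact set \<open>K\<close> is then covered by finitely many
  neighbourhoods of positive multiples, with indices at most \<open>N\<close>, so from any return
  one descends in steps of at most \<open>N\<close> without leaving the vicinity of \<open>X\<close>
  (\<open>desc\<close>). Every window of length \<open>N\<close> thus contains a return.\<close>

lemma monothetic_dichotomy:
 fixes G :: "'k::{topological_ab_group_add, t2_space} set"
 assumes G: "lcg G" and X: "closed X" "add_subgroup X" "X \<subseteq> G" and f: "f \<in> G"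
  and W: "compact W" "infinite {n. zm n f \<in> W + X}"
 shows "cocpt X (range (\<lambda>n. zm n f))"
proof -
 have gG: "add_subgroup G" using G lcg_def by blast
 define h where "h n = zm n f" for n
 have hadd: "h (m + n) = h m + h n" for m n unfolding h_def by (rule zm_add)
 have hneg: "h (- n) = - h n" for n unfolding h_def by (rule zm_neg)
 have hsub: "h (m - n) = h m - h n" for m n using hadd[of m "- n"] hneg[of n] by simp
 have hG: "h n \<in> G" for n unfolding h_def by (rule sg_zm[OF gG f])
 have returns: "\<exists>n>N. h n \<in> U1 + X" if U1: "nb U1" for U1 N
 proof -
  obtain U2 where U2: "nb U2" "!!x y. x \<in> U2 ==> y \<in> U2 ==> x - y \<in> U1" using nb_half[OF U1] by metis
  obtain F where F: "finite F" "F \<subseteq> W" "W \<subseteq> F + U2" using compact_finite_translates[OF W(1) U2(1)] .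
  define I where "I = {n. h n \<in> W + X}"
  have "\<exists>c\<in>F. h n \<in> {c} + U2 + X" if n: "n \<in> I" for n
  proof -
   have "h n \<in> W + X" using n I_def by blast
   also have "\<dots> \<subseteq> (F + U2) + X" by (rule set_plus_mono[OF F(3) order_refl])
   finally obtain a x where ax: "a \<in> F + U2" "x \<in> X" "h n = a + x" by (rule set_plusE)
   then obtain c u where "c \<in> F" "u \<in> U2" "a = c + u" by (elim set_plusE)
   then show ?thesis using ax by (intro bexI[of _ c]) (auto intro!: set_plus_intro)
  qed
  then have "I \<subseteq> (\<Union>c\<in>F. {n \<in> I. h n \<in> {c} + U2 + X})" by blast
  moreover have "infinite I" using W(2) unfolding I_def h_def .
  ultimately have "\<exists>c\<in>F. infinite {n \<in> I. h n \<in> {c} + U2 + X}" using F(1) by (meson finite_UN_I finite_subset)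
  then obtain c where c: "infinite {n \<in> I. h n \<in> {c} + U2 + X}" by blast
  define Ic where "Ic = {n \<in> I. h n \<in> {c} + U2 + X}"
  have icd: "\<exists>u\<in>U2. \<exists>x\<in>X. h n = c + u + x" if "n \<in> Ic" for n using that unfolding Ic_def by (auto simp: set_plus_def)
  have "Ic \<noteq> {}" using c unfolding Ic_def[symmetric] by auto
  then obtain m where m: "m \<in> Ic" by blast
  have "\<not> Ic \<subseteq> {m - \<bar>N\<bar> .. m + \<bar>N\<bar>}" using c finite_subset[OF _ finite_atLeastAtMost_int] unfolding Ic_def[symmetric] by blast
  then obtain n where n: "n \<in> Ic" "n < m - \<bar>N\<bar> \<or> n > m + \<bar>N\<bar>" by force
  have diff: "h (a - b) \<in> U1 + X" if ab: "a \<in> Ic" "b \<in> Ic" for a b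
  proof -
   obtain u x where 1: "u \<in> U2" "x \<in> X" "h a = c + u + x" using icd[OF ab(1)] by blast
   obtain u' x' where 2: "u' \<in> U2" "x' \<in> X" "h b = c + u' + x'" using icd[OF ab(2)] by blast
   have "h (a - b) = (u - u') + (x - x')" unfolding hsub 1(3) 2(3) by (simp add: algebra_simps)
   then show ?thesis using U2(2)[OF 1(1) 2(1)] sg_diff[OF X(2) 1(2) 2(2)] by (metis set_plus_intro)
  qed
  show ?thesis
  proof (cases "n > m + \<bar>N\<bar>")
   case True
   then have "n - m > N" by linarith
   then show ?thesis using diff[OF n(1) m] by blast
  next
   case False
   then have "m - n > N" using n(2) by linarith
   then show ?thesis using diff[OF m n(1)] by blast
  qed
 qed
 obtain U V where UV: "nb U" "compact V" "V \<subseteq> G" "0 \<in> V" "!!v. v \<in> V ==> - v \<in> V" "U \<inter> G \<subseteq> V" using lcg_nbhd[OF G] by metis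
 define R where "R = range h + X"
 have gR: "add_subgroup R" unfolding R_def h_def by (rule sg_plus[OF sg_range_zm X(2)])
 define K where "K = V \<inter> closure R"
 have cK: "compact K" unfolding K_def by (rule compact_Int_closed[OF UV(2)]) simp
 obtain U1 where U1: "nb U1" "!!x y. x \<in> U1 ==> y \<in> U1 ==> x - y \<in> U" using nb_half[OF UV(1)] by metis
 define On where "On n = {y. y - h n \<in> U + X}" for n
 have opn: "open (On n)" for n unfolding On_def
  by (rule open_translate_vimage) (use open_set_plus UV(1) in blast)
 \<comment> \<open>A point near \<open>h j\<close> is also near \<open>h (j + m)\<close> for a
   return \<open>m > \<bar>j\<bar>\<close>; this makes the index positive, as the descent
   requires.\<close>
 have "K \<subseteq> (\<Union>n\<in>{1..}. On n)"
 proof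
  fix y assume "y \<in> K"
  then have "y \<in> closure R" unfolding K_def by blast
  then obtain r where r: "r \<in> R" "y - r \<in> U1" using closure_nb[OF _ U1(1)] by blast
  obtain j x where jx: "x \<in> X" "r = h j + x" using r(1) unfolding R_def by (auto elim: set_plusE)
  obtain m where m: "m > \<bar>j\<bar>" "h m \<in> U1 + X" using returns[OF U1(1)] by blast
  obtain u x' where ux: "u \<in> U1" "x' \<in> X" "h m = u + x'" using m(2) by (rule set_plusE)
  have "y - h (j + m) = ((y - r) - u) + (x - x')" unfolding hadd ux(3) jx(2) by (simp add: algebra_simps)
  then have "y - h (j + m) \<in> U + X" using U1(2)[OF r(2) ux(1)] sg_diff[OF X(2) jx(1) ux(2)] by (metis set_plus_intro)
  moreover have "j + m \<in> {1..}" using m(1) by auto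
  ultimately show "y \<in> (\<Union>n\<in>{1..}. On n)" unfolding On_def by blast
 qed
 then obtain C where C: "C \<subseteq> {1..}" "finite C" "K \<subseteq> (\<Union>n\<in>C. On n)" using compactE_image[OF cK, of "{1..}" On] opn by metis
 define N where "N = Max (insert 1 C)"
 have Kn: "\<exists>n. 1 \<le> n \<and> n \<le> N \<and> y - h n \<in> U + X" if y: "y \<in> K" for y
 proof -
  obtain n where n: "n \<in> C" "y \<in> On n" using C(3) y by blast
  have "n \<le> N" unfolding N_def using C(2) n(1) by (intro Max_ge) auto
  then show ?thesis using n C(1) unfolding On_def by auto
 qed
 have desc: "\<exists>k'. j \<le> k' \<and> k' \<le> j + N \<and> h k' \<in> U + X" if "h (j + int d) \<in> U + X" for j d
  using that
 proof (induction d rule: less_induct)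
  case (less d)
  show ?case
  proof (cases "int d \<le> N")
   case True then show ?thesis using less.prems by (intro exI[of _ "j + int d"]) auto
  next
   case False
   obtain u x where ux: "u \<in> U" "x \<in> X" "h (j + int d) = u + x" using less.prems by (rule set_plusE)
   have "u = h (j + int d) - x" using ux(3) by simp
   then have uR: "u \<in> R" unfolding R_def using sg_neg[OF X(2) ux(2)] by (intro set_plusI[of "h (j + int d)" _ "- x"]) auto
   have "u + x \<in> G" using hG[of "j + int d"] ux(3) by simp
   then have "u \<in> G" using sg_cancel_right[OF gG, of x u] ux(2) X(3) by blast
   then have "u \<in> K" unfolding K_def using ux(1) UV(6) uR closure_subset by blast
   then obtain n where n: "1 \<le> n" "n \<le> N" "u - h n \<in> U + X" using Kn by blast
   then obtain u' x' where ux': "u' \<in> U" "x' \<in> X" "u - h n = u' + x'" by (elim set_plusE)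
   have "h (j + int d - n) = (u - h n) + x" unfolding hsub ux(3) by (simp add: algebra_simps)
   also have "\<dots> = u' + (x' + x)" unfolding ux'(3) by (simp add: add.assoc)
   finally have hh: "h (j + int d - n) \<in> U + X" using ux'(1) sg_add[OF X(2) ux'(2) ux(2)] by (metis set_plus_intro)
   have e: "j + int d - n = j + int (d - nat n)" "d - nat n < d" using n(1,2) False by auto
   have "h (j + int (d - nat n)) \<in> U + X" using hh unfolding e(1) .
   then show ?thesis by (rule less.IH[OF e(2)])
  qed
 qed
 define Vf where "Vf = V + uminus ` (h ` {0..N})"
 have "compact Vf" unfolding Vf_def by (rule compact_set_plus[OF UV(2)]) (auto intro!: finite_imp_compact)
 moreover have "range h \<subseteq> Vf + X"
 proof
  fix y assume "y \<in> range h"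
  then obtain j where j: "y = h j" by blast
  obtain J where J: "J > j" "h J \<in> U + X" using returns[OF UV(1)] by blast
  have "h (j + int (nat (J - j))) \<in> U + X" using J by simp
  from desc[OF this] obtain k where k: "j \<le> k" "k \<le> j + N" "h k \<in> U + X" by blast
  obtain u x where ux: "u \<in> U" "x \<in> X" "h k = u + x" using k(3) by (rule set_plusE)
  have "u + x \<in> G" using hG[of k] ux(3) by simp
  then have "u \<in> G" using sg_cancel_right[OF gG, of x u] ux(2) X(3) by blast
  then have "u \<in> V" using ux(1) UV(6) by blast
  have "h j = h (k - (k - j))" by simp
  also have "\<dots> = (u + - h (k - j)) + x" unfolding hsub[of k "k - j"] ux(3) by (simp add: algebra_simps)
  finally have "y = (u + - h (k - j)) + x" using j by simp
  moreover have "u + - h (k - j) \<in> Vf" unfolding Vf_def using \<open>u \<in> V\<close> k by (intro set_plus_intro) auto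
  ultimately show "y \<in> Vf + X" using ux(2) by (metis set_plus_intro)
 qed
 ultimately show ?thesis unfolding cocpt_def h_def by blast
qed

text \<open>Only finitely many cosets of \<open>X\<close> occur near zero, so the sum is closed
  there and \<open>closed_if_locally_closed\<close> applies.\<close>

lemma proper_closed:
 fixes G :: "'k::{topological_ab_group_add, t2_space} set"
 assumes G: "lcg G" and X: "closed X" "add_subgroup X" "X \<subseteq> G" and f: "f \<in> G"
  and fin: "!!W. compact W ==> finite {n. zm n f \<in> W + X}"
 shows "closed (range (\<lambda>n. zm n f) + X)"
proof -
 have gG: "add_subgroup G" using G lcg_def by blast
 obtain U V where UV: "nb U" "compact V" "U \<inter> G \<subseteq> V" using lcg_nbhd[OF G] by metis
 define B where "B = range (\<lambda>n. zm n f) + X"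
 have gB: "add_subgroup B" unfolding B_def by (rule sg_plus[OF sg_range_zm X(2)])
 have BG: "B \<subseteq> G" unfolding B_def using sg_zm[OF gG f] X(3) by (intro sg_plus_subset[OF gG]) auto
 define I where "I = {n. zm n f \<in> V + X}"
 define C where "C = (\<lambda>n. zm n f) ` I + X"
 have "closed C" unfolding C_def using fin[OF UV(2)] by (intro closed_compact_plus[OF _ X(1)] finite_imp_compact) (simp add: I_def)
 moreover have "C \<subseteq> B" unfolding C_def B_def by (rule set_plus_mono) auto
 moreover have "U \<inter> B \<subseteq> C"
 proof
  fix b assume b: "b \<in> U \<inter> B"
  then obtain n x where nx: "x \<in> X" "b = zm n f + x" unfolding B_def by (auto elim: set_plusE)
  have "b \<in> V" using b BG UV(3) by blast
  then have "zm n f \<in> V + X" using nx sg_neg[OF X(2) nx(1)] by (intro set_plusI[of b _ "- x"]) auto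
  then show "b \<in> C" unfolding C_def nx(2) using nx(1) I_def by (intro set_plus_intro) auto
 qed
 ultimately have "closed B" using closed_if_locally_closed[OF gB UV(1)] by blast
 then show ?thesis unfolding B_def .
qed

fun zspan :: "'k::ab_group_add list => 'k set" where
 "zspan [] = {0}"
| "zspan (f # fs) = range (\<lambda>n. zm n f) + zspan fs"

lemma zspan_subgroup: "add_subgroup (zspan fs)"
 proof (induction fs)
 case Nil then show ?case by (simp add: add_subgroup_def)
next
 case (Cons a fs) then show ?case using sg_plus[OF sg_range_zm] by simp
qed

lemma zspan_contains: "f \<in> set fs ==> f \<in> zspan fs"
proof (induction fs)
 case (Cons a fs)
 show ?case
 proof (cases "f = a")
  case True
  have "zm 1 a + 0 \<in> range (\<lambda>n. zm n a) + zspan fs"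
   by (intro set_plus_intro rangeI sg_zero zspan_subgroup)
  then show ?thesis using True by simp
 next
  case False
  then have "f \<in> zspan fs" using Cons by simp
  then have "zm 0 a + f \<in> range (\<lambda>n. zm n a) + zspan fs" by (intro set_plus_intro rangeI)
  then show ?thesis by simp
 qed
qed simp

lemma zspan_subset: "add_subgroup G ==> set fs \<subseteq> G ==> zspan fs \<subseteq> G"
proof (induction fs)
 case (Cons a fs)
 have "range (\<lambda>n. zm n a) \<subseteq> G" using sg_zm[OF Cons.prems(1), of a] Cons.prems(2) by auto
 moreover have "zspan fs \<subseteq> G" using Cons by simp
 ultimately show ?case using sg_plus_subset[OF Cons.prems(1)] by simp
qed (simp add: sg_zero)

text \<open>The model is a free abelian group of finite rank that is discrete modulo
  \<open>X\<close>, with \<open>\<nu>\<close> its l1 norm. The norm is exactly homogeneous under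
  doubling and has finite balls, the two features that survive in the seminorm built from
  it.\<close>

definition lattice_mod :: "'k::{topological_ab_group_add, t2_space} set => 'k set => ('k => real) => bool" where
 "lattice_mod X L \<nu> \<longleftrightarrow> add_subgroup L \<and> L \<inter> X = {0} \<and> (\<forall>W. compact W --> finite (L \<inter> (W + X))) \<and>
   (\<forall>l\<in>L. \<forall>m\<in>L. \<nu> (l + m) \<le> \<nu> l + \<nu> m) \<and> (\<forall>l\<in>L. \<nu> (l + l) = 2 * \<nu> l) \<and> (\<forall>l\<in>L. \<nu> (- l) = \<nu> l) \<and>
   (\<forall>l\<in>L. 0 \<le> \<nu> l) \<and> (\<forall>r. finite {l \<in> L. \<nu> l \<le> r})"

text \<open>A nonzero multiple of \<open>f\<close> in \<open>X\<close> would bring infinitely many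
  more with it, against \<open>fin\<close>. So the coordinates of \<open>l + zm n f\<close> are
  unique and \<open>\<nu> l + \<bar>n\<bar>\<close> is a well-defined norm. A compact set modulo
  \<open>X\<close> allows finitely many \<open>l\<close>, and for each of these finitely many
  \<open>n\<close>.\<close>

lemma lattice_extend:
 fixes X :: "'k::{topological_ab_group_add, t2_space} set"
 assumes L: "lattice_mod (range (\<lambda>n. zm n f) + X) L \<nu>" and X: "add_subgroup X"
  and fin: "!!W. compact W ==> finite {n. zm n f \<in> W + X}"
 shows "\<exists>\<nu>'. lattice_mod X (L + range (\<lambda>n. zm n f)) \<nu>'"
proof -
 define R where "R = range (\<lambda>n. zm n f)"
 define h where "h n = zm n f" for n
 have hadd: "h (m + n) = h m + h n" for m n unfolding h_def by (rule zm_add)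
 have hneg: "h (- n) = - h n" for n unfolding h_def by (rule zm_neg)
 have hsub: "h (m - n) = h m - h n" for m n using hadd[of m "- n"] hneg[of n] by simp
 have h0: "h 0 = 0" unfolding h_def by simp
 have hR: "h n \<in> R" for n unfolding h_def R_def by blast
 have gR: "add_subgroup R" unfolding R_def by (rule sg_range_zm)
 have gL: "add_subgroup L" and LX: "L \<inter> (R + X) = {0}" and Lfin: "!!W. compact W ==> finite (L \<inter> (W + (R + X)))"
  and nu: "!!l m. l \<in> L ==> m \<in> L ==> \<nu> (l + m) \<le> \<nu> l + \<nu> m" "!!l. l \<in> L ==> \<nu> (l + l) = 2 * \<nu> l"
   "!!l. l \<in> L ==> \<nu> (- l) = \<nu> l" "!!l. l \<in> L ==> 0 \<le> \<nu> l" "!!r. finite {l \<in> L. \<nu> l \<le> r}"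
  using L unfolding lattice_mod_def R_def by auto
 have X0: "0 \<in> X" by (rule sg_zero[OF X])
 have hX: "n = 0" if "h n \<in> X" for n
 proof (rule ccontr)
  assume n: "n \<noteq> 0"
  have "h (i * n) \<in> {0} + X" for i
   using sg_zm[OF X that, of i] unfolding h_def zm_mult by (auto intro!: set_plusI[of 0])
  then have "range (\<lambda>i. i * n) \<subseteq> {n. zm n f \<in> {0} + X}" unfolding h_def by blast
  moreover have "finite {n. zm n f \<in> {0} + X}" by (rule fin) simp
  ultimately have "finite (range (\<lambda>i::int. i * n))" by (rule finite_subset)
  moreover have "inj (\<lambda>i::int. i * n)" using n by (simp add: inj_on_def)
  ultimately show False using finite_imageD infinite_UNIV_int by blast
 qed
 have hRX: "h n + x \<in> R + X" if "x \<in> X" for n x using hR that by (rule set_plus_intro)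
 define \<phi> where "\<phi> p = fst p + h (snd p)" for p
 have inj: "inj_on \<phi> (L \<times> UNIV)"
 proof (rule inj_onI)
  fix p p' assume p: "p \<in> L \<times> UNIV" "p' \<in> L \<times> UNIV" "\<phi> p = \<phi> p'"
  obtain l n l' n' where eq: "p = (l, n)" "p' = (l', n')" by (cases p, cases p')
  have l: "l \<in> L" "l' \<in> L" using p eq by auto
  have e: "l - l' = h (n' - n)" using p(3) eq unfolding \<phi>_def hsub by (simp add: algebra_simps)
  then have "l - l' \<in> R + X" using hRX[OF X0, of "n' - n"] by simp
  then have "l - l' = 0" using LX sg_diff[OF gL l] by blast
  then have "n' - n = 0" using e X0 by (intro hX) simp
  then show "p = p'" using \<open>l - l' = 0\<close> eq by simp
 qed
 define p where "p = inv_into (L \<times> UNIV) \<phi>"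
 have p: "p (l + h n) = (l, n)" if "l \<in> L" for l n
 proof -
  have "p (\<phi> (l, n)) = (l, n)" unfolding p_def by (rule inv_into_f_f[OF inj]) (use that in auto)
  then show ?thesis by (simp add: \<phi>_def)
 qed
 define \<mu> where "\<mu> x = \<nu> (fst (p x)) + \<bar>real_of_int (snd (p x))\<bar>" for x
 have mu: "\<mu> (l + h n) = \<nu> l + \<bar>real_of_int n\<bar>" if "l \<in> L" for l n unfolding \<mu>_def p[OF that] by simp
 define L' where "L' = L + R"
 have L'E: "\<exists>l\<in>L. \<exists>n. x = l + h n" if "x \<in> L'" for x
  using that unfolding L'_def R_def h_def by (elim set_plusE) blast
 have "lattice_mod X L' \<mu>" unfolding lattice_mod_def
 proof (intro conjI allI impI ballI)
  show "add_subgroup L'" unfolding L'_def by (rule sg_plus[OF gL gR])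
  show "L' \<inter> X = {0}"
  proof
   show "L' \<inter> X \<subseteq> {0}"
   proof
    fix x assume x: "x \<in> L' \<inter> X"
    then obtain l n where ln: "l \<in> L" "x = l + h n" using L'E by blast
    have "l = h (- n) + x" using ln(2) hneg by simp
    then have "l \<in> R + X" using hRX x by blast
    then have "l = 0" using LX ln(1) by blast
    then have "n = 0" using x ln by (intro hX) simp
    then show "x \<in> {0}" using ln \<open>l = 0\<close> h0 by simp
   qed
   show "{0} \<subseteq> L' \<inter> X" using sg_zero[OF \<open>add_subgroup L'\<close>] X0 by simp
  qed
  fix W assume W: "compact (W :: 'k set)"
  define L0 where "L0 = L \<inter> (W + (R + X))"
  have "L' \<inter> (W + X) \<subseteq> (\<Union>l\<in>L0. (\<lambda>n. l + h n) ` {n. zm n f \<in> ({- l} + W) + X})"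
  proof
   fix x assume x: "x \<in> L' \<inter> (W + X)"
   then obtain l n where ln: "l \<in> L" "x = l + h n" using L'E by blast
   have "x \<in> W + X" using x by blast
   then obtain w y where wy: "w \<in> W" "y \<in> X" "x = w + y" by (rule set_plusE)
   have "l = w + (h (- n) + y)" using ln(2) wy(3) hneg by (simp add: algebra_simps)
   then have "l \<in> W + (R + X)" using wy(1) hRX[OF wy(2), of "- n"] by (metis set_plus_intro)
   then have "l \<in> L0" using ln(1) L0_def by blast
   moreover have "h n = (- l + w) + y" using ln(2) wy(3) by (simp add: algebra_simps)
   then have "zm n f \<in> ({- l} + W) + X" unfolding h_def[symmetric] using wy(1,2) by (metis set_plus_intro singletonI)
   ultimately show "x \<in> (\<Union>l\<in>L0. (\<lambda>n. l + h n) ` {n. zm n f \<in> ({- l} + W) + X})" using ln(2) by blast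
  qed
  moreover have "finite L0" unfolding L0_def by (rule Lfin[OF W])
  moreover have "finite {n. zm n f \<in> ({- l} + W) + X}" for l by (rule fin[OF compact_set_plus[OF _ W]]) simp
  ultimately show "finite (L' \<inter> (W + X))" by (meson finite_UN_I finite_imageI finite_subset)
 next
  fix x y assume "x \<in> L'" "y \<in> L'"
  then obtain l n l' n' where ln: "l \<in> L" "x = l + h n" "l' \<in> L" "y = l' + h n'" using L'E by meson
  have "x + y = (l + l') + h (n + n')" unfolding ln hadd by (simp add: algebra_simps)
  then have "\<mu> (x + y) = \<nu> (l + l') + \<bar>real_of_int (n + n')\<bar>" using mu[OF sg_add[OF gL ln(1,3)]] by simp
  also have "\<dots> \<le> (\<nu> l + \<nu> l') + (\<bar>real_of_int n\<bar> + \<bar>real_of_int n'\<bar>)" using nu(1)[OF ln(1,3)] by (intro add_mono) auto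
  finally show "\<mu> (x + y) \<le> \<mu> x + \<mu> y" unfolding ln(2,4) mu[OF ln(1)] mu[OF ln(3)] by simp
 next
  fix x assume "x \<in> L'"
  then obtain l n where ln: "l \<in> L" "x = l + h n" using L'E by meson
  have "x + x = (l + l) + h (n + n)" unfolding ln hadd by (simp add: algebra_simps)
  then have "\<mu> (x + x) = \<nu> (l + l) + \<bar>real_of_int (n + n)\<bar>" using mu[OF sg_add[OF gL ln(1,1)]] by simp
  then show "\<mu> (x + x) = 2 * \<mu> x" unfolding ln(2) mu[OF ln(1)] nu(2)[OF ln(1)] by simp
  have "- x = - l + h (- n)" unfolding ln hneg by simp
  then have "\<mu> (- x) = \<nu> (- l) + \<bar>real_of_int (- n)\<bar>" using mu[OF sg_neg[OF gL ln(1)]] by simp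
  then show "\<mu> (- x) = \<mu> x" unfolding ln(2) mu[OF ln(1)] nu(3)[OF ln(1)] by simp
  show "0 \<le> \<mu> x" unfolding ln(2) mu[OF ln(1)] using nu(4)[OF ln(1)] by simp
 next
  fix r
  have "{x \<in> L'. \<mu> x \<le> r} \<subseteq> \<phi> ` ({l \<in> L. \<nu> l \<le> r} \<times> {- \<lceil>r\<rceil>..\<lceil>r\<rceil>})"
  proof
   fix x assume x: "x \<in> {x \<in> L'. \<mu> x \<le> r}"
   then obtain l n where ln: "l \<in> L" "x = l + h n" using L'E by blast
   have "\<nu> l + \<bar>real_of_int n\<bar> \<le> r" using x ln mu[OF ln(1)] by simp
   then have "\<nu> l \<le> r" "\<bar>real_of_int n\<bar> \<le> r" using nu(4)[OF ln(1)] by linarith+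
   then have "n \<in> {- \<lceil>r\<rceil>..\<lceil>r\<rceil>}" by (simp add: abs_le_iff) linarith
   then show "x \<in> \<phi> ` ({l \<in> L. \<nu> l \<le> r} \<times> {- \<lceil>r\<rceil>..\<lceil>r\<rceil>})" using ln \<open>\<nu> l \<le> r\<close>
    by (intro image_eqI[of _ _ "(l, n)"]) (auto simp: \<phi>_def)
  qed
  then show "finite {x \<in> L'. \<mu> x \<le> r}" using nu(5) by (meson finite_SigmaI finite_atLeastAtMost_int finite_imageI finite_subset)
 qed
 then show ?thesis unfolding L'_def R_def by blast
qed

text \<open>Each generator either meets every compact set modulo \<open>X\<close> finitely often,
  and then extends the lattice, or is relatively compact modulo \<open>X\<close> by
  \<open>monothetic_dichotomy\<close>. In the second case the closure of its cyclic group plus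
  \<open>X\<close> replaces \<open>X\<close>, and is afterwards moved into the compact set
  \<open>V'\<close>. The induction therefore varies \<open>X\<close>.\<close>

lemma lattice_exists:
 fixes G :: "'k::{topological_ab_group_add, t2_space} set"
 assumes G: "lcg G" and X: "closed X" "add_subgroup X" "X \<subseteq> G" and fs: "set fs \<subseteq> G" and V: "compact V"
 shows "\<exists>L \<nu> V'. lattice_mod X L \<nu> \<and> compact V' \<and> V + zspan fs + X \<subseteq> V' + L + X"
 using X fs
proof (induction fs arbitrary: X)
 case Nil
 have "lattice_mod X {0} (\<lambda>_. 0)" unfolding lattice_mod_def using sg_zero[OF Nil(2)] by (auto simp: add_subgroup_def)
 then show ?case using V by (intro exI[of _ "{0}"] exI[of _ "\<lambda>_. 0"] exI[of _ V]) simp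
next
 case (Cons f fs)
 note X = Cons.prems(1-3)
 have gG: "add_subgroup G" "closed G" using G lcg_def by auto
 have f: "f \<in> G" "set fs \<subseteq> G" using Cons.prems(4) by auto
 define R where "R = range (\<lambda>n. zm n f)"
 have gR: "add_subgroup R" unfolding R_def by (rule sg_range_zm)
 have RG: "R \<subseteq> G" unfolding R_def using sg_zm[OF gG(1) f(1)] by blast
 have RXG: "R + X \<subseteq> G" by (rule sg_plus_subset[OF gG(1) RG X(3)])
 have gRX: "add_subgroup (R + X)" by (rule sg_plus[OF gR X(2)])
 have re: "V + zspan (f # fs) + X = V + zspan fs + (R + X)" unfolding R_def by (simp add: ac_simps)
 show ?case
 proof (cases "\<forall>W. compact W --> finite {n. zm n f \<in> W + X}")
  case True
  then have fin: "!!W. compact W ==> finite {n. zm n f \<in> W + X}" by blast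
  have "closed (R + X)" unfolding R_def by (rule proper_closed[OF G X f(1) fin])
  from Cons.IH[OF this gRX RXG f(2)] obtain L \<nu> V' where
   L: "lattice_mod (R + X) L \<nu>" "compact V'" "V + zspan fs + (R + X) \<subseteq> V' + L + (R + X)" by blast
  obtain \<nu>' where "lattice_mod X (L + R) \<nu>'" using lattice_extend[OF L(1)[unfolded R_def] X(2) fin] unfolding R_def by blast
  moreover have "V + zspan (f # fs) + X \<subseteq> V' + (L + R) + X" unfolding re using L(3) by (simp add: ac_simps)
  ultimately show ?thesis using L(2) by blast
 next
  case False
  then obtain W where W: "compact W" "infinite {n. zm n f \<in> W + X}" by blast
  have "cocpt X R" unfolding R_def by (rule monothetic_dichotomy[OF G X f(1) W])
  then have "cocpt X (R + X)" using cocpt_plus[OF _ cocpt_refl X(2)] by blast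
  then obtain V1 where V1: "compact V1" "R + X \<subseteq> V1 + X" unfolding cocpt_def by blast
  define X1 where "X1 = closure (R + X)"
  have X1V: "X1 \<subseteq> V1 + X" unfolding X1_def by (rule closure_minimal[OF V1(2) closed_compact_plus[OF V1(1) X(1)]])
  have RX1: "R + X \<subseteq> X1" unfolding X1_def by (rule closure_subset)
  have XX1: "X \<subseteq> X1" using RX1 set_plus_right[OF sg_zero[OF gR], of X] by blast
  have gX1: "add_subgroup X1" unfolding X1_def by (rule closure_add_subgroup[OF gRX])
  have "closed X1" unfolding X1_def by simp
  moreover have "X1 \<subseteq> G" unfolding X1_def by (rule closure_minimal[OF RXG gG(2)])
  ultimately obtain L \<nu> V' where L: "lattice_mod X1 L \<nu>" "compact V'" "V + zspan fs + X1 \<subseteq> V' + L + X1"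
   using Cons.IH[OF _ gX1 _ f(2)] by blast
  have "lattice_mod X L \<nu>"
  proof -
   have 1: "L \<inter> X1 = {0}" using L(1) unfolding lattice_mod_def by (elim conjE)
   have "0 \<in> L" "0 \<in> X" using 1 sg_zero[OF X(2)] by auto
   then have 2: "L \<inter> X = {0}" using 1 XX1 by blast
   have 3:  "finite (L \<inter> (W + X))" if "compact W" for W
   proof (rule finite_subset)
    show "L \<inter> (W + X) \<subseteq> L \<inter> (W + X1)" using set_plus_mono[OF order_refl XX1, of W] by blast
    show "finite (L \<inter> (W + X1))" using L(1) that unfolding lattice_mod_def by simp
   qed
   show ?thesis using L(1) unfolding lattice_mod_def by (simp add: 2 3)
  qed
  moreover have "compact (V' + V1)" by (rule compact_set_plus[OF L(2) V1(1)])
  moreover have "V + zspan (f # fs) + X \<subseteq> (V' + V1) + L + X"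
  proof -
   have "V + zspan (f # fs) + X \<subseteq> V + zspan fs + X1" unfolding re by (rule set_plus_mono[OF order_refl RX1])
   also have "\<dots> \<subseteq> V' + L + X1" by (rule L(3))
   also have "\<dots> \<subseteq> V' + L + (V1 + X)" by (rule set_plus_mono[OF order_refl X1V])
   finally show ?thesis by (simp add: ac_simps)
  qed
  ultimately show ?thesis by blast
 qed
qed

abbreviation dbl :: "nat => 'k::ab_group_add => 'k" where
 "dbl n \<equiv> (\<lambda>x. x + x) ^^ n"

lemma dbl_add: "dbl n (x + y) = dbl n x + dbl n (y::'k::ab_group_add)"
 by (induction n) (auto simp: algebra_simps)

lemma dbl_zero [simp]: "dbl n (0::'k::ab_group_add) = 0"
 by (induction n) auto

lemma dbl_neg: "dbl n (- x) = - dbl n (x::'k::ab_group_add)"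
 by (induction n) auto

lemma dbl_diff: "dbl n (x - y) = dbl n x - dbl n (y::'k::ab_group_add)"
 using dbl_add[of n x "- y"] dbl_neg[of n y] by simp

lemma dbl_mem: "add_subgroup B ==> x \<in> B ==> dbl n x \<in> B"
 by (induction n) (auto intro: sg_add)

lemma dbl_Suc2: "dbl (Suc n) x = dbl n (x + x)"
 by (simp only: funpow_Suc_right o_apply)

lemma dbl_cont: "continuous_on UNIV (dbl n :: 'k::topological_ab_group_add => 'k)"
proof (induction n)
 case (Suc n)
 have "continuous_on UNIV (\<lambda>x::'k. dbl n x + dbl n x)" by (intro continuous_on_add Suc)
 then show ?case by (simp add: o_def)
qed (simp add: id_def)

text \<open>A proper seminorm on \<open>B/X\<close>: its balls are compact modulo \<open>X\<close>,
  in particular its kernel is. Homogeneity is asked only for doubling, the one operator it is made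
  for.\<close>

locale qnorm =
 fixes X B :: "'k::{topological_ab_group_add, t2_space} set" and q :: "'k => real"
 assumes clX: "closed X" and gX: "add_subgroup X" and XB: "X \<subseteq> B" and clB: "closed B" and gB: "add_subgroup B"
  and q_ge0: "x \<in> B ==> 0 \<le> q x"
  and q_add: "x \<in> B ==> y \<in> B ==> q (x + y) \<le> q x + q y"
  and q_dbl: "x \<in> B ==> q (x + x) = 2 * q x"
  and q_neg: "x \<in> B ==> q (- x) = q x"
  and q_X: "x \<in> X ==> q x = 0"
  and q_cpt: "cocpt X {x \<in> B. q x \<le> r}"
  and q_small: "0 < e ==> \<exists>U. nb U \<and> (\<forall>x\<in>U \<inter> B. q x < e)"

text \<open>Rounding to a lattice of B modulo X is additive up to a bounded error, so the norm of the rounded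
 point, homogenised along powers of 2, is a seminorm.\<close>

lemma qnorm_exists:
 fixes G :: "'k::{topological_ab_group_add, t2_space} set"
 assumes G: "lcg G" and X: "closed X" "add_subgroup X" "X \<subseteq> G"
 obtains B q where "qnorm X B q" "B \<subseteq> G" "omod B G"
proof -
 have gG: "add_subgroup G" "closed G" using G unfolding lcg_def by auto
 obtain U V where UV: "nb U" "compact V" "V \<subseteq> G" "0 \<in> V" "!!v. v \<in> V ==> - v \<in> V" "U \<inter> G \<subseteq> V" using lcg_nbhd[OF G] by metis
 have VV: "V + V \<subseteq> G" by (rule sg_plus_subset[OF gG(1) UV(3) UV(3)])
 \<comment> \<open>\<open>V + V\<close> lies within \<open>V\<close> of the finite set
   \<open>F\<close>, so adding the group generated by \<open>F\<close> and the subgroup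
   \<open>X\<close> to \<open>V\<close> gives an open subgroup of \<open>G\<close> that is compact
   modulo a finitely generated group and \<open>X\<close>.\<close>
 obtain F where F: "finite F" "F \<subseteq> V + V" "V + V \<subseteq> F + U"
  using compact_finite_translates[OF compact_set_plus[OF UV(2) UV(2)] UV(1)] .
 obtain fs where fs: "set fs = F" using finite_list[OF F(1)] by blast
 have VVF: "\<exists>f\<in>F. x - f \<in> V" if x: "x \<in> V + V" for x
 proof -
  obtain f u where f: "f \<in> F" "u \<in> U" "x = f + u" using subsetD[OF F(3) x] by (rule set_plusE)
  have "x - f \<in> G" using sg_diff[OF gG(1)] x f(1) F(2) VV by blast
  then have "u \<in> U \<inter> G" using f by simp
  then show ?thesis using f UV(6) by (intro bexI[of _ f]) auto
 qed
 define Z where "Z = zspan fs + X"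
 have gZ: "add_subgroup Z" unfolding Z_def by (rule sg_plus[OF zspan_subgroup X(2)])
 have FZ: "f \<in> Z" if "f \<in> F" for f
  using zspan_contains[of f fs] fs that set_plus_left[OF sg_zero[OF X(2)], of "zspan fs"] unfolding Z_def by blast
 have XZ: "X \<subseteq> Z" unfolding Z_def by (rule set_plus_right[OF sg_zero[OF zspan_subgroup]])
 have ZG: "Z \<subseteq> G" unfolding Z_def using zspan_subset[OF gG(1), of fs] fs F(2) VV X(3) by (intro sg_plus_subset[OF gG(1)]) auto
 define B where "B = V + Z"
 have BG: "B \<subseteq> G" unfolding B_def by (rule sg_plus_subset[OF gG(1) UV(3) ZG])
 have gB: "add_subgroup B" unfolding B_def
 proof (rule sg_plusI[OF gZ UV(4)])
  fix v assume v: "v \<in> V"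
  show "- v \<in> V + Z" by (rule set_plusI[OF UV(5)[OF v] sg_zero[OF gZ]]) simp
  fix w assume w: "w \<in> V"
  obtain f where f: "f \<in> F" "v + w - f \<in> V" using VVF[OF set_plus_intro[OF v w]] by blast
  show "v + w \<in> V + Z" by (rule set_plusI[OF f(2) FZ[OF f(1)]]) simp
 qed
 have VB: "V \<subseteq> B" unfolding B_def by (rule set_plus_left[OF sg_zero[OF gZ]])
 have XB: "X \<subseteq> B" unfolding B_def using set_plus_right[OF UV(4), of Z] XZ by blast
 have oB: "omod B G" unfolding omod_def using UV(1,6) VB by blast
 have clB: "closed B" by (rule omod_closed[OF oB gG(2) gB gG(1) BG])
 have fsG: "set fs \<subseteq> G" using fs F(2) VV by blast
 obtain L \<nu> V' where L: "lattice_mod X L \<nu>" "compact V'" "V + zspan fs + X \<subseteq> V' + L + X"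
  using lattice_exists[OF G X fsG UV(2)] by blast
 have gL: "add_subgroup L" and Lfin: "!!W. compact W ==> finite (L \<inter> (W + X))"
  and nu: "!!l m. l \<in> L ==> m \<in> L ==> \<nu> (l + m) \<le> \<nu> l + \<nu> m" "!!l. l \<in> L ==> \<nu> (l + l) = 2 * \<nu> l"
   "!!l. l \<in> L ==> \<nu> (- l) = \<nu> l" "!!l. l \<in> L ==> 0 \<le> \<nu> l" "!!r. finite {l \<in> L. \<nu> l \<le> r}"
  using L unfolding lattice_mod_def by auto
 have fbd: "\<exists>c. \<forall>d\<in>L \<inter> (W + X). \<nu> d \<le> c" if "compact W" for W
 proof -
  have "bdd_above (\<nu> ` (L \<inter> (W + X)))" using Lfin[OF that] by simp
  then show ?thesis unfolding bdd_above_def by blast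
 qed
 define Q where "Q = insert 0 (V' \<union> uminus ` V')"
 have Q: "compact Q" "0 \<in> Q" "!!x. x \<in> Q ==> - x \<in> Q"
  unfolding Q_def using L(2) compact_uminus_image[OF L(2)] by (auto intro!: compact_insert compact_Un)
 have "\<exists>l\<in>L. x - l \<in> Q + X" if x: "x \<in> B" for x
 proof -
  have "x \<in> V + zspan fs + X" using x unfolding B_def Z_def by (simp add: add.assoc)
  then have "x \<in> V' + L + X" using L(3) by blast
  then obtain w y where w: "w \<in> V' + L" "y \<in> X" "x = w + y" by (rule set_plusE)
  obtain v l where v: "v \<in> V'" "l \<in> L" "w = v + l" using w(1) by (rule set_plusE)
  have "v \<in> Q" using v(1) Q_def by blast
  then have "x - l \<in> Q + X" by (rule set_plusI[OF _ w(2)]) (simp add: w v)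
  then show ?thesis using v(2) by blast
 qed
 \<comment> \<open>\<open>r\<close> rounds to the lattice. The error set \<open>Q\<close> is
   symmetric and contains zero so that up to three errors, with signs, fit into
   \<open>Q + Q + Q\<close>.\<close>
 then obtain r where r: "!!x. x \<in> B ==> r x \<in> L" "!!x. x \<in> B ==> x - r x \<in> Q + X" by metis
 have QXneg: "- x \<in> Q + X" if x: "x \<in> Q + X" for x
 proof -
  obtain a b where ab: "a \<in> Q" "b \<in> X" "x = a + b" using x by (rule set_plusE)
  show ?thesis by (rule set_plusI[OF Q(3)[OF ab(1)] sg_neg[OF X(2) ab(2)]]) (simp add: ab)
 qed
 have QX3: "x + y + z \<in> (Q + Q + Q) + X" if xyz: "x \<in> Q + X" "y \<in> Q + X" "z \<in> Q + X" for x y z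
 proof -
  obtain a b where 1: "a \<in> Q" "b \<in> X" "x = a + b" using xyz(1) by (rule set_plusE)
  obtain a' b' where 2: "a' \<in> Q" "b' \<in> X" "y = a' + b'" using xyz(2) by (rule set_plusE)
  obtain a'' b'' where 3: "a'' \<in> Q" "b'' \<in> X" "z = a'' + b''" using xyz(3) by (rule set_plusE)
  have "a + a' + a'' \<in> Q + Q + Q" by (intro set_plus_intro 1 2 3)
  moreover have "b + b' + b'' \<in> X" by (intro sg_add[OF X(2)] 1 2 3)
  ultimately show ?thesis by (rule set_plusI) (simp add: 1 2 3)
 qed
 have QX0: "0 \<in> Q + X" by (rule set_plusI[OF Q(2) sg_zero[OF X(2)]]) simp
 \<comment> \<open>Only finitely many lattice points lie in the threefold error set;
   \<open>c\<close> bounds their norms and hence the failure of \<open>lr\<close> to be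
   additive.\<close>
 obtain c where c: "!!d. d \<in> L ==> d \<in> (Q + Q + Q) + X ==> \<nu> d \<le> c"
  using fbd[OF compact_set_plus[OF compact_set_plus[OF Q(1) Q(1)] Q(1)]] by blast
 have c0: "0 \<le> c"
 proof -
  have "\<nu> 0 \<le> c" using c[OF sg_zero[OF gL]] QX3[OF QX0 QX0 QX0] by simp
  then show ?thesis using nu(4)[OF sg_zero[OF gL]] by linarith
 qed
 define lr where "lr x = \<nu> (r x)" for x
 have l0: "0 \<le> lr x" if "x \<in> B" for x unfolding lr_def by (rule nu(4)[OF r(1)[OF that]])
 have radd: "\<exists>d\<in>L. \<nu> d \<le> c \<and> r (x + y) = r x + r y + d" if xy: "x \<in> B" "y \<in> B" for x y
 proof -
  define d where "d = r (x + y) - (r x + r y)"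
  have xyB: "x + y \<in> B" by (rule sg_add[OF gB xy])
  have "d = - (x + y - r (x + y)) + (x - r x) + (y - r y)" unfolding d_def by simp
  then have "d \<in> (Q + Q + Q) + X" using QX3[OF QXneg[OF r(2)[OF xyB]] r(2)[OF xy(1)] r(2)[OF xy(2)]] by simp
  moreover have dL: "d \<in> L" unfolding d_def by (intro sg_diff[OF gL] sg_add[OF gL] r xy xyB)
  ultimately show ?thesis using c[OF dL] by (intro bexI[of _ d]) (auto simp: d_def)
 qed
 have ladd: "lr (x + y) \<le> lr x + lr y + c" if xy: "x \<in> B" "y \<in> B" for x y
 proof -
  obtain d where d: "d \<in> L" "\<nu> d \<le> c" "r (x + y) = r x + r y + d" using radd[OF xy] by blast
  have "\<nu> (r x + r y + d) \<le> \<nu> (r x) + \<nu> (r y) + \<nu> d"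
   using nu(1)[OF sg_add[OF gL r(1)[OF xy(1)] r(1)[OF xy(2)]] d(1)] nu(1)[OF r(1)[OF xy(1)] r(1)[OF xy(2)]] by linarith
  then show ?thesis unfolding lr_def d(3) using d(2) by linarith
 qed
 have ldbl: "2 * lr x - c \<le> lr (x + x)" if x: "x \<in> B" for x
 proof -
  obtain d where d: "d \<in> L" "\<nu> d \<le> c" "r (x + x) = r x + r x + d" using radd[OF x x] by blast
  have rr: "r x + r x + d \<in> L" by (intro sg_add[OF gL] r x d)
  have "2 * \<nu> (r x) = \<nu> (r x + r x)" using nu(2)[OF r(1)[OF x]] by simp
  also have "\<dots> = \<nu> ((r x + r x + d) + - d)" by simp
  also have "\<dots> \<le> \<nu> (r x + r x + d) + \<nu> d" using nu(1)[OF rr sg_neg[OF gL d(1)]] nu(3)[OF d(1)] by simp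
  finally show ?thesis unfolding lr_def d(3) using d(2) by linarith
 qed
 have lneg: "lr (- x) \<le> lr x + c" if x: "x \<in> B" for x
 proof -
  have mx: "- x \<in> B" by (rule sg_neg[OF gB x])
  define d where "d = r (- x) + r x"
  have "d = - (- x - r (- x)) + - (x - r x) + 0" unfolding d_def by simp
  then have "d \<in> (Q + Q + Q) + X" using QX3[OF QXneg[OF r(2)[OF mx]] QXneg[OF r(2)[OF x]] QX0] by simp
  moreover have dL: "d \<in> L" unfolding d_def by (intro sg_add[OF gL] r x mx)
  ultimately have "\<nu> d \<le> c" by (rule c[rotated])
  moreover have "\<nu> (r (- x)) = \<nu> (d + - r x)" unfolding d_def by simp
  moreover have "\<nu> (d + - r x) \<le> \<nu> d + \<nu> (r x)"
   using nu(1)[OF dL sg_neg[OF gL r(1)[OF x]]] nu(3)[OF r(1)[OF x]] by simp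
  ultimately show ?thesis unfolding lr_def by linarith
 qed
 have lX: "lr x \<le> c" if x: "x \<in> X" for x
 proof -
  have xB: "x \<in> B" using x XB by blast
  have "x \<in> Q + X" using set_plus_right[OF Q(2), of X] x by blast
  then have "- (x - r x) + x + 0 \<in> (Q + Q + Q) + X" by (intro QX3 QX0 QXneg r(2) xB)
  then show ?thesis unfolding lr_def by (intro c r xB) simp
 qed
 define a where "a n x = lr (dbl n x) / 2 ^ n" for n x
 have dB: "dbl n x \<in> B" if "x \<in> B" for n x by (rule dbl_mem[OF gB that])
 \<comment> \<open>Each doubling halves the contribution of \<open>c\<close>: adding
   \<open>c / 2 ^ n\<close> to \<open>a n x\<close> gives a decreasing sequence, subtracting it an
   increasing one. The first proves convergence, and together they pin \<open>q\<close> to within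
   \<open>c\<close> of \<open>lr\<close>.\<close>
 have up: "a (Suc n) x + c / 2 ^ Suc n \<le> a n x + c / 2 ^ n" if x: "x \<in> B" for n x
  using mult_left_mono[OF ladd[OF dB[OF x, of n] dB[OF x, of n]], of "2 ^ n"] unfolding a_def by (simp add: field_simps)
 have dn: "a n x - c / 2 ^ n \<le> a (Suc n) x - c / 2 ^ Suc n" if x: "x \<in> B" for n x
  using mult_left_mono[OF ldbl[OF dB[OF x, of n]], of "2 ^ n"] unfolding a_def by (simp add: field_simps)
 have a0: "0 \<le> a n x" if "x \<in> B" for n x unfolding a_def using l0[OF dB[OF that]] by simp
 have c2: "(\<lambda>n. k / 2 ^ n) \<longlonglongrightarrow> 0" for k :: real
  by (rule LIMSEQ_divide_realpow_zero) simp
 define q where "q x = lim (\<lambda>n. a n x)" for x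
 have lq: "(\<lambda>n. a n x) \<longlonglongrightarrow> q x" if x: "x \<in> B" for x
 proof -
  have d: "decseq (\<lambda>n. a n x + c / 2 ^ n)" by (rule decseq_SucI) (rule up[OF x])
  have b: "\<forall>n. 0 \<le> a n x + c / 2 ^ n" using a0[OF x] c0 by simp
  obtain l where "(\<lambda>n. a n x + c / 2 ^ n) \<longlonglongrightarrow> l" using decseq_convergent[OF d b] by blast
  then have "(\<lambda>n. a n x + c / 2 ^ n - c / 2 ^ n) \<longlonglongrightarrow> l - 0" by (intro tendsto_diff c2)
  then have "(\<lambda>n. a n x) \<longlonglongrightarrow> l" by simp
  then show ?thesis unfolding q_def by (simp add: limI)
 qed
 have qle: "q x \<le> lr x + c" if x: "x \<in> B" for x
 proof -
  have d: "decseq (\<lambda>n. a n x + c / 2 ^ n)" by (rule decseq_SucI) (rule up[OF x])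
  have "(\<lambda>n. a n x + c / 2 ^ n) \<longlonglongrightarrow> q x + 0" by (intro tendsto_add c2 lq x)
  from decseq_ge[OF d this, of 0] show ?thesis by (simp add: a_def)
 qed
 have qge: "lr x - c \<le> q x" if x: "x \<in> B" for x
 proof -
  have d: "incseq (\<lambda>n. a n x - c / 2 ^ n)" by (rule incseq_SucI) (rule dn[OF x])
  have "(\<lambda>n. a n x - c / 2 ^ n) \<longlonglongrightarrow> q x - 0" by (intro tendsto_diff c2 lq x)
  from incseq_le[OF d this, of 0] show ?thesis by (simp add: a_def)
 qed
 have qdbl: "q (x + x) = 2 * q x" if x: "x \<in> B" for x
 proof -
  have "a n (x + x) = 2 * a (Suc n) x" for n unfolding a_def dbl_Suc2 by simp
  moreover have "(\<lambda>n. 2 * a (Suc n) x) \<longlonglongrightarrow> 2 * q x" by (intro tendsto_mult tendsto_const LIMSEQ_Suc[OF lq[OF x]])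
  ultimately show ?thesis using LIMSEQ_unique[OF lq[OF sg_add[OF gB x x]]] by simp
 qed
 have qd: "q (dbl n x) = 2 ^ n * q x" if x: "x \<in> B" for n x
  by (induction n) (auto simp: qdbl[OF dB[OF x]])
 have "qnorm X B q"
 proof
  show "closed X" "add_subgroup X" "X \<subseteq> B" "closed B" "add_subgroup B" by fact+
  fix x assume x: "x \<in> B"
  show "0 \<le> q x" by (rule LIMSEQ_le_const[OF lq[OF x]]) (use a0[OF x] in blast)
  show "q (x + x) = 2 * q x" by (rule qdbl[OF x])
  have neg: "q (- y) \<le> q y" if y: "y \<in> B" for y
  proof (rule LIMSEQ_le[OF lq[OF sg_neg[OF gB y]]])
   show "(\<lambda>n. a n y + c / 2 ^ n) \<longlonglongrightarrow> q y" using tendsto_add[OF lq[OF y] c2[of c]] by simp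
   have "a n (- y) \<le> a n y + c / 2 ^ n" for n
    using lneg[OF dB[OF y, of n]] unfolding a_def dbl_neg by (simp add: field_simps)
   then show "\<exists>N. \<forall>n\<ge>N. a n (- y) \<le> a n y + c / 2 ^ n" by blast
  qed
  show "q (- x) = q x" using neg[OF x] neg[OF sg_neg[OF gB x]] by simp
  fix y assume y: "y \<in> B"
  show "q (x + y) \<le> q x + q y"
  proof (rule LIMSEQ_le[OF lq[OF sg_add[OF gB x y]]])
   show "(\<lambda>n. a n x + a n y + c / 2 ^ n) \<longlonglongrightarrow> q x + q y" using tendsto_add[OF tendsto_add[OF lq[OF x] lq[OF y]] c2[of c]] by simp
   have "a n (x + y) \<le> a n x + a n y + c / 2 ^ n" for n
    using ladd[OF dB[OF x, of n] dB[OF y, of n]] unfolding a_def dbl_add by (simp add: field_simps)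
   then show "\<exists>N. \<forall>n\<ge>N. a n (x + y) \<le> a n x + a n y + c / 2 ^ n" by blast
  qed
 next
  fix x assume x: "x \<in> X"
  then have xB: "x \<in> B" using XB by blast
  have "q x \<le> 0"
  proof (rule LIMSEQ_le[OF lq[OF xB] c2])
   have "a n x \<le> c / 2 ^ n" for n using lX[OF dbl_mem[OF X(2) x, of n]] unfolding a_def by (simp add: field_simps)
   then show "\<exists>N. \<forall>n\<ge>N. a n x \<le> c / 2 ^ n" by blast
  qed
  moreover have "0 \<le> q x" by (rule LIMSEQ_le_const[OF lq[OF xB]]) (use a0[OF xB] in blast)
  ultimately show "q x = 0" by simp
 next
  fix e :: real
  have "{x \<in> B. q x \<le> e} \<subseteq> ({l \<in> L. \<nu> l \<le> e + c} + Q) + X"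
  proof
   fix x assume "x \<in> {x \<in> B. q x \<le> e}"
   then have x: "x \<in> B" "q x \<le> e" by auto
   then have "\<nu> (r x) \<le> e + c" using qge[OF x(1)] unfolding lr_def by linarith
   then have 1: "r x \<in> {l \<in> L. \<nu> l \<le> e + c}" using r(1)[OF x(1)] by blast
   have "x \<in> {l \<in> L. \<nu> l \<le> e + c} + (Q + X)" by (rule set_plusI[OF 1 r(2)[OF x(1)]]) simp
   then show "x \<in> ({l \<in> L. \<nu> l \<le> e + c} + Q) + X" by (simp add: add.assoc)
  qed
  moreover have "compact ({l \<in> L. \<nu> l \<le> e + c} + Q)" by (rule compact_set_plus[OF finite_imp_compact[OF nu(5)] Q(1)])
  ultimately show "cocpt X {x \<in> B. q x \<le> e}" unfolding cocpt_def by blast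
 next
  fix e :: real assume e: "0 < e"
  obtain c' where c': "!!d. d \<in> L ==> d \<in> (V + Q) + X ==> \<nu> d \<le> c'" using fbd[OF compact_set_plus[OF UV(2) Q(1)]] by blast
  have qV: "q v \<le> c' + c" if v: "v \<in> V" for v
  proof -
   have vB: "v \<in> B" using v VB by blast
   have "r v \<in> V + (Q + X)" by (rule set_plusI[OF v QXneg[OF r(2)[OF vB]]]) simp
   then have "lr v \<le> c'" unfolding lr_def by (intro c' r vB) (simp add: add.assoc)
   then show ?thesis using qle[OF vB] by linarith
  qed
  \<comment> \<open>On \<open>V\<close> the seminorm is at most \<open>c' + c\<close>. A point whose
    \<open>2 ^ n\<close>-fold multiple still lies in \<open>V\<close> has norm smaller by the factor
    \<open>2 ^ n\<close>.\<close>
  obtain n :: nat where "(c' + c) / e < 2 ^ n" using real_arch_pow[of 2 "(c' + c) / e"] by auto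
  then have n: "c' + c < 2 ^ n * e" using e by (simp add: field_simps)
  have "nb {x. dbl n x \<in> U}" by (rule nb_vimage[OF dbl_cont dbl_zero UV(1)])
  moreover have "q x < e" if x: "x \<in> {x. dbl n x \<in> U} \<inter> B" for x
  proof -
   have "dbl n x \<in> V" using x UV(6) dB[of x n] BG by blast
   then have "q (dbl n x) \<le> c' + c" by (rule qV)
   moreover have "q (dbl n x) = 2 ^ n * q x" using x by (intro qd) blast
   ultimately have "2 ^ n * q x < 2 ^ n * e" using n by linarith
   then show ?thesis by simp
  qed
  ultimately show "\<exists>U. nb U \<and> (\<forall>x\<in>U \<inter> B. q x < e)" by blast
 qed
 then show ?thesis using that BG oB by blast
qed

context qnorm
begin

lemma q_rev: "x \<in> B ==> y \<in> B ==> q x \<le> q y + q (x - y)"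
 using q_add[of y "x - y"] sg_diff[OF gB] by simp

lemma q_sym: "x \<in> B ==> y \<in> B ==> q (x - y) = q (y - x)"
 using q_neg[of "x - y"] sg_diff[OF gB] by simp

lemma q_cong: assumes "x \<in> B" "y \<in> B" "q (x - y) = 0" shows "q x = q y"
 using q_rev[OF assms(1,2)] q_rev[OF assms(2,1)] q_sym[OF assms(1,2)] assms(3) by simp

lemma q_tri: "x \<in> B ==> y \<in> B ==> z \<in> B ==> q (x - z) \<le> q (x - y) + q (y - z)"
 using q_add[of "x - y" "y - z"] sg_diff[OF gB] by simp

lemma q_0: "q 0 = 0"
 using q_X[OF sg_zero[OF gX]] .

lemma q_dbln: "x \<in> B ==> q (dbl n x) = 2 ^ n * q x"
 by (induction n) (auto simp: q_dbl[OF dbl_mem[OF gB]])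

lemma near:
 assumes "!!U. nb U ==> \<exists>y\<in>S. x - y \<in> U" "S \<subseteq> B"
 shows "x \<in> B" "0 < e ==> \<exists>y\<in>S. q (x - y) < e"
proof -
 have "x \<in> closure S" by (rule closureI_nb[OF assms(1)])
 then show xB: "x \<in> B" using closure_minimal[OF assms(2) clB] by blast
 assume "0 < e"
 then obtain U where U: "nb U" "\<forall>x\<in>U \<inter> B. q x < e" using q_small by blast
 obtain y where y: "y \<in> S" "x - y \<in> U" using assms(1)[OF U(1)] by blast
 have "x - y \<in> B" using sg_diff[OF gB xB] y assms(2) by blast
 then show "\<exists>y\<in>S. q (x - y) < e" using y U(2) by blast
qed

lemma closed_le: "closed {x \<in> B. q x \<le> r}"
proof (rule closedI_nb)
 fix x assume h: "!!U. nb U ==> \<exists>y\<in>{x \<in> B. q x \<le> r}. x - y \<in> U"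
 have xB: "x \<in> B" and e: "!!e. 0 < e ==> \<exists>y\<in>{x \<in> B. q x \<le> r}. q (x - y) < e" using near[OF h] by auto
 have "q x \<le> r + d" if d: "0 < d" for d
 proof -
  obtain y where "y \<in> B" "q y \<le> r" "q (x - y) < d" using e[OF d] by auto
  then show ?thesis using q_rev[OF xB, of y] by linarith
 qed
 then show "x \<in> {x \<in> B. q x \<le> r}" using xB field_le_epsilon by blast
qed

lemma closed_ge: "closed {x \<in> B. r \<le> q x}"
proof (rule closedI_nb)
 fix x assume h: "!!U. nb U ==> \<exists>y\<in>{x \<in> B. r \<le> q x}. x - y \<in> U"
 have xB: "x \<in> B" and e: "!!e. 0 < e ==> \<exists>y\<in>{x \<in> B. r \<le> q x}. q (x - y) < e" using near[OF h] by auto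
 have "r \<le> q x + d" if d: "0 < d" for d
 proof -
  obtain y where "y \<in> B" "r \<le> q y" "q (x - y) < d" using e[OF d] by auto
  then show ?thesis using q_rev[of y x] xB q_sym[of x y] by linarith
 qed
 then show "x \<in> {x \<in> B. r \<le> q x}" using xB field_le_epsilon by blast
qed

lemma closed_ge_translate: assumes "l \<in> B" shows "closed {x \<in> B. r \<le> q (x - l)}"
proof -
 have "{x \<in> B. r \<le> q (x - l)} = B \<inter> {x. x - l \<in> {x \<in> B. r \<le> q x}}"
  using sg_diff[OF gB _ assms] by blast
 then show ?thesis using closed_Int[OF clB closed_translate_vimage(1)[OF closed_ge]] by simp
qed

lemma closed_le_dbl: assumes "x \<in> B" shows "closed {z \<in> B. q (x - dbl n z) \<le> e}"
proof -
 have "{z \<in> B. q (x - dbl n z) \<le> e} = B \<inter> (\<lambda>z. x - dbl n z) -` {x \<in> B. q x \<le> e}"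
  using sg_diff[OF gB assms dbl_mem[OF gB]] by auto
 moreover have "closed ((\<lambda>z. x - dbl n z) -` {x \<in> B. q x \<le> e})"
  by (rule closed_vimage[OF closed_le]) (intro continuous_on_diff continuous_on_const dbl_cont)
 ultimately show ?thesis using closed_Int[OF clB] by simp
qed

section \<open>The kernel of the seminorm and the part divisible by powers of 2\<close>

definition ker :: "'k set" where "ker = {x \<in> B. q x = 0}"

lemma ker_iff: "x \<in> ker \<longleftrightarrow> x \<in> B \<and> q x = 0"
 by (simp add: ker_def)

lemma ker_le: "ker = {x \<in> B. q x \<le> 0}"
 unfolding ker_def using q_ge0 by force

lemma closed_ker: "closed ker" unfolding ker_le by (rule closed_le)

lemma cocpt_ker: "cocpt X ker" unfolding ker_le by (rule q_cpt)

lemma ker_subset: "ker \<subseteq> B" "X \<subseteq> ker" unfolding ker_def using XB q_X by auto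

lemma ker_subgroup: "add_subgroup ker"
 unfolding add_subgroup_def
proof (intro conjI ballI)
 show "0 \<in> ker" using ker_subset(2) sg_zero[OF gX] by blast
 fix x assume x: "x \<in> ker"
 then show "- x \<in> ker" using q_neg sg_neg[OF gB] by (simp add: ker_iff)
 fix y assume y: "y \<in> ker"
 show "x + y \<in> ker" using q_add[of x y] q_ge0[of "x + y"] sg_add[OF gB, of x y] x y by (simp add: ker_iff)
qed

lemma q_ker: "x \<in> B ==> y \<in> ker ==> q (x - y) = q x"
 by (rule q_cong) (auto simp: ker_iff q_neg intro: sg_diff[OF gB])

text \<open>The balls shrink to \<open>ker\<close> and are compact modulo it, so one of them is
  close to it. Together with \<open>q_small\<close> this says that \<open>q\<close> defines the
  topology of \<open>B/ker\<close>.\<close>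

lemma small_ball: assumes "nb U" shows "\<exists>e>0. {x \<in> B. q x \<le> e} \<subseteq> U + ker"
proof -
 define A where "A k = {x \<in> B. q x \<le> 1 / real (Suc k)}" for k
 have dec: "A (Suc k) \<subseteq> A k" for k
 proof -
  have "1 / real (Suc (Suc k)) \<le> 1 / real (Suc k)" by (intro divide_left_mono) auto
  then show ?thesis unfolding A_def by auto
 qed
 have "\<Inter>(range A) \<subseteq> ker"
 proof
  fix x assume x: "x \<in> \<Inter>(range A)"
  then have xB: "x \<in> B" unfolding A_def by blast
  have "q x \<le> 0"
  proof (rule ccontr)
   assume "\<not> q x \<le> 0"
   then obtain k where "1 / real (Suc k) < q x" using nat_approx_posE[of "q x"] by force
   moreover have "x \<in> A k" using x by blast
   ultimately show False unfolding A_def by simp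
  qed
  then show "x \<in> ker" unfolding ker_le using xB by blast
 qed
 then have int: "\<Inter>(range A) \<subseteq> U + ker" using set_plus_right[of U ker] assms by blast
 have "\<exists>S\<in>range A. S \<subseteq> U + ker"
 proof (rule cocpt_directed_subset[OF directed_down_range[of A, OF dec] rangeI[of A 0] _ _ _ ker_subgroup assms int])
  show "cocpt ker (A 0)" unfolding A_def by (rule cocpt_mono[OF q_cpt ker_subset(2) order_refl])
  fix S assume S: "S \<in> range A"
  then obtain k where k: "S = A k" by blast
  show "closed S" unfolding k A_def by (rule closed_le)
  fix s x assume "s \<in> S" "x \<in> ker"
  then show "s - x \<in> S" unfolding k A_def using q_ker[of s x] sg_diff[OF gB, of s x] by (auto simp: ker_iff)
 qed
 then obtain k where "A k \<subseteq> U + ker" by blast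
 then show ?thesis unfolding A_def by (intro exI[of _ "1 / real (Suc k)"]) simp
qed

lemma bounded_on_compact: assumes "compact W" shows "\<exists>M\<ge>0. \<forall>w\<in>W \<inter> B. q w \<le> M"
proof -
 obtain U where U: "nb U" "\<forall>x\<in>U \<inter> B. q x < 1" using q_small[of 1] by auto
 obtain F where F: "finite F" "F \<subseteq> W \<inter> B" "W \<inter> B \<subseteq> F + U"
  using compact_finite_translates[OF compact_Int_closed[OF assms clB] U(1)] .
 have "q w \<le> (\<Sum>f\<in>F. q f) + 1" if w: "w \<in> W \<inter> B" for w
 proof -
  obtain f u where f: "f \<in> F" "u \<in> U" "w = f + u" using subsetD[OF F(3) w] by (rule set_plusE)
  have fB: "f \<in> B" using f F(2) by blast
  have "w - f \<in> B" using w by (intro sg_diff[OF gB _ fB]) blast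
  then have "q (w - f) < 1" using U(2) f by simp
  moreover have "q f \<le> (\<Sum>f\<in>F. q f)" by (rule member_le_sum[OF f(1) _ F(1)]) (use F(2) q_ge0 in blast)
  ultimately show ?thesis using q_rev[of w f] w fB by force
 qed
 moreover have "0 \<le> (\<Sum>f\<in>F. q f) + 1" using sum_nonneg[of F q] F(2) q_ge0 by (simp add: subset_iff)
 ultimately show ?thesis by blast
qed

text \<open>In the model where \<open>B/ker\<close> is a real vector group times a lattice, the
  lattice part dies in the intersection \<open>divp\<close> of the \<open>Dn n\<close>, and the
  vector group remains.\<close>

definition Dn :: "nat => 'k set" where "Dn n = {x \<in> B. \<exists>z\<in>B. q (x - dbl n z) = 0}"

definition divp :: "'k set" where "divp = (\<Inter>n. Dn n)"

lemma Dn_subset: "Dn n \<subseteq> B" unfolding Dn_def by blast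

lemma Dn_dec: "Dn (Suc n) \<subseteq> Dn n"
 unfolding Dn_def using sg_add[OF gB] by (auto simp: dbl_Suc2 simp del: funpow.simps)

lemma Dn_mono: "n \<le> m ==> Dn m \<subseteq> Dn n"
 by (rule lift_Suc_antimono_le[of Dn, OF Dn_dec])

lemma dbl_Dn: "z \<in> B ==> dbl n z \<in> Dn n"
 unfolding Dn_def using dbl_mem[OF gB] q_0 by (intro CollectI conjI bexI[of _ z]) auto

lemma ker_Dn: "ker \<subseteq> Dn n"
 unfolding Dn_def using sg_zero[OF gB] by (auto simp: ker_iff intro!: bexI[of _ 0])

lemma Dn_subgroup: "add_subgroup (Dn n)"
 unfolding add_subgroup_def
proof (intro conjI ballI)
 show "0 \<in> Dn n" using ker_Dn sg_zero[OF ker_subgroup] by blast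
 fix x assume "x \<in> Dn n"
 then obtain z where x: "x \<in> B" "z \<in> B" "x - dbl n z \<in> ker"
  unfolding Dn_def ker_iff using sg_diff[OF gB _ dbl_mem[OF gB]] by blast
 have "- x - dbl n (- z) \<in> ker" using sg_neg[OF ker_subgroup x(3)] by (simp add: dbl_neg)
 then show "- x \<in> Dn n" unfolding Dn_def ker_iff using sg_neg[OF gB] x by blast
 fix y assume "y \<in> Dn n"
 then obtain z' where y: "y \<in> B" "z' \<in> B" "y - dbl n z' \<in> ker"
  unfolding Dn_def ker_iff using sg_diff[OF gB _ dbl_mem[OF gB]] by blast
 have "x + y - dbl n (z + z') = (x - dbl n z) + (y - dbl n z')" by (simp add: dbl_add)
 then have "x + y - dbl n (z + z') \<in> ker" using sg_add[OF ker_subgroup x(3) y(3)] by (simp only:)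
 then show "x + y \<in> Dn n" unfolding Dn_def ker_iff using sg_add[OF gB] x y by blast
qed

text \<open>The divisors of points approaching \<open>x\<close> have bounded norm, since the norm of
  \<open>dbl n z\<close> is \<open>2 ^ n * q z\<close>. Compactness of balls modulo \<open>X\<close>
  then yields a divisor of \<open>x\<close>.\<close>

lemma closed_Dn: "closed (Dn n)"
proof (rule closedI_nb)
 fix x assume h: "!!U. nb U ==> \<exists>y\<in>Dn n. x - y \<in> U"
 have xB: "x \<in> B" and e: "!!e. 0 < e ==> \<exists>y\<in>Dn n. q (x - y) < e" using near[OF h Dn_subset] by auto
 define A where "A k = {z \<in> B. q (x - dbl n z) \<le> 1 / real (Suc k)} \<inter> {z \<in> B. q z \<le> q x + 1}" for k
 have inv: "1 / real (Suc (Suc k)) \<le> 1 / real (Suc k)" "1 / real (Suc k) \<le> 1" for k by (intro divide_left_mono) auto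
 have dec: "A (Suc k) \<subseteq> A k" for k unfolding A_def using inv(1)[of k] by auto
 have "\<exists>z. \<forall>S\<in>range A. z \<in> S"
 proof (rule cocpt_fip[OF directed_down_range[of A, OF dec] rangeI[of A 0], of X])
  show "cocpt X (A 0)" by (rule cocpt_mono[OF q_cpt order_refl]) (auto simp: A_def)
  fix S assume "S \<in> range A"
  then obtain k where k: "S = A k" by blast
  show "closed S" unfolding k A_def by (intro closed_Int closed_le closed_le_dbl xB)
  show "S \<noteq> {}"
  proof -
   obtain y where y: "y \<in> Dn n" "q (x - y) < 1 / real (Suc k)" using e[of "1 / real (Suc k)"] by auto
   obtain z where z: "z \<in> B" "q (y - dbl n z) = 0" using y(1) Dn_def by blast
   have B: "y \<in> B" "dbl n z \<in> B" using y(1) Dn_subset dbl_mem[OF gB z(1)] by auto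
   have 1: "q (x - dbl n z) < 1 / real (Suc k)" using q_tri[OF xB B] y(2) z(2) by linarith
   then have "q (dbl n z) \<le> q x + 1" using q_rev[OF B(2) xB] q_sym[OF B(2) xB] inv(2)[of k] by linarith
   then have 3: "2 ^ n * q z \<le> q x + 1" using q_dbln[OF z(1)] by simp
   have "1 * q z \<le> 2 ^ n * q z" by (rule mult_right_mono[OF _ q_ge0[OF z(1)]]) simp
   then have "q z \<le> q x + 1" using 3 by linarith
   then have "z \<in> A k" unfolding A_def using z 1 by simp
   then show ?thesis using k by blast
  qed
  fix s y assume s: "s \<in> S" "y \<in> X"
  then have sB: "s \<in> B" "y \<in> ker" "y \<in> B" unfolding k A_def using ker_subset XB by auto
  have "q (s - y) = q s" by (rule q_ker[OF sB(1,2)])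
  moreover have "q (x - dbl n (s - y)) = q (x - dbl n s)"
  proof -
   have "x - dbl n (s - y) = (x - dbl n s) - (- dbl n y)" by (simp add: dbl_diff)
   also have "q \<dots> = q (x - dbl n s)"
    by (rule q_ker[OF sg_diff[OF gB xB dbl_mem[OF gB sB(1)]] sg_neg[OF ker_subgroup dbl_mem[OF ker_subgroup sB(2)]]])
   finally show ?thesis .
  qed
  ultimately show "s - y \<in> S" using s sg_diff[OF gB sB(1,3)] unfolding k A_def by simp
 qed blast
 then obtain z where z: "!!k. z \<in> A k" by blast
 have zB: "z \<in> B" using z[of 0] unfolding A_def by blast
 have "q (x - dbl n z) = 0"
 proof (rule ccontr)
  assume "q (x - dbl n z) \<noteq> 0"
  then have "0 < q (x - dbl n z)" using q_ge0[OF sg_diff[OF gB xB dbl_mem[OF gB zB], of n]] by simp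
  then obtain k where "1 / real (Suc k) < q (x - dbl n z)" using nat_approx_posE by blast
  then show False using z[of k] unfolding A_def by simp
 qed
 then show "x \<in> Dn n" unfolding Dn_def using xB zB by blast
qed

lemma divp_subgroup: "add_subgroup divp" unfolding divp_def by (rule sg_Inter) (use Dn_subgroup in blast)

lemma closed_divp: "closed divp" unfolding divp_def by (rule closed_INT) (use closed_Dn in blast)

lemma divp_subset: "divp \<subseteq> B" "ker \<subseteq> divp" unfolding divp_def using Dn_subset[of 0] ker_Dn by blast+

text \<open>The half must lie in \<open>divp\<close>, not only in \<open>B\<close>. If
  \<open>dbl (Suc n) w\<close> agrees with \<open>x\<close> modulo \<open>ker\<close>, then
  \<open>dbl n w\<close> is a half of \<open>x\<close> in \<open>Dn n\<close>; compactness gives a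
  half in all \<open>Dn n\<close> at once.\<close>

lemma divp_half: assumes x: "x \<in> divp" shows "\<exists>z\<in>divp. q (x - (z + z)) = 0"
proof -
 have xB: "x \<in> B" using x divp_subset by blast
 define A where "A n = {z \<in> B. q (x - dbl 1 z) \<le> 0} \<inter> Dn n" for n
 have dec: "A (Suc n) \<subseteq> A n" for n unfolding A_def using Dn_dec[of n] by blast
 have zero: "q (x - (z + z)) = 0" if "z \<in> A n" for z n
 proof -
  have z: "z \<in> B" "q (x - (z + z)) \<le> 0" using that unfolding A_def by auto
  then show ?thesis using q_ge0[OF sg_diff[OF gB xB sg_add[OF gB z(1) z(1)]]] by linarith
 qed
 have "\<exists>z. \<forall>S\<in>range A. z \<in> S"
 proof (rule cocpt_fip[OF directed_down_range[of A, OF dec] rangeI[of A 0], of X])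
  have "A 0 \<subseteq> {z \<in> B. q z \<le> q x}"
  proof
   fix z assume z: "z \<in> A 0"
   then have zB: "z \<in> B" unfolding A_def by blast
   have "q x = q (z + z)" by (rule q_cong[OF xB sg_add[OF gB zB zB] zero[OF z]])
   then show "z \<in> {z \<in> B. q z \<le> q x}" using zB q_dbl[OF zB] q_ge0[OF zB] by simp
  qed
  then show "cocpt X (A 0)" by (rule cocpt_mono[OF q_cpt order_refl])
  fix S assume "S \<in> range A"
  then obtain n where k: "S = A n" by blast
  show "closed S" unfolding k A_def by (intro closed_Int closed_le_dbl closed_Dn xB)
  show "S \<noteq> {}"
  proof -
   have "x \<in> Dn (Suc n)" using x divp_def by blast
   then obtain w where w: "w \<in> B" "q (x - dbl (Suc n) w) = 0" unfolding Dn_def by blast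
   then have "dbl n w \<in> A n" unfolding A_def using dbl_mem[OF gB w(1)] dbl_Dn[OF w(1)] by simp
   then show ?thesis using k by blast
  qed
  fix s y assume s: "s \<in> S" "y \<in> X"
  then have sB: "s \<in> B" "s \<in> Dn n" "y \<in> ker" "y \<in> B" unfolding k A_def using ker_subset XB by auto
  have "x - ((s - y) + (s - y)) = (x - (s + s)) - - (y + y)" by (simp add: algebra_simps)
  also have "q \<dots> = q (x - (s + s))"
   by (intro q_ker sg_diff[OF gB] sg_add[OF gB] sg_neg[OF ker_subgroup] sg_add[OF ker_subgroup] xB sB)
  also have "\<dots> = 0" using zero[of s n] s(1) k by simp
  finally have "q (x - ((s - y) + (s - y))) = 0" .
  moreover have "s - y \<in> Dn n" using sg_diff[OF Dn_subgroup sB(2)] sB(3) ker_Dn by blast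
  ultimately show "s - y \<in> S" unfolding k A_def using sg_diff[OF gB sB(1,4)] by simp
 qed blast
 then obtain z where z: "!!n. z \<in> A n" by blast
 then have "z \<in> divp" unfolding divp_def A_def by blast
 then show ?thesis using zero[OF z[of 0]] by blast
qed

lemma divp_halfn: assumes "x \<in> divp" shows "\<exists>z\<in>divp. q (x - dbl n z) = 0"
proof (induction n)
 case 0 then show ?case using assms q_0 by (intro bexI[of _ x]) auto
next
 case (Suc n)
 then obtain z where z: "z \<in> divp" "q (x - dbl n z) = 0" by blast
 obtain w where w: "w \<in> divp" "q (z - (w + w)) = 0" using divp_half[OF z(1)] by blast
 have B: "x \<in> B" "z \<in> B" "w + w \<in> B" using assms z w divp_subset(1) sg_add[OF gB] by auto
 have "q (dbl n z - dbl n (w + w)) = 2 ^ n * 0"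
  using q_dbln[OF sg_diff[OF gB B(2,3)], of n] w(2) by (simp add: dbl_diff)
 then have "q (x - dbl (Suc n) w) \<le> 0" unfolding dbl_Suc2
  using q_tri[OF B(1) dbl_mem[OF gB B(2)] dbl_mem[OF gB B(3)], of n n] z(2) by simp
 moreover have "0 \<le> q (x - dbl (Suc n) w)" using w divp_subset(1) by (intro q_ge0 sg_diff[OF gB B(1)] dbl_mem[OF gB]) blast
 ultimately show ?case using w(1) by (intro bexI[of _ w]) auto
qed

text \<open>The distance \<open>r\<close> is positive because \<open>divp\<close> is closed,
  contains \<open>ker\<close>, and \<open>q\<close> controls the topology modulo \<open>ker\<close>.
  The factor 2 only records that the infimum is nearly attained.\<close>

lemma divp_distance: assumes x: "x \<in> B" "x \<notin> divp"
 shows "\<exists>r>0. (\<forall>l\<in>divp. r \<le> q (x - l)) \<and> (\<exists>l\<in>divp. q (x - l) < 2 * r) \<and> r \<le> q x"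
proof -
 define I where "I = (\<lambda>l. q (x - l)) ` divp"
 define r where "r = Inf I"
 have d0: "0 \<in> divp" by (rule sg_zero[OF divp_subgroup])
 have ge: "0 \<le> q (x - l)" if "l \<in> divp" for l using that divp_subset(1) by (intro q_ge0 sg_diff[OF gB x(1)]) blast
 have I: "I \<noteq> {}" "bdd_below I" unfolding I_def using d0 ge by (auto simp: bdd_below_def)
 have le: "r \<le> q (x - l)" if "l \<in> divp" for l unfolding r_def by (rule cInf_lower[OF _ I(2)]) (use that in \<open>auto simp: I_def\<close>)
 have close: "\<exists>l\<in>divp. q (x - l) < t" if "r < t" for t using that cInf_lessD[OF I(1)] unfolding r_def I_def by fastforce
 have "0 < r"
 proof (rule ccontr)
  assume "\<not> 0 < r"
  then have "\<exists>l\<in>divp. q (x - l) < e" if "0 < e" for e using that close[of e] by simp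
  note c = this
  have "x \<in> divp"
  proof (rule mem_closed_if_near[OF closed_divp])
   fix U :: "'k set" assume U: "nb U"
   obtain e where e: "e > 0" "{x \<in> B. q x \<le> e} \<subseteq> U + ker" using small_ball[OF U] by blast
   obtain l where l: "l \<in> divp" "q (x - l) < e" using c[OF e(1)] by blast
   have "x - l \<in> B" using l divp_subset(1) by (intro sg_diff[OF gB x(1)]) blast
   then have "x - l \<in> U + ker" using l e(2) by auto
   then obtain u k where u: "u \<in> U" "k \<in> ker" "x - l = u + k" by (rule set_plusE)
   have "k + l \<in> divp" using u(2) divp_subset(2) by (intro sg_add[OF divp_subgroup _ l(1)]) blast
   then show "x \<in> U + divp" by (rule set_plusI[OF u(1)]) (use u(3) in \<open>simp add: algebra_simps\<close>)
  qed
  then show False using x by blast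
 qed
 then show ?thesis using le close[of "2 * r"] le[OF d0] by (intro exI[of _ r]) auto
qed

text \<open>Small points outside \<open>divp\<close> could be magnified: subtract a nearly closest
  point of \<open>divp\<close> and double \<open>m\<close> times, with \<open>m\<close> least such
  that \<open>2 ^ m * r \<ge> 1\<close> for the distance \<open>r\<close>. The result has norm at
  most 4, distance at least 1 from \<open>divp\<close>, and is divisible by \<open>2 ^ n\<close>
  since \<open>m > n\<close>. By compactness there is a point with these properties for all
  \<open>n\<close>; it would lie in \<open>divp\<close> at distance at least 1 from
  \<open>divp\<close>.\<close>

lemma divp_open: "\<exists>e>0. \<forall>x\<in>B. q x < e --> x \<in> divp"
proof (rule ccontr)
 assume neg: "\<not> ?thesis"
 define A where "A n = (Dn n \<inter> {y \<in> B. q y \<le> 4}) \<inter> (\<Inter>l\<in>divp. {y \<in> B. 1 \<le> q (y - l)})" for n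
 have dec: "A (Suc n) \<subseteq> A n" for n unfolding A_def using Dn_dec[of n] by blast
 have "\<exists>z. \<forall>S\<in>range A. z \<in> S"
 proof (rule cocpt_fip[OF directed_down_range[of A, OF dec] rangeI[of A 0], of X])
  show "cocpt X (A 0)" by (rule cocpt_mono[OF q_cpt order_refl]) (auto simp: A_def)
  fix S assume "S \<in> range A"
  then obtain n where k: "S = A n" by blast
  show "closed S" unfolding k A_def using divp_subset(1) by (intro closed_Int closed_Dn closed_le closed_INT ballI closed_ge_translate) blast
  show "S \<noteq> {}"
  proof -
   have "0 < (1::real) / 2 ^ n" by simp
   then obtain x where x: "x \<in> B" "q x < 1 / 2 ^ n" "x \<notin> divp" using neg by blast
   obtain r l where r: "0 < r" "!!l. l \<in> divp ==> r \<le> q (x - l)" "l \<in> divp" "q (x - l) < 2 * r" "r \<le> q x"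
    using divp_distance[OF x(1,3)] by metis
   obtain p :: nat where p0: "1 / r < 2 ^ p" using real_arch_pow[of 2 "1 / r"] by auto
   define m where "m = (LEAST m. 1 \<le> 2 ^ m * r)"
   have m1: "1 \<le> 2 ^ m * r" unfolding m_def by (rule LeastI[of _ p]) (use p0 r(1) in \<open>simp add: field_simps\<close>)
   have "r < 1 / 2 ^ n" using r(5) x(2) by linarith
   then have nr: "2 ^ n * r < 1" by (simp add: field_simps)
   have mn: "n < m"
   proof (rule ccontr)
    assume "\<not> n < m"
    then have "(2::real) ^ m \<le> 2 ^ n" by simp
    then have "2 ^ m * r \<le> 2 ^ n * r" using r(1) by simp
    then show False using nr m1 by linarith
   qed
   then obtain m' where m': "m = Suc m'" using less_imp_Suc_add by blast
   have "\<not> 1 \<le> 2 ^ m' * r" unfolding m' using not_less_Least[of m' "\<lambda>m. 1 \<le> 2 ^ m * r"] m_def m' by simp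
   then have m2: "2 ^ m * r < 2" using m' by simp
   have lB: "l \<in> B" using r(3) divp_subset by blast
   define y where "y = dbl m (x - l)"
   have xl: "x - l \<in> B" by (rule sg_diff[OF gB x(1) lB])
   have yB: "y \<in> B" unfolding y_def by (rule dbl_mem[OF gB xl])
   have "2 ^ m * q (x - l) < 2 ^ m * (2 * r)" using r(4) by simp
   then have "q y \<le> 4" unfolding y_def q_dbln[OF xl] using m2 by linarith
   moreover have "y \<in> Dn n" unfolding y_def using dbl_Dn[OF xl, of m] Dn_mono[of n m] mn by auto
   moreover have "1 \<le> q (y - l')" if l': "l' \<in> divp" for l'
   proof -
    obtain z where z: "z \<in> divp" "q (l' - dbl m z) = 0" using divp_halfn[OF l'] by blast
    have B: "l' \<in> B" "z \<in> B" using l' z divp_subset(1) by auto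
    have zB: "x - l - z \<in> B" by (rule sg_diff[OF gB xl B(2)])
    have "r \<le> q (x - (l + z))" by (rule r(2)[OF sg_add[OF divp_subgroup r(3) z(1)]])
    then have "2 ^ m * r \<le> 2 ^ m * q (x - l - z)" by (simp add: algebra_simps)
    also have "\<dots> = q (y - dbl m z)" unfolding y_def q_dbln[OF zB, symmetric] by (simp add: dbl_diff)
    also have "\<dots> \<le> q (y - l') + q (l' - dbl m z)" by (rule q_tri[OF yB B(1) dbl_mem[OF gB B(2)]])
    finally show ?thesis using z(2) m1 by linarith
   qed
   ultimately have "y \<in> A n" unfolding A_def using yB by blast
   then show ?thesis using k by blast
  qed
  fix s y assume s: "s \<in> S" "y \<in> X"
  then have sB: "s \<in> B" "s \<in> Dn n" "y \<in> ker" "y \<in> B" unfolding k A_def using ker_subset XB by auto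
  have "s - y \<in> Dn n" using sg_diff[OF Dn_subgroup sB(2)] sB(3) ker_Dn by blast
  moreover have "q (s - y) = q s" by (rule q_ker[OF sB(1,3)])
  moreover have "q (s - y - l) = q (s - l)" if "l \<in> divp" for l
  proof -
   have "s - l \<in> B" using that divp_subset(1) by (intro sg_diff[OF gB sB(1)]) blast
   then show ?thesis using q_ker[OF _ sB(3), of "s - l"] by (simp add: algebra_simps)
  qed
  ultimately show "s - y \<in> S" using s sg_diff[OF gB sB(1,4)] unfolding k A_def by simp
 qed blast
 then obtain z where z: "!!n. z \<in> A n" by blast
 then have "z \<in> divp" unfolding divp_def A_def by blast
 then have "1 \<le> q (z - z)" using z[of 0] unfolding A_def by blast
 then show False using q_0 by simp
qed

lemma divp_omod: "omod divp B"
proof -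
 obtain e where e: "e > 0" "\<forall>x\<in>B. q x < e --> x \<in> divp" using divp_open by blast
 obtain U where "nb U" "\<forall>x\<in>U \<inter> B. q x < e" using q_small[OF e(1)] by blast
 then show ?thesis unfolding omod_def using e(2) by blast
qed

end

context tgact
begin

text \<open>On \<open>divp/ker\<close> doubling is onto by \<open>divp_half\<close> and doubles
  \<open>q\<close>, which measures both smallness and boundedness. For the compactness clause a ball
  of radius \<open>M\<close> suffices: a point of \<open>W + E\<close> has norm at most
  \<open>2 * M\<close>, so its half has norm at most \<open>M\<close>.\<close>

lemma expd_double:
 assumes "qnorm X B q"
 shows "expd (\<lambda>x. x + x) (qnorm.ker B q) (qnorm.divp B q)"
proof -
 interpret qnorm X B q by fact
 have half: "q (y + y) = q x \<and> q y = q x / 2" if h: "x \<in> B" "y \<in> B" "y + y - x \<in> ker" for x y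
 proof -
  have "q (y + y) = q x" by (rule q_cong[OF sg_add[OF gB h(2) h(2)] h(1)]) (use h(3) ker_iff in blast)
  then show ?thesis using q_dbl[OF h(2)] by simp
 qed
 have seqq: "q (s n) = q (s 0) / 2 ^ n" if s: "!!n. s n \<in> divp" "!!n. s (Suc n) + s (Suc n) - s n \<in> ker" for s n
 proof (induction n)
  case (Suc n)
  have "s n \<in> B" "s (Suc n) \<in> B" using s(1) divp_subset(1) by blast+
  then have "q (s (Suc n)) = q (s n) / 2" using half[OF _ _ s(2)] by blast
  then show ?case using Suc by simp
 qed simp
 show ?thesis unfolding expd_def
 proof (intro conjI allI impI)
  fix W y assume h: "compact W \<and> y \<in> divp \<and> (\<forall>n. dbl n y \<in> W + ker)"
  then have yB: "y \<in> B" using divp_subset(1) by blast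
  obtain M where M: "\<forall>w\<in>W \<inter> B. q w \<le> M" using bounded_on_compact[of W] h by blast
  have b: "2 ^ n * q y \<le> M" for n
  proof -
   have "dbl n y \<in> W + ker" using h by blast
   then obtain w k where w: "w \<in> W" "k \<in> ker" "dbl n y = w + k" by (rule set_plusE)
   have dB: "dbl n y \<in> B" by (rule dbl_mem[OF gB yB])
   have e: "w = dbl n y - k" using w(3) by simp
   have "k \<in> B" using w(2) ker_subset by blast
   then have "w \<in> B" unfolding e by (rule sg_diff[OF gB dB])
   moreover have "q w = 2 ^ n * q y" unfolding e q_ker[OF dB w(2)] by (rule q_dbln[OF yB])
   ultimately show ?thesis using M w(1) by force
  qed
  have "q y = 0"
  proof (rule ccontr)
   assume "q y \<noteq> 0"
   then have p: "0 < q y" using q_ge0[OF yB] by simp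
   obtain n :: nat where "M / q y < 2 ^ n" using real_arch_pow[of 2 "M / q y"] by auto
   then have "M < 2 ^ n * q y" using p by (simp add: field_simps)
   then show False using b[of n] by linarith
  qed
  then show "y \<in> ker" using yB ker_iff by blast
 next
  show "divp \<subseteq> null (\<lambda>x. x + x) ker divp"
  proof
   fix y assume y: "y \<in> divp"
   have "\<exists>s. s 0 = y \<and> (\<forall>n. s n \<in> divp) \<and> (\<forall>n. s (Suc n) + s (Suc n) - s n \<in> ker)"
   proof -
    have "\<exists>z. z \<in> divp \<and> z + z - x \<in> ker" if x: "x \<in> divp" for x
    proof -
     obtain z where z: "z \<in> divp" "q (x - (z + z)) = 0" using divp_half[OF x] by blast
     have "x \<in> B" "z + z \<in> B" using x z(1) divp_subset(1) sg_add[OF gB] by auto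
     then have "z + z - x \<in> ker" unfolding ker_iff using z(2) q_sym[of "z + z" x] sg_diff[OF gB] by simp
     then show ?thesis using z(1) by blast
    qed
    then have "\<exists>s. \<forall>n. (s n \<in> divp \<and> (n = 0 --> s n = y)) \<and> s (Suc n) + s (Suc n) - s n \<in> ker"
     using y by (intro dependent_nat_choice) auto
    then show ?thesis by blast
   qed
   then obtain s where s: "s 0 = y" "!!n. s n \<in> divp" "!!n. s (Suc n) + s (Suc n) - s n \<in> ker" by blast
   have "bseq (\<lambda>x. x + x) ker divp s"
   proof (rule bseqI)
    fix U :: "'k set" assume U: "nb U"
    obtain e where e: "e > 0" "{x \<in> B. q x \<le> e} \<subseteq> U + ker" using small_ball[OF U] by blast
    obtain m :: nat where "q (s 0) / e < 2 ^ m" using real_arch_pow[of 2 "q (s 0) / e"] by auto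
    then have m: "q (s 0) < 2 ^ m * e" using e(1) by (simp add: field_simps)
    have "s n \<in> U + ker" if n: "m \<le> n" for n
    proof -
     have "(2::real) ^ m * e \<le> 2 ^ n * e" using n e(1) by simp
     then have "q (s 0) / 2 ^ n \<le> e" using m by (simp add: field_simps)
     then have "q (s n) \<le> e" using seqq[of s n, OF s(2,3)] by simp
     moreover have "s n \<in> B" using s(2) divp_subset(1) by blast
     ultimately show ?thesis using e(2) by blast
    qed
    then show "\<exists>m. \<forall>n\<ge>m. s n \<in> U + ker" by blast
   qed (use s in auto)
   then show "y \<in> null (\<lambda>x. x + x) ker divp" using nullI s(1) by blast
  qed
 next
  fix U :: "'k set" assume U: "nb U"
  obtain e where e: "e > 0" "{x \<in> B. q x \<le> e} \<subseteq> U + ker" using small_ball[OF U] by blast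
  obtain U' where U': "nb U'" "\<forall>x\<in>U' \<inter> B. q x < e" using q_small[OF e(1)] by blast
  have "s n \<in> U + ker" if s: "bseq (\<lambda>x. x + x) ker divp s" "s 0 \<in> U'" for s n
  proof -
   have sB: "s k \<in> B" for k using bseqD(1)[OF s(1)] divp_subset(1) by blast
   have "q (s n) = q (s 0) / 2 ^ n" by (rule seqq) (use bseqD(1,2)[OF s(1)] in auto)
   also have "\<dots> \<le> q (s 0) / 1" using q_ge0[OF sB[of 0]] by (intro divide_left_mono) auto
   also have "\<dots> < e" using U'(2) s(2) sB[of 0] by simp
   finally show ?thesis using e(2) sB[of n] by auto
  qed
  then show "\<exists>U'. nb U' \<and> (\<forall>s. bseq (\<lambda>x. x + x) ker divp s \<and> s 0 \<in> U' --> (\<forall>n. s n \<in> U + ker))" using U'(1) by blast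
 next
  fix W :: "'k set" assume W: "compact W \<and> W \<subseteq> divp"
  obtain M where M: "0 \<le> M" "\<forall>w\<in>W \<inter> B. q w \<le> M" using bounded_on_compact[of W] W by blast
  define E' where "E' = divp \<inter> {x \<in> B. q x \<le> M}"
  have clE: "closed E'" unfolding E'_def by (intro closed_Int closed_divp closed_le)
  have "cocpt ker E'" by (rule cocpt_mono[OF q_cpt[of M] ker_subset(2)]) (auto simp: E'_def)
  then obtain V where V: "compact V" "E' \<subseteq> V + ker" unfolding cocpt_def by blast
  \<comment> \<open>The ball \<open>E'\<close> is compact only modulo \<open>ker\<close>;
    \<open>E\<close> is a compact set of representatives for it, with zero added.\<close>
  define E where "E = insert 0 (V \<inter> E')"
  have "0 \<in> E'" unfolding E'_def using sg_zero[OF divp_subgroup] sg_zero[OF gB] q_0 M(1) by simp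
  then have EE: "E \<subseteq> E'" unfolding E_def by blast
  have cE: "compact E" unfolding E_def by (intro compact_insert compact_Int_closed V(1) clE)
  have "W + E \<subseteq> (\<lambda>x. x + x) ` E + ker"
  proof
   fix x assume "x \<in> W + E"
   then obtain w e where w: "w \<in> W" "e \<in> E" "x = w + e" by (rule set_plusE)
   have d: "w \<in> divp" "e \<in> divp" "e \<in> B" "q e \<le> M" using w W EE E'_def by auto
   have wB: "w \<in> B" "q w \<le> M" using d(1) divp_subset(1) M(2) w(1) by auto
   have xd: "x \<in> divp" unfolding w(3) by (rule sg_add[OF divp_subgroup d(1,2)])
   have qx: "q x \<le> 2 * M" unfolding w(3) using q_add[OF wB(1) d(3)] wB(2) d(4) by linarith
   have xB: "x \<in> B" using xd divp_subset(1) by blast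
   obtain z where z: "z \<in> divp" "q (x - (z + z)) = 0" using divp_half[OF xd] by blast
   have zB: "z \<in> B" using z(1) divp_subset(1) by blast
   have zzB: "z + z \<in> B" by (rule sg_add[OF gB zB zB])
   have "2 * q z = q x" using q_cong[OF xB zzB z(2)] q_dbl[OF zB] by simp
   then have "z \<in> E'" unfolding E'_def using z(1) zB qx by simp
   then obtain v k where v: "v \<in> V" "k \<in> ker" "z = v + k" using V(2) by (blast elim: set_plusE)
   have ve: "v = z - k" using v(3) by simp
   have kd: "k \<in> divp" "k \<in> B" using v(2) divp_subset(2) ker_subset(1) by auto
   have "v \<in> E'" unfolding E'_def ve using sg_diff[OF divp_subgroup z(1) kd(1)]
     sg_diff[OF gB zB kd(2)] q_ker[OF zB v(2)] \<open>z \<in> E'\<close> E'_def by simp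
   then have vE: "v \<in> E" unfolding E_def using v(1) by blast
   have "x - (z + z) \<in> ker" unfolding ker_iff using z(2) sg_diff[OF gB xB zzB] by blast
   then have "x - (z + z) + (k + k) \<in> ker" by (intro sg_add[OF ker_subgroup] v(2))
   then show "x \<in> (\<lambda>x. x + x) ` E + ker" by (rule set_plusI[OF imageI[OF vE]]) (simp add: ve algebra_simps)
  qed
  then show "\<exists>E. compact E \<and> 0 \<in> E \<and> E \<subseteq> divp \<and> W + E \<subseteq> (\<lambda>x. x + x) ` E + ker"
   using cE EE unfolding E'_def by (intro exI[of _ E]) (auto simp: E_def)
 qed
qed

text \<open>\<open>divp\<close> is only an open subgroup, but by \<open>null_absorb\<close> its null
  part equals \<open>null f X G\<close>, which is stable under the action. The splitting takes place
  among plain subgroups, \<open>T = {}\<close>, where \<open>Wzero_restrict_ops\<close> keeps the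
  hypothesis alive.\<close>

theorem double_step:
 assumes G: "lcg G" "sub UNIV G" and X: "closed X" "sub UNIV X" "X \<subseteq> G" and W: "Wzero UNIV X G"
 shows "\<exists>H B. hyper X H \<and> H \<subseteq> B \<and> B \<subseteq> G \<and> add_subgroup B \<and> omod B G \<and> cocpt H B"
proof -
 have gG: "add_subgroup G" by (rule subD(1)[OF G(2)])
 have gX: "add_subgroup X" by (rule subD(1)[OF X(2)])
 obtain B q where B: "qnorm X B q" "B \<subseteq> G" "omod B G" using qnorm_exists[OF G(1) X(1) gX X(3)] .
 interpret qnorm X B q by (rule B(1))
 define f where "f = (\<lambda>x::'k. x + x)"
 have f: "oper f" unfolding f_def by (rule oper_double)
 have st: "f x \<in> Y" if "add_subgroup Y" "x \<in> Y" for x Y unfolding f_def using sg_add[OF that(1) that(2) that(2)] .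
 have e: "expd f ker divp" unfolding f_def by (rule expd_double[OF B(1)])
 have dG: "divp \<subseteq> G" using divp_subset(1) B(2) by blast
 have oG: "omod divp G" by (rule omod_trans[OF divp_omod B(3)])
 have Wk: "Wzero {} X ker"
  by (rule Wzero_mono[OF Wzero_restrict_ops[OF gens_finite[OF finite.emptyI] G X W]]) (use ker_subset(1) B(2) in blast)
 have sX: "sub {} X" by (rule sub_mono[OF X(2)]) simp
 have sk: "sub {} ker" unfolding sub_def using ker_subgroup by simp
 have res: "\<exists>N1. add_subgroup N1 \<and> closed N1 \<and> X \<subseteq> N1 \<and> N1 \<subseteq> ker \<and> omod N1 ker \<and> N1 \<subseteq> U + X \<and> (\<forall>x\<in>N1. f x \<in> N1)"
  if U: "nb U" for U
 proof -
  obtain D where D: "sub {} D" "closed D" "X \<subseteq> D" "D \<subseteq> ker" "fmod D ker" "D \<subseteq> U + X"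
   using profinite_basis[OF gens_finite[OF finite.emptyI] X(1) sX closed_ker sk ker_subset(2) cocpt_ker Wk U] .
  have gD: "add_subgroup D" by (rule subD(1)[OF D(1)])
  have "omod D ker" by (rule fmod_omod[OF D(5,2,4) gD ker_subgroup])
  then show ?thesis using D gD st[OF gD] by blast
 qed
 define H where "H = null f X divp"
 note sp = split_compact_kernel[OF f gX ker_subgroup divp_subgroup X(1) closed_ker closed_divp ker_subset(2) divp_subset(2)
   st[OF gX] st[OF ker_subgroup] st[OF divp_subgroup] e cocpt_ker res, folded H_def]
 have Xd: "X \<subseteq> divp" using ker_subset(2) divp_subset(2) by blast
 have "H = null f X G" unfolding H_def by (rule null_absorb[OF f divp_subgroup st[OF divp_subgroup] Xd dG oG gG, symmetric])
 then have sH: "sub UNIV H" using null_sub[OF f X(2) G(2) X(3)] by simp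
 have XH: "X \<subseteq> H" unfolding H_def by (rule null_contains[OF f gX Xd])
 have "isop f" unfolding isop_def f_def by blast
 then have hy: "hyper X H" by (rule hyper_step[OF hyper_refl[OF X(1,2)] _ sp(4) sp(1) sH XH])
 have "cocpt H (H + ker)" by (rule cocpt_plus[OF cocpt_refl cocpt_mono[OF cocpt_ker XH order_refl] subD(1)[OF sH]])
 then have "cocpt H divp" using sp(3) by simp
 moreover have "H \<subseteq> divp" unfolding H_def by (rule null_subset)
 ultimately show ?thesis using hy dG oG divp_subgroup by blast
qed

end

section \<open>Sheer submodules\<close>

context tgact
begin

lemma hyper_trans: "hyper Y Z ==> hyper X Y ==> hyper X Z"
 by (induction rule: hyper.induct) (auto intro: hyper_step)

lemma sub_zspan:
 assumes "sub T Y" "set fs \<union> uminus ` set fs \<subseteq> T" "a \<in> zspan fs" "x \<in> Y" shows "act a x \<in> Y"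
 using assms(2-4)
proof (induction fs arbitrary: a x)
 case (Cons t fs)
 obtain b c where a: "b \<in> range (\<lambda>n. zm n t)" "c \<in> zspan fs" "a = b + c" using Cons.prems(2) unfolding zspan.simps by (rule set_plusE)
 obtain n where n: "b = zm n t" using a(1) by blast
 have "act c x \<in> Y" by (rule Cons.IH[OF _ a(2) Cons.prems(3)]) (use Cons.prems(1) in auto)
 then have "act (zm n t) (act c x) \<in> Y" by (rule sub_zm[OF assms(1), rotated 2]) (use Cons.prems(1) in auto)
 then show ?case unfolding a(3) n act_act .
qed simp

text \<open>The induction keeps an open subgroup \<open>B\<close>, compact over the current
  \<open>H\<close> and stable under the generators treated so far and their negatives;
  \<open>Wzero_hyper\<close> restores the hypothesis before each step. The compact set
  \<open>S\<close> is dealt with only at the end, by passing to the largest stable subgroup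
  \<open>Q\<close> of \<open>B\<close>, which is open because the operators in \<open>S\<close> are
  uniformly continuous at zero.\<close>

theorem hyper_cocompact:
 assumes S: "gens S UNIV" "zspan fs + S = UNIV" and G: "lcg G" "sub UNIV G"
  and X: "closed X" "sub UNIV X" "X \<subseteq> G" and W: "Wzero UNIV X G"
 shows "\<exists>H Q. hyper X H \<and> H \<subseteq> Q \<and> Q \<subseteq> G \<and> sub UNIV Q \<and> omod Q G \<and> cocpt H Q"
proof -
 have "\<exists>H B. hyper X H \<and> H \<subseteq> B \<and> B \<subseteq> G \<and> sub (set fs \<union> uminus ` set fs) B \<and> omod B G \<and> cocpt H B"
 proof (induction fs)
  case Nil
  show ?case using double_step[OF G X W] unfolding sub_def by simp
 next
  case (Cons t fs)
  define T where "T = set fs \<union> uminus ` set fs"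
  obtain H B where HB: "hyper X H" "H \<subseteq> B" "B \<subseteq> G" "sub T B" "omod B G" "cocpt H B"
   using Cons unfolding T_def by blast
  have HG: "H \<subseteq> G" using HB by blast
  have W': "Wzero UNIV H G" by (rule Wzero_hyper[OF S(1) HB(1) W])
  have fT: "finite T" unfolding T_def by simp
  obtain H' B' where HB': "hyper H H'" "H' \<subseteq> B'" "B' \<subseteq> G" "sub (T \<union> {t, - t}) B'" "omod B' G" "cocpt H' B'"
   using act_step[OF fT G hyperD(3,4)[OF HB(1)] HG W' HB(4,2,3,5,6), of t] by blast
  have "set (t # fs) \<union> uminus ` set (t # fs) = T \<union> {t, - t}" unfolding T_def by auto
  then show ?case using hyper_trans[OF HB'(1) HB(1)] HB' by auto
 qed
 then obtain H B where HB: "hyper X H" "H \<subseteq> B" "B \<subseteq> G" "sub (set fs \<union> uminus ` set fs) B" "omod B G" "cocpt H B" by blast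
 define Q where "Q = {x. \<forall>a. act a x \<in> B}"
 have gB: "add_subgroup B" by (rule subD(1)[OF HB(4)])
 have QB: "Q \<subseteq> B" unfolding Q_def using act_0 by (metis (mono_tags, lifting) mem_Collect_eq subsetI)
 have "sub UNIV Q" unfolding sub_def add_subgroup_def Q_def
  using gB by (auto simp: act_add act_neg act_act[symmetric] sg_zero sg_add sg_neg)
 moreover have "H \<subseteq> Q" unfolding Q_def using subD(2)[OF hyperD(4)[OF HB(1)]] HB(2) by blast
 moreover have "omod Q G"
 proof -
  obtain U where U: "nb U" "U \<inter> G \<subseteq> B" using HB(5) unfolding omod_def by blast
  have "compact S" using S(1) gens_def by blast
  then obtain V where V: "nb V" "!!a v. a \<in> S ==> v \<in> V ==> act a v \<in> U" using nb_act[OF _ U(1)] by metis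
  have "V \<inter> G \<subseteq> Q"
  proof
   fix v assume v: "v \<in> V \<inter> G"
   have "act a v \<in> B" for a
   proof -
    have "a \<in> zspan fs + S" using S(2) by blast
    then obtain z s where z: "z \<in> zspan fs" "s \<in> S" "a = z + s" by (rule set_plusE)
    have "act s v \<in> B" using V(2)[OF z(2)] v U(2) subD(2)[OF G(2)] by blast
    then show ?thesis unfolding z(3) act_act by (rule sub_zspan[OF HB(4) order_refl z(1)])
   qed
   then show "v \<in> Q" unfolding Q_def by blast
  qed
  then show ?thesis unfolding omod_def using V(1) by blast
 qed
 moreover have "cocpt H Q" by (rule cocpt_mono[OF HB(6) order_refl QB])
 ultimately show ?thesis using HB(1,3) QB by blast
qed

text \<open>The half of \<open>sheer\<close> that concerns open submodules; see
  \<open>sheer_iff\<close>.\<close>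

definition full :: "'k set => bool" where
 "full G \<longleftrightarrow> (\<forall>U\<in>Ufam UNIV G. U = G)"

lemma UfamD: assumes "U \<in> Ufam T N" shows "sub T U" "U \<subseteq> N" "omod U N" "pdisc T U N"
 using assms unfolding Ufam_def by auto

lemma fullD: "full G ==> sub UNIV U ==> U \<subseteq> G ==> omod U G ==> pdisc UNIV U G ==> U = G"
 unfolding full_def Ufam_def by blast

lemma Ufam_restrict:
 assumes U: "U \<in> Ufam T N" and L: "sub T L" "L \<subseteq> N" and N: "sub T N"
 shows "U \<inter> L \<in> Ufam T L"
proof -
 have "K = U \<inter> L" if K: "sub T K" "U \<inter> L \<subseteq> K" "K \<subseteq> L" "fmod (U \<inter> L) K" for K
 proof -
  have "K \<subseteq> U" by (rule Ufam_absorb[OF U K(1) _ N K(4)]) (use K(3) L(2) in auto)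
  then show ?thesis using K by blast
 qed
 then show ?thesis unfolding Ufam_def pdisc_def
  using sub_Int[OF UfamD(1)[OF U] L(1)] omod_restrict[OF UfamD(3)[OF U] L(2)] by blast
qed

lemma Ufam_trans:
 assumes R: "R \<in> Ufam T N" and U: "U \<in> Ufam T R" and N: "sub T N"
 shows "U \<in> Ufam T N"
proof -
 have "L = U" if L: "sub T L" "U \<subseteq> L" "L \<subseteq> N" "fmod U L" for L
 proof -
  have "L \<subseteq> R" by (rule Ufam_absorb[OF R L(1,3) N L(4) UfamD(2)[OF U]])
  then show ?thesis using UfamD(4)[OF U] L unfolding pdisc_def by blast
 qed
 then show ?thesis unfolding Ufam_def pdisc_def
  using UfamD(1,2)[OF U] UfamD(2)[OF R] omod_trans[OF UfamD(3)[OF U] UfamD(3)[OF R]] by blast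
qed

text \<open>Let \<open>Lf\<close> be the union of the submodules that are finite over
  \<open>L\<close>. If \<open>L'/Lf\<close> is finite with representatives \<open>F\<close>, then
  sums, negatives and images under \<open>S\<close> of elements of \<open>F\<close> form a compact
  set, so modulo \<open>L\<close> they bring in only finitely many elements of \<open>Lf\<close>,
  and one \<open>Z\<close> finite over \<open>L\<close> contains these. Then \<open>F + Z\<close> is
  a submodule finite over \<open>L\<close>, so \<open>F \<subseteq> Lf\<close>. Thus
  \<open>G/Lf\<close> is purely discrete and fullness gives \<open>Lf = G\<close>.\<close>

lemma locally_finite:
 assumes S: "gens S UNIV" and G: "sub UNIV G" "full G" and L: "sub UNIV L" "L \<subseteq> G" "omod L G"
  and A: "finite A" "A \<subseteq> G"
 shows "\<exists>Z. sub UNIV Z \<and> L \<subseteq> Z \<and> Z \<subseteq> G \<and> fmod L Z \<and> A \<subseteq> Z"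
proof -
 define Lf where "Lf = {x. \<exists>Z. sub UNIV Z \<and> L \<subseteq> Z \<and> Z \<subseteq> G \<and> fmod L Z \<and> x \<in> Z}"
 have gG: "add_subgroup G" by (rule subD(1)[OF G(1)])
 have gL: "add_subgroup L" by (rule subD(1)[OF L(1)])
 have fin: "\<exists>Z. sub UNIV Z \<and> L \<subseteq> Z \<and> Z \<subseteq> G \<and> fmod L Z \<and> A \<subseteq> Z" if A: "finite A" "A \<subseteq> Lf" for A
  using A
 proof (induction A)
  case empty then show ?case using L fmod_refl by blast
 next
  case (insert x A)
  then obtain Z where Z: "sub UNIV Z" "L \<subseteq> Z" "Z \<subseteq> G" "fmod L Z" "A \<subseteq> Z" by auto
  obtain Z' where Z': "sub UNIV Z'" "L \<subseteq> Z'" "Z' \<subseteq> G" "fmod L Z'" "x \<in> Z'" using insert.prems Lf_def by auto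
  have 0: "0 \<in> Z" "0 \<in> Z'" using sg_zero subD(1) Z(1) Z'(1) by blast+
  have "Z \<subseteq> Z + Z'" "Z' \<subseteq> Z + Z'" using set_plus_left[OF 0(2)] set_plus_right[OF 0(1)] by auto
  moreover have "Z + Z' \<subseteq> G" by (rule sg_plus_subset[OF gG Z(3) Z'(3)])
  ultimately show ?case using sub_plus[OF Z(1) Z'(1)] fmod_plus[OF Z(4) Z'(4) gL] Z(2,5) Z'(5)
   by (intro exI[of _ "Z + Z'"]) auto
 qed
 have LLf: "L \<subseteq> Lf" unfolding Lf_def using L fmod_refl by blast
 have LfG: "Lf \<subseteq> G" unfolding Lf_def by blast
 have inLf: "Z \<subseteq> Lf" if "sub UNIV Z" "L \<subseteq> Z" "Z \<subseteq> G" "fmod L Z" for Z unfolding Lf_def using that by blast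
 have sLf: "sub UNIV Lf" unfolding sub_def add_subgroup_def
 proof (intro conjI ballI)
  show "0 \<in> Lf" using LLf sg_zero[OF gL] by blast
  fix x assume x: "x \<in> Lf"
  then obtain Z where Z: "sub UNIV Z" "Z \<subseteq> Lf" "x \<in> Z" unfolding Lf_def by blast
  show "- x \<in> Lf" using sg_neg[OF subD(1)[OF Z(1)] Z(3)] Z(2) by blast
  show "act a x \<in> Lf" for a using subD(2)[OF Z(1) UNIV_I Z(3)] Z(2) by blast
  fix y assume y: "y \<in> Lf"
  have "finite {x, y}" "{x, y} \<subseteq> Lf" using x y by auto
  then obtain Z where Z: "sub UNIV Z" "L \<subseteq> Z" "Z \<subseteq> G" "fmod L Z" "{x, y} \<subseteq> Z" using fin by meson
  then show "x + y \<in> Lf" using sg_add[OF subD(1)[OF Z(1)], of x y] inLf[OF Z(1-4)] by blast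
 qed
 have gLf: "add_subgroup Lf" by (rule subD(1)[OF sLf])
 have "Lf = G"
 proof (rule fullD[OF G(2) sLf LfG])
  show "omod Lf G" by (rule omod_mono[OF L(3) LLf order_refl])
  show "pdisc UNIV Lf G" unfolding pdisc_def
  proof (intro allI impI)
   fix L' assume h: "sub UNIV L' \<and> Lf \<subseteq> L' \<and> L' \<subseteq> G \<and> fmod Lf L'"
   then have gL': "add_subgroup L'" using subD(1) by blast
   obtain F where F: "finite F" "F \<subseteq> L'" "0 \<in> F" "L' = F + Lf" using fmod_inside[of Lf L'] h gLf gL' by metis
   define K1 where "K1 = (F + F) \<union> uminus ` F \<union> (\<lambda>p. act (fst p) (snd p)) ` (S \<times> F)"
   have cF: "compact F" by (rule finite_imp_compact[OF F(1)])
   have "compact S" using S gens_def by blast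
   then have cK: "compact K1" unfolding K1_def by (intro compact_Un compact_set_plus compact_uminus_image compact_act cF)
   have "act a x \<in> L'" if "x \<in> F" for a x using subD(2)[of UNIV L' a x] h F(2) that by blast
   then have KL: "K1 \<subseteq> L'" unfolding K1_def
    using sg_plus_subset[OF gL' F(2) F(2)] sg_neg[OF gL'] F(2) by auto
   have "omod L L'" by (rule omod_mono[OF L(3) order_refl]) (use h in blast)
   then obtain F1 where F1: "finite F1" "F1 \<subseteq> K1" "K1 \<subseteq> F1 + L" using compact_finite_mod[OF cK KL gL'] by metis
   have "\<forall>x\<in>F1. \<exists>f\<in>F. x - f \<in> Lf" using F1(2) KL F(4) set_plus_diff by blast
   then obtain \<phi> where \<phi>: "!!x. x \<in> F1 ==> \<phi> x \<in> F" "!!x. x \<in> F1 ==> x - \<phi> x \<in> Lf" by metis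
   have "finite ((\<lambda>x. x - \<phi> x) ` F1)" "(\<lambda>x. x - \<phi> x) ` F1 \<subseteq> Lf" using F1(1) \<phi>(2) by auto
   then obtain Z where Z: "sub UNIV Z" "L \<subseteq> Z" "Z \<subseteq> G" "fmod L Z" "(\<lambda>x. x - \<phi> x) ` F1 \<subseteq> Z" using fin by meson
   have gZ: "add_subgroup Z" by (rule subD(1)[OF Z(1)])
   have KF: "\<exists>f\<in>F. k - f \<in> Z" if k: "k \<in> K1" for k
   proof -
    obtain x l where x: "x \<in> F1" "l \<in> L" "k = x + l" using subsetD[OF F1(3) k] by (rule set_plusE)
    have "k - \<phi> x = (x - \<phi> x) + l" using x(3) by simp
    moreover have "(x - \<phi> x) + l \<in> Z" using Z(2,5) x by (intro sg_add[OF gZ]) auto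
    ultimately show ?thesis using \<phi>(1)[OF x(1)] by (intro bexI[of _ "\<phi> x"]) (simp only:)
   qed
   have FZ: "k \<in> F + Z" if "k \<in> K1" for k using KF[OF that] set_plus_diff by blast
   have "sub UNIV (F + Z)"
   proof (rule sub_plusI[OF S Z(1) F(3)]; rule FZ)
    show "act a f \<in> K1" if "a \<in> S" "f \<in> F" for a f unfolding K1_def using that by force
   qed (auto simp: K1_def set_plus_intro)
   moreover have "fmod L (F + Z)" by (rule fmod_trans[OF Z(4)]) (use F(1) in \<open>auto simp: fmod_def\<close>)
   moreover have "F + Z \<subseteq> G" using F(2) h Z(3) by (intro sg_plus_subset[OF gG]) auto
   moreover have "L \<subseteq> F + Z" using Z(2) set_plus_right[OF F(3), of Z] by blast
   ultimately have "F + Z \<subseteq> Lf" by (intro inLf)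
   then have "F \<subseteq> Lf" using set_plus_left[OF sg_zero[OF gZ], of F] by blast
   then have "F + Lf \<subseteq> Lf" by (rule sg_plus_subset[OF gLf _ order_refl])
   then show "L' = Lf" using F(4) h by blast
  qed
 qed
 then show ?thesis using fin[OF A(1)] A(2) by blast
qed

lemma parafinD: assumes "parafin T X Y"
 shows "closed X" "closed Y" "sub T X" "sub T Y" "X \<subseteq> Y" "cocpt X Y"
 using assms unfolding parafin_def by auto

lemma parafin_trans:
 assumes 1: "parafin T X Y" and 2: "parafin T Y Z" shows "parafin T X Z"
 unfolding parafin_def
proof (intro conjI allI impI)
 show "X \<subseteq> Z" using parafinD(5)[OF 1] parafinD(5)[OF 2] by blast
 show "cocpt X Z" by (rule cocpt_trans[OF parafinD(6)[OF 1] parafinD(6)[OF 2]])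
 fix U assume U: "sub T U \<and> closed U \<and> X \<subseteq> U \<and> U \<subseteq> Z \<and> fmod U Z"
 then have "Y \<subseteq> U" using parafin_subset[OF 1, of U Z] parafinD(5)[OF 2] by blast
 then show "U = Z" using U 2 unfolding parafin_def by blast
qed (use parafinD[OF 1] parafinD[OF 2] in auto)

text \<open>\<open>(Y + Z)/Z\<close> is an image of \<open>Y/X\<close>: a submodule of finite index
  in it has a trace of finite index on \<open>Y\<close>, which must be all of
  \<open>Y\<close>.\<close>

lemma parafin_push:
 assumes P: "parafin T X Y" and Z: "closed Z" "sub T Z" "X \<subseteq> Z" shows "parafin T Z (Y + Z)"
 unfolding parafin_def
proof (intro conjI allI impI)
 have g: "add_subgroup X" "add_subgroup Y" "add_subgroup Z" using parafinD(3,4)[OF P] Z(2) subD(1) by blast+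
 show "closed (Y + Z)" by (rule closed_if_cocpt[OF parafinD(6,1,2)[OF P] Z(1) parafinD(5)[OF P] Z(3) g])
 show "sub T (Y + Z)" by (rule sub_plus[OF parafinD(4)[OF P] Z(2)])
 show "Z \<subseteq> Y + Z" by (rule set_plus_right[OF sg_zero[OF g(2)]])
 show "cocpt Z (Y + Z)" by (rule cocpt_plus[OF cocpt_mono[OF parafinD(6)[OF P] Z(3) order_refl] cocpt_refl g(3)])
 fix U assume U: "sub T U \<and> closed U \<and> Z \<subseteq> U \<and> U \<subseteq> Y + Z \<and> fmod U (Y + Z)"
 have "Y \<subseteq> Y + Z" by (rule set_plus_left[OF sg_zero[OF g(3)]])
 then have "Y \<subseteq> U" using parafin_subset[OF P, of U "Y + Z"] U Z(3) by blast
 then have "Y + Z \<subseteq> U" using U subD(1) by (intro sg_plus_subset) auto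
 then show "U = Y + Z" using U by blast
qed (use Z in auto)

lemma parafin_raise:
 assumes P: "parafin T X Y" and Z: "closed Z" "sub T Z" "X \<subseteq> Z" "Z \<subseteq> Y" shows "parafin T Z Y"
proof -
 have "Y + Z = Y"
  using sg_plus_subset[OF subD(1)[OF parafinD(4)[OF P]] order_refl Z(4)]
   set_plus_left[OF sg_zero[OF subD(1)[OF Z(2)]], of Y] by blast
 then show ?thesis using parafin_push[OF P Z(1-3)] by simp
qed

text \<open>\<open>rigid_hyper\<close> reaches only \<open>H\<close>, which need not be open. The
  open \<open>L0\<close> of \<open>H\<close> is therefore extended once more by
  \<open>split_off_open\<close>, over a submodule \<open>D\<close> of finite index in
  \<open>Q\<close> that is thin over \<open>H\<close>; this gives \<open>Y\<close>, open in
  \<open>G\<close> with trace \<open>R\<close> on \<open>P\<close>. A submodule finite over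
  \<open>Y\<close> has on \<open>P\<close> a trace finite over \<open>R\<close>, which
  \<open>R\<close> absorbs.\<close>

theorem full_if_Wzero:
 assumes S: "gens S UNIV" "zspan fs + S = UNIV" and G: "lcg G" "sub UNIV G" "full G"
  and P: "closed P" "sub UNIV P" "P \<subseteq> G" and W: "Wzero UNIV P G"
 shows "full P"
proof -
 define R where "R = \<Inter>(Ufam UNIV P)"
 have R: "R \<in> Ufam UNIV P" unfolding R_def
  by (rule Inter_Ufam[OF S(1) lcg_subset[OF G(1) P(1) subD(1)[OF P(2)] P(3)] P(2)])
 obtain H Q where HQ: "hyper P H" "H \<subseteq> Q" "Q \<subseteq> G" "sub UNIV Q" "omod Q G" "cocpt H Q"
  using hyper_cocompact[OF S G(1,2) P W] by blast
 obtain L0 where L0: "sub UNIV L0" "R \<subseteq> L0" "L0 \<subseteq> H" "omod L0 H" "L0 \<inter> P = R"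
  using rigid_hyper[OF HQ(1) UfamD(1-3)[OF R]] by blast
 have gG: "add_subgroup G" "closed G" using G(1) unfolding lcg_def by auto
 have gQ: "add_subgroup Q" by (rule subD(1)[OF HQ(4)])
 have clQ: "closed Q" by (rule omod_closed[OF HQ(5) gG(2) gQ gG(1) HQ(3)])
 obtain U0 where U0: "nb U0" "U0 \<inter> H \<subseteq> L0" using L0(4) unfolding omod_def by blast
 have cS: "compact S" using S(1) gens_def by blast
 obtain U where "nb U \<and> U \<subseteq> U0 \<and> (\<forall>u\<in>U. - u \<in> U) \<and>
   (\<forall>x\<in>U. \<forall>y\<in>U. \<forall>z\<in>U. x + y + z \<in> U0) \<and> (\<forall>a\<in>S. \<forall>u\<in>U. \<forall>v\<in>U. act a u + v \<in> U0)"
  using nb_small[OF cS U0(1)] ..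
 then have U: "nb U" "!!u. u \<in> U ==> - u \<in> U" "!!x y z. x \<in> U ==> y \<in> U ==> z \<in> U ==> x + y + z \<in> U0"
   "!!a u v. a \<in> S ==> u \<in> U ==> v \<in> U ==> act a u + v \<in> U0" by simp_all
 have WQ: "Wzero UNIV H Q" by (rule Wzero_mono[OF Wzero_hyper[OF S(1) HQ(1) W] HQ(3)])
 obtain D where D: "sub UNIV D" "closed D" "H \<subseteq> D" "D \<subseteq> Q" "fmod D Q" "D \<subseteq> U + H"
  using profinite_basis[OF S(1) hyperD(3,4)[OF HQ(1)] clQ HQ(4,2,6) WQ U(1)] .
 define Y where "Y = L0 + (D \<inter> U)"
 have 1: "x + y + z \<in> L0" if "x \<in> U" "y \<in> U" "z \<in> U" "x + y + z \<in> H" for x y z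
  by (rule subsetD[OF U0(2)]) (rule IntI[OF U(3)[OF that(1-3)] that(4)])
 have 2: "act a u + v \<in> L0" if "a \<in> S" "u \<in> U" "v \<in> U" "act a u + v \<in> H" for a u v
  by (rule subsetD[OF U0(2)]) (rule IntI[OF U(4)[OF that(1-3)] that(4)])
 note Y = split_off_open[OF S(1) hyperD(4)[OF HQ(1)] D(1) L0(1,3) D(3) U(1,2) D(6) 1 2, folded Y_def]
 have "omod D Q" by (rule fmod_omod[OF D(5,2,4) subD(1)[OF D(1)] gQ])
 then have oY: "omod Y G" using omod_trans[OF Y(5)] omod_trans[OF _ HQ(5)] by blast
 have YG: "Y \<subseteq> G" using Y(4) D(4) HQ(3) by blast
 have YP: "Y \<inter> P = R" using Y(2) L0(5) hyperD(5)[OF HQ(1)] by blast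
 have "P \<subseteq> R"
 proof
  fix x assume x: "x \<in> P"
  have fx: "finite {x}" "{x} \<subseteq> G" using x P(3) by auto
  obtain Z where Z: "sub UNIV Z" "Y \<subseteq> Z" "Z \<subseteq> G" "fmod Y Z" "{x} \<subseteq> Z"
   using locally_finite[OF S(1) G(2,3) Y(1) YG oY fx] by blast
  have ZP: "sub UNIV (Z \<inter> P)" by (rule sub_Int[OF Z(1) P(2)])
  have 1: "fmod (Y \<inter> (Z \<inter> P)) (Z \<inter> P)" by (rule fmod_restrict[OF Z(4) subD(1)[OF Y(1)] subD(1)[OF ZP] Int_lower1])
  have "Z \<inter> P \<subseteq> R" by (rule Ufam_absorb[OF R ZP Int_lower2 P(2) 1]) (use YP in auto)
  then show "x \<in> R" using x Z(5) by blast
 qed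
 then show ?thesis unfolding full_def R_def using UfamD(2) by blast
qed

text \<open>\<open>P\<close> is compact over \<open>Y\<close> but not over \<open>H\<close>, so
  \<open>corigid_hyper\<close> is applied to a smaller \<open>Z0\<close>. With
  \<open>P = V + Y\<close>, the elements of \<open>Y\<close> needed to bring sums and images of
  \<open>V\<close> back into \<open>V\<close> form a compact set. By \<open>locally_finite\<close>
  they lie in some \<open>Z1\<close> finite over \<open>Q\<close>, so \<open>Z0 = V + Z1\<close> is
  a submodule, and it is compact over \<open>H\<close>.\<close>

theorem no_compact_parafin_extension:
 assumes S: "gens S UNIV" "zspan fs + S = UNIV" and G: "lcg G" "sub UNIV G" and W: "Wzero UNIV {0} G"
  and P: "parafin UNIV Y P" "P \<subseteq> G" and Y: "full Y"
 shows "Y = P"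
proof -
 note p = parafinD[OF P(1)]
 have gY: "add_subgroup Y" and gP: "add_subgroup P" using subD(1) p by blast+
 have YG: "Y \<subseteq> G" using p(5) P(2) by blast
 have lY: "lcg Y" by (rule lcg_subset[OF G(1) p(1) gY YG])
 have s0: "sub UNIV {0}" unfolding sub_def add_subgroup_def by simp
 have g0: "add_subgroup {0::'k}" by (rule subD(1)[OF s0])
 have "{0} \<subseteq> Y" using sg_zero[OF gY] by simp
 then obtain H Q where HQ: "hyper {0} H" "H \<subseteq> Q" "Q \<subseteq> Y" "sub UNIV Q" "omod Q Y" "cocpt H Q"
  using hyper_cocompact[OF S lY p(3) closed_singleton s0 _ Wzero_mono[OF W YG]] by blast
 obtain V where V: "compact V" "V \<subseteq> P" "0 \<in> V" "!!v. v \<in> V ==> - v \<in> V" "P = V + Y"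
  using cocpt_inside[OF p(6,2,5) gY gP] by metis
 have cS: "compact S" using S(1) gens_def by blast
 define K1 where "K1 = (V + V) \<union> (\<lambda>p. act (fst p) (snd p)) ` (S \<times> V)"
 have cK: "compact K1" unfolding K1_def by (intro compact_Un compact_set_plus compact_act V(1) cS)
 have K1P: "K1 \<subseteq> P" unfolding K1_def using sg_plus_subset[OF gP V(2) V(2)] subD(2)[OF p(4)] V(2) by auto
 \<comment> \<open>If \<open>k = v + y\<close> with \<open>k \<in> K1\<close>,
   \<open>v \<in> V\<close> and \<open>y \<in> Y\<close>, then \<open>y = k - v\<close> lies in this
   set, as \<open>V\<close> is symmetric.\<close>
 define C where "C = (K1 + V) \<inter> Y"
 have cC: "compact C" unfolding C_def by (rule compact_Int_closed[OF compact_set_plus[OF cK V(1)] p(1)])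
 obtain F1 where F1: "finite F1" "F1 \<subseteq> C" "C \<subseteq> F1 + Q" using compact_finite_mod[OF cC _ gY HQ(5)] unfolding C_def by blast
 have F1Y: "F1 \<subseteq> Y" using F1(2) C_def by blast
 obtain Z1 where Z1: "sub UNIV Z1" "Q \<subseteq> Z1" "Z1 \<subseteq> Y" "fmod Q Z1" "F1 \<subseteq> Z1"
  using locally_finite[OF S(1) p(3) Y HQ(4,3,5) F1(1) F1Y] by blast
 have gZ1: "add_subgroup Z1" by (rule subD(1)[OF Z1(1)])
 have CZ: "C \<subseteq> Z1" using F1(3) sg_plus_subset[OF gZ1 Z1(5,2)] by blast
 have KZ: "k \<in> V + Z1" if k: "k \<in> K1" for k
 proof -
  have "k \<in> V + Y" using K1P V(5) k by blast
  then obtain v y where v: "v \<in> V" "y \<in> Y" "k = v + y" by (rule set_plusE)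
  have "y \<in> K1 + V" by (rule set_plusI[OF k V(4)[OF v(1)]]) (simp add: v(3))
  then have "y \<in> Z1" using v(2) CZ C_def by blast
  then show ?thesis using v(1,3) by (metis set_plus_intro)
 qed
 define Z0 where "Z0 = V + Z1"
 have sZ0: "sub UNIV Z0" unfolding Z0_def
 proof (rule sub_plusI[OF S(1) Z1(1) V(3)])
  show "- v \<in> V + Z1" if "v \<in> V" for v by (rule set_plusI[OF V(4)[OF that] sg_zero[OF gZ1]]) simp
  show "v + w \<in> V + Z1" if "v \<in> V" "w \<in> V" for v w by (rule KZ) (use set_plus_intro[OF that] in \<open>simp add: K1_def\<close>)
  show "act a v \<in> V + Z1" if "a \<in> S" "v \<in> V" for a v by (rule KZ) (use that in \<open>force simp: K1_def\<close>)
 qed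
 have "omod Z1 Y" by (rule omod_mono[OF HQ(5) Z1(2) order_refl])
 then have "closed Z1" using omod_closed p(1) gZ1 gY Z1(3) by blast
 then have clZ0: "closed Z0" unfolding Z0_def by (rule closed_compact_plus[OF V(1)])
 have Z1Z0: "Z1 \<subseteq> Z0" unfolding Z0_def by (rule set_plus_right[OF V(3)])
 have "cocpt Q Z1" using Z1(4) finite_imp_compact unfolding fmod_def cocpt_def by blast
 then have "cocpt H Z0" using cocpt_trans[OF HQ(6)] cocpt_trans[OF _ cocpt_compact_plus[OF V(1), of Z1]] unfolding Z0_def by blast
 moreover have "H \<subseteq> Z0" using HQ(2) Z1(2) Z1Z0 by blast
 ultimately obtain Z where Z: "closed Z" "sub UNIV Z" "{0} \<subseteq> Z" "Z \<subseteq> Z0" "Z + H = Z0" "cocpt {0} Z"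
  using corigid_hyper[OF HQ(1) clZ0 sZ0] by blast
 have Z0P: "Z0 \<subseteq> P" unfolding Z0_def using Z1(3) p(5) by (intro sg_plus_subset[OF gP V(2)]) blast
 have ZG: "Z \<subseteq> G" using Z(4) Z0P P(2) by blast
 have PZ: "P \<subseteq> Z + Y"
 proof -
  have "V \<subseteq> Z0" unfolding Z0_def by (rule set_plus_left[OF sg_zero[OF gZ1]])
  then have "P \<subseteq> (Z + H) + Y" using V(5) Z(5) set_plus_mono[OF _ order_refl, of V "Z + H" Y] by blast
  also have "\<dots> = Z + (H + Y)" by (simp add: add.assoc)
  also have "\<dots> \<subseteq> Z + Y" using HQ(2,3) by (intro set_plus_mono order_refl sg_plus_subset[OF gY]) auto
  finally show ?thesis .
 qed
 have "P \<subseteq> Y"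
 proof
  fix x assume x: "x \<in> P"
  show "x \<in> Y"
  proof (rule mem_closed_if_near[OF p(1)])
   fix U :: "'k set" assume U: "nb U"
   obtain D where D: "sub UNIV D" "closed D" "{0} \<subseteq> D" "D \<subseteq> Z" "fmod D Z" "D \<subseteq> U + {0}"
    using profinite_basis[OF S(1) closed_singleton s0 Z(1-3,6) Wzero_mono[OF W ZG] U] .
   have gD: "add_subgroup D" by (rule subD(1)[OF D(1)])
   have "closed (D + Y)"
    by (rule closed_if_cocpt[OF cocpt_mono[OF Z(6) order_refl D(4)] closed_singleton D(2) p(1) D(3) _ g0 gD gY])
     (use sg_zero[OF gY] in simp)
   moreover have "Y \<subseteq> D + Y" using D(3) by (intro set_plus_right) blast
   moreover have "fmod (D + Y) P"
   proof -
    obtain F where F: "finite F" "Z \<subseteq> F + D" using D(5) fmod_def by blast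
    have "Z + Y \<subseteq> (F + D) + Y" by (rule set_plus_mono[OF F(2) order_refl])
    then have "P \<subseteq> F + (D + Y)" using PZ by (simp add: add.assoc)
    then show ?thesis using F(1) fmod_def by blast
   qed
   ultimately have "P \<subseteq> D + Y" using parafin_subset[OF P(1) sub_plus[OF D(1) p(3)]] by blast
   also have "\<dots> \<subseteq> U + Y" using D(6) by (intro set_plus_mono order_refl) simp
   finally show "x \<in> U + Y" using x by blast
  qed
 qed
 then show ?thesis using p(5) by blast
qed

end

text \<open>For a symmetric compact neighbourhood \<open>S\<close> of zero that contains the
  generators, \<open>S + S\<close> is covered by finitely many translates of \<open>S\<close>. So
  \<open>S\<close> plus the group generated by those finitely many translations is a subgroup, hence
  everything.\<close>

lemma compactly_generated_span:
 assumes "LCA_group_type TYPE('a::{topological_ab_group_add, t2_space})" "compactly_generated_type TYPE('a)"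
 obtains S fs where "compact S" "!!s. s \<in> S ==> - s \<in> (S::'a set)" "zspan fs + S = UNIV"
  "!!B. add_subgroup B ==> S \<subseteq> B ==> B = UNIV"
proof -
 have "locally_compact_space (euclidean :: 'a topology)" using assms(1) unfolding LCA_group_type_def .
 then have "\<exists>U K. open U \<and> compact K \<and> (0::'a) \<in> U \<and> U \<subseteq> K" unfolding locally_compact_space_def by simp
 then obtain U K0 where U: "open U" "compact K0" "(0::'a) \<in> U" "U \<subseteq> K0" by blast
 obtain K :: "'a set" where K: "compact K" "!!B. add_subgroup B ==> K \<subseteq> B ==> B = UNIV"
  using assms(2) unfolding compactly_generated_type_def by blast
 define S where "S = (K0 \<union> K) \<union> uminus ` (K0 \<union> K)"
 have S: "compact S" unfolding S_def by (intro compact_Un compact_uminus_image U K)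
 have Sneg: "- s \<in> S" if "s \<in> S" for s using that unfolding S_def by auto
 have US: "U \<subseteq> S" and KS: "K \<subseteq> S" unfolding S_def using U(4) by auto
 obtain F where F: "finite F" "F \<subseteq> S + S" "S + S \<subseteq> F + U"
  using compact_finite_translates[OF compact_set_plus[OF S S], of U] U(1,3) by blast
 obtain fs where fs: "set fs = F" using finite_list[OF F(1)] by blast
 have g: "add_subgroup (zspan fs)" by (rule zspan_subgroup)
 have "add_subgroup (S + zspan fs)"
 proof (rule sg_plusI[OF g])
  show "0 \<in> S" using US U(3) by blast
  fix v assume v: "v \<in> S"
  show "- v \<in> S + zspan fs" by (rule set_plusI[OF Sneg[OF v] sg_zero[OF g]]) simp
  fix w assume w: "w \<in> S"
  have "v + w \<in> F + U" using F(3) set_plus_intro[OF v w] by blast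
  then obtain f u where f: "f \<in> F" "u \<in> U" "v + w = f + u" by (rule set_plusE)
  have "f \<in> zspan fs" "u \<in> S" using zspan_contains fs f US by auto
  then show "v + w \<in> S + zspan fs" using f(3) by (intro set_plusI[of u _ f]) auto
 qed
 then have "add_subgroup (zspan fs + S)" by (simp add: add.commute)
 moreover have "K \<subseteq> zspan fs + S" using KS set_plus_right[OF sg_zero[OF g], of S] by blast
 ultimately have "zspan fs + S = UNIV" by (rule K(2))
 then show ?thesis using that[OF S Sneg] K(2) KS by blast
qed

text \<open>For a subgroup stable under \<open>S\<close>, the operators that preserve it together
  with their inverses form a subgroup containing the symmetric set \<open>S\<close>.\<close>

lemma (in tgact) gens_span:
 assumes "LCA_group_type TYPE('a)" "compactly_generated_type TYPE('a)"
 obtains S fs where "gens S UNIV" "zspan fs + S = UNIV"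
proof -
 obtain S fs where S: "compact S" "!!s. s \<in> S ==> - s \<in> (S::'a set)" "zspan fs + S = UNIV"
  "!!B. add_subgroup B ==> S \<subseteq> B ==> B = UNIV" using compactly_generated_span[OF assms] by metis
 have "sub UNIV X" if X: "add_subgroup X" "\<forall>a\<in>S. \<forall>x\<in>X. act a x \<in> X" for X
 proof -
  define B where "B = {a. \<forall>x\<in>X. act a x \<in> X \<and> act (- a) x \<in> X}"
  have "add_subgroup B" unfolding add_subgroup_def B_def 
  proof (intro conjI ballI CollectI; (elim CollectE)?)
   fix a b assume ab: "\<forall>x\<in>X. act a x \<in> X \<and> act (- a) x \<in> X" "\<forall>x\<in>X. act b x \<in> X \<and> act (- b) x \<in> X"
   fix x assume x: "x \<in> X"
   have "- (a + b) = - a + - b" by simp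
   then show "act (a + b) x \<in> X" "act (- (a + b)) x \<in> X" unfolding act_act using ab x by (simp_all only: act_act)
  qed auto
  moreover have "S \<subseteq> B" unfolding B_def using X(2) S(2) by blast
  ultimately have "B = UNIV" by (rule S(4))
  then show ?thesis unfolding sub_def B_def using X(1) by blast
 qed
 then have "gens S UNIV" unfolding gens_def using S(1) by blast
 then show ?thesis using that S(3) by blast
qed

section \<open>Modules as records\<close>

text \<open>The constructor \<open>topology\<close> yields the intended open sets only after the
  predicate is verified to be a topology.\<close>

lemma openin_quotient_topology:
 "openin (quotient_topology X f) U \<longleftrightarrow> U \<subseteq> f ` topspace X \<and> openin X {x \<in> topspace X. f x \<in> U}"
proof -
 have "istopology (\<lambda>U. U \<subseteq> f ` topspace X \<and> openin X {x \<in> topspace X. f x \<in> U})"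
  unfolding istopology_def
 proof (intro conjI allI impI)
  fix S T assume h: "S \<subseteq> f ` topspace X \<and> openin X {x \<in> topspace X. f x \<in> S}"
   "T \<subseteq> f ` topspace X \<and> openin X {x \<in> topspace X. f x \<in> T}"
  show "S \<inter> T \<subseteq> f ` topspace X" using h by blast
  have "{x \<in> topspace X. f x \<in> S \<inter> T} = {x \<in> topspace X. f x \<in> S} \<inter> {x \<in> topspace X. f x \<in> T}" by blast
  then show "openin X {x \<in> topspace X. f x \<in> S \<inter> T}" using openin_Int[OF h(1)[THEN conjunct2] h(2)[THEN conjunct2]] by simp
 next
  fix K assume h: "\<forall>S\<in>K. S \<subseteq> f ` topspace X \<and> openin X {x \<in> topspace X. f x \<in> S}"
  show "\<Union>K \<subseteq> f ` topspace X" using h by blast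
  have "{x \<in> topspace X. f x \<in> \<Union>K} = \<Union>((\<lambda>S. {x \<in> topspace X. f x \<in> S}) ` K)" by blast
  moreover have "openin X (\<Union>((\<lambda>S. {x \<in> topspace X. f x \<in> S}) ` K))" by (rule openin_Union) (use h in blast)
  ultimately show "openin X {x \<in> topspace X. f x \<in> \<Union>K}" by simp
 qed
 then show ?thesis unfolding quotient_topology_def by (simp add: topology_inverse')
qed

lemma topspace_quotient_topology [simp]: "topspace (quotient_topology X f) = f ` topspace X"
proof
 show "topspace (quotient_topology X f) \<subseteq> f ` topspace X"
  using openin_topspace[of "quotient_topology X f"] unfolding openin_quotient_topology by blast
 have "{x \<in> topspace X. f x \<in> f ` topspace X} = topspace X" by blast
 then have "openin (quotient_topology X f) (f ` topspace X)" unfolding openin_quotient_topology by simp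
 then show "f ` topspace X \<subseteq> topspace (quotient_topology X f)" by (rule openin_subset)
qed

lemma submod_simps [simp]:
 "mcar (submod M N) = N" "madd (submod M N) = madd M" "mzero (submod M N) = mzero M"
 "mneg (submod M N) = mneg M" "mact (submod M N) = mact M" "mtop (submod M N) = subtopology (mtop M) N"
 by (simp_all add: submod_def)

lemma mcoset_submod [simp]: "mcoset (submod M Y) N = mcoset M N"
 by (auto simp: mcoset_def fun_eq_iff)

lemma submodule_submod: "N \<subseteq> mcar M ==> submodule (submod M N) U \<longleftrightarrow> submodule M U \<and> U \<subseteq> N"
 by (auto simp: submodule_def)

lemma quotmod_simps [simp]:
 "mcar (quotmod M N) = mcoset M N ` mcar M" "madd (quotmod M N) = (\<lambda>X Y. {madd M x y | x y. x \<in> X \<and> y \<in> Y})"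
 "mzero (quotmod M N) = N" "mneg (quotmod M N) = (\<lambda>X. mneg M ` X)"
 "mact (quotmod M N) = (\<lambda>a X. mact M a ` X)" "mtop (quotmod M N) = quotient_topology (mtop M) (mcoset M N)"
 by (simp_all add: quotmod_def)

lemma lcmodD: assumes "is_lcmod M"
 shows "mzero M \<in> mcar M" "x \<in> mcar M ==> y \<in> mcar M ==> madd M x y \<in> mcar M"
  "x \<in> mcar M ==> mneg M x \<in> mcar M" "x \<in> mcar M ==> mact M a x \<in> mcar M"
  "x \<in> mcar M ==> y \<in> mcar M ==> z \<in> mcar M ==> madd M (madd M x y) z = madd M x (madd M y z)"
  "x \<in> mcar M ==> y \<in> mcar M ==> madd M x y = madd M y x"
  "x \<in> mcar M ==> madd M (mzero M) x = x" "x \<in> mcar M ==> madd M (mneg M x) x = mzero M"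
  "x \<in> mcar M ==> y \<in> mcar M ==> mact M a (madd M x y) = madd M (mact M a x) (mact M a y)"
  "x \<in> mcar M ==> mact M 0 x = x" "x \<in> mcar M ==> mact M (a + b) x = mact M a (mact M b x)"
  "topspace (mtop M) = mcar M" "Hausdorff_space (mtop M)"
  "continuous_map (prod_topology (mtop M) (mtop M)) (mtop M) (\<lambda>(x, y). madd M x y)"
  "continuous_map (mtop M) (mtop M) (mneg M)"
  "continuous_map (prod_topology euclidean (mtop M)) (mtop M) (\<lambda>(a, x). mact M a x)" "locally_compact_space (mtop M)"
 using assms unfolding is_lcmod_def by blast+

lemma continuous_map_nhds2:
 assumes f: "continuous_map (prod_topology X Y) Z f" and V: "openin Z V" and ab: "a \<in> topspace X" "b \<in> topspace Y" "f (a, b) \<in> V"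
 obtains A B where "openin X A" "openin Y B" "a \<in> A" "b \<in> B" "!!x y. x \<in> A ==> y \<in> B ==> f (x, y) \<in> V"
proof -
 have o: "openin (prod_topology X Y) {p \<in> topspace (prod_topology X Y). f p \<in> V}" using f V unfolding continuous_map_def by blast
 have "(a, b) \<in> {p \<in> topspace (prod_topology X Y). f p \<in> V}" using ab by simp
 then obtain A B where AB: "openin X A" "openin Y B" "a \<in> A" "b \<in> B" "A \<times> B \<subseteq> {p \<in> topspace (prod_topology X Y). f p \<in> V}"
  using o unfolding openin_prod_topology_alt by meson
 have "f (x, y) \<in> V" if "x \<in> A" "y \<in> B" for x y using AB(5) that by blast
 then show ?thesis using that AB(1-4) by blast
qed

text \<open>Because \<open>g\<close> and \<open>h\<close> are open and onto, maps out of a product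
  of quotients can be tested upstairs; for arbitrary quotient maps this can fail. It gives the
  continuity of addition and action on a quotient module.\<close>

lemma continuous_map_prod_open_images:
 assumes f: "continuous_map (prod_topology X Y) Z f"
  and g: "!!U. openin X U ==> openin X' (g ` U)" "topspace X' = g ` topspace X"
  and h: "!!U. openin Y U ==> openin Y' (h ` U)" "topspace Y' = h ` topspace Y"
  and F: "!!x y. x \<in> topspace X ==> y \<in> topspace Y ==> F (g x, h y) = f (x, y)"
 shows "continuous_map (prod_topology X' Y') Z F"
 unfolding continuous_map_def
proof (intro conjI allI impI)
 have fZ: "f (x, y) \<in> topspace Z" if "x \<in> topspace X" "y \<in> topspace Y" for x y
  using f that unfolding continuous_map_def by (auto simp: Pi_iff)
 then show "F \<in> topspace (prod_topology X' Y') \<rightarrow> topspace Z" using F by (auto simp: g(2) h(2))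
 fix V assume V: "openin Z V"
 show "openin (prod_topology X' Y') {p \<in> topspace (prod_topology X' Y'). F p \<in> V}"
  unfolding openin_prod_topology_alt
 proof (intro allI impI)
  fix a b assume "(a, b) \<in> {p \<in> topspace (prod_topology X' Y'). F p \<in> V}"
  then obtain x y where xy: "x \<in> topspace X" "y \<in> topspace Y" "a = g x" "b = h y" "f (x, y) \<in> V" using F by (auto simp: g(2) h(2))
  obtain A B where AB: "openin X A" "openin Y B" "x \<in> A" "y \<in> B" "!!x y. x \<in> A ==> y \<in> B ==> f (x, y) \<in> V"
   using continuous_map_nhds2[OF f V xy(1,2,5)] by blast
  have "F (g u, h v) \<in> V \<and> g u \<in> topspace X' \<and> h v \<in> topspace Y'" if "u \<in> A" "v \<in> B" for u v
  proof -
   have "u \<in> topspace X" "v \<in> topspace Y" using that openin_subset[OF AB(1)] openin_subset[OF AB(2)] by blast+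
   then show ?thesis using F[of u v] AB(5)[OF that] unfolding g(2) h(2) by auto
  qed
  then have "g ` A \<times> h ` B \<subseteq> {p \<in> topspace (prod_topology X' Y'). F p \<in> V}" by auto
  then show "\<exists>U W. openin X' U \<and> openin Y' W \<and> a \<in> U \<and> b \<in> W \<and> U \<times> W \<subseteq> {p \<in> topspace (prod_topology X' Y'). F p \<in> V}"
   using g(1)[OF AB(1)] h(1)[OF AB(2)] AB(3,4) xy(3,4) by blast
 qed
qed

lemma lcmod_submod:
 assumes M: "is_lcmod M" and N: "closed_submodule M N" shows "is_lcmod (submod M N)"
proof -
 have s: "submodule M N" "closedin (mtop M) N" using N unfolding closed_submodule_def by auto
 have NM: "N \<subseteq> mcar M" using s(1) unfolding submodule_def by blast
 have top: "topspace (mtop M) = mcar M" "Hausdorff_space (mtop M)" "locally_compact_space (mtop M)"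
  and cont: "continuous_map (prod_topology (mtop M) (mtop M)) (mtop M) (\<lambda>(x, y). madd M x y)"
   "continuous_map (mtop M) (mtop M) (mneg M)"
   "continuous_map (prod_topology euclidean (mtop M)) (mtop M) (\<lambda>(a, x). mact M a x)"
  using M unfolding is_lcmod_def by auto
 have A: "\<forall>x\<in>mcar M. \<forall>y\<in>mcar M. \<forall>z\<in>mcar M. madd M (madd M x y) z = madd M x (madd M y z)"
  "\<forall>x\<in>mcar M. \<forall>y\<in>mcar M. madd M x y = madd M y x" "\<forall>x\<in>mcar M. madd M (mzero M) x = x" "\<forall>x\<in>mcar M. madd M (mneg M x) x = mzero M"
  "\<forall>a. \<forall>x\<in>mcar M. \<forall>y\<in>mcar M. mact M a (madd M x y) = madd M (mact M a x) (mact M a y)" "\<forall>x\<in>mcar M. mact M 0 x = x"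
  "\<forall>a b. \<forall>x\<in>mcar M. mact M (a + b) x = mact M a (mact M b x)"
  using M unfolding is_lcmod_def by - (elim conjE, assumption)+
 have 1: "prod_topology (subtopology (mtop M) N) (subtopology (mtop M) N) = subtopology (prod_topology (mtop M) (mtop M)) (N \<times> N)"
  using NM top(1) by (simp add: prod_topology_subtopology subtopology_subtopology Times_Int_Times Int_absorb1 Int_absorb2)
 have 2: "prod_topology (euclidean :: 'a topology) (subtopology (mtop M) N) = subtopology (prod_topology euclidean (mtop M)) (UNIV \<times> N)"
  by (simp add: prod_topology_subtopology)
 have "continuous_map (prod_topology (subtopology (mtop M) N) (subtopology (mtop M) N)) (subtopology (mtop M) N) (\<lambda>(x, y). madd M x y)"
  unfolding continuous_map_in_subtopology 1
  using continuous_map_from_subtopology[OF cont(1)] s(1) by (auto simp: submodule_def)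
 moreover have "continuous_map (subtopology (mtop M) N) (subtopology (mtop M) N) (mneg M)"
  unfolding continuous_map_in_subtopology
  using continuous_map_from_subtopology[OF cont(2)] s(1) by (auto simp: submodule_def)
 moreover have "continuous_map (prod_topology euclidean (subtopology (mtop M) N)) (subtopology (mtop M) N) (\<lambda>(a, x). mact M a x)"
  unfolding continuous_map_in_subtopology 2
  using continuous_map_from_subtopology[OF cont(3)] s(1) by (auto simp: submodule_def)
 moreover have "locally_compact_space (subtopology (mtop M) N)" by (rule locally_compact_space_closed_subset[OF top(3) s(2)])
 moreover have "Hausdorff_space (subtopology (mtop M) N)" by (rule Hausdorff_space_subtopology[OF top(2)])
 moreover have "topspace (subtopology (mtop M) N) = N" using NM top(1) by auto
 moreover have "\<forall>x\<in>N. \<forall>y\<in>N. \<forall>z\<in>N. madd M (madd M x y) z = madd M x (madd M y z)"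
  "\<forall>x\<in>N. \<forall>y\<in>N. madd M x y = madd M y x" "\<forall>x\<in>N. madd M (mzero M) x = x" "\<forall>x\<in>N. madd M (mneg M x) x = mzero M"
  "\<forall>a. \<forall>x\<in>N. \<forall>y\<in>N. mact M a (madd M x y) = madd M (mact M a x) (mact M a y)" "\<forall>x\<in>N. mact M 0 x = x"
  "\<forall>a b. \<forall>x\<in>N. mact M (a + b) x = mact M a (mact M b x)"
  using A NM by blast+
 ultimately show ?thesis using s(1) unfolding is_lcmod_def submodule_def submod_simps
  by - (elim conjE, (intro conjI; assumption))
qed

text \<open>Transports a record-based module into a class-based topological group, where submodules
  become actual subgroups. The image is closed so that being closed in \<open>M\<close> and in the
  ambient group mean the same (\<open>closedin_iff\<close>).\<close>

locale emb = tgact act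
 for act :: "'a::{topological_ab_group_add, t2_space} => 'k::{topological_ab_group_add, t2_space} => 'k" +
 fixes M :: "('a, 'm) amod" and j :: "'m => 'k"
 assumes lc: "is_lcmod M"
  and i_add: "x \<in> mcar M ==> y \<in> mcar M ==> j (madd M x y) = j x + j y"
  and i_act: "x \<in> mcar M ==> j (mact M a x) = act a (j x)"
  and i_inj: "inj_on j (mcar M)"
  and i_open: "openin (mtop M) V \<longleftrightarrow> V \<subseteq> mcar M \<and> (\<exists>T. open T \<and> V = {x \<in> mcar M. j x \<in> T})"
  and i_closed: "closed (j ` mcar M)"
begin

abbreviation im :: "'k set" where "im \<equiv> j ` mcar M"

lemma car [simp]: "mzero M \<in> mcar M" "x \<in> mcar M ==> y \<in> mcar M ==> madd M x y \<in> mcar M"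
  "x \<in> mcar M ==> mneg M x \<in> mcar M" "x \<in> mcar M ==> mact M a x \<in> mcar M"
 and m_zero: "x \<in> mcar M ==> madd M (mzero M) x = x" "x \<in> mcar M ==> madd M (mneg M x) x = mzero M"
 and m_top [simp]: "topspace (mtop M) = mcar M"
 using lc unfolding is_lcmod_def by blast+

lemma i_zero [simp]: "j (mzero M) = 0"
 using i_add[of "mzero M" "mzero M"] m_zero(1)[of "mzero M"] by simp

lemma i_neg: "x \<in> mcar M ==> j (mneg M x) = - j x"
 using i_add[of "mneg M x" x] m_zero(2)[of x] by (simp add: eq_neg_iff_add_eq_0)

lemma i_mem: "x \<in> mcar M ==> Y \<subseteq> mcar M ==> j x \<in> j ` Y \<longleftrightarrow> x \<in> Y"
 using i_inj unfolding inj_on_def by blast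

lemma i_subset: "X \<subseteq> mcar M ==> Y \<subseteq> mcar M ==> j ` X \<subseteq> j ` Y \<longleftrightarrow> X \<subseteq> Y"
 by (rule inj_on_image_subset_iff[OF i_inj])

lemma i_image_eq: "X \<subseteq> mcar M ==> Y \<subseteq> mcar M ==> j ` X = j ` Y \<longleftrightarrow> X = Y"
 by (rule inj_on_image_eq_iff[OF i_inj])

lemma i_lift: assumes "Z \<subseteq> im" obtains Y where "Y \<subseteq> mcar M" "Z = j ` Y"
 using assms unfolding subset_image_iff by blast

lemma submodule_iff: assumes "Y \<subseteq> mcar M" shows "submodule M Y \<longleftrightarrow> sub UNIV (j ` Y)"
proof
 assume s: "submodule M Y"
 have "j x + j y \<in> j ` Y" "- j x \<in> j ` Y" "act a (j x) \<in> j ` Y" if "x \<in> Y" "y \<in> Y" for x y a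
  using that s assms i_add[of x y, symmetric] i_neg[of x, symmetric] i_act[of x a, symmetric] unfolding submodule_def by auto
 moreover have "0 \<in> j ` Y" using s i_zero unfolding submodule_def by (metis image_eqI)
 ultimately show "sub UNIV (j ` Y)" unfolding sub_def add_subgroup_def by auto
next
 assume s: "sub UNIV (j ` Y)"
 note g = subD(1)[OF s]
 have mem: "x \<in> Y" if "x \<in> mcar M" "j x \<in> j ` Y" for x using i_mem[OF that(1) assms] that(2) by simp
 show "submodule M Y" unfolding submodule_def
 proof (intro conjI ballI allI)
  show "mzero M \<in> Y" by (rule mem) (use sg_zero[OF g] in auto)
  fix x assume x: "x \<in> Y"
  then have xM: "x \<in> mcar M" using assms by blast
  show "mneg M x \<in> Y" by (rule mem) (use xM x i_neg[OF xM] sg_neg[OF g] in auto)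
  show "mact M a x \<in> Y" for a by (rule mem) (use xM x i_act[OF xM] subD(2)[OF s] in auto)
  fix y assume y: "y \<in> Y"
  then have yM: "y \<in> mcar M" using assms by blast
  show "madd M x y \<in> Y" by (rule mem) (use xM x yM y i_add[OF xM yM] sg_add[OF g] in auto)
 qed (use assms in auto)
qed

lemma submoduleD: assumes "submodule M Y" shows "Y \<subseteq> mcar M" "sub UNIV (j ` Y)" "add_subgroup (j ` Y)"
proof -
 show Y: "Y \<subseteq> mcar M" using assms unfolding submodule_def by blast
 show "sub UNIV (j ` Y)" using assms submodule_iff[OF Y] by blast
 then show "add_subgroup (j ` Y)" by (rule subD(1))
qed

lemma submodule_mcar: "submodule M (mcar M)"
 unfolding submodule_def by auto

lemmas sub_im = submoduleD(2)[OF submodule_mcar]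
lemmas group_im = submoduleD(3)[OF submodule_mcar]

lemma closedin_iff: assumes Y: "Y \<subseteq> mcar M" shows "closedin (mtop M) Y \<longleftrightarrow> closed (j ` Y)"
proof
 assume "closedin (mtop M) Y"
 then have "openin (mtop M) (mcar M - Y)" unfolding closedin_def by simp
 then obtain T where T: "open T" "mcar M - Y = {x \<in> mcar M. j x \<in> T}" unfolding i_open by blast
 have "j ` Y = im \<inter> - T" using T(2) Y by blast
 then show "closed (j ` Y)" using closed_Int[OF i_closed] T(1) by (simp add: closed_Compl)
next
 assume c: "closed (j ` Y)"
 have "mcar M - Y = {x \<in> mcar M. j x \<in> - j ` Y}" using i_mem[OF _ Y] by blast
 moreover have "open (- j ` Y)" using c by (simp add: open_Compl)
 ultimately have "openin (mtop M) (mcar M - Y)" unfolding i_open by blast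
 then show "closedin (mtop M) Y" unfolding closedin_def using Y by simp
qed

lemma compactin_iff: assumes K: "K \<subseteq> mcar M" shows "compactin (mtop M) K \<longleftrightarrow> compact (j ` K)"
proof
 have "continuous_map (mtop M) euclidean j" unfolding continuous_map_def using i_open by auto
 moreover assume "compactin (mtop M) K"
 ultimately have "compactin euclidean (j ` K)" using image_compactin by blast
 then show "compact (j ` K)" by simp
next
 assume c: "compact (j ` K)"
 show "compactin (mtop M) K" unfolding compactin_def
 proof (intro conjI allI impI)
  fix \<U> assume U: "Ball \<U> (openin (mtop M)) \<and> K \<subseteq> \<Union>\<U>"
  then have "\<forall>U\<in>\<U>. \<exists>T. open T \<and> U = {x \<in> mcar M. j x \<in> T}" unfolding i_open by blast
  then obtain T where T: "!!U. U \<in> \<U> ==> open (T U)" "!!U. U \<in> \<U> ==> U = {x \<in> mcar M. j x \<in> T U}" by metis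
  have "j ` K \<subseteq> \<Union>(T ` \<U>)" using U T(2) by blast
  then obtain D where D: "D \<subseteq> \<U>" "finite D" "j ` K \<subseteq> (\<Union>c\<in>D. T c)" using compactE_image[OF c, of \<U> T] T(1) by blast
  have "K \<subseteq> \<Union>D" using D T(2) K by blast
  then show "\<exists>\<F>. finite \<F> \<and> \<F> \<subseteq> \<U> \<and> K \<subseteq> \<Union>\<F>" using D by blast
 qed (use K in simp)
qed

text \<open>The open set cutting out \<open>V\<close> is the sum of \<open>T\<close> and the image
  of \<open>V\<close>: within the image of \<open>M\<close>, adding an element of \<open>T\<close>
  is adding an element of \<open>U\<close>.\<close>

lemma openin_translates:
 assumes T: "nb T" "T \<inter> im \<subseteq> j ` U" and V: "V \<subseteq> mcar M" "!!v u. v \<in> V ==> u \<in> U ==> j v + j u \<in> j ` V"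
 shows "openin (mtop M) V"
proof -
 have "V = {x \<in> mcar M. j x \<in> T + j ` V}"
 proof (intro equalityI subsetI)
  fix x assume x: "x \<in> V"
  have "j x \<in> T + j ` V" by (rule set_plusI[of 0]) (use T(1) x in auto)
  then show "x \<in> {x \<in> mcar M. j x \<in> T + j ` V}" using x V(1) by blast
 next
  fix x assume "x \<in> {x \<in> mcar M. j x \<in> T + j ` V}"
  then have x: "x \<in> mcar M" "j x \<in> T + j ` V" by auto
  obtain t v where tv: "t \<in> T" "v \<in> V" "j x = t + j v" using x(2) by (auto elim!: set_plusE)
  have "j x - j v \<in> im" using x tv(2) V(1) by (intro sg_diff[OF group_im]) auto
  then have "t \<in> im" using tv(3) by simp
  then obtain u where u: "u \<in> U" "t = j u" using tv(1) T(2) by blast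
  then have "j x \<in> j ` V" using V(2)[OF tv(2) u(1)] tv(3) by (simp add: add.commute)
  then show "x \<in> V" using i_mem[OF x(1) V(1)] by blast
 qed
 moreover have "open (T + j ` V)" using T(1) open_set_plus by blast
 ultimately show ?thesis unfolding i_open using V(1) by blast
qed

lemma openin_iff: assumes U: "submodule M U" shows "openin (mtop M) U \<longleftrightarrow> omod (j ` U) im"
proof
 assume "openin (mtop M) U"
 then obtain T where T: "open T" "U = {x \<in> mcar M. j x \<in> T}" unfolding i_open by blast
 have "mzero M \<in> U" using U unfolding submodule_def by blast
 then have "nb T" using T by auto
 moreover have "T \<inter> im \<subseteq> j ` U" using T(2) by blast
 ultimately show "omod (j ` U) im" unfolding omod_def by blast
next
 assume "omod (j ` U) im"
 then obtain T where T: "nb T" "T \<inter> im \<subseteq> j ` U" unfolding omod_def by blast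
 show "openin (mtop M) U"
  by (rule openin_translates[OF T submoduleD(1)[OF U]]) (auto intro: sg_add[OF submoduleD(3)[OF U]])
qed

lemma lcg_im: "lcg im"
proof -
 have "locally_compact_space (mtop M)" using lc unfolding is_lcmod_def by blast
 then obtain U K where UK: "openin (mtop M) U" "compactin (mtop M) K" "mzero M \<in> U" "U \<subseteq> K"
  unfolding locally_compact_space_def by (metis car(1) m_top)
 obtain T where T: "open T" "U = {x \<in> mcar M. j x \<in> T}" using UK(1) unfolding i_open by blast
 have "K \<subseteq> mcar M" using UK(2) compactin_subset_topspace by fastforce
 then have "compact (j ` K)" using UK(2) compactin_iff by blast
 moreover have "nb T" using T UK(3) by auto
 moreover have "T \<inter> im \<subseteq> j ` K" using T(2) UK(4) by blast
 ultimately show ?thesis unfolding lcg_def using i_closed group_im by blast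
qed

lemma closed_submoduleD: assumes "closed_submodule M N"
 shows "submodule M N" "N \<subseteq> mcar M" "sub UNIV (j ` N)" "add_subgroup (j ` N)" "closed (j ` N)" "j ` N \<subseteq> im" "0 \<in> j ` N"
proof -
 show s: "submodule M N" using assms unfolding closed_submodule_def by blast
 show N: "N \<subseteq> mcar M" "sub UNIV (j ` N)" "add_subgroup (j ` N)" by (rule submoduleD[OF s])+
 show "closed (j ` N)" using assms closedin_iff[OF N(1)] unfolding closed_submodule_def by blast
 show "j ` N \<subseteq> im" using N(1) by blast
 show "0 \<in> j ` N" by (rule sg_zero[OF N(3)])
qed

lemma closed_submodule_iff: "N \<subseteq> mcar M ==> closed_submodule M N \<longleftrightarrow> sub UNIV (j ` N) \<and> closed (j ` N)"
 unfolding closed_submodule_def using closedin_iff submodule_iff by blast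

lemma emb_submod: assumes N: "closed_submodule M N" shows "emb act (submod M N) j"
proof
 note n = closed_submoduleD[OF N]
 show "is_lcmod (submod M N)" by (rule lcmod_submod[OF lc N])
 show "inj_on j (mcar (submod M N))" using inj_on_subset[OF i_inj n(2)] by simp
 show "closed (j ` mcar (submod M N))" using n(5) by simp
 fix V show "openin (mtop (submod M N)) V \<longleftrightarrow> V \<subseteq> mcar (submod M N) \<and> (\<exists>T. open T \<and> V = {x \<in> mcar (submod M N). j x \<in> T})"
 proof
  assume "openin (mtop (submod M N)) V"
  then obtain Q where Q: "openin (mtop M) Q" "V = Q \<inter> N" by (auto simp: openin_subtopology)
  obtain T where T: "open T" "Q = {x \<in> mcar M. j x \<in> T}" using Q(1) unfolding i_open by blast
  have "V = {x \<in> N. j x \<in> T}" using Q(2) T(2) n(2) by blast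
  then show "V \<subseteq> mcar (submod M N) \<and> (\<exists>T. open T \<and> V = {x \<in> mcar (submod M N). j x \<in> T})" using T(1) by auto
 next
  assume "V \<subseteq> mcar (submod M N) \<and> (\<exists>T. open T \<and> V = {x \<in> mcar (submod M N). j x \<in> T})"
  then obtain T where T: "open T" "V = {x \<in> N. j x \<in> T}" by auto
  have "openin (mtop M) {x \<in> mcar M. j x \<in> T}" unfolding i_open using T(1) by blast
  moreover have "V = {x \<in> mcar M. j x \<in> T} \<inter> N" using T(2) n(2) by blast
  ultimately show "openin (mtop (submod M N)) V" by (auto simp: openin_subtopology)
 qed
qed (use closed_submoduleD(2)[OF N] in \<open>auto simp: i_add i_act subset_iff\<close>)

lemma mcoset_subset: "N \<subseteq> mcar M ==> x \<in> mcar M ==> mcoset M N x \<subseteq> mcar M"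
 unfolding mcoset_def by auto

lemma i_mcoset: assumes "N \<subseteq> mcar M" "x \<in> mcar M" shows "j ` mcoset M N x = {j x} + j ` N"
proof (intro equalityI subsetI)
 fix k assume "k \<in> j ` mcoset M N x"
 then obtain n where n: "n \<in> N" "k = j (madd M x n)" unfolding mcoset_def by blast
 then have "k = j x + j n" using assms i_add by auto
 then show "k \<in> {j x} + j ` N" using n(1) by (intro set_plusI[of "j x" _ "j n"]) auto
next
 fix k assume "k \<in> {j x} + j ` N"
 then obtain n where n: "n \<in> N" "k = j x + j n" by (auto elim!: set_plusE)
 then have "k = j (madd M x n)" using assms i_add by auto
 then show "k \<in> j ` mcoset M N x" using n(1) unfolding mcoset_def by blast
qed

lemma singleton_plus_eq: fixes B :: "'k set" assumes "add_subgroup B" shows "{a} + B = {b} + B \<longleftrightarrow> a - b \<in> B"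
proof
 assume e: "{a} + B = {b} + B"
 have "a \<in> {a} + B" using set_plus_left[OF sg_zero[OF assms], of "{a}"] by blast
 then have "a \<in> {b} + B" using e by simp
 then show "a - b \<in> B" by (auto elim!: set_plusE)
next
 have le: "{c} + B \<subseteq> {d} + B" if "c - d \<in> B" for c d :: 'k
 proof
  fix k assume "k \<in> {c} + B"
  then obtain n where "n \<in> B" "k = c + n" by (auto elim!: set_plusE)
  then show "k \<in> {d} + B" using sg_add[OF assms that, of n] by (intro set_plusI[of d _ "c - d + n"]) auto
 qed
 assume ab: "a - b \<in> B"
 then have "b - a \<in> B" using sg_neg[OF assms ab] by simp
 then show "{a} + B = {b} + B" using le ab by blast
qed

lemma mcoset_eq_iff:
 assumes N: "submodule M N" and "x \<in> mcar M" "y \<in> mcar M"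
 shows "mcoset M N x = mcoset M N y \<longleftrightarrow> j x - j y \<in> j ` N"
 using i_image_eq[OF mcoset_subset[OF submoduleD(1)[OF N]] mcoset_subset[OF submoduleD(1)[OF N]], of x y]
  i_mcoset[OF submoduleD(1)[OF N]] assms singleton_plus_eq[OF submoduleD(3)[OF N]] by simp

lemma mcoset_zero: assumes "submodule M N" shows "mcoset M N (mzero M) = N"
 using submoduleD(1)[OF assms] m_zero(1) unfolding mcoset_def by force

lemma finite_cosets_iff:
 assumes N: "submodule M N" and Y: "submodule M Y" "N \<subseteq> Y"
 shows "finite (mcoset M N ` Y) \<longleftrightarrow> fmod (j ` N) (j ` Y)"
proof
 note n = submoduleD[OF N] and y = submoduleD[OF Y(1)]
 assume "finite (mcoset M N ` Y)"
 then obtain F where F: "finite F" "F \<subseteq> Y" "mcoset M N ` Y = mcoset M N ` F" using finite_subset_image[of "mcoset M N ` Y" "mcoset M N" Y] by auto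
 have "j ` Y \<subseteq> j ` F + j ` N"
 proof
  fix k assume "k \<in> j ` Y"
  then obtain x where x: "x \<in> Y" "k = j x" by blast
  then obtain f where f: "f \<in> F" "mcoset M N x = mcoset M N f" using F(3) by blast
  have "j x - j f \<in> j ` N" using mcoset_eq_iff[OF N, of x f] x f F(2) y(1) by blast
  then show "k \<in> j ` F + j ` N" using f(1) x(2) by (intro set_plusI[of "j f" _ "j x - j f"]) auto
 qed
 then show "fmod (j ` N) (j ` Y)" unfolding fmod_def using F(1) by blast
next
 note n = submoduleD[OF N] and y = submoduleD[OF Y(1)]
 assume "fmod (j ` N) (j ` Y)"
 then obtain F where F: "finite F" "j ` Y \<subseteq> F + j ` N" unfolding fmod_def by blast
 have "mcoset M N ` Y \<subseteq> (\<lambda>f. {x \<in> mcar M. j x \<in> {f} + j ` N}) ` F"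
 proof
  fix c assume "c \<in> mcoset M N ` Y"
  then obtain x where x: "x \<in> Y" "c = mcoset M N x" by blast
  have xM: "x \<in> mcar M" using x y by blast
  obtain f m where f: "f \<in> F" "m \<in> j ` N" "j x = f + m" using F(2) x(1) by (blast elim: set_plusE)
  then have "{j x} + j ` N = {f} + j ` N" using singleton_plus_eq[OF n(3), of "j x" f] by simp
  then have "j ` c = {f} + j ` N" using i_mcoset[OF n(1) xM] x(2) by simp
  then have "c = {x \<in> mcar M. j x \<in> {f} + j ` N}" using mcoset_subset[OF n(1) xM] x(2) i_mem[of _ c] by blast
  then show "c \<in> (\<lambda>f. {x \<in> mcar M. j x \<in> {f} + j ` N}) ` F" using f(1) by blast
 qed
 then show "finite (mcoset M N ` Y)" using F(1) by (meson finite_imageI finite_subset)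
qed

end

section \<open>Cosets and quotients of an embedded module\<close>

context emb
begin

lemma i_madd_set: assumes "X \<subseteq> mcar M" "Y \<subseteq> mcar M"
 shows "j ` {madd M x y | x y. x \<in> X \<and> y \<in> Y} = j ` X + j ` Y"
proof (intro equalityI subsetI)
 fix k assume "k \<in> j ` {madd M x y | x y. x \<in> X \<and> y \<in> Y}"
 then obtain x y where xy: "x \<in> X" "y \<in> Y" "k = j (madd M x y)" by blast
 then show "k \<in> j ` X + j ` Y" using assms i_add[of x y] by (intro set_plusI[of "j x" _ "j y"]) auto
next
 fix k assume "k \<in> j ` X + j ` Y"
 then obtain x y where xy: "x \<in> X" "y \<in> Y" "k = j x + j y" by (auto elim!: set_plusE)
 moreover have "x \<in> mcar M" "y \<in> mcar M" using xy assms by blast+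
 ultimately have "k = j (madd M x y)" by (simp add: i_add)
 then show "k \<in> j ` {madd M x y | x y. x \<in> X \<and> y \<in> Y}" using xy by blast
qed

lemma i_mneg_set: "X \<subseteq> mcar M ==> j ` (mneg M ` X) = uminus ` (j ` X)"
 unfolding image_image by (rule image_cong[OF refl]) (use i_neg in blast)

lemma i_mact_set: "X \<subseteq> mcar M ==> j ` (mact M a ` X) = act a ` (j ` X)"
 unfolding image_image by (rule image_cong[OF refl]) (use i_act in blast)

lemma act_set_plus: "act a ` (A + B) = act a ` A + act a ` B"
proof (intro equalityI subsetI)
 fix k assume "k \<in> act a ` (A + B)"
 then obtain x y where "x \<in> A" "y \<in> B" "k = act a (x + y)" by (auto elim!: set_plusE)
 then show "k \<in> act a ` A + act a ` B" by (intro set_plusI[of "act a x" _ "act a y"]) (auto simp: act_add)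
next
 fix k assume "k \<in> act a ` A + act a ` B"
 then obtain x y where "x \<in> A" "y \<in> B" "k = act a x + act a y" by (auto elim!: set_plusE)
 then show "k \<in> act a ` (A + B)" by (intro image_eqI[of _ _ "x + y"]) (auto simp: act_add set_plus_intro)
qed

lemma act_sub: assumes "sub UNIV B" shows "act a ` B = B"
proof
 show "act a ` B \<subseteq> B" using subD(2)[OF assms] by blast
 show "B \<subseteq> act a ` B"
 proof
  fix b assume "b \<in> B"
  then have "act (- a) b \<in> B" using subD(2)[OF assms] by blast
  then show "b \<in> act a ` B" by (intro image_eqI[of _ _ "act (- a) b"]) auto
 qed
qed

lemma uminus_coset: fixes B :: "'k set" assumes "add_subgroup B" shows "uminus ` ({a} + B) = {- a} + B"
proof (intro equalityI subsetI)
 fix k assume "k \<in> uminus ` ({a} + B)"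
 then obtain b where "b \<in> B" "k = - (a + b)" by (auto elim!: set_plusE)
 then show "k \<in> {- a} + B" using sg_neg[OF assms] by (intro set_plusI[of "- a" _ "- b"]) auto
next
 fix k assume "k \<in> {- a} + B"
 then obtain b where "b \<in> B" "k = - a + b" by (auto elim!: set_plusE)
 then show "k \<in> uminus ` ({a} + B)"
  using sg_neg[OF assms] by (intro image_eqI[of _ _ "a + - b"]) (auto intro!: set_plusI[of a _ "- b"])
qed

lemma coset_plus: fixes B :: "'k set" assumes "add_subgroup B" shows "({a} + B) + ({b} + B) = {a + b} + B"
proof -
 have "({a} + B) + ({b} + B) = ({a} + {b}) + (B + B)" by (simp add: ac_simps)
 moreover have "{a} + {b} = {a + b}" by (auto simp: set_plus_def)
 ultimately show ?thesis using sg_plus_self[OF assms] by simp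
qed

context
 fixes N assumes N: "submodule M N"
begin

lemmas n = submoduleD[OF N]

lemma q_sub: "x \<in> mcar M ==> mcoset M N x \<subseteq> mcar M"
 by (rule mcoset_subset[OF n(1)])

lemma q_add: assumes "x \<in> mcar M" "y \<in> mcar M"
 shows "madd (quotmod M N) (mcoset M N x) (mcoset M N y) = mcoset M N (madd M x y)"
proof -
 have "j ` {madd M u v | u v. u \<in> mcoset M N x \<and> v \<in> mcoset M N y} = j ` mcoset M N (madd M x y)"
  unfolding i_madd_set[OF q_sub[OF assms(1)] q_sub[OF assms(2)]] using assms
  by (simp add: i_mcoset[OF n(1)] coset_plus[OF n(3)] i_add)
 moreover have "{madd M u v | u v. u \<in> mcoset M N x \<and> v \<in> mcoset M N y} \<subseteq> mcar M"
  using q_sub[OF assms(1)] q_sub[OF assms(2)] by (auto simp: subset_iff)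
 ultimately show ?thesis using i_image_eq q_sub assms by (simp add: car)
qed

lemma q_neg: assumes "x \<in> mcar M" shows "mneg (quotmod M N) (mcoset M N x) = mcoset M N (mneg M x)"
proof -
 have "j ` (mneg M ` mcoset M N x) = j ` mcoset M N (mneg M x)"
  unfolding i_mneg_set[OF q_sub[OF assms]] using assms by (simp add: i_mcoset[OF n(1)] uminus_coset[OF n(3)] i_neg)
 moreover have "mneg M ` mcoset M N x \<subseteq> mcar M" using q_sub assms by force
 ultimately show ?thesis using i_image_eq q_sub assms by (simp add: car)
qed

lemma q_act: assumes "x \<in> mcar M" shows "mact (quotmod M N) a (mcoset M N x) = mcoset M N (mact M a x)"
proof -
 have "j ` (mact M a ` mcoset M N x) = j ` mcoset M N (mact M a x)"
  unfolding i_mact_set[OF q_sub[OF assms]] using assms by (simp add: i_mcoset[OF n(1)] act_set_plus act_sub[OF n(2)] i_act)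
 moreover have "mact M a ` mcoset M N x \<subseteq> mcar M" using q_sub assms by force
 ultimately show ?thesis using i_image_eq q_sub assms by (simp add: car)
qed

lemma q_zero: "mzero (quotmod M N) = mcoset M N (mzero M)"
 using mcoset_zero[OF N] by simp

lemma openin_q: "openin (mtop (quotmod M N)) V \<longleftrightarrow> V \<subseteq> mcoset M N ` mcar M \<and> openin (mtop M) {x \<in> mcar M. mcoset M N x \<in> V}"
 by (simp add: openin_quotient_topology)

text \<open>The union of the cosets that meet \<open>V\<close> is cut out by the sum of
  \<open>T\<close> and the image of \<open>N\<close>, which is open.\<close>

lemma q_open: assumes "openin (mtop M) V" shows "openin (mtop (quotmod M N)) (mcoset M N ` V)"
 unfolding openin_q
proof
 have VM: "V \<subseteq> mcar M" using openin_subset[OF assms] by simp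
 then show "mcoset M N ` V \<subseteq> mcoset M N ` mcar M" by blast
 obtain T where T: "open T" "V = {x \<in> mcar M. j x \<in> T}" using assms unfolding i_open by blast
 have "{x \<in> mcar M. mcoset M N x \<in> mcoset M N ` V} = {x \<in> mcar M. j x \<in> T + j ` N}"
 proof (intro equalityI subsetI)
  fix x assume "x \<in> {x \<in> mcar M. mcoset M N x \<in> mcoset M N ` V}"
  then obtain v where v: "x \<in> mcar M" "v \<in> V" "mcoset M N x = mcoset M N v" by blast
  then have "j x - j v \<in> j ` N" using mcoset_eq_iff[OF N, of x v] VM by blast
  then have "j x \<in> T + j ` N" using v(2) T(2) by (intro set_plusI[of "j v" _ "j x - j v"]) auto
  then show "x \<in> {x \<in> mcar M. j x \<in> T + j ` N}" using v(1) by blast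
 next
  fix x assume "x \<in> {x \<in> mcar M. j x \<in> T + j ` N}"
  then have x: "x \<in> mcar M" "j x \<in> T + j ` N" by auto
  obtain t m where t: "t \<in> T" "m \<in> j ` N" "j x = t + m" using x(2) by (rule set_plusE)
  have "j x - m \<in> im" using x(1) t(2) n(1) by (intro sg_diff[OF group_im]) auto
  then obtain v where v: "v \<in> mcar M" "t = j v" using t(3) by auto
  then have "v \<in> V" using T(2) t(1) by blast
  moreover have "mcoset M N x = mcoset M N v" using mcoset_eq_iff[OF N x(1) v(1)] t v by simp
  ultimately show "x \<in> {x \<in> mcar M. mcoset M N x \<in> mcoset M N ` V}" using x(1) by blast
 qed
 moreover have "openin (mtop M) {x \<in> mcar M. j x \<in> T + j ` N}" unfolding i_open using open_set_plus[OF T(1)] by blast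
 ultimately show "openin (mtop M) {x \<in> mcar M. mcoset M N x \<in> mcoset M N ` V}" by simp
qed

lemma q_cont: "continuous_map (mtop M) (mtop (quotmod M N)) (mcoset M N)"
 unfolding continuous_map_def using openin_q by (auto simp del: quotmod_simps(6) simp: Pi_iff) simp

lemma q_saturated: assumes "submodule M Y" "N \<subseteq> Y" "x \<in> mcar M" "mcoset M N x \<in> mcoset M N ` Y" shows "x \<in> Y"
proof -
 obtain y where y: "y \<in> Y" "mcoset M N x = mcoset M N y" using assms(4) by blast
 have yM: "y \<in> mcar M" using y submoduleD(1)[OF assms(1)] by blast
 have "j x - j y \<in> j ` Y" using mcoset_eq_iff[OF N assms(3) yM] y(2) assms(2) by blast
 then have "j x \<in> j ` Y" using sg_cancel_diff[OF submoduleD(3)[OF assms(1)]] y(1) by blast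
 then show ?thesis using i_mem[OF assms(3) submoduleD(1)[OF assms(1)]] by blast
qed

lemma submodule_q_image: assumes Y: "submodule M Y" shows "submodule (quotmod M N) (mcoset M N ` Y)"
proof -
 note y = submoduleD(1)[OF Y]
 show ?thesis unfolding submodule_def
 proof (intro conjI ballI allI)
  show "mcoset M N ` Y \<subseteq> mcar (quotmod M N)" using y by auto
  show "mzero (quotmod M N) \<in> mcoset M N ` Y" unfolding q_zero using Y unfolding submodule_def by blast
  fix A assume "A \<in> mcoset M N ` Y"
  then obtain a where a: "a \<in> Y" "A = mcoset M N a" by blast
  show "mneg (quotmod M N) A \<in> mcoset M N ` Y" using q_neg[of a] a y Y unfolding submodule_def by auto
  show "mact (quotmod M N) c A \<in> mcoset M N ` Y" for c using q_act[of a c] a y Y unfolding submodule_def by auto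
  fix B assume "B \<in> mcoset M N ` Y"
  then obtain b where b: "b \<in> Y" "B = mcoset M N b" by blast
  show "madd (quotmod M N) A B \<in> mcoset M N ` Y" 
   unfolding a(2) b(2) q_add[OF subsetD[OF y a(1)] subsetD[OF y b(1)]] using a b Y unfolding submodule_def by blast
 qed
qed

lemma submodule_q_preimage: assumes C: "submodule (quotmod M N) C"
 obtains Y where "submodule M Y" "N \<subseteq> Y" "C = mcoset M N ` Y" "Y = {x \<in> mcar M. mcoset M N x \<in> C}"
proof
 define Y where "Y = {x \<in> mcar M. mcoset M N x \<in> C}"
 show "Y = {x \<in> mcar M. mcoset M N x \<in> C}" by (rule Y_def)
 have c: "C \<subseteq> mcoset M N ` mcar M" "mzero (quotmod M N) \<in> C" "!!A B. A \<in> C ==> B \<in> C ==> madd (quotmod M N) A B \<in> C"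
  "!!A. A \<in> C ==> mneg (quotmod M N) A \<in> C" "!!A a. A \<in> C ==> mact (quotmod M N) a A \<in> C"
  using C unfolding submodule_def by (simp_all only: quotmod_simps(1))
 show "submodule M Y" unfolding submodule_def
 proof (intro conjI ballI allI)
  show "mzero M \<in> Y" unfolding Y_def using c(2) unfolding q_zero by simp
  fix x assume x: "x \<in> Y"
  show "mneg M x \<in> Y" using x c(4)[of "mcoset M N x"] q_neg[of x] unfolding Y_def by auto
  show "mact M a x \<in> Y" for a using x c(5)[of "mcoset M N x" a] q_act[of x a] unfolding Y_def by auto
  fix y assume y: "y \<in> Y"
  show "madd M x y \<in> Y" using x y c(3)[of "mcoset M N x" "mcoset M N y"] q_add[of x y] unfolding Y_def by auto
 qed (auto simp: Y_def)
 show "C = mcoset M N ` Y" using c(1) unfolding Y_def by blast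
 show "N \<subseteq> Y"
 proof
  fix x assume x: "x \<in> N"
  then have xM: "x \<in> mcar M" using n(1) by blast
  have "mcoset M N x = mcoset M N (mzero M)" using mcoset_eq_iff[OF N xM car(1)] x by simp
  then show "x \<in> Y" unfolding Y_def using c(2) xM unfolding q_zero by simp
 qed
qed

lemma closedin_q: assumes Y: "submodule M Y" "N \<subseteq> Y"
 shows "closedin (mtop (quotmod M N)) (mcoset M N ` Y) \<longleftrightarrow> closedin (mtop M) Y"
proof -
 have YM: "Y \<subseteq> mcar M" by (rule submoduleD(1)[OF Y(1)])
 have "{x \<in> mcar M. mcoset M N x \<in> mcoset M N ` mcar M - mcoset M N ` Y} = mcar M - Y"
  using q_saturated[OF Y] by blast
 then show ?thesis unfolding closedin_def openin_q using YM by auto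
qed

text \<open>Both sides have literally the same cosets as elements, so the records are equal and not
  merely isomorphic. Only the two topologies need a comparison, which rests on openness of the coset
  map.\<close>

lemma submod_quotmod: assumes Y: "submodule M Y" "N \<subseteq> Y"
 shows "submod (quotmod M N) (mcoset M N ` Y) = quotmod (submod M Y) N"
proof -
 have YM: "Y \<subseteq> mcar M" by (rule submoduleD(1)[OF Y(1)])
 have "subtopology (mtop (quotmod M N)) (mcoset M N ` Y) = quotient_topology (subtopology (mtop M) Y) (mcoset M N)"
  unfolding topology_eq
 proof (intro allI iffI)
  fix V assume "openin (subtopology (mtop (quotmod M N)) (mcoset M N ` Y)) V"
  then obtain T where T: "openin (mtop (quotmod M N)) T" "V = T \<inter> mcoset M N ` Y" unfolding openin_subtopology by blast
  have "{x \<in> Y. mcoset M N x \<in> V} = {x \<in> mcar M. mcoset M N x \<in> T} \<inter> Y" using T(2) YM by blast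
  then have "openin (subtopology (mtop M) Y) {x \<in> Y. mcoset M N x \<in> V}" using T(1) unfolding openin_q openin_subtopology by blast
  then show "openin (quotient_topology (subtopology (mtop M) Y) (mcoset M N)) V"
   unfolding openin_quotient_topology using YM T(2) by (simp add: Int_absorb1)
 next
  fix V assume "openin (quotient_topology (subtopology (mtop M) Y) (mcoset M N)) V"
  then have V: "V \<subseteq> mcoset M N ` Y" "openin (subtopology (mtop M) Y) {x \<in> Y. mcoset M N x \<in> V}"
   unfolding openin_quotient_topology using YM by (simp_all add: Int_absorb1)
  obtain T where T: "openin (mtop M) T" "{x \<in> Y. mcoset M N x \<in> V} = T \<inter> Y" using V(2) unfolding openin_subtopology by blast
  have TM: "T \<subseteq> mcar M" using openin_subset[OF T(1)] by simp
  have "V = mcoset M N ` T \<inter> mcoset M N ` Y"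
  proof (intro equalityI subsetI)
   fix A assume "A \<in> V" then show "A \<in> mcoset M N ` T \<inter> mcoset M N ` Y" using V(1) T(2) by blast
  next
   fix A assume "A \<in> mcoset M N ` T \<inter> mcoset M N ` Y"
   then obtain t where t: "t \<in> T" "A = mcoset M N t" "A \<in> mcoset M N ` Y" by blast
   then have "t \<in> Y" using q_saturated[OF Y, of t] TM by blast
   then show "A \<in> V" using T(2) t by blast
  qed
  then show "openin (subtopology (mtop (quotmod M N)) (mcoset M N ` Y)) V" unfolding openin_subtopology using q_open[OF T(1)] by blast
 qed
 then show ?thesis unfolding submod_def[of "quotmod M N"] quotmod_def[of "submod M Y"] by (simp add: quotmod_def)
qed

text \<open>The algebraic laws pass along the coset map; its openness gives local compactness and
  continuity of the operations, and closedness of \<open>N\<close> the Hausdorff property.\<close>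

lemma lcmod_quotmod: assumes cl: "closedin (mtop M) N" shows "is_lcmod (quotmod M N)"
proof -
 let ?Q = "quotmod M N" and ?q = "mcoset M N"
 note [simp del] = quotmod_simps(2-6)
 have clN: "closed (j ` N)" using cl closedin_iff[OF n(1)] by blast
 have topQ: "topspace (mtop ?Q) = mcar ?Q" unfolding quotmod_simps(6) by simp
 note A = lcmodD(5,6,9,10,11,14,15,16,17)[OF lc]
 have haus: "Hausdorff_space (mtop ?Q)" unfolding Hausdorff_space_def
 proof (intro allI impI)
  fix X Y assume h: "X \<in> topspace (mtop ?Q) \<and> Y \<in> topspace (mtop ?Q) \<and> X \<noteq> Y"
  then obtain x y where xy: "x \<in> mcar M" "X = ?q x" "y \<in> mcar M" "Y = ?q y" unfolding topQ by auto
  define z where "z = j x - j y"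
  have zN: "z \<notin> j ` N" using h xy mcoset_eq_iff[OF N xy(1,3)] unfolding z_def by blast
  have "open {u. u - (- z) \<in> - j ` N}" by (rule open_translate_vimage) (use clN in \<open>simp add: open_Compl\<close>)
  then have "nb {u. z + u \<notin> j ` N}" using zN by (simp add: add.commute)
  then obtain V where V: "nb V" "!!u v. u \<in> V ==> v \<in> V ==> u - v \<in> {u. z + u \<notin> j ` N}" using nb_half by metis
  define B where "B c = {b \<in> mcar M. j b \<in> {k. k - j c \<in> V}}" for c
  have oB: "openin (mtop M) (B c)" for c
  proof -
   have "open {k. k - j c \<in> V}" using V(1) open_translate_vimage by blast
   then show ?thesis unfolding i_open B_def by blast
  qed
  have "x \<in> B x" "y \<in> B y" unfolding B_def using xy V(1) by auto
  moreover have "disjnt (?q ` B x) (?q ` B y)" unfolding disjnt_def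
  proof (rule equals0I)
   fix A assume "A \<in> ?q ` B x \<inter> ?q ` B y"
   then obtain b b' where b: "b \<in> B x" "b' \<in> B y" "?q b = ?q b'" by force
   then have "j b - j b' \<in> j ` N" using mcoset_eq_iff[OF N, of b b'] unfolding B_def by blast
   moreover have "j b - j b' = z + ((j b - j x) - (j b' - j y))" unfolding z_def by (simp add: algebra_simps)
   ultimately show False using V(2)[of "j b - j x" "j b' - j y"] b(1,2) unfolding B_def by simp
  qed
  ultimately show "\<exists>U V. openin (mtop ?Q) U \<and> openin (mtop ?Q) V \<and> X \<in> U \<and> Y \<in> V \<and> disjnt U V"
   using q_open[OF oB] xy(2,4) by blast
 qed
 have loc: "locally_compact_space (mtop ?Q)" unfolding locally_compact_space_def
 proof
  fix X assume "X \<in> topspace (mtop ?Q)"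
  then obtain x where x: "x \<in> mcar M" "X = ?q x" unfolding topQ by auto
  obtain U K where UK: "openin (mtop M) U" "compactin (mtop M) K" "x \<in> U" "U \<subseteq> K"
   using A(9) x(1) unfolding locally_compact_space_def m_top by blast
  show "\<exists>U K. openin (mtop ?Q) U \<and> compactin (mtop ?Q) K \<and> X \<in> U \<and> U \<subseteq> K"
   using q_open[OF UK(1)] image_compactin[OF UK(2) q_cont] UK(3,4) x(2) by blast
 qed
 have topQ': "topspace (mtop ?Q) = ?q ` topspace (mtop M)" using topQ by simp
 have add: "continuous_map (prod_topology (mtop ?Q) (mtop ?Q)) (mtop ?Q) (\<lambda>(x, y). madd ?Q x y)"
  by (rule continuous_map_prod_open_images[OF continuous_map_compose[OF A(6) q_cont] q_open topQ' q_open topQ']) (simp_all add: q_add)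
 have act: "continuous_map (prod_topology (euclidean :: 'a topology) (mtop ?Q)) (mtop ?Q) (\<lambda>(a, x). mact ?Q a x)"
  by (rule continuous_map_prod_open_images[OF continuous_map_compose[OF A(8) q_cont], of euclidean "\<lambda>a. a", OF _ _ q_open topQ']) (simp_all add: q_act)
 have neg: "continuous_map (mtop ?Q) (mtop ?Q) (mneg ?Q)"
  unfolding continuous_map_def
 proof (intro conjI allI impI)
  show "mneg ?Q \<in> topspace (mtop ?Q) \<rightarrow> topspace (mtop ?Q)" unfolding topQ using q_neg by (auto simp: Pi_iff)
  fix V assume V: "openin (mtop ?Q) V"
  have "continuous_map (mtop M) (mtop ?Q) (?q \<circ> mneg M)" by (rule continuous_map_compose[OF A(7) q_cont])
  then have "openin (mtop M) {x \<in> mcar M. (?q \<circ> mneg M) x \<in> V}" using V unfolding continuous_map_def m_top by blast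
  moreover have "{x \<in> mcar M. ?q x \<in> {x \<in> topspace (mtop ?Q). mneg ?Q x \<in> V}} = {x \<in> mcar M. (?q \<circ> mneg M) x \<in> V}"
   unfolding topQ using q_neg by auto
  ultimately show "openin (mtop ?Q) {x \<in> topspace (mtop ?Q). mneg ?Q x \<in> V}" unfolding openin_q using topQ by auto
 qed
 show ?thesis unfolding is_lcmod_def q_zero
 proof (intro conjI topQ haus loc add act neg ballI allI)
  show "?q (mzero M) \<in> mcar ?Q" by simp
  fix X assume "X \<in> mcar ?Q"
  then obtain x where x: "x \<in> mcar M" "X = ?q x" by auto
  show "mneg ?Q X \<in> mcar ?Q" "!!a. mact ?Q a X \<in> mcar ?Q" using x q_neg q_act by auto
  show "madd ?Q (?q (mzero M)) X = X" "madd ?Q (mneg ?Q X) X = ?q (mzero M)" using x q_add q_neg m_zero by auto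
  show "mact ?Q 0 X = X" using x q_act A(4) by auto
  show "!!a b. mact ?Q (a + b) X = mact ?Q a (mact ?Q b X)" using x q_act A(5) by auto
  fix Y assume "Y \<in> mcar ?Q"
  then obtain y where y: "y \<in> mcar M" "Y = ?q y" by auto
  show "madd ?Q X Y \<in> mcar ?Q" using x y q_add by auto
  show "madd ?Q X Y = madd ?Q Y X" using x y q_add A(2) by simp
  show "!!a. mact ?Q a (madd ?Q X Y) = madd ?Q (mact ?Q a X) (mact ?Q a Y)" using x y q_add q_act A(3) by auto
  fix Z assume "Z \<in> mcar ?Q"
  then obtain z where z: "z \<in> mcar M" "Z = ?q z" by auto
  show "madd ?Q (madd ?Q X Y) Z = madd ?Q X (madd ?Q Y Z)" using x y z q_add A(1) by simp
 qed
qed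

end

end

section \<open>Translation between the notions for records and those for subgroups\<close>

context emb
begin

lemma finite_quotmod_iff: assumes U: "submodule M U"
 shows "finite (mcar (quotmod M U)) \<longleftrightarrow> fmod (j ` U) im" "mcar (quotmod M U) = {mzero (quotmod M U)} \<longleftrightarrow> U = mcar M"
proof -
 note u = submoduleD[OF U]
 show "finite (mcar (quotmod M U)) \<longleftrightarrow> fmod (j ` U) im" using finite_cosets_iff[OF U submodule_mcar u(1)] by simp
 have 1: "mcoset M U x = U \<longleftrightarrow> x \<in> U" if x: "x \<in> mcar M" for x
  using mcoset_eq_iff[OF U x car(1)] mcoset_zero[OF U] i_mem[OF x u(1)] by simp
 have "mcoset M U ` mcar M = {U} \<longleftrightarrow> (\<forall>x\<in>mcar M. mcoset M U x = U)" using car(1) by blast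
 also have "\<dots> \<longleftrightarrow> U = mcar M" using 1 u(1) by blast
 finally show "mcar (quotmod M U) = {mzero (quotmod M U)} \<longleftrightarrow> U = mcar M" by simp
qed

lemma compact_parafinite_iff: "compact_parafinite M \<longleftrightarrow> parafin UNIV {0} im"
proof -
 have s0: "sub UNIV {0}" unfolding sub_def add_subgroup_def by simp
 have 1: "compact_space (mtop M) \<longleftrightarrow> cocpt {0} im"
 proof -
  have "compact im \<longleftrightarrow> cocpt {0} im" unfolding cocpt_def
   using closed_Int_compact[OF i_closed] by (auto simp: Int_absorb2) (metis Int_absorb2 closed_Int_compact i_closed)
  then show ?thesis using compactin_iff[OF order_refl] unfolding compact_space_def by simp
 qed
 have "(\<exists>U. closed_submodule M U \<and> finite (mcar (quotmod M U)) \<and> mcar (quotmod M U) \<noteq> {mzero (quotmod M U)}) \<longleftrightarrow>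
  (\<exists>Z. sub UNIV Z \<and> closed Z \<and> {0} \<subseteq> Z \<and> Z \<subseteq> im \<and> fmod Z im \<and> Z \<noteq> im)"
 proof
  assume "\<exists>U. closed_submodule M U \<and> finite (mcar (quotmod M U)) \<and> mcar (quotmod M U) \<noteq> {mzero (quotmod M U)}"
  then obtain U where U: "closed_submodule M U" "finite (mcar (quotmod M U))" "mcar (quotmod M U) \<noteq> {mzero (quotmod M U)}" by blast
  note u = closed_submoduleD[OF U(1)]
  have "fmod (j ` U) im" "U \<noteq> mcar M" using finite_quotmod_iff[OF u(1)] U(2,3) by blast+
  then show "\<exists>Z. sub UNIV Z \<and> closed Z \<and> {0} \<subseteq> Z \<and> Z \<subseteq> im \<and> fmod Z im \<and> Z \<noteq> im"
   using u i_image_eq[OF u(2) order_refl] by (intro exI[of _ "j ` U"]) simp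
 next
  assume "\<exists>Z. sub UNIV Z \<and> closed Z \<and> {0} \<subseteq> Z \<and> Z \<subseteq> im \<and> fmod Z im \<and> Z \<noteq> im"
  then obtain Z where Z: "sub UNIV Z" "closed Z" "Z \<subseteq> im" "fmod Z im" "Z \<noteq> im" by blast
  obtain U where U: "U \<subseteq> mcar M" "Z = j ` U" by (rule i_lift[OF Z(3)])
  have c: "closed_submodule M U" using closed_submodule_iff[OF U(1)] Z U(2) by blast
  show "\<exists>U. closed_submodule M U \<and> finite (mcar (quotmod M U)) \<and> mcar (quotmod M U) \<noteq> {mzero (quotmod M U)}"
   using finite_quotmod_iff[OF closed_submoduleD(1)[OF c]] c Z(4,5) U(2) by blast
 qed
 then show ?thesis unfolding compact_parafinite_def parafin_def
  using lc 1 s0 sub_im i_closed sg_zero[OF group_im] by auto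
qed

text \<open>If the quotient is compact, finitely many translates of a neighbourhood of zero cover
  it, and by local compactness each lies in a translate of the compact \<open>V\<close>. Conversely,
  the elements whose image lies in \<open>V\<close> form a compact set that maps onto the
  quotient.\<close>

lemma compact_quotmod_iff: assumes N: "submodule M N"
 shows "compact_space (mtop (quotmod M N)) \<longleftrightarrow> cocpt (j ` N) im"
proof
 note n = submoduleD[OF N]
 let ?q = "mcoset M N"
 have topQ: "topspace (mtop (quotmod M N)) = ?q ` mcar M" by simp
 assume "compact_space (mtop (quotmod M N))"
 then have c: "compactin (mtop (quotmod M N)) (?q ` mcar M)" unfolding compact_space_def topQ .
 obtain U V where UV: "nb U" "compact V" "U \<inter> im \<subseteq> V" using lcg_nbhd[OF lcg_im] by metis
 define B where "B x = {b \<in> mcar M. j b \<in> {k. k - j x \<in> U}}" for x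
 have oB: "openin (mtop M) (B c)" for c unfolding i_open B_def using open_translate_vimage UV(1) by blast
 have xB: "x \<in> B x" if "x \<in> mcar M" for x using that UV(1) unfolding B_def by simp
 have "Ball ((\<lambda>x. ?q ` B x) ` mcar M) (openin (mtop (quotmod M N)))" using q_open[OF N oB] by blast
 moreover have "?q ` mcar M \<subseteq> \<Union>((\<lambda>x. ?q ` B x) ` mcar M)" using xB by blast
 ultimately obtain \<F> where F: "finite \<F>" "\<F> \<subseteq> (\<lambda>x. ?q ` B x) ` mcar M" "?q ` mcar M \<subseteq> \<Union>\<F>"
  using c unfolding compactin_def by meson
 obtain F where F': "finite F" "F \<subseteq> mcar M" "\<F> = (\<lambda>x. ?q ` B x) ` F" using finite_subset_image[OF F(1,2)] by blast
 have "im \<subseteq> (j ` F + V) + j ` N"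
 proof
  fix k assume "k \<in> im"
  then obtain x where x: "x \<in> mcar M" "k = j x" by blast
  obtain f b where f: "f \<in> F" "b \<in> B f" "?q x = ?q b" using F(3) F'(3) x(1) by blast
  have b: "b \<in> mcar M" "j b - j f \<in> U" using f(2) unfolding B_def by auto
  have "j b - j f \<in> im" using b(1) f(1) F'(2) by (intro sg_diff[OF group_im]) auto
  then have "j b - j f \<in> V" using b(2) UV(3) by blast
  then have 1: "j b \<in> j ` F + V" using f(1) by (intro set_plusI[of "j f" _ "j b - j f"]) auto
  have 2: "j x - j b \<in> j ` N" using mcoset_eq_iff[OF N x(1) b(1)] f(3) by blast
  show "k \<in> (j ` F + V) + j ` N" by (rule set_plusI[OF 1 2]) (simp add: x(2))
 qed
 moreover have "compact (j ` F + V)" using F'(1) by (intro compact_set_plus UV(2) finite_imp_compact) simp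
 ultimately show "cocpt (j ` N) im" unfolding cocpt_def by blast
next
 note n = submoduleD[OF N]
 let ?q = "mcoset M N"
 have topQ: "topspace (mtop (quotmod M N)) = ?q ` mcar M" by simp
 assume "cocpt (j ` N) im"
 then obtain V where V: "compact V" "im \<subseteq> V + j ` N" unfolding cocpt_def by blast
 define K where "K = {x \<in> mcar M. j x \<in> V}"
 have "j ` K = V \<inter> im" unfolding K_def by blast
 then have "compact (j ` K)" using compact_Int_closed[OF V(1) i_closed] by simp
 then have "compactin (mtop M) K" using compactin_iff[of K] unfolding K_def by blast
 then have c: "compactin (mtop (quotmod M N)) (?q ` K)" by (rule image_compactin[OF _ q_cont[OF N]])
 have "?q ` mcar M \<subseteq> ?q ` K"
 proof
  fix A assume "A \<in> ?q ` mcar M"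
  then obtain x where x: "x \<in> mcar M" "A = ?q x" by blast
  obtain v m where v: "v \<in> V" "m \<in> j ` N" "j x = v + m" using V(2) x(1) by (blast elim: set_plusE)
  have "j x - m \<in> im" using x(1) v(2) n(1) by (intro sg_diff[OF group_im]) auto
  then obtain y where y: "y \<in> mcar M" "v = j y" using v(3) by auto
  have "?q x = ?q y" using mcoset_eq_iff[OF N x(1) y(1)] v y by simp
  then show "A \<in> ?q ` K" using x(2) y v(1) unfolding K_def by blast
 qed
 then have "?q ` K = ?q ` mcar M" unfolding K_def by blast
 then show "compact_space (mtop (quotmod M N))" unfolding compact_space_def topQ using c by simp
qed

text \<open>Elements of the double quotient are cosets of cosets. Taking images under the coset map
  of \<open>N\<close> gives a bijection onto them from the cosets of \<open>Y\<close>: such a coset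
  is a union of cosets of \<open>N\<close> and so can be recovered from its image
  (\<open>sat\<close>).\<close>

lemma finite_double_quotient:
 assumes N: "submodule M N" and Y: "submodule M Y" "N \<subseteq> Y"
 defines "Q \<equiv> quotmod M N"
 shows "finite (mcar (quotmod Q (mcoset M N ` Y))) \<longleftrightarrow> fmod (j ` Y) im"
  "mcar (quotmod Q (mcoset M N ` Y)) = {mzero (quotmod Q (mcoset M N ` Y))} \<longleftrightarrow> Y = mcar M"
proof -
 let ?q = "mcoset M N" and ?r = "mcoset M Y"
 note y = submoduleD[OF Y(1)]
 have r: "mcoset Q (?q ` Y) (?q x) = ?q ` ?r x" if x: "x \<in> mcar M" for x
 proof -
  have "madd Q (?q x) (?q u) = ?q (madd M x u)" if "u \<in> Y" for u unfolding Q_def by (rule q_add[OF N x subsetD[OF y(1) that]])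
  then show ?thesis unfolding mcoset_def[of Q] mcoset_def[of M Y] by (auto simp del: quotmod_simps simp: image_iff)
 qed
 have mq: "mcar (quotmod Q (?q ` Y)) = image ?q ` (?r ` mcar M)" using r by (simp add: Q_def image_image)
 have sat: "v \<in> ?r x'" if h: "x' \<in> mcar M" "v \<in> mcar M" "?q v \<in> ?q ` ?r x'" for x' v
 proof -
  obtain w where w: "w \<in> ?r x'" "?q v = ?q w" using h(3) by blast
  have wM: "w \<in> mcar M" using w mcoset_subset[OF y(1) h(1)] by blast
  have "j v - j w \<in> j ` Y" using mcoset_eq_iff[OF N h(2) wM] w(2) Y(2) by blast
  moreover have "j w \<in> {j x'} + j ` Y" using w(1) i_mcoset[OF y(1) h(1)] by blast
  then have "j w - j x' \<in> j ` Y" by (auto elim!: set_plusE)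
  ultimately have "(j v - j w) + (j w - j x') \<in> j ` Y" by (rule sg_add[OF y(3)])
  then have "j v \<in> {j x'} + j ` Y" by (intro set_plusI[of "j x'" _ "j v - j x'"]) auto
  then have "j v \<in> j ` ?r x'" using i_mcoset[OF y(1) h(1)] by simp
  then show ?thesis using i_mem[OF h(2) mcoset_subset[OF y(1) h(1)]] by blast
 qed
 have le: "?r x \<subseteq> ?r x'" if h: "x \<in> mcar M" "x' \<in> mcar M" "?q ` ?r x = ?q ` ?r x'" for x x'
  using sat[OF h(2)] mcoset_subset[OF y(1) h(1)] h(3) by blast
 have inj: "inj_on (image ?q) (?r ` mcar M)"
 proof (rule inj_onI)
  fix A B assume "A \<in> ?r ` mcar M" "B \<in> ?r ` mcar M" and e: "?q ` A = ?q ` B"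
  then obtain a b where ab: "a \<in> mcar M" "A = ?r a" "b \<in> mcar M" "B = ?r b" by blast
  show "A = B" unfolding ab(2,4) using le[OF ab(1,3)] le[OF ab(3,1)] e ab by (intro equalityI) auto
 qed
 show "finite (mcar (quotmod Q (?q ` Y))) \<longleftrightarrow> fmod (j ` Y) im"
  unfolding mq finite_image_iff[OF inj] using finite_quotmod_iff(1)[OF Y(1)] by simp
 have "Y \<in> ?r ` mcar M" using mcoset_zero[OF Y(1)] car(1) by (metis image_eqI)
 then have "image ?q ` (?r ` mcar M) = {?q ` Y} \<longleftrightarrow> ?r ` mcar M = {Y}"
  using inj_on_image_eq_iff[OF inj order_refl, of "{Y}"] by auto
 then show "mcar (quotmod Q (?q ` Y)) = {mzero (quotmod Q (?q ` Y))} \<longleftrightarrow> Y = mcar M"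
  unfolding mq using finite_quotmod_iff(2)[OF Y(1)] by simp
qed

lemma compact_parafinite_quotmod_iff: assumes N: "closed_submodule M N"
 shows "compact_parafinite (quotmod M N) \<longleftrightarrow> parafin UNIV (j ` N) im"
proof -
 note n = closed_submoduleD[OF N]
 let ?q = "mcoset M N"
 have lcq: "is_lcmod (quotmod M N)" using lcmod_quotmod[OF n(1)] N unfolding closed_submodule_def by blast
 have "(\<exists>U. closed_submodule (quotmod M N) U \<and> finite (mcar (quotmod (quotmod M N) U)) \<and> mcar (quotmod (quotmod M N) U) \<noteq> {mzero (quotmod (quotmod M N) U)}) \<longleftrightarrow>
  (\<exists>Z. sub UNIV Z \<and> closed Z \<and> j ` N \<subseteq> Z \<and> Z \<subseteq> im \<and> fmod Z im \<and> Z \<noteq> im)" (is "?L \<longleftrightarrow> ?R")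
 proof
  assume ?L
  then obtain U where U: "closed_submodule (quotmod M N) U" "finite (mcar (quotmod (quotmod M N) U))"
   "mcar (quotmod (quotmod M N) U) \<noteq> {mzero (quotmod (quotmod M N) U)}" by blast
  have "submodule (quotmod M N) U" using U(1) unfolding closed_submodule_def by blast
  then obtain Y where Y: "submodule M Y" "N \<subseteq> Y" "U = ?q ` Y" using submodule_q_preimage[OF n(1)] by metis
  note y = submoduleD[OF Y(1)]
  have "closedin (mtop M) Y" using U(1) closedin_q[OF n(1) Y(1,2)] unfolding closed_submodule_def Y(3) by blast
  then have "closed (j ` Y)" using closedin_iff[OF y(1)] by blast
  moreover have "fmod (j ` Y) im" "Y \<noteq> mcar M" using finite_double_quotient[OF n(1) Y(1,2)] U(2,3) unfolding Y(3) by blast+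
  ultimately show ?R using y Y(2) i_image_eq[OF y(1) order_refl] by (intro exI[of _ "j ` Y"]) auto
 next
  assume ?R
  then obtain Z where Z: "sub UNIV Z" "closed Z" "j ` N \<subseteq> Z" "Z \<subseteq> im" "fmod Z im" "Z \<noteq> im" by blast
  obtain Y where U: "Y \<subseteq> mcar M" "Z = j ` Y" by (rule i_lift[OF Z(4)])
  have Y: "submodule M Y" "N \<subseteq> Y" using submodule_iff[OF U(1)] Z(1,3) U(2) i_subset[OF n(2) U(1)] by blast+
  have "closedin (mtop M) Y" using closedin_iff[OF U(1)] Z(2) U(2) by blast
  then have "closed_submodule (quotmod M N) (?q ` Y)"
   unfolding closed_submodule_def using submodule_q_image[OF n(1) Y(1)] closedin_q[OF n(1) Y] by blast
  then show ?L using finite_double_quotient[OF n(1) Y] Z(5,6) U(2) by (intro exI[of _ "?q ` Y"]) auto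
 qed
 then show ?thesis unfolding compact_parafinite_def parafin_def compact_quotmod_iff[OF n(1)]
  using lcq n sub_im i_closed by blast
qed

lemma purely_discrete_quotmod_iff: assumes U: "submodule M U" "openin (mtop M) U"
 shows "purely_discrete (quotmod M U) \<longleftrightarrow> pdisc UNIV (j ` U) im"
proof -
 note u = submoduleD[OF U(1)]
 let ?q = "mcoset M U"
 have o: "omod (j ` U) im" using openin_iff[OF U(1)] U(2) by blast
 have "closed (j ` U)" by (rule omod_closed[OF o i_closed u(3) group_im]) (use u(1) in blast)
 then have lcq: "is_lcmod (quotmod M U)" using lcmod_quotmod[OF U(1)] closedin_iff[OF u(1)] by blast
 have disc: "mtop (quotmod M U) = discrete_topology (mcar (quotmod M U))"
  unfolding topology_eq
 proof (intro allI)
  fix V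
  obtain T where T: "nb T" "T \<inter> im \<subseteq> j ` U" using o unfolding omod_def by blast
  have "openin (mtop M) {x \<in> mcar M. ?q x \<in> V}"
  proof (rule openin_translates[OF T])
   fix v w assume v: "v \<in> {x \<in> mcar M. ?q x \<in> V}" "w \<in> U"
   then have wM: "w \<in> mcar M" "v \<in> mcar M" using u(1) by auto
   have "?q (madd M v w) = ?q v" using mcoset_eq_iff[OF U(1), of "madd M v w" v] v wM by (simp add: i_add)
   then have "madd M v w \<in> {x \<in> mcar M. ?q x \<in> V}" using v wM by simp
   then show "j v + j w \<in> j ` {x \<in> mcar M. ?q x \<in> V}" using i_add[OF wM(2,1)] by (metis image_eqI)
  qed blast
  then show "openin (mtop (quotmod M U)) V \<longleftrightarrow> openin (discrete_topology (mcar (quotmod M U))) V"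
   unfolding openin_q[OF U(1)] by simp
 qed
 have "(\<exists>L. submodule (quotmod M U) L \<and> finite L \<and> L \<noteq> {mzero (quotmod M U)}) \<longleftrightarrow>
  (\<exists>Z. sub UNIV Z \<and> j ` U \<subseteq> Z \<and> Z \<subseteq> im \<and> fmod (j ` U) Z \<and> Z \<noteq> j ` U)" (is "?L \<longleftrightarrow> ?R")
 proof
  assume ?L
  then obtain L where L: "submodule (quotmod M U) L" "finite L" "L \<noteq> {U}" by auto
  obtain Y where Y: "submodule M Y" "U \<subseteq> Y" "L = ?q ` Y" using submodule_q_preimage[OF U(1) L(1)] by metis
  note y = submoduleD[OF Y(1)]
  have "fmod (j ` U) (j ` Y)" using finite_cosets_iff[OF U(1) Y(1,2)] L(2) Y(3) by blast
  moreover have "Y \<noteq> U"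
  proof
   assume "Y = U"
   then have "?q x = U" if "x \<in> Y" for x using mcoset_eq_iff[OF U(1), of x "mzero M"] that u(1) mcoset_zero[OF U(1)] by auto
   moreover have "Y \<noteq> {}" using Y(1) unfolding submodule_def by blast
   ultimately have "?q ` Y = {U}" by blast
   then show False using L(3) Y(3) by blast
  qed
  ultimately show ?R using y Y(2) i_image_eq[OF y(1) u(1)] by (intro exI[of _ "j ` Y"]) auto
 next
  assume ?R
  then obtain Z where Z: "sub UNIV Z" "j ` U \<subseteq> Z" "Z \<subseteq> im" "fmod (j ` U) Z" "Z \<noteq> j ` U" by blast
  obtain Y where y: "Y \<subseteq> mcar M" "Z = j ` Y" by (rule i_lift[OF Z(3)])
  have Y: "submodule M Y" "U \<subseteq> Y" using submodule_iff[OF y(1)] Z(1,2) y(2) i_subset[OF u(1) y(1)] by blast+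
  have "finite (?q ` Y)" using finite_cosets_iff[OF U(1) Y] Z(4) y(2) by blast
  moreover have "?q ` Y \<noteq> {U}"
  proof
   assume e: "?q ` Y = {U}"
   have "y \<in> U" if "y \<in> Y" for y
   proof -
    have yM: "y \<in> mcar M" using that y(1) by blast
    have "?q y = ?q (mzero M)" using e that mcoset_zero[OF U(1)] by auto
    then show ?thesis using mcoset_eq_iff[OF U(1) yM car(1)] i_mem[OF yM u(1)] by simp
   qed
   then show False using Y(2) Z(5) y(2) by blast
  qed
  ultimately show ?L using submodule_q_image[OF U(1) Y(1)] by (intro exI[of _ "?q ` Y"]) simp
 qed
 then show ?thesis unfolding purely_discrete_def pdisc_def using lcq disc by blast
qed

lemma Omega_sharp_image: "j ` Omega_sharp M = \<Inter>(Ufam UNIV im)"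
proof -
 define \<U> where "\<U> = {U. submodule M U \<and> openin (mtop M) U \<and> purely_discrete (quotmod M U)}"
 have 1: "Ufam UNIV im = image j ` \<U>"
 proof (intro equalityI subsetI)
  fix Z assume Z: "Z \<in> Ufam UNIV im"
  obtain U where U: "U \<subseteq> mcar M" "Z = j ` U" by (rule i_lift[OF UfamD(2)[OF Z]])
  have s: "submodule M U" using submodule_iff[OF U(1)] UfamD(1)[OF Z] U(2) by blast
  have "openin (mtop M) U" using openin_iff[OF s] UfamD(3)[OF Z] U(2) by blast
  then have "U \<in> \<U>" unfolding \<U>_def using s purely_discrete_quotmod_iff[OF s] UfamD(4)[OF Z] U(2) by blast
  then show "Z \<in> image j ` \<U>" using U(2) by blast
 next
  fix Z assume "Z \<in> image j ` \<U>"
  then obtain U where U: "submodule M U" "openin (mtop M) U" "purely_discrete (quotmod M U)" "Z = j ` U" unfolding \<U>_def by blast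
  show "Z \<in> Ufam UNIV im" unfolding Ufam_def
   using submoduleD[OF U(1)] openin_iff[OF U(1)] purely_discrete_quotmod_iff[OF U(1,2)] U by blast
 qed
 have 2: "im \<in> Ufam UNIV im" unfolding Ufam_def pdisc_def using sub_im omod_refl by blast
 \<comment> \<open>Injectivity of \<open>j\<close> allows the image to be exchanged with the
   intersection.\<close>
 have 3: "j ` Omega_sharp M = im \<inter> \<Inter>(image j ` \<U>)"
 proof -
  have "x \<in> mcar M ==> U \<in> \<U> ==> j x \<in> j ` U \<longleftrightarrow> x \<in> U" for x U
   by (rule i_mem) (use submoduleD(1) in \<open>auto simp: \<U>_def\<close>)
  then show ?thesis unfolding Omega_sharp_def \<U>_def[symmetric] by auto
 qed
 show ?thesis unfolding 3 1[symmetric] using 2 by (rule Int_absorb1[OF Inter_lower])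
qed

text \<open>\<open>Wflat\<close> ranges over arbitrary submodules, while the translation to
  subgroups needs closed ones; compactness in a Hausdorff space bridges the gap.\<close>

lemma emb_compact: assumes C: "submodule M C" "compact_space (mtop (submod M C))" shows "closed_submodule M C"
proof -
 have "C \<subseteq> mcar M" by (rule submoduleD(1)[OF C(1)])
 then have "compactin (mtop M) C" using C(2) compactin_subspace[of "mtop M" C] by simp
 moreover have "Hausdorff_space (mtop M)" using lc unfolding is_lcmod_def by blast
 ultimately show ?thesis unfolding closed_submodule_def using C(1) compactin_imp_closedin by blast
qed

lemma compact_parafinite_submod_iff: assumes "closed_submodule M C"
 shows "compact_parafinite (submod M C) \<longleftrightarrow> parafin UNIV {0} (j ` C)"
 using emb.compact_parafinite_iff[OF emb_submod[OF assms]] by simp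

lemma Wflat_iff: "Wflat M = {mzero M} \<longleftrightarrow> Wzero UNIV {0} im"
proof
 assume W: "Wflat M = {mzero M}"
 show "Wzero UNIV {0} im" unfolding Wzero_def
 proof (intro allI impI)
  fix Z assume Z: "parafin UNIV {0} Z \<and> Z \<subseteq> im"
  then obtain C where C: "C \<subseteq> mcar M" "Z = j ` C" using i_lift by metis
  have "closed_submodule M C" using closed_submodule_iff[OF C(1)] parafinD(2,4) Z C(2) by blast
  then have "compact_parafinite (submod M C)" "submodule M C" using compact_parafinite_submod_iff Z C(2) closed_submodule_def by blast+
  then have "C \<subseteq> Wflat M" unfolding Wflat_def by blast
  then have "Z \<subseteq> {0}" using W C(2) by auto
  then show "Z = {0}" using parafinD(5) Z by blast
 qed
next
 assume W: "Wzero UNIV {0} im"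
 have s0: "submodule M {mzero M}" using submodule_iff[of "{mzero M}"] by (simp add: sub_def add_subgroup_def)
 have "C \<subseteq> {mzero M}" if C: "submodule M C" "compact_parafinite (submod M C)" for C
 proof -
  have c: "closed_submodule M C" using emb_compact[OF C(1)] C(2) unfolding compact_parafinite_def by blast
  have "j ` C = {0}" using W compact_parafinite_submod_iff[OF c] C(2) closed_submoduleD(6)[OF c] unfolding Wzero_def by blast
  then have "j ` C = j ` {mzero M}" by simp
  then show ?thesis using i_image_eq[OF closed_submoduleD(2)[OF c], of "{mzero M}"] by simp
 qed
 then have "Wflat M \<subseteq> {mzero M}" unfolding Wflat_def using s0 by blast
 moreover have "mzero M \<in> Wflat M" unfolding Wflat_def submodule_def by blast
 ultimately show "Wflat M = {mzero M}" by blast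
qed

lemma sheer_iff: "sheer M \<longleftrightarrow> Wzero UNIV {0} im \<and> full im"
proof -
 have "Omega_sharp M \<subseteq> mcar M" unfolding Omega_sharp_def by blast
 then have "Omega_sharp M = mcar M \<longleftrightarrow> \<Inter>(Ufam UNIV im) = im" using i_image_eq[OF _ order_refl] Omega_sharp_image by auto
 also have "\<dots> \<longleftrightarrow> full im"
 proof
  assume e: "\<Inter>(Ufam UNIV im) = im"
  show "full im" unfolding full_def
  proof
   fix U assume U: "U \<in> Ufam UNIV im"
   show "U = im" using Inter_lower[OF U] UfamD(2)[OF U] unfolding e by (rule equalityI[rotated])
  qed
 next
  assume f: "full im"
  have "im \<in> Ufam UNIV im" unfolding Ufam_def pdisc_def using sub_im omod_refl by blast
  then have "Ufam UNIV im = {im}" using f unfolding full_def by blast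
  then show "\<Inter>(Ufam UNIV im) = im" by simp
 qed
 finally show ?thesis unfolding sheer_def Wflat_iff by blast
qed

lemma sheer_submod_iff: assumes "closed_submodule M N"
 shows "sheer (submod M N) \<longleftrightarrow> Wzero UNIV {0} (j ` N) \<and> full (j ` N)"
 using emb.sheer_iff[OF emb_submod[OF assms]] by simp

lemma boxminus_image: assumes "closed_submodule M N"
 shows "j ` boxminus M N = \<Inter>(Ufam UNIV (j ` N))" "boxminus M N \<subseteq> N"
 using emb.Omega_sharp_image[OF emb_submod[OF assms]] unfolding boxminus_def by (simp_all add: Omega_sharp_def)

lemma compact_parafinite_between: assumes N: "closed_submodule M N" and Y: "closed_submodule M Y" "N \<subseteq> Y"
 shows "compact_parafinite (quotmod (submod M Y) N) \<longleftrightarrow> parafin UNIV (j ` N) (j ` Y)"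
proof -
 note y = closed_submoduleD[OF Y(1)]
 have "closed_submodule (submod M Y) N" using N Y(2) y(2) closedin_subset_topspace
  unfolding closed_submodule_def submodule_submod[OF y(2)] by (auto intro: closedin_subset_topspace)
 then show ?thesis using emb.compact_parafinite_quotmod_iff[OF emb_submod[OF Y(1)]] by simp
qed

text \<open>Since there is a largest parafinite \<open>W\<close> over the image of \<open>N\<close>,
  the sum defining \<open>Wflat\<close> is a single submodule, the image of \<open>P\<close> in the
  quotient. Its preimage is \<open>P\<close> again, because \<open>P\<close> is a union of cosets of
  \<open>N\<close>.\<close>

lemma boxplus_image:
 assumes N: "closed_submodule M N" and W: "parafin UNIV (j ` N) W" "W \<subseteq> im"
  "!!Y. parafin UNIV (j ` N) Y ==> Y \<subseteq> im ==> Y \<subseteq> W"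
 shows "j ` boxplus M N = W" "boxplus M N \<subseteq> mcar M"
proof -
 note n = closed_submoduleD[OF N]
 let ?q = "mcoset M N" and ?Q = "quotmod M N"
 have lcq: "is_lcmod ?Q" using lcmod_quotmod[OF n(1)] N unfolding closed_submodule_def by blast
 obtain P where P: "P \<subseteq> mcar M" "W = j ` P" by (rule i_lift[OF W(2)])
 have cP: "closed_submodule M P" using closed_submodule_iff[OF P(1)] parafinD(2,4)[OF W(1)] P(2) by blast
 note p = closed_submoduleD[OF cP]
 have NP: "N \<subseteq> P" using parafinD(5)[OF W(1)] i_subset[OF n(2) P(1)] P(2) by blast
 have "compact_parafinite (quotmod (submod M P) N)" using compact_parafinite_between[OF N cP NP] W(1) P(2) by blast
 then have 1: "compact_parafinite (submod ?Q (?q ` P))" unfolding submod_quotmod[OF n(1) p(1) NP] .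
 have sP: "submodule ?Q (?q ` P)" by (rule submodule_q_image[OF n(1) p(1)])
 have "C \<subseteq> ?q ` P" if C: "submodule ?Q C" "compact_parafinite (submod ?Q C)" for C
 proof -
  obtain Y where Y: "submodule M Y" "N \<subseteq> Y" "C = ?q ` Y" using submodule_q_preimage[OF n(1) C(1)] by metis
  note y = submoduleD[OF Y(1)]
  have CQ: "C \<subseteq> topspace (mtop ?Q)" using C(1) unfolding submodule_def by simp
  have "compact_space (subtopology (mtop ?Q) C)" using C(2) unfolding compact_parafinite_def by simp
  then have "compactin (mtop ?Q) C" using CQ compactin_subspace by blast
  moreover have "Hausdorff_space (mtop ?Q)" using lcq unfolding is_lcmod_def by blast
  ultimately have "closedin (mtop ?Q) C" using compactin_imp_closedin by blast
  then have "closedin (mtop M) Y" using closedin_q[OF n(1) Y(1,2)] Y(3) by blast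
  then have cY: "closed_submodule M Y" unfolding closed_submodule_def using Y(1) by blast
  have "compact_parafinite (quotmod (submod M Y) N)" using C(2) submod_quotmod[OF n(1) Y(1,2)] Y(3) by simp
  then have "parafin UNIV (j ` N) (j ` Y)" using compact_parafinite_between[OF N cY Y(2)] by blast
  then have "j ` Y \<subseteq> j ` P" using W(3) P(2) closed_submoduleD(6)[OF cY] by blast
  then show ?thesis using i_subset[OF y(1) P(1)] Y(3) by blast
 qed
 then have "Wflat ?Q = ?q ` P" unfolding Wflat_def using 1 sP by blast
 then have "boxplus M N = P" unfolding boxplus_def using q_saturated[OF n(1) p(1) NP] P(1) by auto
 then show "j ` boxplus M N = W" "boxplus M N \<subseteq> mcar M" using P by auto
qed

end

section \<open>The product of all modules\<close>

text \<open>A structure given by a record cannot be turned into a type of its own. Instead, the product of all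
 locally compact modules over the given base types is a single topological group containing each of them
 as a closed subgroup, and the class-based theory above is applied inside that product.\<close>

typedef (overloaded) ('a::"{topological_ab_group_add, t2_space}", 'm) univ =
 "{f :: ('a, 'm) amod => 'm. \<forall>M. if is_lcmod M then f M \<in> mcar M else f M = undefined}"
 morphisms coord Abs_univ
proof
 have "mzero M \<in> mcar M" if "is_lcmod M" for M :: "('a, 'm) amod" using that unfolding is_lcmod_def by (elim conjE)
 then show "(\<lambda>M. if is_lcmod M then mzero M else undefined) \<in> {f :: ('a, 'm) amod => 'm. \<forall>M. if is_lcmod M then f M \<in> mcar M else f M = undefined}"
  by simp
qed

lemma coord_mem: "is_lcmod M ==> coord x M \<in> mcar M"
 using coord[of x] by force

text \<open>At records that are not modules every element takes the value \<open>undefined\<close>,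
  so the module coordinates determine it.\<close>

lemma univ_eqI: assumes "!!M. is_lcmod M ==> coord x M = coord y M" shows "x = y"
proof -
 have "coord x M = coord y M" for M using assms[of M] coord[of x] coord[of y] by (cases "is_lcmod M") auto
 then show ?thesis by (simp add: coord_inject[symmetric] fun_eq_iff)
qed

definition mk :: "(('a::{topological_ab_group_add, t2_space}, 'm) amod => 'm) => ('a, 'm) univ" where
 "mk f = Abs_univ (\<lambda>M. if is_lcmod M then f M else undefined)"

lemma coord_mk: assumes "!!M. is_lcmod M ==> f M \<in> mcar M" "is_lcmod M" shows "coord (mk f) M = f M"
 unfolding mk_def using assms by (subst Abs_univ_inverse) auto

lemma lcmod_act_zero: assumes M: "is_lcmod M" shows "mact M a (mzero M) = mzero M"
proof -
 let ?z = "mact M a (mzero M)"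
 have z: "?z \<in> mcar M" by (intro lcmodD[OF M])
 have "madd M ?z ?z = mact M a (madd M (mzero M) (mzero M))" by (rule lcmodD(9)[OF M, symmetric]) (rule lcmodD(1)[OF M])+
 then have e: "madd M ?z ?z = ?z" using lcmodD(7)[OF M lcmodD(1)[OF M]] by simp
 have "?z = madd M (madd M (mneg M ?z) ?z) ?z" using lcmodD(7,8)[OF M z] by simp
 also have "\<dots> = madd M (mneg M ?z) (madd M ?z ?z)" by (intro lcmodD[OF M] z)
 also have "\<dots> = mzero M" unfolding e by (rule lcmodD(8)[OF M z])
 finally show ?thesis .
qed

instantiation univ :: ("{topological_ab_group_add, t2_space}", type) ab_group_add
begin

definition "0 = mk mzero"
definition "x + y = mk (\<lambda>M. madd M (coord x M) (coord y M))"
definition "- x = mk (\<lambda>M. mneg M (coord x M))"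
definition "x - (y :: ('a, 'b) univ) = x + - y"

lemma coord_ops: assumes "is_lcmod M"
 shows "coord 0 M = mzero M" "coord (x + y) M = madd M (coord x M) (coord y M)" "coord (- x) M = mneg M (coord x M)"
 unfolding zero_univ_def plus_univ_def uminus_univ_def using assms by (auto simp: coord_mk lcmodD coord_mem)

instance
proof
 fix a b c :: "('a, 'b) univ"
 show "a + b + c = a + (b + c)" by (rule univ_eqI) (simp add: coord_ops lcmodD(5) coord_mem)
 show "a + b = b + a" by (rule univ_eqI) (simp add: coord_ops lcmodD(6) coord_mem)
 show "0 + a = a" by (rule univ_eqI) (simp add: coord_ops lcmodD(7) coord_mem)
 show "- a + a = 0" by (rule univ_eqI) (simp add: coord_ops lcmodD(8) coord_mem)
 show "a - b = a + - b" by (rule minus_univ_def)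
qed

end

definition box :: "('a::{topological_ab_group_add, t2_space}, 'm) amod => 'm set => ('a, 'm) univ set" where
 "box M V = {x. coord x M \<in> V}"

text \<open>The product topology, generated by boxes restricting one coordinate. The factors are
  topologies on sets inside \<open>'m\<close>, so it is given by this subbasis directly.\<close>

instantiation univ :: ("{topological_ab_group_add, t2_space}", type) topological_space
begin

definition "open (S :: ('a, 'b) univ set) \<longleftrightarrow> generate_topology {box M V | M V. is_lcmod M \<and> openin (mtop M) V} S"

instance
 by standard (auto simp: open_univ_def intro: generate_topology.intros)

end

lemma open_box: "is_lcmod M ==> openin (mtop M) V ==> open (box M V)"
 unfolding open_univ_def by (rule generate_topology.Basis) blast

text \<open>Convergence may be tested on the subbasis, that is, coordinate by coordinate. This
  reduces continuity of the operations to that in each factor.\<close>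

lemma univ_tendstoI:
 fixes l :: "('a::{topological_ab_group_add, t2_space}, 'm) univ"
 assumes "!!M V. is_lcmod M ==> openin (mtop M) V ==> coord l M \<in> V ==> eventually (\<lambda>x. coord (g x) M \<in> V) F"
 shows "(g \<longlongrightarrow> l) F"
proof (rule topological_tendstoI)
 fix S :: "('a, 'm) univ set" assume "open S" and l: "l \<in> S"
 then have "generate_topology {box M V | M V. is_lcmod M \<and> openin (mtop M) V} S" unfolding open_univ_def by blast
 then show "eventually (\<lambda>x. g x \<in> S) F" using l
 proof (induction rule: generate_topology.induct)
  case (Int a b) then show ?case by (auto intro: eventually_conj)
 next
  case (UN K)
  then obtain k where k: "k \<in> K" "l \<in> k" by blast
  have "eventually (\<lambda>x. g x \<in> k) F" by (rule UN.IH[OF k])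
  then show ?case by (rule eventually_mono) (use k in blast)
 next
  case (Basis s) then show ?case using assms unfolding box_def by auto
 qed simp
qed

lemma coord_nhds:
 assumes "is_lcmod M" "openin (mtop M) V" "coord a M \<in> V" shows "eventually (\<lambda>x. coord x M \<in> V) (nhds a)"
 using open_box[OF assms(1,2)] assms(3) unfolding eventually_nhds box_def by blast

instance univ :: ("{topological_ab_group_add, t2_space}", type) "{topological_ab_group_add, t2_space}"
proof
 fix a b :: "('a, 'b) univ"
 show "((\<lambda>x. fst x + snd x) \<longlongrightarrow> a + b) (nhds a \<times>\<^sub>F nhds b)"
 proof (rule univ_tendstoI)
  fix M :: "('a, 'b) amod" and V assume M: "is_lcmod M" and V: "openin (mtop M) V" "coord (a + b) M \<in> V"
  obtain A B where AB: "openin (mtop M) A" "openin (mtop M) B" "coord a M \<in> A" "coord b M \<in> B"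
    "!!x y. x \<in> A ==> y \<in> B ==> (\<lambda>(x, y). madd M x y) (x, y) \<in> V"
   using continuous_map_nhds2[OF lcmodD(14)[OF M] V(1), of "coord a M" "coord b M"] V(2)
   by (auto simp: coord_ops[OF M] coord_mem[OF M] lcmodD(12)[OF M])
  show "eventually (\<lambda>x. coord (fst x + snd x) M \<in> V) (nhds a \<times>\<^sub>F nhds b)" unfolding eventually_prod_filter
   using coord_nhds[OF M AB(1,3)] coord_nhds[OF M AB(2,4)] AB(5)
   by (intro exI[of _ "\<lambda>x. coord x M \<in> A"] exI[of _ "\<lambda>x. coord x M \<in> B"]) (auto simp: coord_ops[OF M])
 qed
 show "(uminus \<longlongrightarrow> - a) (nhds a)"
 proof (rule univ_tendstoI)
  fix M :: "('a, 'b) amod" and V assume M: "is_lcmod M" and V: "openin (mtop M) V" "coord (- a) M \<in> V"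
  have "openin (mtop M) {x \<in> mcar M. mneg M x \<in> V}"
   using lcmodD(15)[OF M] V(1) unfolding continuous_map_def lcmodD(12)[OF M] by blast
  then have "eventually (\<lambda>x. coord x M \<in> {x \<in> mcar M. mneg M x \<in> V}) (nhds a)"
   by (rule coord_nhds[OF M]) (use V(2) in \<open>simp add: coord_ops[OF M] coord_mem[OF M]\<close>)
  then show "eventually (\<lambda>x. coord (- x) M \<in> V) (nhds a)" by (rule eventually_mono) (simp add: coord_ops[OF M])
 qed
 assume "a \<noteq> b"
 then obtain M where M: "is_lcmod M" "coord a M \<noteq> coord b M" using univ_eqI by blast
 then obtain U V where UV: "openin (mtop M) U" "openin (mtop M) V" "coord a M \<in> U" "coord b M \<in> V" "disjnt U V"
  using lcmodD(13)[OF M(1)] coord_mem[OF M(1)] unfolding Hausdorff_space_def lcmodD(12)[OF M(1)] by metis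
 show "\<exists>U V. open U \<and> open V \<and> a \<in> U \<and> b \<in> V \<and> U \<inter> V = {}"
  using open_box[OF M(1)] UV by (intro exI[of _ "box M U"] exI[of _ "box M V"]) (auto simp: box_def disjnt_def)
qed

definition uact :: "'a::{topological_ab_group_add, t2_space} => ('a, 'm) univ => ('a, 'm) univ" where
 "uact a x = mk (\<lambda>M. mact M a (coord x M))"

lemma coord_uact: "is_lcmod M ==> coord (uact a x) M = mact M a (coord x M)"
 unfolding uact_def by (auto simp: coord_mk lcmodD coord_mem)

lemma tgact_uact: "tgact (uact :: 'a::{topological_ab_group_add, t2_space} => ('a, 'm) univ => ('a, 'm) univ)"
proof
 fix a b :: 'a and x y :: "('a, 'm) univ"
 show "uact a (x + y) = uact a x + uact a y" by (rule univ_eqI) (simp add: coord_uact coord_ops lcmodD(9) coord_mem)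
 show "uact 0 x = x" by (rule univ_eqI) (simp add: coord_uact lcmodD(10) coord_mem)
 show "uact (a + b) x = uact a (uact b x)" by (rule univ_eqI) (simp add: coord_uact lcmodD(11) coord_mem)
next
 have "((\<lambda>p. uact (fst p) (snd p)) \<longlongrightarrow> uact a x) (nhds a \<times>\<^sub>F nhds x)" for a :: 'a and x :: "('a, 'm) univ"
 proof (rule univ_tendstoI)
  fix M :: "('a, 'm) amod" and V assume M: "is_lcmod M" and V: "openin (mtop M) V" "coord (uact a x) M \<in> V"
  obtain A B where AB: "openin euclidean A" "openin (mtop M) B" "a \<in> A" "coord x M \<in> B"
    "!!x y. x \<in> A ==> y \<in> B ==> (\<lambda>(x, y). mact M x y) (x, y) \<in> V"
   using continuous_map_nhds2[OF lcmodD(16)[OF M] V(1), of a "coord x M"] V(2)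
   by (auto simp: coord_uact[OF M] coord_mem[OF M] lcmodD(12)[OF M])
  have "eventually (\<lambda>t. t \<in> A) (nhds a)" using AB(1,3) eventually_nhds by auto
  then show "eventually (\<lambda>p. coord (uact (fst p) (snd p)) M \<in> V) (nhds a \<times>\<^sub>F nhds x)" unfolding eventually_prod_filter
   using coord_nhds[OF M AB(2,4)] AB(5)
   by (intro exI[of _ "\<lambda>t. t \<in> A"] exI[of _ "\<lambda>x. coord x M \<in> B"]) (auto simp: coord_uact[OF M])
 qed
 then have "((\<lambda>p. uact (fst p) (snd p)) \<longlongrightarrow> uact (fst p) (snd p)) (nhds p)" for p :: "'a \<times> ('a, 'm) univ"
  using nhds_prod[of "fst p" "snd p"] by simp
 then show "continuous_on UNIV (\<lambda>p :: 'a \<times> ('a, 'm) univ. uact (fst p) (snd p))"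
  unfolding continuous_on_def at_within_def
  by (intro ballI) (rule tendsto_mono[OF inf_le1])
qed

definition inc :: "('a::{topological_ab_group_add, t2_space}, 'm) amod => 'm => ('a, 'm) univ" where
 "inc M x = mk (\<lambda>M'. if M' = M then x else mzero M')"

lemma coord_inc: "x \<in> mcar M ==> is_lcmod M' ==> coord (inc M x) M' = (if M' = M then x else mzero M')"
 unfolding inc_def by (subst coord_mk) (auto simp: lcmodD)

text \<open>The image is the axis of \<open>M\<close>, the points with zero in all other
  coordinates, and is closed because each factor is Hausdorff. A box in the coordinate
  \<open>M\<close> pulls back to its own open set, and a box in another coordinate to everything or
  nothing.\<close>

lemma emb_inc: assumes M: "is_lcmod M" shows "emb uact M (inc M)"
proof -
 interpret tgact uact by (rule tgact_uact)
 show ?thesis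
 proof
  show "is_lcmod M" by fact
  show "inc M (madd M x y) = inc M x + inc M y" if "x \<in> mcar M" "y \<in> mcar M" for x y
   by (rule univ_eqI) (use that M in \<open>simp add: coord_ops coord_inc lcmodD\<close>)
  show "inc M (mact M a x) = uact a (inc M x)" if "x \<in> mcar M" for x a
   by (rule univ_eqI) (use that M in \<open>simp add: coord_uact coord_inc lcmodD lcmod_act_zero\<close>)
  show "inj_on (inc M) (mcar M)"
  proof (rule inj_onI)
   fix x y assume xy: "x \<in> mcar M" "y \<in> mcar M" "inc M x = inc M y"
   have "x = coord (inc M x) M" using coord_inc[OF xy(1) M] by simp
   also have "\<dots> = y" unfolding xy(3) using coord_inc[OF xy(2) M] by simp
   finally show "x = y" .
  qed
  show "openin (mtop M) V \<longleftrightarrow> V \<subseteq> mcar M \<and> (\<exists>T. open T \<and> V = {x \<in> mcar M. inc M x \<in> T})" for V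
  proof
   assume V: "openin (mtop M) V"
   then have VM: "V \<subseteq> mcar M" using openin_subset lcmodD(12)[OF M] by metis
   then have "V = {x \<in> mcar M. inc M x \<in> box M V}" unfolding box_def using coord_inc[OF _ M] by auto
   then show "V \<subseteq> mcar M \<and> (\<exists>T. open T \<and> V = {x \<in> mcar M. inc M x \<in> T})" using open_box[OF M V] VM by blast
  next
   assume "V \<subseteq> mcar M \<and> (\<exists>T. open T \<and> V = {x \<in> mcar M. inc M x \<in> T})"
   then obtain T where T: "open T" and V: "V = {x \<in> mcar M. inc M x \<in> T}" by blast
   from T have "generate_topology {box M V | M V. is_lcmod M \<and> openin (mtop M) V} T" unfolding open_univ_def .
   then have "openin (mtop M) {x \<in> mcar M. inc M x \<in> T}"
   proof (induction rule: generate_topology.induct)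
    case UNIV then show ?case using openin_topspace[of "mtop M"] lcmodD(12)[OF M] by simp
   next
    case (Int a b)
    have "{x \<in> mcar M. inc M x \<in> a \<inter> b} = {x \<in> mcar M. inc M x \<in> a} \<inter> {x \<in> mcar M. inc M x \<in> b}" by blast
    then show ?case using openin_Int[OF Int.IH] by simp
   next
    case (UN K)
    have "{x \<in> mcar M. inc M x \<in> \<Union>K} = (\<Union>k\<in>K. {x \<in> mcar M. inc M x \<in> k})" by blast
    moreover have "openin (mtop M) (\<Union>k\<in>K. {x \<in> mcar M. inc M x \<in> k})" using UN.IH by (intro openin_Union) blast
    ultimately show ?case by simp
   next
    case (Basis s)
    then obtain M' V' where s: "s = box M' V'" "is_lcmod M'" "openin (mtop M') V'" by blast
    show ?case
    proof (cases "M' = M")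
     case True
     then have "{x \<in> mcar M. inc M x \<in> s} = V'"
      unfolding s(1) box_def using coord_inc[OF _ M] openin_subset[OF s(3)] lcmodD(12)[OF M] by auto
     then show ?thesis using s(3) True by simp
    next
     case False
     then have "{x \<in> mcar M. inc M x \<in> s} = (if mzero M' \<in> V' then topspace (mtop M) else {})"
      unfolding s(1) box_def using coord_inc[OF _ s(2)] lcmodD(12)[OF M] by auto
     then show ?thesis by simp
    qed
   qed
   then show "openin (mtop M) V" unfolding V .
  qed
  show "closed (inc M ` mcar M)"
  proof -
   define Z where "Z M' = {x. coord x M' = mzero M'}" for M' :: "('a, 'b) amod"
   have "closed (Z M')" if M': "is_lcmod M'" for M'
   proof -
    have "closedin (mtop M') {mzero M'}" using closedin_Hausdorff_singleton[OF lcmodD(13)[OF M']] lcmodD(1,12)[OF M'] by simp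
    then have "openin (mtop M') (mcar M' - {mzero M'})" unfolding closedin_def lcmodD(12)[OF M'] by blast
    then have "open (box M' (mcar M' - {mzero M'}))" by (rule open_box[OF M'])
    moreover have "- box M' (mcar M' - {mzero M'}) = Z M'" unfolding box_def Z_def using coord_mem[OF M'] by auto
    ultimately show ?thesis using closed_Compl by metis
   qed
   then have "closed (\<Inter>M'\<in>{M'. is_lcmod M' \<and> M' \<noteq> M}. Z M')" by (intro closed_INT) blast
   moreover have "inc M ` mcar M = (\<Inter>M'\<in>{M'. is_lcmod M' \<and> M' \<noteq> M}. Z M')"
   proof (intro equalityI subsetI)
    fix y assume "y \<in> inc M ` mcar M"
    then show "y \<in> (\<Inter>M'\<in>{M'. is_lcmod M' \<and> M' \<noteq> M}. Z M')" using coord_inc unfolding Z_def by fastforce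
   next
    fix y assume y: "y \<in> (\<Inter>M'\<in>{M'. is_lcmod M' \<and> M' \<noteq> M}. Z M')"
    have "y = inc M (coord y M)"
     by (rule univ_eqI) (use y in \<open>auto simp: coord_inc[OF coord_mem[OF M]] Z_def\<close>)
    then show "y \<in> inc M ` mcar M" using coord_mem[OF M] by blast
   qed
   ultimately show ?thesis by simp
  qed
 qed
qed

section \<open>The two operations on closed submodules\<close>

context emb
begin

lemma boxminus_props:
 assumes S: "gens S UNIV" and N: "closed_submodule M N"
 shows "j ` boxminus M N \<in> Ufam UNIV (j ` N)" "closed_submodule M (boxminus M N)"
  "purely_discrete (quotmod (submod M N) (boxminus M N))"
proof -
 note n = closed_submoduleD[OF N]
 note b = boxminus_image[OF N]
 interpret E: emb act "submod M N" j by (rule emb_submod[OF N])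
 show R: "j ` boxminus M N \<in> Ufam UNIV (j ` N)" unfolding b(1)
  by (rule Inter_Ufam[OF S lcg_subset[OF lcg_im n(5,4,6)] n(3)])
 have bM: "boxminus M N \<subseteq> mcar M" using b(2) n(2) by blast
 have "closed (j ` boxminus M N)" by (rule omod_closed[OF UfamD(3)[OF R] n(5) subD(1)[OF UfamD(1)[OF R]] n(4) UfamD(2)[OF R]])
 then show c: "closed_submodule M (boxminus M N)" using closed_submodule_iff[OF bM] UfamD(1)[OF R] by blast
 have s: "submodule (submod M N) (boxminus M N)" using submodule_submod[OF n(2)] closed_submoduleD(1)[OF c] b(2) by blast
 have "openin (mtop (submod M N)) (boxminus M N)" using E.openin_iff[OF s] UfamD(3)[OF R] by simp
 then show "purely_discrete (quotmod (submod M N) (boxminus M N))"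
  using E.purely_discrete_quotmod_iff[OF s] UfamD(4)[OF R] by simp
qed

lemma boxplus_props:
 assumes S: "gens S UNIV" and N: "closed_submodule M N"
 shows "parafin UNIV (j ` N) (j ` boxplus M N)" "closed_submodule M (boxplus M N)" "N \<subseteq> boxplus M N"
  "parafin UNIV (j ` N) Y ==> Y \<subseteq> im ==> Y \<subseteq> j ` boxplus M N"
proof -
 note n = closed_submoduleD[OF N]
 obtain W where W: "parafin UNIV (j ` N) W" "W \<subseteq> im" "!!Y. parafin UNIV (j ` N) Y ==> Y \<subseteq> im ==> Y \<subseteq> W"
  using largest_parafin[OF S lcg_im sub_im n(5,3,6)] by blast
 note b = boxplus_image[OF N W]
 show p: "parafin UNIV (j ` N) (j ` boxplus M N)" using W(1) b(1) by simp
 show "closed_submodule M (boxplus M N)" using closed_submodule_iff[OF b(2)] parafinD(2,4)[OF p] by blast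
 show "N \<subseteq> boxplus M N" using parafinD(5)[OF p] i_subset[OF n(2) b(2)] by blast
 show "Y \<subseteq> j ` boxplus M N" if "parafin UNIV (j ` N) Y" "Y \<subseteq> im" using W(3)[OF that] b(1) by simp
qed

text \<open>By \<open>Ufam_restrict\<close> the trace of \<open>boxminus M N\<close> on
  \<open>L\<close> is open in \<open>L\<close> with purely discrete quotient, so it is all of a full
  \<open>L\<close>. This makes \<open>boxminus M N\<close> a greatest element, which is stronger
  than maximality.\<close>

lemma boxminus_greatest:
 assumes S: "gens S UNIV" and N: "closed_submodule M N" and L: "closed_submodule M L" "L \<subseteq> N" "full (j ` L)"
 shows "L \<subseteq> boxminus M N"
proof -
 note l = closed_submoduleD[OF L(1)] and n = closed_submoduleD[OF N] and b = boxminus_props[OF S N]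
 have "j ` boxminus M N \<inter> j ` L \<in> Ufam UNIV (j ` L)" by (rule Ufam_restrict[OF b(1) l(3) _ n(3)]) (use L(2) in blast)
 then have "j ` boxminus M N \<inter> j ` L = j ` L" by (rule bspec[OF L(3)[unfolded full_def]])
 then have "j ` L \<subseteq> j ` boxminus M N" unfolding inf.absorb_iff2 .
 then show ?thesis using i_subset[OF l(2) closed_submoduleD(2)[OF b(2)]] by blast
qed

text \<open>By \<open>Ufam_trans\<close> a member of the family for \<open>boxminus M N\<close> is
  also one for \<open>N\<close>, hence contains the smallest member, which is
  \<open>boxminus M N\<close> itself.\<close>

lemma sheer_boxminus:
 assumes S: "gens S UNIV" and M: "sheer M" and N: "closed_submodule M N"
 shows "sheer (submod M (boxminus M N))" "full (j ` boxminus M N)"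
proof -
 note n = closed_submoduleD[OF N] and b = boxminus_props[OF S N]
 have W: "Wzero UNIV {0} im" using M sheer_iff by blast
 show f: "full (j ` boxminus M N)" unfolding full_def
 proof
  fix U assume U: "U \<in> Ufam UNIV (j ` boxminus M N)"
  have "U \<in> Ufam UNIV (j ` N)" by (rule Ufam_trans[OF b(1) U n(3)])
  then have "j ` boxminus M N \<subseteq> U" unfolding boxminus_image(1)[OF N] by (rule Inter_lower)
  then show "U = j ` boxminus M N" using UfamD(2)[OF U] by blast
 qed
 show "sheer (submod M (boxminus M N))"
  using sheer_submod_iff[OF b(2)] f Wzero_mono[OF W closed_submoduleD(6)[OF b(2)]] by blast
qed

text \<open>By \<open>parafin_trans\<close> a parafinite extension of \<open>boxplus M N\<close> is
  parafinite over \<open>N\<close>, so the largest one leaves no room for it. That is the vanishing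
  required by \<open>full_if_Wzero\<close>.\<close>

lemma sheer_boxplus:
 assumes S: "gens S UNIV" "zspan fs + S = UNIV" and M: "sheer M" and N: "closed_submodule M N"
 shows "sheer (submod M (boxplus M N))"
proof -
 note b = boxplus_props[OF S(1) N]
 note p = closed_submoduleD[OF b(2)]
 have W: "Wzero UNIV {0} im" "full im" using M sheer_iff by blast+
 have "Wzero UNIV (j ` boxplus M N) im" unfolding Wzero_def
 proof (intro allI impI; elim conjE)
  fix Z assume Z: "parafin UNIV (j ` boxplus M N) Z" "Z \<subseteq> im"
  show "Z = j ` boxplus M N" by (rule equalityI[OF b(4)[OF parafin_trans[OF b(1) Z(1)] Z(2)] parafinD(5)[OF Z(1)]])
 qed
 then have "full (j ` boxplus M N)" by (rule full_if_Wzero[OF S lcg_im sub_im W(2) p(5,3,6)])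
 then show ?thesis using sheer_submod_iff[OF b(2)] Wzero_mono[OF W(1) p(6)] by blast
qed

lemma boxplus_least:
 assumes S: "gens S UNIV" "zspan fs + S = UNIV" and M: "sheer M" and N: "closed_submodule M N"
  and L: "closed_submodule M L" "N \<subseteq> L" "L \<subseteq> boxplus M N" "sheer (submod M L)"
 shows "L = boxplus M N"
proof -
 note b = boxplus_props[OF S(1) N] and l = closed_submoduleD[OF L(1)]
 note p = closed_submoduleD[OF b(2)]
 have 1: "parafin UNIV (j ` L) (j ` boxplus M N)" by (rule parafin_raise[OF b(1) l(5,3)]) (use L(2,3) in blast)+
 have 2: "full (j ` L)" using L(4) sheer_submod_iff[OF L(1)] by blast
 have 3: "Wzero UNIV {0} im" using M sheer_iff by blast
 have "j ` L = j ` boxplus M N" by (rule no_compact_parafin_extension[OF S lcg_im sub_im 3 1 p(6) 2])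
 then show ?thesis using i_image_eq[OF l(2) p(2)] by blast
qed

text \<open>Modulo \<open>N2\<close> the image of \<open>boxplus M N1\<close> is still compact
  parafinite, by \<open>parafin_push\<close>, so it lies in the largest such submodule over
  \<open>N2\<close>.\<close>

lemma boxplus_mono:
 assumes S: "gens S UNIV" and N: "closed_submodule M N1" "closed_submodule M N2" "N1 \<subseteq> N2"
 shows "boxplus M N1 \<subseteq> boxplus M N2"
proof -
 note b1 = boxplus_props[OF S N(1)] and b2 = boxplus_props[OF S N(2)] and n2 = closed_submoduleD[OF N(2)]
 note p1 = closed_submoduleD[OF b1(2)] and p2 = closed_submoduleD[OF b2(2)]
 have "parafin UNIV (j ` N2) (j ` boxplus M N1 + j ` N2)" by (rule parafin_push[OF b1(1) n2(5,3)]) (use N(3) in blast)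
 moreover have "j ` boxplus M N1 + j ` N2 \<subseteq> im" by (rule sg_plus_subset[OF group_im p1(6) n2(6)])
 ultimately have "j ` boxplus M N1 + j ` N2 \<subseteq> j ` boxplus M N2" by (rule b2(4))
 then have "j ` boxplus M N1 \<subseteq> j ` boxplus M N2" using set_plus_left[OF n2(7), of "j ` boxplus M N1"] by blast
 then show ?thesis using i_subset[OF p1(2) p2(2)] by blast
qed

lemma boxminus_mono:
 assumes S: "gens S UNIV" and M: "sheer M" and N: "closed_submodule M N1" "closed_submodule M N2" "N1 \<subseteq> N2"
 shows "boxminus M N1 \<subseteq> boxminus M N2"
 by (rule boxminus_greatest[OF S N(2) boxminus_props(2)[OF S N(1)] _ sheer_boxminus(2)[OF S M N(1)]])
  (use boxminus_image(2)[OF N(1)] N(3) in blast)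

end

theorem mainTheorem8:
  fixes M :: "('a::{topological_ab_group_add, t2_space}, 'm) amod"
  assumes "LCA_group_type TYPE('a)"
    and "compactly_generated_type TYPE('a)"
    and "is_lcmod M"
    and "sheer M"
  shows "(\<forall>N. closed_submodule M N \<longrightarrow>
            boxminus M N \<subseteq> N \<and> N \<subseteq> boxplus M N \<and>
            purely_discrete (quotmod (submod M N) (boxminus M N)) \<and>
            compact_parafinite (quotmod (submod M (boxplus M N)) N) \<and>
            closed_submodule M (boxminus M N) \<and> sheer (submod M (boxminus M N)) \<and>
            \<not> (\<exists>S. closed_submodule M S \<and> sheer (submod M S) \<and>
                   boxminus M N \<subset> S \<and> S \<subseteq> N) \<and>
            closed_submodule M (boxplus M N) \<and> sheer (submod M (boxplus M N)) \<and>
            \<not> (\<exists>S. closed_submodule M S \<and> sheer (submod M S) \<and>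
                   N \<subseteq> S \<and> S \<subset> boxplus M N)) \<and>
         (\<forall>N1 N2. closed_submodule M N1 \<and> closed_submodule M N2 \<and> N1 \<subseteq> N2 \<longrightarrow>
            boxminus M N1 \<subseteq> boxminus M N2 \<and> boxplus M N1 \<subseteq> boxplus M N2)"
proof -
 interpret emb uact M "inc M" by (rule emb_inc[OF assms(3)])
 obtain S :: "'a set" and fs where S: "gens S UNIV" "zspan fs + S = UNIV" using gens_span[OF assms(1,2)] .
 note M = assms(4)
 show ?thesis
 proof (intro conjI allI impI)
  fix N assume N: "closed_submodule M N"
  note m = boxminus_props[OF S(1) N] and p = boxplus_props[OF S(1) N]
  show "boxminus M N \<subseteq> N" by (rule boxminus_image(2)[OF N])
  show "N \<subseteq> boxplus M N" by (rule p(3))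
  show "purely_discrete (quotmod (submod M N) (boxminus M N))" by (rule m(3))
  show "compact_parafinite (quotmod (submod M (boxplus M N)) N)" using compact_parafinite_between[OF N p(2,3)] p(1) by blast
  show "closed_submodule M (boxminus M N)" by (rule m(2))
  show "sheer (submod M (boxminus M N))" by (rule sheer_boxminus(1)[OF S(1) M N])
  show "closed_submodule M (boxplus M N)" by (rule p(2))
  show "sheer (submod M (boxplus M N))" by (rule sheer_boxplus[OF S M N])
  show "\<not> (\<exists>S. closed_submodule M S \<and> sheer (submod M S) \<and> boxminus M N \<subset> S \<and> S \<subseteq> N)"
  proof (rule notI, elim exE conjE)
   fix L assume L: "closed_submodule M L" "sheer (submod M L)" "boxminus M N \<subset> L" "L \<subseteq> N"
   have "full (inc M ` L)" using L(2) sheer_submod_iff[OF L(1)] by blast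
   then have "L \<subseteq> boxminus M N" by (rule boxminus_greatest[OF S(1) N L(1,4)])
   then show False using L(3) by blast
  qed
  show "\<not> (\<exists>S. closed_submodule M S \<and> sheer (submod M S) \<and> N \<subseteq> S \<and> S \<subset> boxplus M N)"
  proof (rule notI, elim exE conjE)
   fix L assume L: "closed_submodule M L" "sheer (submod M L)" "N \<subseteq> L" "L \<subset> boxplus M N"
   have "L = boxplus M N" by (rule boxplus_least[OF S M N L(1,3) _ L(2)]) (use L(4) in blast)
   then show False using L(4) by blast
  qed
 next
  fix N1 N2 assume "closed_submodule M N1 \<and> closed_submodule M N2 \<and> N1 \<subseteq> N2"
  then have N: "closed_submodule M N1" "closed_submodule M N2" "N1 \<subseteq> N2" by auto
  show "boxminus M N1 \<subseteq> boxminus M N2" by (rule boxminus_mono[OF S(1) M N])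
  show "boxplus M N1 \<subseteq> boxplus M N2" by (rule boxplus_mono[OF S(1) N])
 qed
qed

end
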